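(* For $n\ge1$ let $R_n\otimes\mathrm{id}:\mathbb Q[\mathcal{BP}_n]\to\mathcal O_n\rtimes\mathbb Q[\Sigma_n]$ be the $\mathbb Q$-algebra map determined by $a_{ij}\mapsto\exp(v_{ij})\otimes\mathrm{id}$ for $1\le i\ne j\le n$ and $s\mapsto1\otimes s$ for $s\in\Sigma_n$. Let $J\subset\mathbb Q[\mathcal{BP}_n]$ be the two-sided ideal generated by $\{\sigma_i-s_i\}_{1\le i<n}$, and equip $\mathbb Q[\mathcal{BP}_n]$ with the $J$-adic filtration $\{J^k\}_{k\ge0}$ and $\mathcal O_n\rtimes\mathbb Q[\Sigma_n]$ with the filtration $F_k:=F_k\mathcal O_n\otimes\mathbb Q[\Sigma_n]$, $k\ge0$. Then $R_n\otimes\mathrm{id}$ respects these filtrations, i.e. $(R_n\otimes\mathrm{id})(J^k)\subset F_k$ for all $k$, and induces a degree zero multiplicative isomorphism at the associated graded level, $$\mathrm{gr}^*(R_n\otimes\mathrm{id}):\mathrm{gr}^*_J(\mathcal{BP}_n):=\bigoplus_{k\ge0}J^k/J^{k+1}\ \stackrel{\sim}{\longrightarrow}\ \mathcal O_n^*\rtimes\mathbb Q[\Sigma_n].$$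
   Context: $\mathbb F_n$ is the free group on $x_1,\dots,x_n$. The braid-permutation (welded braid) group $\mathcal{BP}_n\subset\mathrm{Aut}(\mathbb F_n)$ consists of the automorphisms $a$ with $a(x_i)=y_i^{-1}x_{s(i)}y_i$ for $1\le i\le n$, for some $y_i\in\mathbb F_n$ and $s\in\Sigma_n$; the product is composition of automorphisms. Sending $a$ to $s$ gives a surjection $\mathcal{BP}_n\to\Sigma_n$ with kernel the McCool group $\mathcal{BC}_n$, split by the permutation action of $\Sigma_n$ on $\{x_1,\dots,x_n\}$. For $1\le i\ne j\le n$, $a_{ij}\in\mathcal{BC}_n$ sends $x_i$ to $x_j^{-1}x_ix_j$ and fixes $x_k$ for $k\ne i$. By McCool, $\mathcal{BC}_n$ is generated by the $a_{ij}$ with defining relations, for pairwise distinct indices, $(a_{ik},a_{jk})=1$, $(a_{ij},a_{ik}a_{jk})=1$, $(a_{ij},a_{kl})=1$, where $(x,y)=xyx^{-1}y^{-1}$; moreover $sa_{ij}s^{-1}=a_{s(i),s(j)}$ for $s\in\Sigma_n$, and $\mathcal{BP}_n=\mathcal{BC}_n\rtimes\Sigma_n$. Put $s_i=(i,i+1)\in\Sigma_n$ and $\sigma_i=a_{i,i+1}s_i\in\mathcal{BP}_n$ (the images of the Artin generators of the braid group). The oriented Artin Hopf algebra $\mathcal O_n$ is the complete Hopf algebra, the quotient of the completed free associative algebra $\mathbb Q\langle\langle v_{ij}\mid1\le i\ne j\le n\rangle\rangle$ ($v_{ij}$ primitive of degree $1$) by the relations, for pairwise distinct indices, (I) $[v_{ik},v_{jk}]=0$,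 (II) $[v_{ij},v_{ik}+v_{jk}]=0$, (III) $[v_{ij},v_{kl}]=0$. $\{F_k\mathcal O_n\}_{k\ge0}$ is its canonical complete filtration, induced by the degree filtration ($F_k\mathcal O_n$ is the set of classes of series with all terms of degree $\ge k$). Its associated graded algebra $\mathcal O_n^*=\bigoplus_{k\ge0}\mathcal O_n^k$ is the quotient of the free associative $\mathbb Q$-algebra on the $v_{ij}$, graded by tensor length, by (I)-(III). $\Sigma_n$ acts on $\mathcal O_n$ and $\mathcal O_n^*$ by ${}^{\pi}v_{ij}=v_{\pi(i),\pi(j)}$. The oriented braid algebra $\mathcal O_n\rtimes\mathbb Q[\Sigma_n]$ is $\mathcal O_n\otimes\mathbb Q[\Sigma_n]$ with product $(a\otimes x)(b\otimes y)=a\cdot{}^{x}b\otimes xy$; $\mathcal O_n^*\rtimes\mathbb Q[\Sigma_n]$ is defined in the same way, is graded with degree $k$ part $\mathcal O_n^k\otimes\mathbb Q[\Sigma_n]$, and is the associated graded algebra of the filtration $\{F_k\}$. *)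

theory Defs
  imports Complex_Main "HOL-Algebra.Bij" "HOL-Algebra.Sym_Groups" "HOL-Algebra.QuotRing"
    "HOL-Algebra.Ideal_Product" "HOL-Algebra.Module"
begin

section \<open>Free groups and the braid-permutation group\<close>

text \<open>A letter \<open>(i, True)\<close> stands for \<open>x\<^sub>i\<close> and \<open>(i, False)\<close> for its inverse; the elements of the
  free group on \<open>x\<^sub>1, \<dots>, x\<^sub>n\<close> are the reduced words.\<close>

definition fg_cons :: "nat \<times> bool \<Rightarrow> (nat \<times> bool) list \<Rightarrow> (nat \<times> bool) list" where
  "fg_cons l w = (case w of [] \<Rightarrow> [l]
     | m # v \<Rightarrow> if fst m = fst l \<and> snd m \<noteq> snd l then v else l # w)"

definition free_group :: "nat \<Rightarrow> (nat \<times> bool) list monoid" where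
  "free_group n =
    \<lparr>carrier = {w. successively (\<lambda>l m. \<not> (fst l = fst m \<and> snd l \<noteq> snd m)) w \<and> fst ` set w \<subseteq> {1..n}},
     monoid.mult = (\<lambda>u v. foldr fg_cons u v),
     one = []\<rparr>"

definition fg_gen :: "nat \<Rightarrow> (nat \<times> bool) list" where
  "fg_gen i = [(i, True)]"

text \<open>The endomorphism of the free group that sends \<open>x\<^sub>i\<close> to \<open>y i\<close>.\<close>

definition fg_subst :: "nat \<Rightarrow> (nat \<Rightarrow> (nat \<times> bool) list) \<Rightarrow> (nat \<times> bool) list \<Rightarrow> (nat \<times> bool) list" where
  "fg_subst n y = (\<lambda>w \<in> carrier (free_group n).
     foldr (\<lambda>(i, b) u. (if b then y i else inv\<^bsub>free_group n\<^esub> (y i)) \<otimes>\<^bsub>free_group n\<^esub> u)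
       w \<one>\<^bsub>free_group n\<^esub>)"

definition BP :: "nat \<Rightarrow> ((nat \<times> bool) list \<Rightarrow> (nat \<times> bool) list) monoid" where
  "BP n = (AutoGroup (free_group n))
    \<lparr>carrier := {a \<in> auto (free_group n).
       \<exists>s y. s \<in> carrier (sym_group n) \<and> y \<in> {1..n} \<rightarrow> carrier (free_group n) \<and>
         (\<forall>i\<in>{1..n}. a (fg_gen i) =
            inv\<^bsub>free_group n\<^esub> (y i) \<otimes>\<^bsub>free_group n\<^esub> fg_gen (s i) \<otimes>\<^bsub>free_group n\<^esub> y i)}\<rparr>"

definition conj_aut :: "nat \<Rightarrow> nat \<Rightarrow> nat \<Rightarrow> (nat \<times> bool) list \<Rightarrow> (nat \<times> bool) list" where
  "conj_aut n i j = fg_subst n (\<lambda>k. if k = i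
     then inv\<^bsub>free_group n\<^esub> (fg_gen j) \<otimes>\<^bsub>free_group n\<^esub> fg_gen i \<otimes>\<^bsub>free_group n\<^esub> fg_gen j
     else fg_gen k)"

definition perm_aut :: "nat \<Rightarrow> (nat \<Rightarrow> nat) \<Rightarrow> (nat \<times> bool) list \<Rightarrow> (nat \<times> bool) list" where
  "perm_aut n s = fg_subst n (\<lambda>k. fg_gen (s k))"

definition artin_gen :: "nat \<Rightarrow> nat \<Rightarrow> (nat \<times> bool) list \<Rightarrow> (nat \<times> bool) list" where
  "artin_gen n i = conj_aut n i (i + 1) \<otimes>\<^bsub>BP n\<^esub> perm_aut n (transpose i (i + 1))"


section \<open>Algebras over the rationals\<close>

text \<open>A (not necessarily commutative) \<open>\<rat>\<close>-algebra is a ring with an additional scalar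
  multiplication, i.e. a record of type \<open>(rat, 'a) module\<close>.\<close>

definition alg_hom :: "(rat, 'a) module \<Rightarrow> (rat, 'b) module \<Rightarrow> ('a \<Rightarrow> 'b) set" where
  "alg_hom A B = {h \<in> ring_hom A B. \<forall>c. \<forall>x\<in>carrier A. h (c \<odot>\<^bsub>A\<^esub> x) = c \<odot>\<^bsub>B\<^esub> h x}"

definition alg_iso :: "(rat, 'a) module \<Rightarrow> (rat, 'b) module \<Rightarrow> ('a \<Rightarrow> 'b) set" where
  "alg_iso A B = {h \<in> alg_hom A B. bij_betw h (carrier A) (carrier B)}"

definition quot_alg :: "(rat, 'a) module \<Rightarrow> 'a set \<Rightarrow> (rat, 'a set) module" where
  "quot_alg A I =
    \<lparr>carrier = carrier (A Quot I), monoid.mult = monoid.mult (A Quot I), one = one (A Quot I),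
     zero = zero (A Quot I), add = add (A Quot I),
     smult = (\<lambda>c X. \<Union>x\<in>X. I +>\<^bsub>A\<^esub> (c \<odot>\<^bsub>A\<^esub> x))\<rparr>"

definition group_algebra :: "'g monoid \<Rightarrow> (rat, 'g \<Rightarrow> rat) module" where
  "group_algebra G =
    \<lparr>carrier = {f. finite {x. f x \<noteq> 0} \<and> {x. f x \<noteq> 0} \<subseteq> carrier G},
     monoid.mult = (\<lambda>f g x. \<Sum>y\<in>{y. f y \<noteq> 0}. \<Sum>z\<in>{z. g z \<noteq> 0}. if y \<otimes>\<^bsub>G\<^esub> z = x then f y * g z else 0),
     one = (\<lambda>x. if x = \<one>\<^bsub>G\<^esub> then 1 else 0),
     zero = (\<lambda>x. 0),
     add = (\<lambda>f g x. f x + g x),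
     smult = (\<lambda>c f x. c * f x)\<rparr>"

definition ga_elem :: "'g \<Rightarrow> 'g \<Rightarrow> rat" where
  "ga_elem g = (\<lambda>x. if x = g then 1 else 0)"

text \<open>The crossed product \<open>A \<rtimes> \<rat>[G]\<close> for a finite group \<open>G\<close> acting on \<open>A\<close> through \<open>act\<close>:
  the element \<open>\<Sum>\<^sub>x a\<^sub>x \<otimes> x\<close> of \<open>A \<otimes> \<rat>[G]\<close> is represented by the function \<open>x \<mapsto> a\<^sub>x\<close>.\<close>

definition pure_tensor :: "(rat, 'a) module \<Rightarrow> 'g monoid \<Rightarrow> 'a \<Rightarrow> 'g \<Rightarrow> 'g \<Rightarrow> 'a" where
  "pure_tensor A G a x = (\<lambda>y \<in> carrier G. if y = x then a else \<zero>\<^bsub>A\<^esub>)"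

definition crossed_product :: "(rat, 'a) module \<Rightarrow> 'g monoid \<Rightarrow> ('g \<Rightarrow> 'a \<Rightarrow> 'a) \<Rightarrow> (rat, 'g \<Rightarrow> 'a) module" where
  "crossed_product A G act =
    \<lparr>carrier = carrier G \<rightarrow>\<^sub>E carrier A,
     monoid.mult = (\<lambda>f g. \<lambda>z \<in> carrier G.
       \<Oplus>\<^bsub>A\<^esub>x\<in>carrier G. f x \<otimes>\<^bsub>A\<^esub> act x (g (inv\<^bsub>G\<^esub> x \<otimes>\<^bsub>G\<^esub> z))),
     one = pure_tensor A G \<one>\<^bsub>A\<^esub> \<one>\<^bsub>G\<^esub>,
     zero = (\<lambda>z \<in> carrier G. \<zero>\<^bsub>A\<^esub>),
     add = (\<lambda>f g. \<lambda>z \<in> carrier G. f z \<oplus>\<^bsub>A\<^esub> g z),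
     smult = (\<lambda>c f. \<lambda>z \<in> carrier G. c \<odot>\<^bsub>A\<^esub> f z)\<rparr>"


section \<open>Filtrations and associated graded algebras\<close>

text \<open>The direct sum \<open>\<Oplus>\<^sub>k F\<^sub>k / F\<^sub>k\<^sub>+\<^sub>1\<close> for a decreasing multiplicative filtration \<open>F\<close> with
  \<open>F\<^sub>0 = A\<close>: finitely supported families of cosets, the zero of the \<open>k\<close>-th summand being
  \<open>F (Suc k)\<close>.\<close>

definition assoc_graded :: "(rat, 'a) module \<Rightarrow> (nat \<Rightarrow> 'a set) \<Rightarrow> (rat, nat \<Rightarrow> 'a set) module" where
  "assoc_graded A F =
    \<lparr>carrier = {\<xi>. (\<forall>k. \<exists>x\<in>F k. \<xi> k = F (Suc k) +>\<^bsub>A\<^esub> x) \<and> finite {k. \<xi> k \<noteq> F (Suc k)}},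
     monoid.mult = (\<lambda>\<xi> \<eta> k. finprod (A A_Mod F (Suc k))
       (\<lambda>i. rcoset_mult A (F (Suc k)) (\<xi> i) (\<eta> (k - i))) {..k}),
     one = (\<lambda>k. if k = 0 then F (Suc 0) +>\<^bsub>A\<^esub> \<one>\<^bsub>A\<^esub> else F (Suc k)),
     zero = (\<lambda>k. F (Suc k)),
     add = (\<lambda>\<xi> \<eta> k. \<xi> k <+>\<^bsub>A\<^esub> \<eta> k),
     smult = (\<lambda>c \<xi> k. \<Union>x\<in>\<xi> k. F (Suc k) +>\<^bsub>A\<^esub> (c \<odot>\<^bsub>A\<^esub> x))\<rparr>"

definition assoc_graded_part :: "(rat, 'a) module \<Rightarrow> (nat \<Rightarrow> 'a set) \<Rightarrow> nat \<Rightarrow> (nat \<Rightarrow> 'a set) set" where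
  "assoc_graded_part A F k = {\<xi> \<in> carrier (assoc_graded A F). \<forall>m. m \<noteq> k \<longrightarrow> \<xi> m = F (Suc m)}"

text \<open>The map of associated graded algebras induced by a map \<open>h\<close> into \<open>B\<close> (with filtration \<open>G\<close>):
  the class of \<open>x\<close> is sent to the class of \<open>h x\<close>. The union is over equal cosets when \<open>h\<close> is
  additive and respects the filtrations.\<close>

definition gr_map :: "(rat, 'b) module \<Rightarrow> (nat \<Rightarrow> 'b set) \<Rightarrow> ('a \<Rightarrow> 'b) \<Rightarrow> (nat \<Rightarrow> 'a set) \<Rightarrow> nat \<Rightarrow> 'b set" where
  "gr_map B G h \<xi> = (\<lambda>k. \<Union>x\<in>\<xi> k. G (Suc k) +>\<^bsub>B\<^esub> h x)"

definition ideal_power :: "(rat, 'a) module \<Rightarrow> 'a set \<Rightarrow> nat \<Rightarrow> 'a set" where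
  "ideal_power A I k = I [^]\<^bsub>ideals_set A\<^esub> k"


section \<open>The oriented Artin algebras\<close>

text \<open>Words in the \<open>v\<^sub>i\<^sub>j\<close> are lists of index pairs; a series is its family of coefficients.\<close>

type_synonym series = "(nat \<times> nat) list \<Rightarrow> rat"

definition indices :: "nat \<Rightarrow> (nat \<times> nat) set" where
  "indices n = {(i, j). i \<in> {1..n} \<and> j \<in> {1..n} \<and> i \<noteq> j}"

definition series_alg :: "nat \<Rightarrow> (rat, series) module" where
  "series_alg n =
    \<lparr>carrier = {f. \<forall>w. f w \<noteq> 0 \<longrightarrow> set w \<subseteq> indices n},
     monoid.mult = (\<lambda>f g w. \<Sum>k\<le>length w. f (take k w) * g (drop k w)),
     one = (\<lambda>w. if w = [] then 1 else 0),
     zero = (\<lambda>w. 0),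
     add = (\<lambda>f g w. f w + g w),
     smult = (\<lambda>c f w. c * f w)\<rparr>"

definition free_alg :: "nat \<Rightarrow> (rat, series) module" where
  "free_alg n = (series_alg n) \<lparr>carrier := {f \<in> carrier (series_alg n). finite {w. f w \<noteq> 0}}\<rparr>"

definition series_var :: "nat \<Rightarrow> nat \<Rightarrow> series" where
  "series_var i j = (\<lambda>w. if w = [(i, j)] then 1 else 0)"

definition series_filt :: "nat \<Rightarrow> nat \<Rightarrow> series set" where
  "series_filt n k = {f \<in> carrier (series_alg n). \<forall>w. length w < k \<longrightarrow> f w = 0}"

definition series_comp :: "nat \<Rightarrow> series \<Rightarrow> series" where
  "series_comp k f = (\<lambda>w. if length w = k then f w else 0)"

text \<open>Exponential of a series without constant term: only the powers \<open>f\<^sup>k\<close> with \<open>k \<le> length w\<close>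
  contribute to the coefficient of \<open>w\<close>.\<close>

definition series_exp :: "nat \<Rightarrow> series \<Rightarrow> series" where
  "series_exp n f = (\<lambda>w. \<Sum>k\<le>length w. (f [^]\<^bsub>series_alg n\<^esub> k) w / fact k)"

definition commutator :: "(rat, 'a) module \<Rightarrow> 'a \<Rightarrow> 'a \<Rightarrow> 'a" where
  "commutator A a b = a \<otimes>\<^bsub>A\<^esub> b \<ominus>\<^bsub>A\<^esub> b \<otimes>\<^bsub>A\<^esub> a"

definition relators :: "nat \<Rightarrow> (rat, series) module \<Rightarrow> series set" where
  "relators n A =
     {commutator A (series_var i k) (series_var j k) | i j k.
        {i, j, k} \<subseteq> {1..n} \<and> distinct [i, j, k]} \<union>
     {commutator A (series_var i j) (series_var i k \<oplus>\<^bsub>A\<^esub> series_var j k) | i j k.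
        {i, j, k} \<subseteq> {1..n} \<and> distinct [i, j, k]} \<union>
     {commutator A (series_var i j) (series_var k l) | i j k l.
        {i, j, k, l} \<subseteq> {1..n} \<and> distinct [i, j, k, l]}"

text \<open>As \<open>\<O>\<^sub>n\<close> is complete, the relations generate a closed ideal: the closure, in the topology of
  the degree filtration, of the ideal they generate algebraically.\<close>

definition closed_ideal :: "nat \<Rightarrow> series set" where
  "closed_ideal n = {f \<in> carrier (series_alg n).
     \<forall>k. \<exists>g \<in> genideal (series_alg n) (relators n (series_alg n)).
       f \<ominus>\<^bsub>series_alg n\<^esub> g \<in> series_filt n k}"

definition graded_ideal :: "nat \<Rightarrow> series set" where
  "graded_ideal n = genideal (free_alg n) (relators n (free_alg n))"

definition artin_alg :: "nat \<Rightarrow> (rat, series set) module" where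
  "artin_alg n = quot_alg (series_alg n) (closed_ideal n)"

definition artin_filt :: "nat \<Rightarrow> nat \<Rightarrow> series set set" where
  "artin_filt n k = (\<lambda>f. closed_ideal n +>\<^bsub>series_alg n\<^esub> f) ` series_filt n k"

definition artin_exp :: "nat \<Rightarrow> nat \<Rightarrow> nat \<Rightarrow> series set" where
  "artin_exp n i j = closed_ideal n +>\<^bsub>series_alg n\<^esub> series_exp n (series_var i j)"

definition graded_artin_alg :: "nat \<Rightarrow> (rat, series set) module" where
  "graded_artin_alg n = quot_alg (free_alg n) (graded_ideal n)"

definition graded_artin_part :: "nat \<Rightarrow> nat \<Rightarrow> series set set" where
  "graded_artin_part n k =
     (\<lambda>f. graded_ideal n +>\<^bsub>free_alg n\<^esub> f) ` {f \<in> carrier (free_alg n). \<forall>w. f w \<noteq> 0 \<longrightarrow> length w = k}"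

text \<open>The action \<open>v\<^sub>i\<^sub>j \<mapsto> v\<^bsub>\<pi>(i),\<pi>(j)\<^esub>\<close>, on series and on the two quotients (elementwise on cosets).\<close>

definition series_act :: "(nat \<Rightarrow> nat) \<Rightarrow> series \<Rightarrow> series" where
  "series_act \<pi> f = (\<lambda>w. f (map (map_prod (Hilbert_Choice.inv \<pi>) (Hilbert_Choice.inv \<pi>)) w))"

definition coset_act :: "(nat \<Rightarrow> nat) \<Rightarrow> series set \<Rightarrow> series set" where
  "coset_act \<pi> X = series_act \<pi> ` X"

definition braid_alg :: "nat \<Rightarrow> (rat, (nat \<Rightarrow> nat) \<Rightarrow> series set) module" where
  "braid_alg n = crossed_product (artin_alg n) (sym_group n) coset_act"

definition braid_filt :: "nat \<Rightarrow> nat \<Rightarrow> ((nat \<Rightarrow> nat) \<Rightarrow> series set) set" where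
  "braid_filt n k = carrier (sym_group n) \<rightarrow>\<^sub>E artin_filt n k"

definition graded_braid_alg :: "nat \<Rightarrow> (rat, (nat \<Rightarrow> nat) \<Rightarrow> series set) module" where
  "graded_braid_alg n = crossed_product (graded_artin_alg n) (sym_group n) coset_act"

definition graded_braid_part :: "nat \<Rightarrow> nat \<Rightarrow> ((nat \<Rightarrow> nat) \<Rightarrow> series set) set" where
  "graded_braid_part n k = carrier (sym_group n) \<rightarrow>\<^sub>E graded_artin_part n k"

text \<open>The canonical identification of the associated graded algebra of \<open>\<O>\<^sub>n \<rtimes> \<rat>[\<Sigma>\<^sub>n]\<close> with
  \<open>\<O>\<^sub>n\<^sup>* \<rtimes> \<rat>[\<Sigma>\<^sub>n]\<close>: the class in \<open>F\<^sub>k \<O>\<^sub>n / F\<^sub>k\<^sub>+\<^sub>1 \<O>\<^sub>n\<close> of a series \<open>f\<close> of order at least \<open>k\<close> goes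
  to the class of its component of degree \<open>k\<close>. All unions are over equal cosets.\<close>

definition leading_part :: "nat \<Rightarrow> nat \<Rightarrow> series set \<Rightarrow> series set" where
  "leading_part n k X = (\<Union>f \<in> X \<inter> series_filt n k. graded_ideal n +>\<^bsub>free_alg n\<^esub> series_comp k f)"

definition gr_braid_ident :: "nat \<Rightarrow> (nat \<Rightarrow> ((nat \<Rightarrow> nat) \<Rightarrow> series set) set) \<Rightarrow> (nat \<Rightarrow> nat) \<Rightarrow> series set" where
  "gr_braid_ident n \<xi> = (\<lambda>s \<in> carrier (sym_group n).
     \<Oplus>\<^bsub>graded_artin_alg n\<^esub>k\<in>{k. \<xi> k \<noteq> braid_filt n (Suc k)}. \<Union>X\<in>\<xi> k. leading_part n k (X s))"


section \<open>The representation\<close>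

definition BP_alg :: "nat \<Rightarrow> (rat, ((nat \<times> bool) list \<Rightarrow> (nat \<times> bool) list) \<Rightarrow> rat) module" where
  "BP_alg n = group_algebra (BP n)"

definition J_ideal :: "nat \<Rightarrow> (((nat \<times> bool) list \<Rightarrow> (nat \<times> bool) list) \<Rightarrow> rat) set" where
  "J_ideal n = genideal (BP_alg n)
     {ga_elem (artin_gen n i) \<ominus>\<^bsub>BP_alg n\<^esub> ga_elem (perm_aut n (transpose i (i + 1))) | i.
        1 \<le> i \<and> i < n}"

definition J_filt :: "nat \<Rightarrow> nat \<Rightarrow> (((nat \<times> bool) list \<Rightarrow> (nat \<times> bool) list) \<Rightarrow> rat) set" where
  "J_filt n = ideal_power (BP_alg n) (J_ideal n)"

definition is_artin_rep ::
  "nat \<Rightarrow> ((((nat \<times> bool) list \<Rightarrow> (nat \<times> bool) list) \<Rightarrow> rat) \<Rightarrow> (nat \<Rightarrow> nat) \<Rightarrow> series set) \<Rightarrow> bool" where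
  "is_artin_rep n R \<longleftrightarrow>
     R \<in> alg_hom (BP_alg n) (braid_alg n) \<and>
     (\<forall>(i, j) \<in> indices n. R (ga_elem (conj_aut n i j)) =
        pure_tensor (artin_alg n) (sym_group n) (artin_exp n i j) \<one>\<^bsub>sym_group n\<^esub>) \<and>
     (\<forall>s \<in> carrier (sym_group n). R (ga_elem (perm_aut n s)) =
        pure_tensor (artin_alg n) (sym_group n) \<one>\<^bsub>artin_alg n\<^esub> s)"

end

theory Submission
  imports Defs "HOL-Algebra.UnivPoly"
begin

text \<open>Put \<open>A\<^sub>i\<^sub>j = a\<^sub>i\<^sub>j - 1\<close> in the group algebra of \<open>BP n\<close>. The proof has three ingredients.

  Existence of the representation. A homomorphism on \<open>BP n\<close> has to be built from the images of the
  generators \<open>a\<^sub>i\<^sub>j\<close> and of the permutations, so a presentation of \<open>BP n\<close> is needed. It is obtained by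
  peak reduction. The height of an automorphism is the total length of the images of the generators.
  Multiplication by a generator never preserves it, an automorphism that no generator shortens is a
  permutation (\<open>irreducible_perm\<close>), and where two generators both shorten, the two results are joined
  below the peak by one of McCool's relations. Hence a map that follows shortening moves down to a
  permutation does not depend on the moves chosen and is a homomorphism (\<open>rep_hom\<close>). The relations hold
  for the exponentials \<open>exp v\<^sub>i\<^sub>j\<close> because exponentials of commuting elements commute, and the exponential
  of their sum is the product (\<open>exp_add\<close>).

  Upper bound. Conjugation by permutations carries \<open>A\<^sub>1\<^sub>2\<close> to every \<open>A\<^sub>i\<^sub>j\<close>, so \<open>J\<close> is the two-sided ideal
  generated by all of them, and \<open>J\<^sup>k\<close> is spanned modulo \<open>J\<^sup>k\<^sup>+\<^sup>1\<close> by the products \<open>A\<^sub>w s\<close> with \<open>w\<close> a word of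
  length \<open>k\<close> in the index pairs and \<open>s\<close> a permutation (\<open>spanned_J\<close>). McCool's relations, rewritten in the
  \<open>A\<^sub>i\<^sub>j\<close>, are the defining relations of the graded Artin algebra up to terms of degree three, so the
  substitution of \<open>A\<^sub>i\<^sub>j\<close> for \<open>v\<^sub>i\<^sub>j\<close> sends the degree \<open>k\<close> part of the graded ideal into \<open>J\<^sup>k\<^sup>+\<^sup>1\<close>
  (\<open>lift_graded_ideal\<close>).

  Lower bound. The representation sends \<open>A\<^sub>i\<^sub>j\<close> to \<open>exp v\<^sub>i\<^sub>j - 1\<close>, whose leading term is \<open>v\<^sub>i\<^sub>j\<close>. It therefore
  respects the filtrations, and the leading term of the image of \<open>A\<^sub>w s\<close> is the class of the word \<open>w\<close>,
  tensored with \<open>s\<close> (\<open>lead_rep_word\<close>). So the substitution followed by the leading term is the identity of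
  the graded braid algebra; as the substitution is onto each \<open>J\<^sup>k / J\<^sup>k\<^sup>+\<^sup>1\<close>, both maps are bijective. In
  terms of kernels, the leading term of degree \<open>k\<close> vanishes on \<open>J\<^sup>k\<close> exactly on \<open>J\<^sup>k\<^sup>+\<^sup>1\<close> (\<open>lead_rep_kernel\<close>).
  That multiplicative maps of this kind assemble to an isomorphism of graded algebras is a general
  fact about filtered algebras (\<open>graded_iso\<close>).\<close>

section \<open>Words and the free group\<close>

type_synonym word = "(nat \<times> bool) list"

abbreviation linv :: "nat \<times> bool \<Rightarrow> nat \<times> bool" where
  "linv l \<equiv> (fst l, \<not> snd l)"

definition winv :: "word \<Rightarrow> word" where
  "winv w = rev (map linv w)"

definition reduced :: "word \<Rightarrow> bool" where
  "reduced w \<longleftrightarrow> successively (\<lambda>l m. m \<noteq> linv l) w"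

definition nf :: "word \<Rightarrow> word" where
  "nf w = foldr fg_cons w []"

lemma winv_simps [simp]:
  "winv [] = []" "winv (l # w) = winv w @ [linv l]" "winv (u @ v) = winv v @ winv u"
  by (auto simp: winv_def)

lemma winv_winv [simp]: "winv (winv w) = w"
  by (induction w) auto

lemma length_winv [simp]: "length (winv w) = length w"
  by (simp add: winv_def)

lemma fst_set_winv [simp]: "fst ` set (winv w) = fst ` set w"
  by (simp add: winv_def image_image)

lemma reduced_append:
  "reduced (u @ v) \<longleftrightarrow> reduced u \<and> reduced v \<and> (u = [] \<or> v = [] \<or> hd v \<noteq> linv (last u))"
  by (simp add: reduced_def successively_append_iff)

lemma reduced_Cons: "reduced (l # w) \<longleftrightarrow> reduced w \<and> (w = [] \<or> hd w \<noteq> linv l)"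
  by (auto simp: reduced_def successively_Cons)

lemma reduced_Nil [simp]: "reduced []"
  by (simp add: reduced_def)

lemma reduced_winv [simp]: "reduced (winv w) \<longleftrightarrow> reduced w"
proof -
  have 1: "reduced (winv w)" if "reduced w" for w
    using that
  proof (induction w)
    case (Cons l w)
    have "last (winv w) = linv (hd w)" if "w \<noteq> []"
      using that by (cases w) auto
    with Cons show ?case
      by (cases "w = []") (auto simp: reduced_Cons reduced_append prod_eq_iff)
  qed simp
  show ?thesis using 1[of w] 1[of "winv w"] by auto
qed

lemma fg_cons_reduced: "reduced w \<Longrightarrow> reduced (fg_cons l w)"
  by (auto simp: fg_cons_def reduced_Cons split: list.splits)

lemma fg_cons_reduced_eq: "reduced (l # w) \<Longrightarrow> fg_cons l w = l # w"
  by (auto simp: fg_cons_def reduced_Cons prod_eq_iff split: list.splits)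

lemma fg_cons_linv: "reduced w \<Longrightarrow> fg_cons l (fg_cons (linv l) w) = w"
  by (cases w) (auto simp: fg_cons_def reduced_Cons prod_eq_iff split: list.splits if_splits)

lemma reduced_foldr_fg_cons: "reduced v \<Longrightarrow> reduced (foldr fg_cons u v)"
  by (induction u) (auto simp: fg_cons_reduced)

lemma reduced_nf [simp]: "reduced (nf w)"
  by (simp add: nf_def reduced_foldr_fg_cons)

lemma nf_reduced: "reduced w \<Longrightarrow> nf w = w"
  by (induction w) (auto simp: nf_def fg_cons_reduced_eq reduced_Cons[of _ "_"])

lemma nf_idem [simp]: "nf (nf w) = nf w"
  by (simp add: nf_reduced)

lemma nf_Nil [simp]: "nf [] = []"
  by (simp add: nf_def)

lemma foldr_fg_cons_nf: "foldr fg_cons u (nf v) = nf (u @ v)"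
  by (simp add: nf_def)

lemma nf_append_right: "nf (u @ nf v) = nf (u @ v)"
  by (metis foldr_fg_cons_nf nf_idem)

lemma foldr_fg_cons_eq: "reduced z \<Longrightarrow> reduced w \<Longrightarrow>
    foldr fg_cons (fg_cons l z) w = fg_cons l (foldr fg_cons z w)"
proof (cases z)
  case (Cons m y)
  assume "reduced w" "reduced z"
  then have "reduced (foldr fg_cons y w)" by (simp add: reduced_foldr_fg_cons)
  then have "fg_cons l (fg_cons (linv l) (foldr fg_cons y w)) = foldr fg_cons y w"
    by (rule fg_cons_linv)
  moreover have "fg_cons l (m # y) = (if m = linv l then y else l # m # y)"
    by (auto simp: fg_cons_def prod_eq_iff)
  ultimately show ?thesis using Cons by simp
qed (simp add: fg_cons_def)

lemma nf_append_left: "nf (nf u @ v) = nf (u @ v)"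
proof (induction u)
  case (Cons l u)
  have "nf (nf (l # u) @ v) = foldr fg_cons (fg_cons l (nf u)) (nf v)"
    by (simp add: nf_def)
  also have "\<dots> = fg_cons l (foldr fg_cons (nf u) (nf v))"
    by (rule foldr_fg_cons_eq) auto
  also have "\<dots> = fg_cons l (nf (nf u @ v))"
    by (simp add: nf_def)
  also have "\<dots> = nf ((l # u) @ v)"
    by (simp add: Cons) (simp add: nf_def)
  finally show ?case .
qed simp

lemma nf_cong_append: "nf u = nf u' \<Longrightarrow> nf v = nf v' \<Longrightarrow> nf (u @ v) = nf (u' @ v')"
  by (metis nf_append_left nf_append_right)

text \<open>Free reduction is confluent: inserting or deleting a cancelling pair anywhere does not change the
  normal form. All identities between conjugates below are reduced to this.\<close>

lemma nf_cancel_letter: "nf (u @ linv l # l # v) = nf (u @ v)" "nf (u @ l # linv l # v) = nf (u @ v)"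
proof -
  have 1: "nf (u @ l # linv l # v) = nf (u @ v)" for l
  proof -
    have "nf (l # linv l # v) = nf v"
      using fg_cons_linv[of "nf v" l] by (simp add: nf_def reduced_foldr_fg_cons)
    then show ?thesis by (rule nf_cong_append[OF refl])
  qed
  show "nf (u @ linv l # l # v) = nf (u @ v)" using 1[of "linv l"] by simp
  show "nf (u @ l # linv l # v) = nf (u @ v)" by (rule 1)
qed

lemma nf_cancel: "nf (u @ winv c @ c @ v) = nf (u @ v)" "nf (u @ c @ winv c @ v) = nf (u @ v)"
proof -
  have 1: "nf (u @ winv c @ c @ v) = nf (u @ v)" for c u
  proof (induction c arbitrary: u)
    case (Cons l c)
    show ?case using nf_cancel_letter(1)[of "u @ winv c" l "c @ v"] Cons[of u] by simp
  qed simp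
  show "nf (u @ winv c @ c @ v) = nf (u @ v)" by (rule 1)
  show "nf (u @ c @ winv c @ v) = nf (u @ v)" using 1[of u "winv c"] by simp
qed

lemma nf_winv: "nf (winv w) = winv (nf w)"
proof -
  have "nf (winv w) = nf (winv w @ nf w @ winv (nf w) @ [])"
    using nf_cancel(2)[of "winv w" "nf w" "[]"] by simp
  also have "\<dots> = nf (winv w @ nf (nf w @ winv (nf w)))"
    by (simp add: nf_append_right)
  also have "\<dots> = nf (winv w @ w @ winv (nf w))"
    by (simp add: nf_append_right nf_append_left)
  also have "\<dots> = nf (winv (nf w))"
    using nf_cancel(1)[of "[]" w "winv (nf w)"] by simp
  finally show ?thesis by (simp add: nf_reduced)
qed

lemma nf_winv_cong: "nf u = nf v \<Longrightarrow> nf (winv u) = nf (winv v)"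
  by (simp add: nf_winv)

lemma length_nf: "length (nf w) \<le> length w"
proof (induction w)
  case (Cons l w)
  have "length (fg_cons l v) \<le> Suc (length v)" for v
    by (auto simp: fg_cons_def split: list.splits)
  from this[of "nf w"] Cons show ?case by (simp add: nf_def)
qed simp

lemma set_nf: "set (nf w) \<subseteq> set w"
proof (induction w)
  case (Cons l w)
  have "set (fg_cons l v) \<subseteq> insert l (set v)" for v
    by (auto simp: fg_cons_def split: list.splits)
  from this[of "nf w"] Cons show ?case by (auto simp: nf_def)
qed simp

definition words :: "nat \<Rightarrow> word set" where
  "words n = {w. fst ` set w \<subseteq> {1..n}}"

lemma words_simps [simp]:
  "[] \<in> words n" "l # w \<in> words n \<longleftrightarrow> fst l \<in> {1..n} \<and> w \<in> words n"
  "u @ v \<in> words n \<longleftrightarrow> u \<in> words n \<and> v \<in> words n" "winv w \<in> words n \<longleftrightarrow> w \<in> words n"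
  by (simp_all add: words_def image_Un)

lemma nf_in_words [simp]: "w \<in> words n \<Longrightarrow> nf w \<in> words n"
  using set_nf[of w] by (auto simp: words_def)

lemma carrier_free_group: "w \<in> carrier (free_group n) \<longleftrightarrow> reduced w \<and> w \<in> words n"
proof -
  have "(\<lambda>l m. \<not> (fst l = fst m \<and> snd l \<noteq> snd m)) = (\<lambda>(l :: nat \<times> bool) m. m \<noteq> linv l)"
    by (auto simp: fun_eq_iff prod_eq_iff)
  then show ?thesis unfolding free_group_def reduced_def words_def by (simp only: partial_object.simps mem_Collect_eq)
qed

lemma nf_in_free_group [simp]: "w \<in> words n \<Longrightarrow> nf w \<in> carrier (free_group n)"
  by (simp add: carrier_free_group)

lemma mult_free_group: "reduced v \<Longrightarrow> u \<otimes>\<^bsub>free_group n\<^esub> v = nf (u @ v)"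
  by (metis (no_types, lifting) foldr_fg_cons_nf free_group_def monoid.select_convs(1) nf_reduced)

lemma one_free_group: "\<one>\<^bsub>free_group n\<^esub> = []"
  by (simp add: free_group_def)

lemma group_free_group: "group (free_group n)"
proof (rule groupI)
  fix x assume "x \<in> carrier (free_group n)"
  then show "\<exists>y\<in>carrier (free_group n). y \<otimes>\<^bsub>free_group n\<^esub> x = \<one>\<^bsub>free_group n\<^esub>"
    using nf_cancel(1)[of "[]" x "[]"]
    by (intro bexI[of _ "winv x"]) (auto simp: carrier_free_group mult_free_group one_free_group)
qed (auto simp: carrier_free_group mult_free_group one_free_group nf_append_left nf_append_right nf_reduced)

lemma inv_free_group: "w \<in> carrier (free_group n) \<Longrightarrow> inv\<^bsub>free_group n\<^esub> w = winv w"
  using nf_cancel(1)[of "[]" w "[]"]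
  by (intro group.inv_equality[OF group_free_group])
     (auto simp: carrier_free_group mult_free_group one_free_group)

lemma fg_gen_in [simp]: "i \<in> {1..n} \<Longrightarrow> [(i, b)] \<in> carrier (free_group n)"
  by (simp add: carrier_free_group reduced_Cons)

text \<open>Substitution of words for letters, without reduction: a homomorphism of free groups is
  \<open>nf \<circ> wsub t\<close> for the images \<open>t\<close> of the generators.\<close>

definition wsub :: "(nat \<Rightarrow> word) \<Rightarrow> word \<Rightarrow> word" where
  "wsub t w = concat (map (\<lambda>(i, b). if b then t i else winv (t i)) w)"

lemma wsub_simps [simp]:
  "wsub t [] = []" "wsub t (l # w) = (if snd l then t (fst l) else winv (t (fst l))) @ wsub t w"
  "wsub t (u @ v) = wsub t u @ wsub t v"
  by (auto simp: wsub_def split: prod.splits)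

lemma wsub_winv [simp]: "wsub t (winv w) = winv (wsub t w)"
  by (induction w) auto

lemma wsub_words: "w \<in> words n \<Longrightarrow> (\<And>i. i \<in> {1..n} \<Longrightarrow> t i \<in> words m) \<Longrightarrow> wsub t w \<in> words m"
  by (induction w) auto

lemma wsub_cong: "w \<in> words n \<Longrightarrow> (\<And>i. i \<in> {1..n} \<Longrightarrow> nf (t i) = nf (t' i)) \<Longrightarrow>
    nf (wsub t w) = nf (wsub t' w)"
  by (induction w) (auto intro!: nf_cong_append nf_winv_cong)

lemma nf_wsub_nf: "nf (wsub t (nf w)) = nf (wsub t w)"
proof (induction w)
  case (Cons l w)
  have "nf (wsub t (fg_cons l v)) = nf (wsub t (l # v))" for v
    using nf_cancel[of "[]" "t (fst l)"]
    by (auto simp: fg_cons_def split: list.splits)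
  then have "nf (wsub t (nf (l # w))) = nf (wsub t (l # nf w))"
    by (simp add: nf_def)
  also have "\<dots> = nf (wsub t (l # w))"
    using Cons by (auto intro!: nf_cong_append)
  finally show ?case .
qed simp

lemma wsub_wsub: "wsub t (wsub u w) = wsub (\<lambda>i. wsub t (u i)) w"
  by (induction w) auto

lemma fg_subst_eq:
  assumes "w \<in> carrier (free_group n)" "\<And>i. i \<in> {1..n} \<Longrightarrow> y i \<in> carrier (free_group n)"
  shows "fg_subst n y w = nf (wsub y w)"
proof -
  have "foldr (\<lambda>(i, b) u. (if b then y i else inv\<^bsub>free_group n\<^esub> (y i)) \<otimes>\<^bsub>free_group n\<^esub> u) v \<one>\<^bsub>free_group n\<^esub>
      = nf (wsub y v)" if "v \<in> words n" for v
    using that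
  proof (induction v)
    case (Cons l v)
    then show ?case using assms(2)[of "fst l"]
      by (auto simp: mult_free_group inv_free_group nf_append_right split: prod.splits)
  qed (simp add: one_free_group)
  with assms(1) show ?thesis by (simp add: fg_subst_def carrier_free_group)
qed

text \<open>Freeness: an endomorphism is determined by the images of the generators. Stated on unreduced words,
  so that it can be applied to products before they are simplified.\<close>

lemma hom_free_group_eq:
  assumes "a \<in> hom (free_group n) (free_group n)" "w \<in> words n"
  shows "a (nf w) = nf (wsub (\<lambda>i. a [(i, True)]) w)"
proof -
  interpret group_hom "free_group n" "free_group n" a
    using assms(1) by (simp add: group_hom_def group_hom_axioms_def group_free_group)
  show ?thesis using assms(2)
  proof (induction w)
    case Nil
    then show ?case using hom_one by (simp add: one_free_group)
  next
    case (Cons l w)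
    have l: "[l] \<in> carrier (free_group n)" using Cons.prems fg_gen_in[of "fst l" n "snd l"] by simp
    have al: "a [l] = (if snd l then a [(fst l, True)] else winv (a [(fst l, True)]))"
    proof (cases "snd l")
      case False
      then have "[l] = inv\<^bsub>free_group n\<^esub> [(fst l, True)]"
        using Cons.prems by (subst inv_free_group) (auto simp: prod_eq_iff)
      then have "a [l] = inv\<^bsub>free_group n\<^esub> (a [(fst l, True)])"
        using Cons.prems by (metis fg_gen_in hom_inv words_simps(2))
      then show ?thesis using False Cons.prems by (simp add: inv_free_group)
    qed (cases l, auto)
    have "nf (l # w) = [l] \<otimes>\<^bsub>free_group n\<^esub> nf w"
      by (simp add: mult_free_group) (metis append_Cons append_Nil nf_append_right)
    then have "a (nf (l # w)) = nf (a [l] @ a (nf w))"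
      using hom_mult[OF l nf_in_free_group, of w] Cons.prems hom_closed[of "nf w"]
      by (simp add: mult_free_group carrier_free_group del: append_Cons)
    also have "\<dots> = nf (a [l] @ wsub (\<lambda>i. a [(i, True)]) w)"
      using Cons by (simp add: nf_append_right)
    finally show ?case using al by simp
  qed
qed

lemma fg_subst_hom:
  assumes "\<And>i. i \<in> {1..n} \<Longrightarrow> y i \<in> carrier (free_group n)"
  shows "fg_subst n y \<in> hom (free_group n) (free_group n)"
proof (rule homI)
  fix u v assume uv: "u \<in> carrier (free_group n)" "v \<in> carrier (free_group n)"
  have "wsub y u \<in> words n"
    using uv assms by (intro wsub_words[of u n]) (auto simp: carrier_free_group)
  then show "fg_subst n y u \<in> carrier (free_group n)"
    by (metis assms fg_subst_eq nf_in_free_group uv(1))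
  show "fg_subst n y (u \<otimes>\<^bsub>free_group n\<^esub> v) = fg_subst n y u \<otimes>\<^bsub>free_group n\<^esub> fg_subst n y v"
    using uv assms
    by (subst (1 2 3) fg_subst_eq)
       (auto simp: carrier_free_group mult_free_group nf_wsub_nf nf_append_left nf_append_right)
qed

lemma auto_free_group_eqI:
  assumes "a \<in> auto (free_group n)" "b \<in> auto (free_group n)"
    "\<And>i. i \<in> {1..n} \<Longrightarrow> a [(i, True)] = b [(i, True)]"
  shows "a = b"
proof (rule extensionalityI[of _ "carrier (free_group n)"])
  show "a \<in> extensional (carrier (free_group n))" "b \<in> extensional (carrier (free_group n))"
    using assms by (auto simp: auto_def Bij_def)
  fix w assume w: "w \<in> carrier (free_group n)"
  then have "a (nf w) = b (nf w)"
    using assms by (subst (1 2) hom_free_group_eq) (auto simp: auto_def carrier_free_group intro: wsub_cong)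
  then show "a w = b w" using w by (simp add: carrier_free_group nf_reduced)
qed

section \<open>The braid-permutation group by conjugation data\<close>

lemma auto_simps:
  assumes "a \<in> auto (free_group n)"
  shows "a \<in> hom (free_group n) (free_group n)" "a \<in> Bij (carrier (free_group n))"
  using assms by (auto simp: auto_def)

lemma auto_apply:
  "a \<in> auto (free_group n) \<Longrightarrow> w \<in> words n \<Longrightarrow> a (nf w) = nf (wsub (\<lambda>i. a [(i, True)]) w)"
  by (rule hom_free_group_eq[OF auto_simps(1)])

lemma auto_gen_words:
  assumes "a \<in> auto (free_group n)" "i \<in> {1..n}"
  shows "a [(i, True)] \<in> words n" "reduced (a [(i, True)])"
proof -
  have "a [(i, True)] \<in> carrier (free_group n)"
    by (rule hom_in_carrier[OF auto_simps(1)[OF assms(1)] fg_gen_in[OF assms(2)]])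
  then show "a [(i, True)] \<in> words n" "reduced (a [(i, True)])" by (auto simp: carrier_free_group)
qed

text \<open>Any word may serve as the conjugator \<open>g k\<close>, reduced or not, so \<open>g\<close> is not determined by \<open>a\<close>. This
  freedom avoids normalising the conjugators after each product.\<close>

definition conj_data :: "nat \<Rightarrow> (word \<Rightarrow> word) \<Rightarrow> (nat \<Rightarrow> nat) \<Rightarrow> (nat \<Rightarrow> word) \<Rightarrow> bool" where
  "conj_data n a s g \<longleftrightarrow> a \<in> auto (free_group n) \<and> s permutes {1..n} \<and>
     (\<forall>k\<in>{1..n}. g k \<in> words n \<and> a [(k, True)] = nf (winv (g k) @ (s k, True) # g k))"

lemma carrier_BP: "a \<in> carrier (BP n) \<longleftrightarrow> (\<exists>s g. conj_data n a s g)"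
proof -
  have eq: "inv\<^bsub>free_group n\<^esub> y \<otimes>\<^bsub>free_group n\<^esub> fg_gen i \<otimes>\<^bsub>free_group n\<^esub> y
      = nf (winv y @ (i, True) # y)" if "y \<in> carrier (free_group n)" for y i
    using that nf_append_left[of "winv y @ [(i, True)]" y]
    by (simp add: inv_free_group mult_free_group fg_gen_def carrier_free_group reduced_Cons)
  show ?thesis
  proof
    assume "a \<in> carrier (BP n)"
    then obtain s y where "a \<in> auto (free_group n)" "s permutes {1..n}"
      "y \<in> {1..n} \<rightarrow> carrier (free_group n)"
      "\<forall>i\<in>{1..n}. a (fg_gen i) =
            inv\<^bsub>free_group n\<^esub> (y i) \<otimes>\<^bsub>free_group n\<^esub> fg_gen (s i) \<otimes>\<^bsub>free_group n\<^esub> y i"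
      by (auto simp: BP_def sym_group_carrier)
    then have "conj_data n a s y"
      unfolding conj_data_def using eq
      by (auto simp: Pi_iff fg_gen_def) (simp_all add: carrier_free_group)
    then show "\<exists>s g. conj_data n a s g" by blast
  next
    assume "\<exists>s g. conj_data n a s g"
    then obtain s g where d: "conj_data n a s g" by blast
    have "a (fg_gen i) = inv\<^bsub>free_group n\<^esub> nf (g i) \<otimes>\<^bsub>free_group n\<^esub> fg_gen (s i) \<otimes>\<^bsub>free_group n\<^esub> nf (g i)"
      if "i \<in> {1..n}" for i
    proof -
      have "nf (winv (nf (g i)) @ (s i, True) # nf (g i)) = nf (winv (g i) @ [(s i, True)] @ g i)"
        unfolding nf_winv[symmetric] using nf_append_left[of "winv (g i)" "(s i, True) # nf (g i)"]
          nf_append_right[of "winv (g i) @ [(s i, True)]" "g i"] by simp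
      then show ?thesis using d that by (subst eq) (auto simp: conj_data_def fg_gen_def)
    qed
    then show "a \<in> carrier (BP n)"
      using d unfolding BP_def by (auto simp: sym_group_carrier conj_data_def intro!: exI[of _ s] exI[of _ "\<lambda>i. nf (g i)"])
  qed
qed

lemma conj_data_auto: "conj_data n a s g \<Longrightarrow> a \<in> auto (free_group n)"
  by (simp add: conj_data_def)

lemma conj_data_BP: "conj_data n a s g \<Longrightarrow> a \<in> carrier (BP n)"
  by (auto simp: carrier_BP)

lemma nf_conj_cong:
  assumes "nf g = nf h"
  shows "nf (winv g @ l # g) = nf (winv h @ l # h)"
  using nf_cong_append[OF nf_winv_cong[OF assms] nf_cong_append[OF refl[of "nf [l]"] assms]] by simp

lemma conj_data_cong:
  assumes "conj_data n a s g" "\<And>k. k \<in> {1..n} \<Longrightarrow> h k \<in> words n \<and> nf (g k) = nf (h k)"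
  shows "conj_data n a s h"
  using assms nf_conj_cong unfolding conj_data_def by metis

lemma conj_data_eqI:
  assumes "conj_data n a s g" "conj_data n b s h" "\<And>k. k \<in> {1..n} \<Longrightarrow> nf (g k) = nf (h k)"
  shows "a = b"
proof (rule auto_free_group_eqI)
  fix i assume i: "i \<in> {1..n}"
  have "a [(i, True)] = nf (winv (g i) @ (s i, True) # g i)" using assms(1) i by (simp add: conj_data_def)
  also have "\<dots> = nf (winv (h i) @ (s i, True) # h i)" by (rule nf_conj_cong) (rule assms(3)[OF i])
  also have "\<dots> = b [(i, True)]" using assms(2) i by (simp add: conj_data_def)
  finally show "a [(i, True)] = b [(i, True)]" .
qed (use assms in \<open>auto simp: conj_data_def\<close>)

lemma mult_BP: "a \<in> auto (free_group n) \<Longrightarrow> b \<in> auto (free_group n) \<Longrightarrow>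
    a \<otimes>\<^bsub>BP n\<^esub> b = compose (carrier (free_group n)) a b"
  by (simp add: BP_def AutoGroup_def BijGroup_def auto_simps)

lemma subgroup_carrier_BP_aux:
  assumes "a \<in> auto (free_group n)" "b \<in> auto (free_group n)"
  shows "compose (carrier (free_group n)) a b \<in> auto (free_group n)"
  using subgroup.m_closed[OF group.subgroup_auto[OF group_free_group] assms] assms
  by (simp add: BijGroup_def auto_simps)

text \<open>The conjugators multiply like a cocycle: the second one is transported by the first automorphism.\<close>

lemma conj_data_mult:
  assumes "conj_data n a s g" "conj_data n b t h"
  shows "conj_data n (a \<otimes>\<^bsub>BP n\<^esub> b) (s \<circ> t) (\<lambda>k. g (t k) @ wsub (\<lambda>i. a [(i, True)]) (h k))"
  unfolding conj_data_def
proof (intro conjI ballI)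
  have aut: "a \<in> auto (free_group n)" "b \<in> auto (free_group n)" using assms by (auto simp: conj_data_def)
  then show "a \<otimes>\<^bsub>BP n\<^esub> b \<in> auto (free_group n)"
    by (simp add: mult_BP subgroup_carrier_BP_aux)
  show "s \<circ> t permutes {1..n}" using assms by (auto simp: conj_data_def permutes_compose)
  fix k assume k: "k \<in> {1..n}"
  then have tk: "t k \<in> {1..n}" using assms by (auto simp: conj_data_def simp del: atLeastAtMost_iff intro: permutes_in_image[THEN iffD2])
  have h: "h k \<in> words n" using assms k by (auto simp: conj_data_def)
  let ?w = "wsub (\<lambda>i. a [(i, True)]) (h k)"
  have "?w \<in> words n" using h by (rule wsub_words) (rule auto_gen_words[OF aut(1)])
  then show "g (t k) @ ?w \<in> words n" using tk assms by (auto simp: conj_data_def)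
  have "(a \<otimes>\<^bsub>BP n\<^esub> b) [(k, True)] = a (nf (winv (h k) @ (t k, True) # h k))"
    using k assms by (simp add: mult_BP[OF aut] compose_def) (simp add: conj_data_def)
  also have "\<dots> = nf (winv ?w @ a [(t k, True)] @ ?w)"
    using tk h by (subst auto_apply[OF aut(1)]) auto
  also have "\<dots> = nf (winv ?w @ nf (nf (winv (g (t k)) @ (s (t k), True) # g (t k)) @ ?w))"
    using tk assms by (simp add: conj_data_def nf_append_right)
  also have "\<dots> = nf (winv ?w @ (winv (g (t k)) @ (s (t k), True) # g (t k)) @ ?w)"
    by (simp only: nf_append_left nf_append_right)
  finally show "(a \<otimes>\<^bsub>BP n\<^esub> b) [(k, True)] = nf (winv (g (t k) @ ?w) @ ((s \<circ> t) k, True) # g (t k) @ ?w)"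
    by simp
qed

lemma conj_data_one: "conj_data n \<one>\<^bsub>BP n\<^esub> id (\<lambda>k. [])"
  using group.id_in_auto[OF group_free_group, of n]
  by (auto simp: conj_data_def BP_def AutoGroup_def BijGroup_def permutes_id nf_reduced reduced_Cons)

text \<open>The inverse of \<open>a\<close> as an automorphism of the free group is again of the required form; the
  conjugator is found by solving \<open>b (a x\<^sub>j) = x\<^sub>j\<close> for \<open>b x\<^sub>k\<close> with \<open>k = s j\<close>.\<close>

lemma conj_data_inv:
  assumes d: "conj_data n a s g" and b: "b \<in> auto (free_group n)"
    and ba: "compose (carrier (free_group n)) b a = (\<lambda>x\<in>carrier (free_group n). x)"
  shows "conj_data n b (Hilbert_Choice.inv s) (\<lambda>k. winv (wsub (\<lambda>i. b [(i, True)]) (g (Hilbert_Choice.inv s k))))"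
  unfolding conj_data_def
proof (intro conjI ballI b)
  have s: "s permutes {1..n}" using d by (simp add: conj_data_def)
  then show "Hilbert_Choice.inv s permutes {1..n}" by (rule permutes_inv)
  fix k assume k: "k \<in> {1..n}"
  define j where "j = Hilbert_Choice.inv s k"
  have j: "j \<in> {1..n}" using k permutes_inv[OF s] unfolding j_def by (metis permutes_in_image)
  have sj: "s j = k" unfolding j_def by (rule permutes_inverses(1)[OF s])
  let ?w = "wsub (\<lambda>i. b [(i, True)]) (g j)"
  have gj: "g j \<in> words n" using d j by (auto simp: conj_data_def)
  show "winv (wsub (\<lambda>i. b [(i, True)]) (g (Hilbert_Choice.inv s k))) \<in> words n"
    unfolding j_def[symmetric] using gj auto_gen_words[OF b] by (auto intro!: wsub_words)
  have "b (a [(j, True)]) = [(j, True)]"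
    using fun_cong[OF ba, of "[(j, True)]"] j by (simp add: compose_def)
  moreover have "b (a [(j, True)]) = nf (winv ?w @ b [(k, True)] @ ?w)"
    using d j k gj sj by (simp add: conj_data_def auto_apply[OF b])
  ultimately have eq: "[(j, True)] = nf (winv ?w @ b [(k, True)] @ ?w)" by simp
  have "nf (?w @ [(j, True)] @ winv ?w) = nf (?w @ nf (nf (winv ?w @ b [(k, True)] @ ?w) @ winv ?w))"
    by (subst eq) (simp only: nf_append_right)
  also have "\<dots> = nf (?w @ (winv ?w @ b [(k, True)] @ ?w) @ winv ?w)"
    by (simp only: nf_append_left nf_append_right)
  also have "\<dots> = nf (b [(k, True)] @ ?w @ winv ?w @ [])"
    using nf_cancel(2)[of "[]" ?w "b [(k, True)] @ ?w @ winv ?w"] by simp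
  also have "\<dots> = b [(k, True)]"
    unfolding nf_cancel(2) using auto_gen_words[OF b k] by (simp add: nf_reduced)
  finally show "b [(k, True)] = nf (winv (winv (wsub (\<lambda>i. b [(i, True)]) (g (Hilbert_Choice.inv s k)))) @
      (Hilbert_Choice.inv s k, True) # winv (wsub (\<lambda>i. b [(i, True)]) (g (Hilbert_Choice.inv s k))))"
    by (simp add: j_def)
qed

lemma group_BP: "group (BP n)"
proof -
  interpret A: group "AutoGroup (free_group n)" by (rule group.AutoGroup[OF group_free_group])
  have carr: "carrier (AutoGroup (free_group n)) = auto (free_group n)" by (simp add: AutoGroup_def)
  have mult: "a \<otimes>\<^bsub>AutoGroup (free_group n)\<^esub> b = a \<otimes>\<^bsub>BP n\<^esub> b" for a b by (simp add: BP_def)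
  have one: "\<one>\<^bsub>AutoGroup (free_group n)\<^esub> = \<one>\<^bsub>BP n\<^esub>" by (simp add: BP_def)
  have "subgroup (carrier (BP n)) (AutoGroup (free_group n))"
  proof (rule A.subgroupI)
    show "carrier (BP n) \<subseteq> carrier (AutoGroup (free_group n))" by (auto simp: carr BP_def)
    show "carrier (BP n) \<noteq> {}" using conj_data_BP[OF conj_data_one] by blast
    show "a \<otimes>\<^bsub>AutoGroup (free_group n)\<^esub> b \<in> carrier (BP n)"
      if "a \<in> carrier (BP n)" "b \<in> carrier (BP n)" for a b
      using that conj_data_mult by (fastforce simp: carrier_BP mult)
    show "inv\<^bsub>AutoGroup (free_group n)\<^esub> a \<in> carrier (BP n)" if a: "a \<in> carrier (BP n)" for a
    proof -
      let ?b = "inv\<^bsub>AutoGroup (free_group n)\<^esub> a"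
      obtain s g where d: "conj_data n a s g" using a by (auto simp: carrier_BP)
      then have aa: "a \<in> carrier (AutoGroup (free_group n))" by (simp add: carr conj_data_def)
      then have b: "?b \<in> auto (free_group n)" using A.inv_closed carr by blast
      have "?b \<otimes>\<^bsub>BP n\<^esub> a = \<one>\<^bsub>BP n\<^esub>" using A.l_inv[OF aa] by (simp add: mult one)
      then have "compose (carrier (free_group n)) ?b a = (\<lambda>x\<in>carrier (free_group n). x)"
        using aa carr b by (simp add: mult_BP) (simp add: BP_def AutoGroup_def BijGroup_def)
      from conj_data_inv[OF d b this] show ?thesis by (auto simp: carrier_BP)
    qed
  qed
  from subgroup.subgroup_is_group[OF this A.is_group] show ?thesis
    by (simp add: BP_def)
qed

text \<open>A substitution is invertible as soon as an inverse is given on the generators.\<close>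

lemma fg_subst_auto:
  assumes y: "\<And>i. i \<in> {1..n} \<Longrightarrow> y i \<in> carrier (free_group n)"
    and z: "\<And>i. i \<in> {1..n} \<Longrightarrow> z i \<in> carrier (free_group n)"
    and yz: "\<And>i. i \<in> {1..n} \<Longrightarrow> nf (wsub y (z i)) = [(i, True)]"
    and zy: "\<And>i. i \<in> {1..n} \<Longrightarrow> nf (wsub z (y i)) = [(i, True)]"
  shows "fg_subst n y \<in> auto (free_group n)"
proof -
  note hom = fg_subst_hom[of n y, OF y] fg_subst_hom[of n z, OF z]
  have inverse: "fg_subst n y (fg_subst n z w) = w"
    if w: "w \<in> carrier (free_group n)" and y: "\<And>i. i \<in> {1..n} \<Longrightarrow> y i \<in> carrier (free_group n)"
    and z: "\<And>i. i \<in> {1..n} \<Longrightarrow> z i \<in> carrier (free_group n)"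
    and yz: "\<And>i. i \<in> {1..n} \<Longrightarrow> nf (wsub y (z i)) = [(i, True)]" for w y z
  proof -
    have zw: "wsub z w \<in> words n" using w z by (auto intro!: wsub_words simp: carrier_free_group)
    have "fg_subst n y (fg_subst n z w) = nf (wsub y (wsub z w))"
      by (subst fg_subst_eq[OF w z], assumption, subst fg_subst_eq[OF nf_in_free_group[OF zw] y],
          assumption, rule nf_wsub_nf)
    also have "\<dots> = nf (wsub (\<lambda>i. wsub y (z i)) w)" by (simp add: wsub_wsub)
    also have "\<dots> = nf (wsub (\<lambda>i. [(i, True)]) w)"
      using w yz by (intro wsub_cong[of w n]) (auto simp: carrier_free_group nf_reduced reduced_Cons)
    also have "wsub (\<lambda>i. [(i, True)]) w = w" by (induction w) (auto simp: prod_eq_iff)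
    finally show ?thesis using w by (simp add: carrier_free_group nf_reduced)
  qed
  have "bij_betw (fg_subst n y) (carrier (free_group n)) (carrier (free_group n))"
    using inverse[OF _ y z yz] inverse[OF _ z y zy] hom
    by (intro bij_betwI[of _ _ _ "fg_subst n z"]) (auto simp: hom_def)
  then show ?thesis using hom by (auto simp: auto_def Bij_def fg_subst_def)
qed

text \<open>The move \<open>(i, j, True)\<close> is \<open>a\<^sub>i\<^sub>j\<close>, and \<open>(i, j, False)\<close> is its inverse. Treating both signs alike halves
  the case distinctions of the peak reduction.\<close>

definition conj_move :: "nat \<Rightarrow> nat \<times> nat \<times> bool \<Rightarrow> word \<Rightarrow> word" where
  "conj_move n = (\<lambda>(i, j, e). fg_subst n (\<lambda>k. if k = i then [(j, \<not> e), (i, True), (j, e)] else [(k, True)]))"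

definition moves :: "nat \<Rightarrow> (nat \<times> nat \<times> bool) set" where
  "moves n = {(i, j, e). i \<in> {1..n} \<and> j \<in> {1..n} \<and> i \<noteq> j}"

lemma conj_aut_eq_move: "(i, j) \<in> indices n \<Longrightarrow> conj_aut n i j = conj_move n (i, j, True)"
  unfolding conj_aut_def conj_move_def prod.case
  by (intro arg_cong[of _ _ "fg_subst n"] ext)
     (auto simp: fg_gen_def inv_free_group mult_free_group reduced_Cons nf_reduced indices_def)

lemma conj_data_conj_move_gen:
  assumes "(i, j, e) \<in> moves n"
  shows "conj_data n (conj_move n (i, j, e)) id (\<lambda>k. if k = i then [(j, e)] else [])"
proof -
  let ?y = "\<lambda>e k. if k = i then [(j, \<not> e), (i, True), (j, e)] else [(k, True)]"
  have y: "?y e k \<in> carrier (free_group n)" if "k \<in> {1..n}" for k e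
    using that assms by (auto simp: carrier_free_group reduced_Cons moves_def)
  have c: "nf (wsub (?y e) (?y (\<not> e) k)) = [(k, True)]" for k e
    using assms by (cases e) (auto simp: moves_def nf_def fg_cons_def)
  have "fg_subst n (?y e) \<in> auto (free_group n)"
    by (rule fg_subst_auto[where z = "?y (\<not> e)", OF y y c]) (use c[of "\<not> e"] in \<open>simp_all only: not_not\<close>)
  moreover have "fg_subst n (?y e) [(k, True)] = ?y e k" if "k \<in> {1..n}" for k
    using that y assms by (subst fg_subst_eq) (auto simp: moves_def nf_reduced reduced_Cons)
  ultimately show ?thesis using assms
    by (auto simp: conj_data_def conj_move_def permutes_id moves_def nf_reduced reduced_Cons)
qed

text \<open>Multiplication by a move changes a single conjugator, namely that of \<open>x\<^sub>i\<close>. Everything about the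
  height of a product is read off from this formula.\<close>

lemma conj_data_move:
  assumes d: "conj_data n a s g" and m: "(i, j, e) \<in> moves n"
  shows "conj_data n (a \<otimes>\<^bsub>BP n\<^esub> conj_move n (i, j, e)) s (g(i := g i @ winv (g j) @ (s j, e) # g j))"
proof (rule conj_data_cong[OF conj_data_mult[OF d conj_data_conj_move_gen[OF m], simplified]])
  fix k assume k: "k \<in> {1..n}"
  have w: "s j \<in> {1..n}" "g i \<in> words n" "g j \<in> words n" "g k \<in> words n"
    using d m k by (auto simp: conj_data_def moves_def simp del: atLeastAtMost_iff intro: permutes_in_image[THEN iffD2])
  have "nf (if e then a [(j, True)] else winv (a [(j, True)])) = nf (winv (g j) @ (s j, e) # g j)"
    using d m by (auto simp: conj_data_def moves_def nf_winv[symmetric])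
  then show "(g(i := g i @ winv (g j) @ (s j, e) # g j)) k \<in> words n \<and>
      nf (g k @ wsub (\<lambda>i. a [(i, True)]) (if k = i then [(j, e)] else [])) =
      nf ((g(i := g i @ winv (g j) @ (s j, e) # g j)) k)"
    using w nf_cong_append[OF refl, of "if e then a [(j, True)] else winv (a [(j, True)])"] by auto
qed

lemma conj_data_perm_aut_gen:
  assumes "s permutes {1..n}"
  shows "conj_data n (perm_aut n s) s (\<lambda>k. [])"
proof -
  have s: "s k \<in> {1..n}" "Hilbert_Choice.inv s k \<in> {1..n}" if "k \<in> {1..n}" for k
    using that assms permutes_inv[OF assms] by (metis permutes_in_image)+
  have "fg_subst n (\<lambda>k. fg_gen (s k)) \<in> auto (free_group n)"
    using s permutes_inverses[OF assms]
    by (intro fg_subst_auto[where z = "\<lambda>k. fg_gen (Hilbert_Choice.inv s k)"])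
       (auto simp: fg_gen_def carrier_free_group nf_reduced reduced_Cons)
  moreover have "fg_subst n (\<lambda>k. fg_gen (s k)) [(k, True)] = [(s k, True)]" if "k \<in> {1..n}" for k
    using s that by (subst fg_subst_eq) (auto simp: fg_gen_def carrier_free_group nf_reduced reduced_Cons)
  ultimately show ?thesis using assms
    by (auto simp: conj_data_def perm_aut_def nf_reduced reduced_Cons)
qed

lemma conj_data_perm:
  assumes d: "conj_data n a s g" and t: "t permutes {1..n}"
  shows "conj_data n (a \<otimes>\<^bsub>BP n\<^esub> perm_aut n t) (s \<circ> t) (g \<circ> t)"
  using conj_data_mult[OF d conj_data_perm_aut_gen[OF t]] by (simp add: comp_def)

section \<open>Peak reduction to permutations\<close>

text \<open>Conjugation data in which no conjugator can be shortened: then \<open>a x\<^sub>k\<close> is the concatenation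
  \<open>winv (w k) @ [x\<^bsub>s k\<^esub>] @ w k\<close>, without cancellation.\<close>

definition canonical :: "nat \<Rightarrow> (word \<Rightarrow> word) \<Rightarrow> (nat \<Rightarrow> nat) \<Rightarrow> (nat \<Rightarrow> word) \<Rightarrow> bool" where
  "canonical n a s w \<longleftrightarrow> conj_data n a s w \<and>
     (\<forall>k\<in>{1..n}. reduced (w k) \<and> (w k = [] \<or> fst (hd (w k)) \<noteq> s k))"

definition height :: "nat \<Rightarrow> (word \<Rightarrow> word) \<Rightarrow> nat" where
  "height n a = (\<Sum>k\<in>{1..n}. length (a [(k, True)]))"

abbreviation strip :: "nat \<Rightarrow> word \<Rightarrow> word" where
  "strip p w \<equiv> dropWhile (\<lambda>l. fst l = p) w"

text \<open>Letters of \<open>w\<close> next to the middle letter that are powers of it commute with it and can be removed.\<close>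

lemma nf_conj_strip: "nf (winv (strip p w) @ (p, True) # strip p w) = nf (winv w @ (p, True) # w)"
proof (induction w)
  case (Cons l w)
  show ?case
  proof (cases "fst l = p")
    case True
    show ?thesis
    proof (cases "snd l")
      case True
      with \<open>fst l = p\<close> have "l = (p, True)" by (cases l) auto
      then show ?thesis using Cons nf_cancel_letter(1)[of "winv w" "(p, True)" "(p, True) # w"] by simp
    next
      case False
      with \<open>fst l = p\<close> have "l = (p, False)" by (cases l) auto
      then show ?thesis
        using Cons nf_cancel_letter(2)[of "winv w @ [(p, True)]" "(p, True)" w] by simp
    qed
  qed simp
qed simp

lemma reduced_strip: "reduced w \<Longrightarrow> reduced (strip p w)"
  by (induction w) (auto simp: reduced_Cons)

lemma words_strip: "w \<in> words n \<Longrightarrow> strip p w \<in> words n"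
  by (auto simp: words_def dest: set_dropWhileD)

lemma hd_strip: "strip p w = [] \<or> fst (hd (strip p w)) \<noteq> p"
  using hd_dropWhile[of "\<lambda>l. fst l = p" w] by auto

lemma reduced_conj:
  assumes "reduced w" "w = [] \<or> fst (hd w) \<noteq> fst l"
  shows "reduced (winv w @ l # w)"
proof (cases "w = []")
  case False
  then have "last (winv w) = linv (hd w)" by (cases w) auto
  then show ?thesis using assms False by (auto simp: reduced_append reduced_Cons prod_eq_iff)
qed (simp add: reduced_Cons)

lemma canonical_strip:
  assumes "conj_data n a s g"
  shows "canonical n a s (\<lambda>k. strip (s k) (nf (g k)))"
proof -
  have "a [(k, True)] = nf (winv (strip (s k) (nf (g k))) @ (s k, True) # strip (s k) (nf (g k)))"
    if "k \<in> {1..n}" for k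
    using assms that nf_conj_cong[of "nf (g k)" "g k" "(s k, True)"]
    by (simp add: nf_conj_strip) (simp add: conj_data_def)
  then show ?thesis using assms
    using hd_strip unfolding canonical_def conj_data_def
    by (intro conjI ballI) (auto simp: reduced_strip intro!: words_strip)
qed

lemma canonical_apply:
  "canonical n a s w \<Longrightarrow> k \<in> {1..n} \<Longrightarrow> a [(k, True)] = winv (w k) @ (s k, True) # w k"
  by (auto simp: canonical_def conj_data_def intro!: nf_reduced reduced_conj)

lemma height_canonical: "canonical n a s w \<Longrightarrow> height n a = (\<Sum>k\<in>{1..n}. Suc (2 * length (w k)))"
  unfolding height_def by (intro sum.cong) (auto simp: canonical_apply)

text \<open>In canonical data the images of the generators are written without cancellation, so their lengths
  are known exactly; for arbitrary data the conjugators give only an upper bound, which suffices on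
  the side of the smaller automorphism.\<close>

lemma height_less:
  assumes a: "canonical n a s w" and b: "conj_data n b s h"
    and le: "\<And>k. k \<in> {1..n} \<Longrightarrow> length (h k) \<le> length (w k)"
    and i: "i \<in> {1..n}" "length (h i) < length (w i)"
  shows "height n b < height n a"
proof -
  have len: "length (b [(k, True)]) \<le> Suc (2 * length (h k))" if "k \<in> {1..n}" for k
    using b that length_nf[of "winv (h k) @ (s k, True) # h k"] by (simp add: conj_data_def)
  have "(\<Sum>k\<in>{1..n}. length (b [(k, True)])) < (\<Sum>k\<in>{1..n}. Suc (2 * length (w k)))"
  proof (rule sum_strict_mono_ex1)
    show "\<forall>k\<in>{1..n}. length (b [(k, True)]) \<le> Suc (2 * length (w k))"
      using len le by (meson Suc_le_mono dual_order.trans mult_le_mono2)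
    show "\<exists>k\<in>{1..n}. length (b [(k, True)]) < Suc (2 * length (w k))"
      using len[OF i(1)] i by (intro bexI[of _ i]) auto
  qed simp
  then show ?thesis unfolding height_canonical[OF a] by (simp add: height_def)
qed

text \<open>When the conjugator of \<open>x\<^sub>i\<close> ends with a letter followed by \<open>g\<^sub>j\<close>, the move with the opposite sign
  cancels that letter. In canonical data this is the only way in which a move lowers the height.\<close>

lemma conj_data_step:
  assumes d: "conj_data n a s g" and m: "(i, j, e) \<in> moves n"
    and g: "nf (g i) = nf (u @ (s j, \<not> e) # g j)" and u: "u \<in> words n"
  shows "conj_data n (a \<otimes>\<^bsub>BP n\<^esub> conj_move n (i, j, e)) s (g(i := u @ g j))"
proof (rule conj_data_cong[OF conj_data_move[OF d m]])
  have "nf (g i @ winv (g j) @ (s j, e) # g j) = nf ((u @ (s j, \<not> e) # g j) @ winv (g j) @ (s j, e) # g j)"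
    by (rule nf_cong_append[OF g refl])
  also have "\<dots> = nf (u @ (s j, \<not> e) # (s j, e) # g j)"
    using nf_cancel(2)[of "u @ [(s j, \<not> e)]" "g j" "(s j, e) # g j"] by simp
  also have "\<dots> = nf (u @ g j)"
    using nf_cancel_letter(1)[of u "(s j, e)" "g j"] by simp
  finally show "(g(i := u @ g j)) k \<in> words n \<and>
      nf ((g(i := g i @ winv (g j) @ (s j, e) # g j)) k) = nf ((g(i := u @ g j)) k)"
    if "k \<in> {1..n}" for k
    using that d u m by (auto simp: conj_data_def moves_def)
qed

lemma move_inverse:
  assumes "a \<in> carrier (BP n)" "(i, j, e) \<in> moves n"
  shows "a \<otimes>\<^bsub>BP n\<^esub> conj_move n (i, j, e) \<otimes>\<^bsub>BP n\<^esub> conj_move n (i, j, \<not> e) = a"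
proof -
  obtain s g where d: "conj_data n a s g" using assms by (auto simp: carrier_BP)
  have m: "(i, j, \<not> e) \<in> moves n" "i \<noteq> j" using assms by (auto simp: moves_def)
  have w: "g i \<in> words n" "g j \<in> words n" using d assms by (auto simp: conj_data_def moves_def)
  let ?g = "g(i := g i @ winv (g j) @ (s j, e) # g j)"
  have "conj_data n (a \<otimes>\<^bsub>BP n\<^esub> conj_move n (i, j, e) \<otimes>\<^bsub>BP n\<^esub> conj_move n (i, j, \<not> e)) s
     (?g(i := (g i @ winv (g j)) @ ?g j))"
    using m w by (intro conj_data_step[OF conj_data_move[OF d assms(2)]]) auto
  from conj_data_eqI[OF this d] show ?thesis
    using m nf_cancel(1)[of "g i" "g j" "[]"] by (auto split: if_splits)
qed

text \<open>A move is called reducing when multiplication by it on the right lowers the height.\<close>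

definition reduces :: "nat \<Rightarrow> (word \<Rightarrow> word) \<Rightarrow> nat \<times> nat \<times> bool \<Rightarrow> bool" where
  "reduces n a m \<longleftrightarrow> a \<in> carrier (BP n) \<and> m \<in> moves n \<and> height n (a \<otimes>\<^bsub>BP n\<^esub> conj_move n m) < height n a"

lemma canonical_words:
  assumes "canonical n a s w" "i \<in> {1..n}"
  shows "w i \<in> words n" "s i \<in> {1..n}" "reduced (w i)"
  using assms by (auto simp: canonical_def conj_data_def simp del: atLeastAtMost_iff intro: permutes_in_image[THEN iffD2])

lemma canonical_inj:
  assumes "canonical n a s w"
  shows "s i = s j \<longleftrightarrow> i = j"
  using assms permutes_inj[of s "{1..n}"] by (auto simp: canonical_def conj_data_def inj_eq)

lemma reduces_suffix:
  assumes a: "canonical n a s w" and m: "(i, j, e) \<in> moves n" and w: "w i = u @ (s j, \<not> e) # w j"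
  shows "reduces n a (i, j, e)"
proof -
  have d: "conj_data n a s w" using a by (simp add: canonical_def)
  have ij: "i \<in> {1..n}" "j \<in> {1..n}" using m by (auto simp: moves_def)
  have u: "u \<in> words n" using canonical_words[OF a ij(1)] w by auto
  have "height n (a \<otimes>\<^bsub>BP n\<^esub> conj_move n (i, j, e)) < height n a"
  proof (rule height_less[OF a conj_data_step[OF d m _ u]])
    show "nf (w i) = nf (u @ (s j, \<not> e) # w j)" using w by simp
    show "length ((w(i := u @ w j)) k) \<le> length (w k)" for k using w by simp
    show "length ((w(i := u @ w j)) i) < length (w i)" using w by simp
  qed (rule ij)
  then show ?thesis using m d by (simp add: reduces_def conj_data_BP)
qed

text \<open>A move never preserves the height. Write \<open>p\<close> for the reduced form of \<open>w\<^sub>i w\<^sub>j\<inverse>\<close>. If \<open>p\<close> ends with the letter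
  that the move removes, then \<open>w\<^sub>i\<close> visibly ends with that letter followed by \<open>w\<^sub>j\<close>. Otherwise the letter
  added by the move survives in the new conjugator, and the inverse move removes it.\<close>

lemma suffix_or_reverse:
  assumes a: "canonical n a s w" and m: "(i, j, e) \<in> moves n"
  shows "(\<exists>u. w i = u @ (s j, \<not> e) # w j) \<or> reduces n (a \<otimes>\<^bsub>BP n\<^esub> conj_move n (i, j, e)) (i, j, \<not> e)"
proof (rule disjCI)
  assume no: "\<not> reduces n (a \<otimes>\<^bsub>BP n\<^esub> conj_move n (i, j, e)) (i, j, \<not> e)"
  let ?b = "a \<otimes>\<^bsub>BP n\<^esub> conj_move n (i, j, e)"
  have d: "conj_data n a s w" using a by (simp add: canonical_def)
  have ij: "i \<in> {1..n}" "j \<in> {1..n}" "i \<noteq> j" using m by (auto simp: moves_def)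
  have wj: "reduced (w j)" "w j = [] \<or> fst (hd (w j)) \<noteq> s j" using a ij by (auto simp: canonical_def)
  have wi: "reduced (w i)" using canonical_words[OF a ij(1)] by simp
  \<comment> \<open>\<open>p\<close> is the part of \<open>w\<^sub>i\<close> in front of \<open>w\<^sub>j\<close> after all cancellation\<close>
  define p where "p = nf (w i @ winv (w j))"
  have p_wj: "nf (p @ w j) = w i"
    using nf_cancel(1)[of "w i" "w j" "[]"] wi by (simp add: p_def nf_append_left nf_reduced)
  show "\<exists>u. w i = u @ (s j, \<not> e) # w j"
  proof (cases "p = [] \<or> last p \<noteq> (s j, \<not> e)")
    case False
    then have p: "p = butlast p @ [(s j, \<not> e)]" by (metis append_butlast_last_id)
    have "reduced (butlast p @ [(s j, \<not> e)])" using p by (metis p_def reduced_nf)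
    then have "reduced (butlast p @ [(s j, \<not> e)] @ w j)"
      using wj by (auto simp: reduced_append reduced_Cons)
    then have "w i = butlast p @ [(s j, \<not> e)] @ w j" using p_wj p by (metis append.assoc nf_reduced)
    then show ?thesis by auto
  next
    case True
    have red: "reduced (p @ (s j, e) # w j)"
      using wj True by (auto simp: reduced_append reduced_Cons prod_eq_iff) (auto simp: p_def)
    let ?g = "w(i := w i @ winv (w j) @ (s j, e) # w j)"
    let ?w = "\<lambda>k. strip (s k) (nf (?g k))"
    have can: "canonical n ?b s ?w" by (rule canonical_strip[OF conj_data_move[OF d m]])
    have nfg: "nf (?g i) = p @ (s j, e) # w j"
      using red nf_append_left[of "w i @ winv (w j)" "(s j, e) # w j"] by (simp add: p_def nf_reduced)
    have "s j \<noteq> s i" using canonical_inj[OF a] ij by auto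
    then have "?w i = strip (s i) p @ (s j, e) # w j"
      unfolding nfg by (simp add: dropWhile_append3 dropWhile_append)
    moreover have "?w j = w j"
      using wj ij by (cases "w j") (auto simp: nf_reduced)
    ultimately have "?w i = strip (s i) p @ (s j, \<not> \<not> e) # ?w j" by simp
    moreover have "(i, j, \<not> e) \<in> moves n" using m by (simp add: moves_def)
    ultimately have "reduces n ?b (i, j, \<not> e)" using reduces_suffix[OF can] by blast
    with no show ?thesis by simp
  qed
qed

lemma move_in_BP: "m \<in> moves n \<Longrightarrow> conj_move n m \<in> carrier (BP n)"
  using conj_data_BP[OF conj_data_conj_move_gen] by (cases m) auto

lemma perm_in_BP: "s permutes {1..n} \<Longrightarrow> perm_aut n s \<in> carrier (BP n)"
  by (rule conj_data_BP[OF conj_data_perm_aut_gen])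

lemma mult_in_BP: "a \<in> carrier (BP n) \<Longrightarrow> b \<in> carrier (BP n) \<Longrightarrow> a \<otimes>\<^bsub>BP n\<^esub> b \<in> carrier (BP n)"
  using group_BP by (simp add: group_def monoid.m_closed)

lemma reduces_iff_suffix:
  assumes a: "canonical n a s w" and m: "(i, j, e) \<in> moves n"
  shows "reduces n a (i, j, e) \<longleftrightarrow> (\<exists>u. w i = u @ (s j, \<not> e) # w j)"
proof
  assume r: "reduces n a (i, j, e)"
  then show "\<exists>u. w i = u @ (s j, \<not> e) # w j"
    using suffix_or_reverse[OF a m] move_inverse[of a n i j e] by (auto simp: reduces_def)
qed (use reduces_suffix[OF assms] in blast)

lemma canonical_exists: "a \<in> carrier (BP n) \<Longrightarrow> \<exists>s w. canonical n a s w"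
  using canonical_strip carrier_BP by metis

abbreviation move_inv :: "nat \<times> nat \<times> bool \<Rightarrow> nat \<times> nat \<times> bool" where
  "move_inv m \<equiv> (fst m, fst (snd m), \<not> snd (snd m))"

lemma move_inv_in [simp]: "move_inv m \<in> moves n \<longleftrightarrow> m \<in> moves n"
  by (cases m) (simp add: moves_def)

lemma reduces_or_reverse:
  assumes "a \<in> carrier (BP n)" "m \<in> moves n"
  shows "reduces n a m \<or> reduces n (a \<otimes>\<^bsub>BP n\<^esub> conj_move n m) (move_inv m)"
proof -
  obtain s w where "canonical n a s w" using canonical_exists[OF assms(1)] by auto
  then show ?thesis using suffix_or_reverse reduces_iff_suffix assms(2) by (cases m) auto
qed

text \<open>When no move reduces the height, the conjugates \<open>a x\<^sub>k\<close> are Nielsen reduced: the middle letters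
  survive in any product of them, so a generator can only be such a product if some conjugator is
  empty.\<close>

lemma nielsen_reduced:
  assumes a: "canonical n a s w" and no: "\<And>m. \<not> reduces n a m"
    and v: "reduced v" "v \<in> words n" "v \<noteq> []"
  shows "\<exists>q. nf (wsub (\<lambda>k. a [(k, True)]) v) = winv (w (fst (hd v))) @ (s (fst (hd v)), snd (hd v)) # q"
  using v
proof (induction v)
  case (Cons l v)
  define i e where "i = fst l" and "e = snd l"
  have i: "i \<in> {1..n}" using Cons.prems by (simp add: i_def)
  have wi: "reduced (winv (w i) @ (s i, e) # w i)"
    using a i by (intro reduced_conj) (auto simp: canonical_def)
  have li: "(if snd l then a [(fst l, True)] else winv (a [(fst l, True)])) = winv (w i) @ (s i, e) # w i"
    using canonical_apply[OF a i] by (auto simp: i_def e_def)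
  show ?case
  proof (cases "v = []")
    case True
    then show ?thesis using nf_reduced[OF wi] li by (auto simp: i_def e_def)
  next
    case False
    define k f where "k = fst (hd v)" and "f = snd (hd v)"
    have k: "k \<in> {1..n}" using Cons.prems False by (cases v) (auto simp: k_def)
    obtain q where q: "nf (wsub (\<lambda>k. a [(k, True)]) v) = winv (w k) @ (s k, f) # q"
      using Cons False by (auto simp: reduced_Cons k_def f_def)
    define p where "p = nf (w i @ winv (w k))"
    have "reduced (winv (w k) @ (s k, f) # q)" using q by (metis reduced_nf)
    then have rq: "reduced ((s k, f) # q)" by (simp add: reduced_append)
    \<comment> \<open>if nothing separates the two middle letters, they could cancel only for equal indices and opposite signs, which the reduced word \<open>v\<close> excludes\<close>
    have ne: "(s k, f) \<noteq> linv (s i, e)" if "p = []"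
    proof (cases "i = k")
      case True
      then show ?thesis using Cons.prems False
        by (auto simp: reduced_Cons i_def k_def e_def f_def prod_eq_iff)
    next
      case False
      then show ?thesis using canonical_inj[OF a, of k i] by auto
    qed
    \<comment> \<open>otherwise \<open>w\<^sub>i\<close> would end with \<open>x\<^bsub>s k\<^esub>\<^sup>\<plusminus>\<^sup>1 w\<^sub>k\<close> and a move would reduce the height\<close>
    have suffix: "fst (last (nf (w i' @ winv (w k')))) \<noteq> s k'"
      if "i' \<in> {1..n}" "k' \<in> {1..n}" "nf (w i' @ winv (w k')) \<noteq> []" for i' k'
    proof
      let ?p = "nf (w i' @ winv (w k'))"
      assume l: "fst (last ?p) = s k'"
      have "i' \<noteq> k'" using that nf_cancel(2)[of "[]" "w i'" "[]"] by auto
      then have m: "(i', k', \<not> snd (last ?p)) \<in> moves n" using that by (auto simp: moves_def)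
      have "?p = butlast ?p @ [last ?p]" using that by simp
      moreover have "last ?p = (s k', snd (last ?p))" using l by (auto simp: prod_eq_iff)
      ultimately have p: "?p = butlast ?p @ [(s k', snd (last ?p))]" by metis
      have "reduced (?p @ w k')"
        using l a that by (auto simp: reduced_append canonical_def prod_eq_iff)
      then have "w i' = ?p @ w k'"
        using nf_cancel(1)[of "w i'" "w k'" "[]"] canonical_words[OF a that(1)]
        by (metis append.right_neutral append_assoc nf_append_left nf_reduced)
      then have "w i' = butlast ?p @ (s k', \<not> \<not> snd (last ?p)) # w k'"
        using p by (metis append.assoc append_Cons append_Nil)
      then show False using reduces_suffix[OF a m] no by blast
    qed
    have pk: "fst (last p) \<noteq> s k" if "p \<noteq> []" using suffix[OF i k] that by (simp add: p_def)
    have pi: "fst (hd p) \<noteq> s i" if "p \<noteq> []"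
    proof -
      have "winv p = nf (w k @ winv (w i))" by (simp add: p_def nf_winv[symmetric])
      moreover have "last (winv p) = linv (hd p)" using that by (cases p) auto
      moreover have "winv p \<noteq> []" using that by (simp add: winv_def)
      ultimately show ?thesis using suffix[OF k i] by (metis fst_conv)
    qed
    have "reduced p" by (simp add: p_def)
    have "reduced (p @ (s k, f) # q)"
      using rq \<open>reduced p\<close> pk by (auto simp: reduced_append[of p])
    then have "reduced ((s i, e) # p @ (s k, f) # q)"
      using pi ne by (auto simp: reduced_Cons[of "(s i, e)"] hd_append)
    moreover have "reduced (winv (w i) @ [(s i, e)])" using wi by (simp add: reduced_append reduced_Cons)
    ultimately have red: "reduced (winv (w i) @ (s i, e) # p @ (s k, f) # q)"
      by (auto simp: reduced_append)
    have "nf (wsub (\<lambda>k. a [(k, True)]) (l # v)) = nf ((winv (w i) @ (s i, e) # w i) @ nf (wsub (\<lambda>k. a [(k, True)]) v))"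
      unfolding nf_append_right using li by simp
    also have "\<dots> = nf (((winv (w i) @ [(s i, e)]) @ (w i @ winv (w k)) @ (s k, f) # q))"
      unfolding q by simp
    also have "\<dots> = nf ((winv (w i) @ [(s i, e)]) @ p @ (s k, f) # q)"
      unfolding p_def by (metis nf_append_left nf_append_right)
    also have "\<dots> = winv (w i) @ (s i, e) # p @ (s k, f) # q"
      using nf_reduced[OF red] by simp
    finally show ?thesis by (auto simp: i_def e_def)
  qed
qed simp

text \<open>The word \<open>v\<close> with \<open>a v = x\<^bsub>s k\<^esub>\<close> exists because \<open>a\<close> is surjective. By \<open>nielsen_reduced\<close> the value
  begins with the inverse of a conjugator followed by its middle letter, and it has only one letter:
  that conjugator is empty and belongs to \<open>x\<^sub>k\<close>.\<close>

lemma irreducible_perm: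
  assumes a: "a \<in> carrier (BP n)" and no: "\<And>m. \<not> reduces n a m"
  shows "\<exists>s. s permutes {1..n} \<and> a = perm_aut n s"
proof -
  obtain s w where can: "canonical n a s w" using canonical_exists[OF a] by auto
  then have d: "conj_data n a s w" and s: "s permutes {1..n}" by (auto simp: canonical_def conj_data_def)
  have "w k = []" if k: "k \<in> {1..n}" for k
  proof -
    have sk: "[(s k, True)] \<in> carrier (free_group n)" using canonical_words(2)[OF can k] by (rule fg_gen_in)
    obtain v where v: "v \<in> carrier (free_group n)" "a v = [(s k, True)]"
      using sk conj_data_auto[OF d] by (auto simp: auto_def Bij_def bij_betw_def) (metis image_iff)
    have "nf (wsub (\<lambda>k. a [(k, True)]) v) = [(s k, True)]"
      using v auto_apply[OF conj_data_auto[OF d], of v] by (auto simp: carrier_free_group nf_reduced)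
    moreover from this have "v \<noteq> []" by auto
    moreover have "reduced v" "v \<in> words n" using v by (auto simp: carrier_free_group)
    ultimately obtain q where q: "[(s k, True)] = winv (w (fst (hd v))) @ (s (fst (hd v)), snd (hd v)) # q"
      using nielsen_reduced[OF can no] by metis
    then have "winv (w (fst (hd v))) = []" "s (fst (hd v)) = s k"
      by (auto simp: Cons_eq_append_conv)
    then show "w k = []" using canonical_inj[OF can] by (metis winv_simps(1) winv_winv)
  qed
  then have "a = perm_aut n s"
    by (intro conj_data_eqI[OF d conj_data_perm_aut_gen[OF s]]) auto
  with s show ?thesis by blast
qed

lemma perm_irreducible:
  assumes "s permutes {1..n}"
  shows "\<not> reduces n (perm_aut n s) m"
proof
  assume r: "reduces n (perm_aut n s) m"
  have "canonical n (perm_aut n s) s (\<lambda>_. [])"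
    using conj_data_perm_aut_gen[OF assms] by (simp add: canonical_def)
  from reduces_iff_suffix[OF this] r show False by (cases m) (auto simp: reduces_def)
qed

text \<open>Generation of \<open>BP n\<close> by permutations and moves: descend along reducing moves to a permutation and
  return along their inverses.\<close>

lemma BP_induct [consumes 1, case_names perm move]:
  assumes "a \<in> carrier (BP n)"
    and "\<And>s. s permutes {1..n} \<Longrightarrow> Q (perm_aut n s)"
    and "\<And>b m. b \<in> carrier (BP n) \<Longrightarrow> m \<in> moves n \<Longrightarrow> Q b \<Longrightarrow> Q (b \<otimes>\<^bsub>BP n\<^esub> conj_move n m)"
  shows "Q a"
  using assms(1)
proof (induction "height n a" arbitrary: a rule: less_induct)
  case less
  show ?case
  proof (cases "\<exists>m. reduces n a m")
    case False
    then show ?thesis using irreducible_perm[OF less.prems] assms(2) by blast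
  next
    case True
    then obtain m where m: "reduces n a m" by blast
    let ?b = "a \<otimes>\<^bsub>BP n\<^esub> conj_move n m"
    have mm: "m \<in> moves n" using m by (simp add: reduces_def)
    have b: "?b \<in> carrier (BP n)" using less.prems mm by (simp add: mult_in_BP move_in_BP)
    have "Q ?b" using less.hyps[OF _ b] m by (simp add: reduces_def)
    then have "Q (?b \<otimes>\<^bsub>BP n\<^esub> conj_move n (move_inv m))" using assms(3)[OF b] mm by simp
    also have "?b \<otimes>\<^bsub>BP n\<^esub> conj_move n (move_inv m) = a"
      using move_inverse[OF less.prems] mm by (cases m) auto
    finally show ?thesis .
  qed
qed

section \<open>The presentation of the braid-permutation group by peak reduction\<close>

text \<open>The left factor \<open>a\<close> is kept so that the identity can be used at any vertex of a reduction path.\<close>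

lemma moves_commute:
  assumes a: "a \<in> carrier (BP n)" and m: "(i, j, e) \<in> moves n" "(k, l, d) \<in> moves n"
    and ne: "i \<noteq> k" "i \<noteq> l" "k \<noteq> j"
  shows "a \<otimes>\<^bsub>BP n\<^esub> conj_move n (i, j, e) \<otimes>\<^bsub>BP n\<^esub> conj_move n (k, l, d)
       = a \<otimes>\<^bsub>BP n\<^esub> conj_move n (k, l, d) \<otimes>\<^bsub>BP n\<^esub> conj_move n (i, j, e)"
proof -
  obtain s g where d: "conj_data n a s g" using a by (auto simp: carrier_BP)
  show ?thesis
    by (rule conj_data_eqI[OF conj_data_move[OF conj_data_move[OF d m(1)] m(2)]
          conj_data_move[OF conj_data_move[OF d m(2)] m(1)]])
       (use ne in auto)
qed

lemma perm_move:
  assumes a: "a \<in> carrier (BP n)" and m: "(i, j, e) \<in> moves n" and t: "t permutes {1..n}"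
  shows "a \<otimes>\<^bsub>BP n\<^esub> perm_aut n t \<otimes>\<^bsub>BP n\<^esub> conj_move n (i, j, e)
       = a \<otimes>\<^bsub>BP n\<^esub> conj_move n (t i, t j, e) \<otimes>\<^bsub>BP n\<^esub> perm_aut n t"
    and "(t i, t j, e) \<in> moves n"
proof -
  obtain s g where d: "conj_data n a s g" using a by (auto simp: carrier_BP)
  have inj: "t x = t y \<longleftrightarrow> x = y" for x y using permutes_inj[OF t] by (auto simp: inj_eq)
  have "t i \<in> {1..n}" "t j \<in> {1..n}" using m permutes_in_image[OF t] by (auto simp: moves_def simp del: atLeastAtMost_iff)
  then show m': "(t i, t j, e) \<in> moves n"
    using m inj by (auto simp: moves_def)
  show "a \<otimes>\<^bsub>BP n\<^esub> perm_aut n t \<otimes>\<^bsub>BP n\<^esub> conj_move n (i, j, e)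
       = a \<otimes>\<^bsub>BP n\<^esub> conj_move n (t i, t j, e) \<otimes>\<^bsub>BP n\<^esub> perm_aut n t"
    by (rule conj_data_eqI[OF conj_data_move[OF conj_data_perm[OF d t] m]
          conj_data_perm[OF conj_data_move[OF d m'] t]]) (auto simp: inj)
qed

lemma perm_aut_mult:
  assumes "s permutes {1..n}" "t permutes {1..n}"
  shows "perm_aut n s \<otimes>\<^bsub>BP n\<^esub> perm_aut n t = perm_aut n (s \<circ> t)"
  using conj_data_eqI[OF conj_data_perm[OF conj_data_perm_aut_gen[OF assms(1)] assms(2)]
      conj_data_perm_aut_gen[OF permutes_compose[OF assms(2,1)]]] by simp

lemma perm_aut_id: "perm_aut n id = \<one>\<^bsub>BP n\<^esub>"
  using conj_data_eqI[OF conj_data_perm_aut_gen[OF permutes_id] conj_data_one] by simp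

text \<open>Two reducing moves at \<open>a\<close> that do not commute are among the three moves \<open>(i, j, e)\<close>, \<open>(l, j, e)\<close> and
  \<open>(i, l, d)\<close> below, and the conjugators are nested as in the hypotheses. The relation between \<open>a\<^sub>i\<^sub>l\<close> and
  \<open>a\<^sub>i\<^sub>j a\<^sub>l\<^sub>j\<close> then closes the peak by a hexagon whose other vertices all lie strictly below \<open>a\<close>.\<close>

lemma triple_heights:
  assumes can: "canonical n a s w" and dist: "distinct [i, j, l]"
    and m: "(i, j, e) \<in> moves n" "(l, j, e) \<in> moves n" "(i, l, d) \<in> moves n"
    and wl: "w l = v @ (s j, \<not> e) # w j" and wi: "w i = u @ (s l, \<not> d) # w l"
  defines "D1 \<equiv> conj_move n (i, j, e)" and "D2 \<equiv> conj_move n (l, j, e)" and "L \<equiv> conj_move n (i, l, d)"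
  shows "height n (a \<otimes>\<^bsub>BP n\<^esub> D1) < height n a" "height n (a \<otimes>\<^bsub>BP n\<^esub> D2) < height n a"
    "height n (a \<otimes>\<^bsub>BP n\<^esub> L) < height n a" "height n (a \<otimes>\<^bsub>BP n\<^esub> D1 \<otimes>\<^bsub>BP n\<^esub> D2) < height n a"
    "height n (a \<otimes>\<^bsub>BP n\<^esub> D1 \<otimes>\<^bsub>BP n\<^esub> D2 \<otimes>\<^bsub>BP n\<^esub> L) < height n a"
    "height n (a \<otimes>\<^bsub>BP n\<^esub> L \<otimes>\<^bsub>BP n\<^esub> D1) < height n a"
    "a \<otimes>\<^bsub>BP n\<^esub> D1 \<otimes>\<^bsub>BP n\<^esub> D2 \<otimes>\<^bsub>BP n\<^esub> L = a \<otimes>\<^bsub>BP n\<^esub> L \<otimes>\<^bsub>BP n\<^esub> D1 \<otimes>\<^bsub>BP n\<^esub> D2"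
proof -
  have d: "conj_data n a s w" using can by (simp add: canonical_def)
  have ijl: "i \<in> {1..n}" "j \<in> {1..n}" "l \<in> {1..n}" using m by (auto simp: moves_def)
  have uv: "u \<in> words n" "v \<in> words n" "w j \<in> words n" "s j \<in> {1..n}" "s l \<in> {1..n}"
    using canonical_words[OF can ijl(1)] canonical_words[OF can ijl(2)] canonical_words[OF can ijl(3)] wl wi
    by auto
  have 1: "conj_data n (a \<otimes>\<^bsub>BP n\<^esub> D1) s (w(i := (u @ (s l, \<not> d) # v) @ w j))"
    unfolding D1_def by (rule conj_data_step[OF d m(1)]) (use wl wi uv in auto)
  have 2: "conj_data n (a \<otimes>\<^bsub>BP n\<^esub> D2) s (w(l := v @ w j))"
    unfolding D2_def by (rule conj_data_step[OF d m(2)]) (use wl wi uv in auto)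
  have 3: "conj_data n (a \<otimes>\<^bsub>BP n\<^esub> L) s (w(i := u @ w l))"
    unfolding L_def by (rule conj_data_step[OF d m(3)]) (use wl wi uv in auto)
  have 4: "conj_data n (a \<otimes>\<^bsub>BP n\<^esub> D1 \<otimes>\<^bsub>BP n\<^esub> D2) s (w(i := (u @ (s l, \<not> d) # v) @ w j, l := v @ w j))"
    using conj_data_step[OF 1 m(2), of v, folded D2_def] wl wi uv dist by auto
  have 5: "conj_data n (a \<otimes>\<^bsub>BP n\<^esub> D1 \<otimes>\<^bsub>BP n\<^esub> D2 \<otimes>\<^bsub>BP n\<^esub> L) s
      (w(i := (u @ (s l, \<not> d) # v) @ w j, l := v @ w j, i := u @ (v @ w j)))"
    using conj_data_step[OF 4 m(3), of u, folded L_def] wl wi uv dist by auto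
  have 6: "conj_data n (a \<otimes>\<^bsub>BP n\<^esub> L \<otimes>\<^bsub>BP n\<^esub> D1) s (w(i := u @ w l, i := (u @ v) @ w j))"
    using conj_data_step[OF 3 m(1), of "u @ v", folded D1_def] wl wi uv dist by auto
  have 7: "conj_data n (a \<otimes>\<^bsub>BP n\<^esub> L \<otimes>\<^bsub>BP n\<^esub> D1 \<otimes>\<^bsub>BP n\<^esub> D2) s
      (w(i := u @ w l, i := (u @ v) @ w j, l := v @ w j))"
    using conj_data_step[OF 6 m(2), of v, folded D2_def] wl wi uv dist by auto
  show "height n (a \<otimes>\<^bsub>BP n\<^esub> D1) < height n a"
    by (rule height_less[OF can 1 _ ijl(1)]) (use wl wi in auto)
  show "height n (a \<otimes>\<^bsub>BP n\<^esub> D2) < height n a"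
    by (rule height_less[OF can 2 _ ijl(3)]) (use wl wi in auto)
  show "height n (a \<otimes>\<^bsub>BP n\<^esub> L) < height n a"
    by (rule height_less[OF can 3 _ ijl(1)]) (use wl wi in auto)
  show "height n (a \<otimes>\<^bsub>BP n\<^esub> D1 \<otimes>\<^bsub>BP n\<^esub> D2) < height n a"
    by (rule height_less[OF can 4 _ ijl(3)]) (use wl wi in auto)
  show "height n (a \<otimes>\<^bsub>BP n\<^esub> D1 \<otimes>\<^bsub>BP n\<^esub> D2 \<otimes>\<^bsub>BP n\<^esub> L) < height n a"
    by (rule height_less[OF can 5 _ ijl(3)]) (use wl wi dist in auto)
  show "height n (a \<otimes>\<^bsub>BP n\<^esub> L \<otimes>\<^bsub>BP n\<^esub> D1) < height n a"
    by (rule height_less[OF can 6 _ ijl(1)]) (use wl wi in auto)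
  show "a \<otimes>\<^bsub>BP n\<^esub> D1 \<otimes>\<^bsub>BP n\<^esub> D2 \<otimes>\<^bsub>BP n\<^esub> L = a \<otimes>\<^bsub>BP n\<^esub> L \<otimes>\<^bsub>BP n\<^esub> D1 \<otimes>\<^bsub>BP n\<^esub> D2"
    by (rule conj_data_eqI[OF 5 7]) (use dist in auto)
qed

text \<open>Commuting reducing moves shorten different conjugators, so the opposite vertex of the square is
  lower still.\<close>

lemma commuting_height:
  assumes can: "canonical n a s w"
    and r: "reduces n a (i, j, e)" "reduces n a (k, l, d)" and ne: "i \<noteq> k" "i \<noteq> l" "k \<noteq> j"
  shows "height n (a \<otimes>\<^bsub>BP n\<^esub> conj_move n (i, j, e) \<otimes>\<^bsub>BP n\<^esub> conj_move n (k, l, d)) < height n a"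
proof -
  have d: "conj_data n a s w" using can by (simp add: canonical_def)
  have m: "(i, j, e) \<in> moves n" "(k, l, d) \<in> moves n" using r by (auto simp: reduces_def)
  then have ik: "i \<in> {1..n}" "k \<in> {1..n}" by (auto simp: moves_def)
  obtain u v where u: "w i = u @ (s j, \<not> e) # w j" and v: "w k = v @ (s l, \<not> d) # w l"
    using r reduces_iff_suffix[OF can] m by metis
  have uv: "u \<in> words n" "v \<in> words n"
    using canonical_words[OF can ik(1)] canonical_words[OF can ik(2)] u v by auto
  have 1: "conj_data n (a \<otimes>\<^bsub>BP n\<^esub> conj_move n (i, j, e)) s (w(i := u @ w j))"
    by (rule conj_data_step[OF d m(1)]) (use u uv in auto)
  have 2: "conj_data n (a \<otimes>\<^bsub>BP n\<^esub> conj_move n (i, j, e) \<otimes>\<^bsub>BP n\<^esub> conj_move n (k, l, d)) s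
      (w(i := u @ w j, k := v @ w l))"
    using conj_data_step[OF 1 m(2), of v] v uv ne by auto
  show ?thesis by (rule height_less[OF can 2 _ ik(2)]) (use u v in auto)
qed

text \<open>The relations of the presentation of \<open>BP n\<close> as a semidirect product: McCool's relations between the
  \<open>E i j\<close>, and the action of the permutations on them. Any target with such elements receives a
  homomorphism, constructed in this locale.\<close>

locale BP_relations = group H for H (structure) +
  fixes n :: nat and E :: "nat \<Rightarrow> nat \<Rightarrow> 'h" and P :: "(nat \<Rightarrow> nat) \<Rightarrow> 'h"
  assumes E_closed: "(i, j) \<in> indices n \<Longrightarrow> E i j \<in> carrier H"
    and P_hom: "P \<in> hom (sym_group n) H"
    and P_E: "s permutes {1..n} \<Longrightarrow> (i, j) \<in> indices n \<Longrightarrow> P s \<otimes> E i j = E (s i) (s j) \<otimes> P s"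
    and rel_same: "{i, j, k} \<subseteq> {1..n} \<Longrightarrow> distinct [i, j, k] \<Longrightarrow> E i k \<otimes> E j k = E j k \<otimes> E i k"
    and rel_triple: "{i, j, k} \<subseteq> {1..n} \<Longrightarrow> distinct [i, j, k] \<Longrightarrow>
      E i j \<otimes> (E i k \<otimes> E j k) = (E i k \<otimes> E j k) \<otimes> E i j"
    and rel_disjoint: "{i, j, k, l} \<subseteq> {1..n} \<Longrightarrow> distinct [i, j, k, l] \<Longrightarrow> E i j \<otimes> E k l = E k l \<otimes> E i j"
begin

definition Em :: "nat \<times> nat \<times> bool \<Rightarrow> 'h" where
  "Em = (\<lambda>(i, j, e). if e then E i j else inv E i j)"

lemma P_closed [simp]: "s permutes {1..n} \<Longrightarrow> P s \<in> carrier H"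
  using P_hom by (auto simp: hom_def sym_group_carrier)

lemma P_mult: "s permutes {1..n} \<Longrightarrow> t permutes {1..n} \<Longrightarrow> P (s \<circ> t) = P s \<otimes> P t"
  using P_hom by (auto simp: hom_def sym_group_carrier sym_group_mult)

lemma Em_closed [simp]: "m \<in> moves n \<Longrightarrow> Em m \<in> carrier H"
  using E_closed by (auto simp: Em_def moves_def indices_def split: prod.splits)

lemma Em_move_inv: "m \<in> moves n \<Longrightarrow> Em (move_inv m) = inv (Em m)"
  using E_closed by (auto simp: Em_def moves_def indices_def split: prod.splits)

lemma commute_inv:
  assumes "x \<in> carrier H" "y \<in> carrier H" "x \<otimes> y = y \<otimes> x"
  shows "inv x \<otimes> y = y \<otimes> inv x"
proof -
  have "inv x \<otimes> y = inv x \<otimes> (y \<otimes> x) \<otimes> inv x" using assms(1,2) by (simp add: m_assoc)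
  also have "\<dots> = inv x \<otimes> (x \<otimes> y) \<otimes> inv x" by (simp only: assms(3))
  also have "\<dots> = y \<otimes> inv x" using assms(1,2) by (simp flip: m_assoc)
  finally show ?thesis .
qed

lemma Em_commute_signs:
  assumes "(i, j) \<in> indices n" "(k, l) \<in> indices n" "E i j \<otimes> E k l = E k l \<otimes> E i j"
  shows "Em (i, j, e) \<otimes> Em (k, l, d) = Em (k, l, d) \<otimes> Em (i, j, e)"
  using assms E_closed commute_inv by (simp add: Em_def)

lemma Em_commute:
  assumes "(i, j, e) \<in> moves n" "(k, l, d) \<in> moves n" "i \<noteq> k" "i \<noteq> l" "k \<noteq> j"
  shows "Em (i, j, e) \<otimes> Em (k, l, d) = Em (k, l, d) \<otimes> Em (i, j, e)"
proof (rule Em_commute_signs)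
  show "(i, j) \<in> indices n" "(k, l) \<in> indices n" using assms by (auto simp: moves_def indices_def)
  show "E i j \<otimes> E k l = E k l \<otimes> E i j"
    using assms rel_same[of i k j] rel_disjoint[of i j k l] by (cases "j = l") (auto simp: moves_def)
qed

text \<open>The relation for \<open>a\<^sub>i\<^sub>l\<close> and \<open>a\<^sub>i\<^sub>j a\<^sub>l\<^sub>j\<close> with signs: the two factors of the product commute, so inverting
  both of them inverts the product.\<close>

lemma Em_triple:
  assumes m: "(i, j, e) \<in> moves n" "(l, j, e) \<in> moves n" "(i, l, d) \<in> moves n"
  shows "Em (i, l, d) \<otimes> (Em (i, j, e) \<otimes> Em (l, j, e)) = (Em (i, j, e) \<otimes> Em (l, j, e)) \<otimes> Em (i, l, d)"
proof -
  have ijl: "{i, l, j} \<subseteq> {1..n}" "distinct [i, l, j]" using m by (auto simp: moves_def)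
  have c: "E i l \<in> carrier H" "E i j \<in> carrier H" "E l j \<in> carrier H"
    using ijl E_closed by (auto simp: indices_def)
  let ?D = "E i j \<otimes> E l j"
  have D: "?D \<in> carrier H" using c by simp
  have *: "E i l \<otimes> ?D = ?D \<otimes> E i l" using rel_triple[OF ijl] .
  have eD: "Em (i, j, e) \<otimes> Em (l, j, e) = (if e then ?D else inv ?D)"
    using c rel_same[of i l j] ijl by (auto simp: Em_def inv_mult_group[symmetric])
  show ?thesis
    unfolding eD using * commute_inv[OF c(1) D] commute_inv[OF D c(1)] commute_inv[OF D inv_closed[OF c(1)]]
    by (auto simp: Em_def)
qed

text \<open>Intended for permutation automorphisms, where the image of \<open>x\<^sub>i\<close> is a single letter.\<close>

definition perm_of :: "(word \<Rightarrow> word) \<Rightarrow> nat \<Rightarrow> nat" where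
  "perm_of a i = (if i \<in> {1..n} then fst (hd (a [(i, True)])) else i)"

lemma perm_of_perm_aut:
  assumes "s permutes {1..n}"
  shows "perm_of (perm_aut n s) = s"
proof
  fix i show "perm_of (perm_aut n s) i = s i"
    using conj_data_perm_aut_gen[OF assms] permutes_not_in[OF assms]
    by (auto simp: perm_of_def conj_data_def nf_reduced reduced_Cons simp del: atLeastAtMost_iff)
qed

definition reducing_move :: "(word \<Rightarrow> word) \<Rightarrow> nat \<times> nat \<times> bool" where
  "reducing_move a = (SOME m. reduces n a m)"

text \<open>Follow arbitrarily chosen reducing moves down to a permutation and record the inverses of their
  images.\<close>

function rep :: "(word \<Rightarrow> word) \<Rightarrow> 'h" where
  "rep a = (if \<exists>m. reduces n a m
     then rep (a \<otimes>\<^bsub>BP n\<^esub> conj_move n (reducing_move a)) \<otimes> inv (Em (reducing_move a))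
     else P (perm_of a))"
  by pat_completeness auto
termination
proof (relation "measure (height n)")
  fix a assume "\<exists>m. reduces n a m"
  then have "reduces n a (reducing_move a)" unfolding reducing_move_def by (rule someI_ex)
  then show "(a \<otimes>\<^bsub>BP n\<^esub> conj_move n (reducing_move a), a) \<in> measure (height n)"
    by (simp add: reduces_def)
qed simp

declare rep.simps [simp del]

lemma rep_perm [simp]: "s permutes {1..n} \<Longrightarrow> rep (perm_aut n s) = P s"
  by (subst rep.simps) (simp add: perm_irreducible perm_of_perm_aut)

lemma reducing_move: "reduces n a m \<Longrightarrow> reduces n a (reducing_move a)"
  unfolding reducing_move_def by (rule someI)

lemma reduces_BP: "reduces n a m \<Longrightarrow> a \<otimes>\<^bsub>BP n\<^esub> conj_move n m \<in> carrier (BP n)"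
  by (auto simp: reduces_def intro: mult_in_BP move_in_BP)

lemma rep_reducible: "reduces n a m \<Longrightarrow>
    rep a = rep (a \<otimes>\<^bsub>BP n\<^esub> conj_move n (reducing_move a)) \<otimes> inv (Em (reducing_move a))"
  by (subst rep.simps) (rule if_P, blast)

lemma rep_closed: "a \<in> carrier (BP n) \<Longrightarrow> rep a \<in> carrier H"
proof (induction "height n a" arbitrary: a rule: less_induct)
  case less
  show ?case
  proof (cases "\<exists>m. reduces n a m")
    case True
    then have r: "reduces n a (reducing_move a)" using reducing_move by blast
    then have "rep (a \<otimes>\<^bsub>BP n\<^esub> conj_move n (reducing_move a)) \<in> carrier H"
      using less.hyps[OF _ reduces_BP[OF r]] by (simp add: reduces_def)
    then show ?thesis using r by (subst rep_reducible[OF r]) (simp add: reduces_def)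
  next
    case False
    then obtain s where "s permutes {1..n}" "a = perm_aut n s" using irreducible_perm[OF less.prems] by blast
    then show ?thesis by simp
  qed
qed

text \<open>The value that \<open>rep a\<close> would have if the first reducing move were \<open>m\<close>. That it does not depend on \<open>m\<close>
  is the local confluence of the reduction.\<close>

abbreviation via :: "(word \<Rightarrow> word) \<Rightarrow> nat \<times> nat \<times> bool \<Rightarrow> 'h" where
  "via a m \<equiv> rep (a \<otimes>\<^bsub>BP n\<^esub> conj_move n m) \<otimes> inv (Em m)"

lemma via_independent_rep:
  assumes "\<And>m m'. reduces n a m \<Longrightarrow> reduces n a m' \<Longrightarrow> via a m = via a m'" "reduces n a m"
  shows "rep a = via a m"
  using assms(1)[OF reducing_move[OF assms(2)] assms(2)] rep_reducible[OF assms(2)] by simp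

text \<open>Both sides are evaluated along the hexagon of \<open>triple_heights\<close>. The hypothesis \<open>IH\<close> says that \<open>rep\<close> is
  already multiplicative along edges strictly below the peak, and the relation in the target group
  closes the hexagon.\<close>

lemma via_triple:
  assumes can: "canonical n a s w" and dist: "distinct [i, j, l]"
    and m: "(i, j, e) \<in> moves n" "(l, j, e) \<in> moves n" "(i, l, d) \<in> moves n"
    and wl: "w l = v @ (s j, \<not> e) # w j" and wi: "w i = u @ (s l, \<not> d) # w l"
    and IH: "\<And>b m. b \<in> carrier (BP n) \<Longrightarrow> height n b < height n a \<Longrightarrow> m \<in> moves n \<Longrightarrow>
        height n (b \<otimes>\<^bsub>BP n\<^esub> conj_move n m) < height n a \<Longrightarrow>
        rep (b \<otimes>\<^bsub>BP n\<^esub> conj_move n m) = rep b \<otimes> Em m"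
  shows "via a (i, j, e) = via a (l, j, e)" "via a (i, l, d) = via a (l, j, e)"
proof -
  let ?D1 = "conj_move n (i, j, e)" and ?D2 = "conj_move n (l, j, e)" and ?L = "conj_move n (i, l, d)"
  note h = triple_heights[OF can dist m wl wi]
  have a: "a \<in> carrier (BP n)" using can by (auto simp: canonical_def intro: conj_data_BP)
  note cl = mult_in_BP[OF _ move_in_BP[OF m(1)]] mult_in_BP[OF _ move_in_BP[OF m(2)]] mult_in_BP[OF _ move_in_BP[OF m(3)]]
  have comm: "a \<otimes>\<^bsub>BP n\<^esub> ?D2 \<otimes>\<^bsub>BP n\<^esub> ?D1 = a \<otimes>\<^bsub>BP n\<^esub> ?D1 \<otimes>\<^bsub>BP n\<^esub> ?D2"
    using moves_commute[OF a m(1,2)] dist by auto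
  define r where "r = rep (a \<otimes>\<^bsub>BP n\<^esub> ?D1 \<otimes>\<^bsub>BP n\<^esub> ?D2)"
  have r1: "r = rep (a \<otimes>\<^bsub>BP n\<^esub> ?D1) \<otimes> Em (l, j, e)"
    unfolding r_def using a m h cl by (intro IH) auto
  have r2: "r = rep (a \<otimes>\<^bsub>BP n\<^esub> ?D2) \<otimes> Em (i, j, e)"
    unfolding r_def comm[symmetric] using a m h cl comm by (intro IH) auto
  have r3: "r \<otimes> Em (i, l, d) = rep (a \<otimes>\<^bsub>BP n\<^esub> ?L) \<otimes> Em (i, j, e) \<otimes> Em (l, j, e)"
  proof -
    have "r \<otimes> Em (i, l, d) = rep (a \<otimes>\<^bsub>BP n\<^esub> ?D1 \<otimes>\<^bsub>BP n\<^esub> ?D2 \<otimes>\<^bsub>BP n\<^esub> ?L)"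
      unfolding r_def using a m h cl by (intro IH[symmetric]) auto
    also have "\<dots> = rep (a \<otimes>\<^bsub>BP n\<^esub> ?L \<otimes>\<^bsub>BP n\<^esub> ?D1 \<otimes>\<^bsub>BP n\<^esub> ?D2)"
      using h(7) by simp
    also have "\<dots> = rep (a \<otimes>\<^bsub>BP n\<^esub> ?L \<otimes>\<^bsub>BP n\<^esub> ?D1) \<otimes> Em (l, j, e)"
      using a m h cl by (intro IH) auto
    also have "rep (a \<otimes>\<^bsub>BP n\<^esub> ?L \<otimes>\<^bsub>BP n\<^esub> ?D1) = rep (a \<otimes>\<^bsub>BP n\<^esub> ?L) \<otimes> Em (i, j, e)"
      using a m h cl by (intro IH) auto
    finally show ?thesis .
  qed
  have c: "rep (a \<otimes>\<^bsub>BP n\<^esub> ?D1) \<in> carrier H" "rep (a \<otimes>\<^bsub>BP n\<^esub> ?D2) \<in> carrier H"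
    "rep (a \<otimes>\<^bsub>BP n\<^esub> ?L) \<in> carrier H" "r \<in> carrier H"
    unfolding r_def using a m cl by (auto intro!: rep_closed)
  note E = Em_closed[OF m(1)] Em_closed[OF m(2)] Em_closed[OF m(3)]
  have ED: "Em (i, j, e) \<otimes> Em (l, j, e) = Em (l, j, e) \<otimes> Em (i, j, e)"
    using Em_commute[OF m(1,2)] dist by auto
  have v1: "rep (a \<otimes>\<^bsub>BP n\<^esub> ?D1) = r \<otimes> inv (Em (l, j, e))"
    using r1 c E by (simp add: m_assoc)
  have v2: "rep (a \<otimes>\<^bsub>BP n\<^esub> ?D2) = r \<otimes> inv (Em (i, j, e))"
    using r2 c E by (simp add: m_assoc)
  have D: "Em (i, j, e) \<otimes> Em (l, j, e) \<in> carrier H" using E by simp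
  have v3: "rep (a \<otimes>\<^bsub>BP n\<^esub> ?L) = r \<otimes> Em (i, l, d) \<otimes> inv (Em (i, j, e) \<otimes> Em (l, j, e))"
    using r3 c E D by (simp add: m_assoc)
  have "via a (i, j, e) = r \<otimes> inv (Em (i, j, e) \<otimes> Em (l, j, e))"
    unfolding v1 using c E by (simp add: m_assoc inv_mult_group)
  moreover have *: "via a (l, j, e) = r \<otimes> inv (Em (i, j, e) \<otimes> Em (l, j, e))"
    unfolding v2 ED using c E by (simp add: m_assoc inv_mult_group)
  ultimately show "via a (i, j, e) = via a (l, j, e)" by simp
  have "Em (i, l, d) \<otimes> inv (Em (i, j, e) \<otimes> Em (l, j, e)) = inv (Em (i, j, e) \<otimes> Em (l, j, e)) \<otimes> Em (i, l, d)"
    using commute_inv[OF D E(3)] Em_triple[OF m] by simp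
  then have "via a (i, l, d) = r \<otimes> (inv (Em (i, j, e) \<otimes> Em (l, j, e)) \<otimes> Em (i, l, d)) \<otimes> inv (Em (i, l, d))"
    unfolding v3 using c E D by (simp add: m_assoc)
  also have "\<dots> = r \<otimes> inv (Em (i, j, e) \<otimes> Em (l, j, e))"
    using c E D by (simp add: m_assoc)
  finally show "via a (i, l, d) = via a (l, j, e)" using * by simp
qed

lemma via_commuting:
  assumes can: "canonical n a s w"
    and r: "reduces n a (i, j, e)" "reduces n a (k, l, d)" and ne: "i \<noteq> k" "i \<noteq> l" "k \<noteq> j"
    and IH: "\<And>b m. b \<in> carrier (BP n) \<Longrightarrow> height n b < height n a \<Longrightarrow> m \<in> moves n \<Longrightarrow>
        height n (b \<otimes>\<^bsub>BP n\<^esub> conj_move n m) < height n a \<Longrightarrow>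
        rep (b \<otimes>\<^bsub>BP n\<^esub> conj_move n m) = rep b \<otimes> Em m"
  shows "via a (i, j, e) = via a (k, l, d)"
proof -
  let ?M1 = "conj_move n (i, j, e)" and ?M2 = "conj_move n (k, l, d)"
  have a: "a \<in> carrier (BP n)" and m: "(i, j, e) \<in> moves n" "(k, l, d) \<in> moves n"
    using r by (auto simp: reduces_def)
  have h: "height n (a \<otimes>\<^bsub>BP n\<^esub> ?M1) < height n a" "height n (a \<otimes>\<^bsub>BP n\<^esub> ?M2) < height n a"
    using r by (auto simp: reduces_def)
  have h2: "height n (a \<otimes>\<^bsub>BP n\<^esub> ?M1 \<otimes>\<^bsub>BP n\<^esub> ?M2) < height n a" by (rule commuting_height[OF can r ne])
  have comm: "a \<otimes>\<^bsub>BP n\<^esub> ?M1 \<otimes>\<^bsub>BP n\<^esub> ?M2 = a \<otimes>\<^bsub>BP n\<^esub> ?M2 \<otimes>\<^bsub>BP n\<^esub> ?M1"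
    by (rule moves_commute[OF a m ne])
  note cl = mult_in_BP[OF a move_in_BP[OF m(1)]] mult_in_BP[OF a move_in_BP[OF m(2)]]
  have "rep (a \<otimes>\<^bsub>BP n\<^esub> ?M1) \<otimes> Em (k, l, d) = rep (a \<otimes>\<^bsub>BP n\<^esub> ?M1 \<otimes>\<^bsub>BP n\<^esub> ?M2)"
    by (rule IH[symmetric, OF cl(1) h(1) m(2) h2])
  also have "\<dots> = rep (a \<otimes>\<^bsub>BP n\<^esub> ?M2) \<otimes> Em (i, j, e)"
    using IH[OF cl(2) h(2) m(1)] h2 comm by simp
  finally have eq: "rep (a \<otimes>\<^bsub>BP n\<^esub> ?M1) \<otimes> Em (k, l, d) = rep (a \<otimes>\<^bsub>BP n\<^esub> ?M2) \<otimes> Em (i, j, e)" .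
  note c = rep_closed[OF cl(1)] rep_closed[OF cl(2)] and E = Em_closed[OF m(1)] Em_closed[OF m(2)]
  have "rep (a \<otimes>\<^bsub>BP n\<^esub> ?M1) = rep (a \<otimes>\<^bsub>BP n\<^esub> ?M2) \<otimes> Em (i, j, e) \<otimes> inv (Em (k, l, d))"
    using c E by (simp flip: eq add: m_assoc)
  moreover have "Em (i, j, e) \<otimes> inv (Em (k, l, d)) = inv (Em (k, l, d)) \<otimes> Em (i, j, e)"
    using commute_inv[OF E(2,1)] Em_commute[OF m ne] by simp
  ultimately have "rep (a \<otimes>\<^bsub>BP n\<^esub> ?M1) = rep (a \<otimes>\<^bsub>BP n\<^esub> ?M2) \<otimes> inv (Em (k, l, d)) \<otimes> Em (i, j, e)"
    using c E by (simp add: m_assoc)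
  then show ?thesis using c E by (simp add: m_assoc)
qed

text \<open>Induction on the height. Two reducing moves at \<open>a\<close> share their conjugated generator, or one conjugates
  by the generator that the other moves, or they commute. In the first two cases the suffixes they
  remove are nested.\<close>

lemma rep_step: "reduces n a m \<Longrightarrow> rep a = via a m"
proof (induction "height n a" arbitrary: a m rule: less_induct)
  case less
  have a: "a \<in> carrier (BP n)" using less.prems by (simp add: reduces_def)
  obtain s w where can: "canonical n a s w" using canonical_exists[OF a] by auto
  \<comment> \<open>one end of every edge below the peak is reduced by the edge, so the induction hypothesis covers it in one direction or the other\<close>
  have IH: "rep (b \<otimes>\<^bsub>BP n\<^esub> conj_move n m) = rep b \<otimes> Em m"
    if b: "b \<in> carrier (BP n)" "height n b < height n a" and m: "m \<in> moves n"
      and h: "height n (b \<otimes>\<^bsub>BP n\<^esub> conj_move n m) < height n a" for b m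
    using reduces_or_reverse[OF b(1) m]
  proof
    assume "reduces n b m"
    from less.hyps[OF b(2) this] show ?thesis
      using m rep_closed[OF mult_in_BP[OF b(1) move_in_BP[OF m]]] by (simp add: m_assoc)
  next
    assume "reduces n (b \<otimes>\<^bsub>BP n\<^esub> conj_move n m) (move_inv m)"
    from less.hyps[OF h this] show ?thesis
      using m move_inverse[OF b(1), of "fst m" "fst (snd m)" "snd (snd m)"]
      by (simp add: Em_move_inv del: prod.collapse) (simp add: Em_move_inv)
  qed
  have via: "via a m = via a m'" if r: "reduces n a m" "reduces n a m'" for m m'
  proof -
    obtain i j e k l d where mm: "m = (i, j, e)" "m' = (k, l, d)" by (cases m, cases m')
    have m: "(i, j, e) \<in> moves n" "(k, l, d) \<in> moves n" using r mm by (auto simp: reduces_def)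
    obtain u v where u: "w i = u @ (s j, \<not> e) # w j" and v: "w k = v @ (s l, \<not> d) # w l"
      using r reduces_iff_suffix[OF can] m mm by metis
    \<comment> \<open>the situation of \<open>triple_heights\<close>, for two of the three moves\<close>
    have nested: "via a (i, j, e) = via a (i, l, d)"
      if ul: "w i = u @ (s j, \<not> e) # w j" and vl: "w i = v @ (s l, \<not> d) # w l"
        and m: "(i, j, e) \<in> moves n" "(i, l, d) \<in> moves n" and less: "length (w j) < length (w l)"
      for i j e l d u v
    proof -
      have "v @ (s l, \<not> d) # w l = u @ (s j, \<not> e) # w j" using ul vl by simp
      then obtain x where x: "u = v @ (s l, \<not> d) # x" "w l = x @ (s j, \<not> e) # w j"
        using less by (auto simp: append_eq_append_conv2 Cons_eq_append_conv dest: arg_cong[of _ _ length])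
      then have jl: "j \<noteq> l" by auto
      have "(l, j, e) \<in> moves n" "distinct [i, j, l]" using m jl by (auto simp: moves_def)
      from via_triple[OF can this(2) m(1) this(1) m(2) x(2) vl IH] show ?thesis by simp
    qed
    have nested': "via a (i, j, e) = via a (j, l, d)"
      if ul: "w i = u @ (s j, \<not> e) # w j" and vl: "w j = v @ (s l, \<not> d) # w l"
        and m: "(i, j, e) \<in> moves n" "(j, l, d) \<in> moves n" and il: "i \<noteq> l" for i j e l d u v
    proof -
      have "(i, l, d) \<in> moves n" "distinct [i, l, j]" using m il by (auto simp: moves_def)
      from via_triple[OF can this(2) this(1) m(2) m(1) vl ul IH] show ?thesis by simp
    qed
    \<comment> \<open>the third case is impossible, since each of \<open>w\<^sub>i\<close> and \<open>w\<^sub>j\<close> would be longer than the other\<close>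
    consider "i = k" "j = l" | "i = k" "j \<noteq> l" | "j = k" "l = i" | "j = k" "l \<noteq> i" | "l = i" "j \<noteq> k"
      | "i \<noteq> k" "i \<noteq> l" "k \<noteq> j" by blast
    then show ?thesis
    proof cases
      case 1
      then show ?thesis using u v mm by auto
    next
      case 2
      have "length (w j) \<noteq> length (w l)"
      proof
        assume "length (w j) = length (w l)"
        then have "(s j, \<not> e) # w j = (s l, \<not> d) # w l" using u v 2 by (auto simp: append_eq_append_conv)
        then show False using 2 canonical_inj[OF can, of j l] by simp
      qed
      then consider "length (w j) < length (w l)" | "length (w l) < length (w j)" by linarith
      then show ?thesis
      proof cases
        case 1
        from nested[OF u v[folded 2(1)] m(1) m(2)[folded 2(1)] 1] show ?thesis using mm 2 by simp
      next
        case 1: 2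
        from nested[OF v[folded 2(1)] u m(2)[folded 2(1)] m(1) 1] show ?thesis using mm 2 by simp
      qed
    next
      case 3
      then have "length (w i) < length (w i)" using arg_cong[OF u, of length] arg_cong[OF v, of length] by simp
      then show ?thesis by simp
    next
      case 4
      then show ?thesis using nested'[OF u, of v l d] v m mm by auto
    next
      case 5
      then show ?thesis using nested'[OF v, of u j e] u m mm by auto
    next
      case 6
      show ?thesis unfolding mm by (rule via_commuting[OF can _ _ 6 IH]) (use r mm in auto)
    qed
  qed
  show ?case by (rule via_independent_rep[OF via less.prems])
qed

lemma rep_move:
  assumes a: "a \<in> carrier (BP n)" and m: "m \<in> moves n"
  shows "rep (a \<otimes>\<^bsub>BP n\<^esub> conj_move n m) = rep a \<otimes> Em m"
  using reduces_or_reverse[OF a m]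
proof
  assume "reduces n a m"
  from rep_step[OF this] show ?thesis
    using m rep_closed[OF mult_in_BP[OF a move_in_BP[OF m]]] by (simp add: m_assoc)
next
  assume "reduces n (a \<otimes>\<^bsub>BP n\<^esub> conj_move n m) (move_inv m)"
  from rep_step[OF this] show ?thesis
    using m move_inverse[OF a, of "fst m" "fst (snd m)" "snd (snd m)"]
    by (simp add: Em_move_inv)
qed

lemma P_Em:
  assumes t: "t permutes {1..n}" and m: "(i, j, e) \<in> moves n"
  shows "P t \<otimes> Em (i, j, e) = Em (t i, t j, e) \<otimes> P t"
proof -
  have ij: "(i, j) \<in> indices n" using m by (auto simp: moves_def indices_def)
  have tij: "(t i, t j) \<in> indices n"
    using perm_move(2)[OF perm_in_BP[OF t] m t] by (auto simp: moves_def indices_def)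
  note c = E_closed[OF ij] E_closed[OF tij] P_closed[OF t]
  have eq: "P t \<otimes> E i j = E (t i) (t j) \<otimes> P t" by (rule P_E[OF t ij])
  have "P t \<otimes> inv E i j = inv E (t i) (t j) \<otimes> (E (t i) (t j) \<otimes> P t) \<otimes> inv E i j"
    using c by (simp add: m_assoc[symmetric])
  also have "\<dots> = inv E (t i) (t j) \<otimes> P t"
    unfolding eq[symmetric] using c by (simp add: m_assoc)
  finally show ?thesis using eq by (simp add: Em_def)
qed

lemma rep_perm_right:
  assumes "a \<in> carrier (BP n)" and t: "t permutes {1..n}"
  shows "rep (a \<otimes>\<^bsub>BP n\<^esub> perm_aut n t) = rep a \<otimes> P t"
  using assms(1)
proof (induction rule: BP_induct)
  case (perm s)
  then show ?case using t by (simp add: perm_aut_mult P_mult permutes_compose)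
next
  case (move b m)
  let ?t = "Hilbert_Choice.inv t"
  obtain i j e where m: "m = (i, j, e)" by (cases m)
  have t': "?t permutes {1..n}" using t by (rule permutes_inv)
  have tt: "t (?t x) = x" for x by (rule permutes_inverses(1)[OF t])
  have m': "(?t i, ?t j, e) \<in> moves n" using perm_move(2)[OF move(1) _ t'] move(2) m by blast
  have "b \<otimes>\<^bsub>BP n\<^esub> conj_move n m \<otimes>\<^bsub>BP n\<^esub> perm_aut n t
      = b \<otimes>\<^bsub>BP n\<^esub> perm_aut n t \<otimes>\<^bsub>BP n\<^esub> conj_move n (?t i, ?t j, e)"
    using perm_move(1)[OF move(1) m' t] m tt by simp
  then have "rep (b \<otimes>\<^bsub>BP n\<^esub> conj_move n m \<otimes>\<^bsub>BP n\<^esub> perm_aut n t) = rep b \<otimes> P t \<otimes> Em (?t i, ?t j, e)"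
    using rep_move[OF mult_in_BP[OF move(1) perm_in_BP[OF t]] m'] move(3) by simp
  also have "\<dots> = rep b \<otimes> (Em m \<otimes> P t)"
    using P_Em[OF t m'] rep_closed[OF move(1)] m' t by (simp add: m_assoc tt m)
  also have "\<dots> = rep (b \<otimes>\<^bsub>BP n\<^esub> conj_move n m) \<otimes> P t"
    using move rep_closed[OF move(1)] t by (simp add: rep_move m_assoc)
  finally show ?case .
qed

text \<open>Von Dyck's theorem for the presentation.\<close>

theorem rep_hom: "rep \<in> hom (BP n) H"
proof (rule homI)
  interpret B: group "BP n" by (rule group_BP)
  fix a b assume a: "a \<in> carrier (BP n)" and "b \<in> carrier (BP n)"
  from this(2) show "rep (a \<otimes>\<^bsub>BP n\<^esub> b) = rep a \<otimes> rep b"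
  proof (induction rule: BP_induct)
    case (perm s)
    then show ?case using rep_perm_right[OF a] by simp
  next
    case (move b m)
    have "rep (a \<otimes>\<^bsub>BP n\<^esub> (b \<otimes>\<^bsub>BP n\<^esub> conj_move n m)) = rep (a \<otimes>\<^bsub>BP n\<^esub> b \<otimes>\<^bsub>BP n\<^esub> conj_move n m)"
      using a move move_in_BP by (simp add: B.m_assoc)
    also have "\<dots> = rep a \<otimes> (rep b \<otimes> Em m)"
      using a move rep_closed by (simp add: rep_move m_assoc)
    also have "\<dots> = rep a \<otimes> rep (b \<otimes>\<^bsub>BP n\<^esub> conj_move n m)"
      using move by (simp add: rep_move)
    finally show ?case .
  qed
qed (rule rep_closed)

lemma rep_conj_aut:
  assumes "(i, j) \<in> indices n"
  shows "rep (conj_aut n i j) = E i j"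
proof -
  interpret B: group "BP n" by (rule group_BP)
  have m: "(i, j, True) \<in> moves n" using assms by (auto simp: moves_def indices_def)
  have one: "rep \<one>\<^bsub>BP n\<^esub> = \<one>"
    using rep_hom hom_one[OF rep_hom group_BP is_group] by simp
  have "rep (\<one>\<^bsub>BP n\<^esub> \<otimes>\<^bsub>BP n\<^esub> conj_move n (i, j, True)) = \<one> \<otimes> Em (i, j, True)"
    using rep_move[OF B.one_closed m] one by simp
  then show ?thesis
    using m move_in_BP[OF m] E_closed[OF assms] by (simp add: conj_aut_eq_move[OF assms] Em_def)
qed

end

section \<open>Rational algebras\<close>

locale rat_alg = ring A for A :: "(rat, 'a) module" (structure) +
  assumes smult_closed [simp, intro]: "x \<in> carrier A \<Longrightarrow> c \<odot> x \<in> carrier A"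
    and smult_l_distr: "x \<in> carrier A \<Longrightarrow> (c + d) \<odot> x = c \<odot> x \<oplus> d \<odot> x"
    and smult_r_distr: "x \<in> carrier A \<Longrightarrow> y \<in> carrier A \<Longrightarrow> c \<odot> (x \<oplus> y) = c \<odot> x \<oplus> c \<odot> y"
    and smult_smult: "x \<in> carrier A \<Longrightarrow> c \<odot> (d \<odot> x) = (c * d) \<odot> x"
    and smult_one [simp]: "x \<in> carrier A \<Longrightarrow> 1 \<odot> x = x"
    and smult_mult_left: "x \<in> carrier A \<Longrightarrow> y \<in> carrier A \<Longrightarrow> (c \<odot> x) \<otimes> y = c \<odot> (x \<otimes> y)"
    and smult_mult_right: "x \<in> carrier A \<Longrightarrow> y \<in> carrier A \<Longrightarrow> x \<otimes> (c \<odot> y) = c \<odot> (x \<otimes> y)"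
begin

lemma smult_zero_left [simp]: "x \<in> carrier A \<Longrightarrow> 0 \<odot> x = \<zero>"
  using smult_l_distr[of x 0 0] by (metis add.r_cancel_one' add_0 smult_closed)

lemma smult_zero_right [simp]: "c \<odot> \<zero> = \<zero>"
  using smult_r_distr[of \<zero> \<zero> c] by (metis add.r_cancel_one' l_zero smult_closed zero_closed)

lemma smult_minus: "x \<in> carrier A \<Longrightarrow> c \<odot> (\<ominus> x) = \<ominus> (c \<odot> x)"
  using smult_r_distr[of x "\<ominus> x" c] by (intro minus_equality[symmetric]) (auto simp: r_neg l_neg a_comm)

lemma smult_diff: "x \<in> carrier A \<Longrightarrow> y \<in> carrier A \<Longrightarrow> c \<odot> (x \<ominus> y) = c \<odot> x \<ominus> c \<odot> y"
  by (simp add: a_minus_def smult_r_distr smult_minus)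

lemma smult_cancel: "c \<noteq> 0 \<Longrightarrow> x \<in> carrier A \<Longrightarrow> y \<in> carrier A \<Longrightarrow> c \<odot> x = c \<odot> y \<Longrightarrow> x = y"
  by (metis divide_self nonzero_divide_eq_eq smult_one smult_smult times_divide_eq_left)

lemma smult_finsum:
  assumes "finite S" "f \<in> S \<rightarrow> carrier A"
  shows "c \<odot> (\<Oplus>x\<in>S. f x) = (\<Oplus>x\<in>S. c \<odot> f x)"
  using assms by (induction S rule: finite_induct) (auto simp: smult_r_distr Pi_def finsum_closed)

lemma ideal_smult:
  assumes "ideal I A" "x \<in> I"
  shows "c \<odot> x \<in> I"
proof -
  have "(c \<odot> \<one>) \<otimes> x \<in> I" using assms by (intro ideal.I_l_closed) auto
  then show ?thesis using ideal.Icarr[OF assms] by (simp add: smult_mult_left)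
qed

end

lemma (in abelian_group) finsum_swap:
  assumes "finite S" "finite T" "\<And>x y. x \<in> S \<Longrightarrow> y \<in> T \<Longrightarrow> f x y \<in> carrier G"
  shows "(\<Oplus>x\<in>S. \<Oplus>y\<in>T. f x y) = (\<Oplus>y\<in>T. \<Oplus>x\<in>S. f x y)"
  using assms(1,3)
proof (induction S rule: finite_induct)
  case (insert x S)
  then have "(\<Oplus>y\<in>T. \<Oplus>x\<in>insert x S. f x y) = (\<Oplus>y\<in>T. f x y \<oplus> (\<Oplus>x\<in>S. f x y))"
    by (intro finsum_cong') (auto intro!: finsum_closed)
  also have "\<dots> = (\<Oplus>y\<in>T. f x y) \<oplus> (\<Oplus>y\<in>T. \<Oplus>x\<in>S. f x y)"
    using insert by (intro finsum_addf) (auto intro!: finsum_closed)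
  finally show ?case
    using insert by (simp add: finsum_closed Pi_def)
qed (use assms in \<open>auto simp: finsum_zero\<close>)

text \<open>The map need only be additive on a submonoid \<open>K\<close>. This is what leading terms of degree \<open>k\<close> require,
  which are additive only on the \<open>k\<close>-th step of a filtration.\<close>

lemma finsum_additive:
  fixes A (structure) and B (structure)
  assumes "abelian_monoid A" "abelian_monoid B"
    and K: "K \<subseteq> carrier A" "\<zero>\<^bsub>A\<^esub> \<in> K" "\<And>x y. x \<in> K \<Longrightarrow> y \<in> K \<Longrightarrow> x \<oplus>\<^bsub>A\<^esub> y \<in> K"
    and h: "\<And>x. x \<in> K \<Longrightarrow> h x \<in> carrier B" "h \<zero>\<^bsub>A\<^esub> = \<zero>\<^bsub>B\<^esub>"
      "\<And>x y. x \<in> K \<Longrightarrow> y \<in> K \<Longrightarrow> h (x \<oplus>\<^bsub>A\<^esub> y) = h x \<oplus>\<^bsub>B\<^esub> h y"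
    and S: "finite S" "\<And>x. x \<in> S \<Longrightarrow> f x \<in> K"
  shows "h (\<Oplus>\<^bsub>A\<^esub>x\<in>S. f x) = (\<Oplus>\<^bsub>B\<^esub>x\<in>S. h (f x))" "(\<Oplus>\<^bsub>A\<^esub>x\<in>S. f x) \<in> K"
proof -
  interpret A: abelian_monoid A by fact
  interpret B: abelian_monoid B by fact
  have "h (\<Oplus>\<^bsub>A\<^esub>x\<in>S. f x) = (\<Oplus>\<^bsub>B\<^esub>x\<in>S. h (f x)) \<and> (\<Oplus>\<^bsub>A\<^esub>x\<in>S. f x) \<in> K"
    using S
  proof (induction S rule: finite_induct)
    case (insert x S)
    have "f \<in> S \<rightarrow> carrier A" "f x \<in> carrier A" using insert.prems K(1) by auto
    moreover have "(\<lambda>x. h (f x)) \<in> S \<rightarrow> carrier B" "h (f x) \<in> carrier B" using insert.prems h(1) by auto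
    ultimately show ?case using insert h(3) K(3) by (simp add: A.finsum_insert B.finsum_insert)
  qed (use K h in \<open>auto simp: A.finsum_empty B.finsum_empty\<close>)
  then show "h (\<Oplus>\<^bsub>A\<^esub>x\<in>S. f x) = (\<Oplus>\<^bsub>B\<^esub>x\<in>S. h (f x))" "(\<Oplus>\<^bsub>A\<^esub>x\<in>S. f x) \<in> K" by auto
qed

text \<open>The additive inverse is supplied by the scalar \<open>-1\<close>.\<close>

lemma rat_algI:
  fixes A :: "(rat, 'a) module" (structure)
  assumes "\<And>x y. x \<in> carrier A \<Longrightarrow> y \<in> carrier A \<Longrightarrow> x \<oplus> y \<in> carrier A"
    "\<zero> \<in> carrier A"
    "\<And>x y z. x \<in> carrier A \<Longrightarrow> y \<in> carrier A \<Longrightarrow> z \<in> carrier A \<Longrightarrow> (x \<oplus> y) \<oplus> z = x \<oplus> (y \<oplus> z)"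
    "\<And>x y. x \<in> carrier A \<Longrightarrow> y \<in> carrier A \<Longrightarrow> x \<oplus> y = y \<oplus> x"
    "\<And>x. x \<in> carrier A \<Longrightarrow> \<zero> \<oplus> x = x"
    "\<And>x y. x \<in> carrier A \<Longrightarrow> y \<in> carrier A \<Longrightarrow> x \<otimes> y \<in> carrier A"
    "\<one> \<in> carrier A"
    "\<And>x y z. x \<in> carrier A \<Longrightarrow> y \<in> carrier A \<Longrightarrow> z \<in> carrier A \<Longrightarrow> (x \<otimes> y) \<otimes> z = x \<otimes> (y \<otimes> z)"
    "\<And>x. x \<in> carrier A \<Longrightarrow> \<one> \<otimes> x = x"
    "\<And>x. x \<in> carrier A \<Longrightarrow> x \<otimes> \<one> = x"
    "\<And>x y z. x \<in> carrier A \<Longrightarrow> y \<in> carrier A \<Longrightarrow> z \<in> carrier A \<Longrightarrow> (x \<oplus> y) \<otimes> z = x \<otimes> z \<oplus> y \<otimes> z"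
    "\<And>x y z. x \<in> carrier A \<Longrightarrow> y \<in> carrier A \<Longrightarrow> z \<in> carrier A \<Longrightarrow> z \<otimes> (x \<oplus> y) = z \<otimes> x \<oplus> z \<otimes> y"
    "\<And>c x. x \<in> carrier A \<Longrightarrow> c \<odot> x \<in> carrier A"
    "\<And>c d x. x \<in> carrier A \<Longrightarrow> (c + d) \<odot> x = c \<odot> x \<oplus> d \<odot> x"
    "\<And>c x y. x \<in> carrier A \<Longrightarrow> y \<in> carrier A \<Longrightarrow> c \<odot> (x \<oplus> y) = c \<odot> x \<oplus> c \<odot> y"
    "\<And>c d x. x \<in> carrier A \<Longrightarrow> c \<odot> (d \<odot> x) = (c * d) \<odot> x"
    "\<And>x. x \<in> carrier A \<Longrightarrow> 1 \<odot> x = x"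
    "\<And>x. x \<in> carrier A \<Longrightarrow> 0 \<odot> x = \<zero>"
    "\<And>c x y. x \<in> carrier A \<Longrightarrow> y \<in> carrier A \<Longrightarrow> (c \<odot> x) \<otimes> y = c \<odot> (x \<otimes> y)"
    "\<And>c x y. x \<in> carrier A \<Longrightarrow> y \<in> carrier A \<Longrightarrow> x \<otimes> (c \<odot> y) = c \<odot> (x \<otimes> y)"
  shows "rat_alg A"
proof -
  have "\<exists>y\<in>carrier A. y \<oplus> x = \<zero>" if "x \<in> carrier A" for x
    using assms(13)[OF that, of "-1"] assms(14)[OF that, of "-1" 1] assms(17,18)[OF that]
    by (intro bexI[of _ "(-1) \<odot> x"]) auto
  then have "abelian_group A" using assms by (intro abelian_groupI) auto
  moreover have "monoid A" using assms by (intro monoidI) auto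
  ultimately have "ring A" using assms by (intro ringI) auto
  then show ?thesis using assms by (intro rat_alg.intro rat_alg_axioms.intro) auto
qed

subsection \<open>Quotients\<close>

lemma quot_alg_simps:
  fixes A :: "(rat, 'a) module" (structure)
  assumes "rat_alg A" "ideal I A"
  shows "carrier (quot_alg A I) = (\<lambda>x. I +>\<^bsub>A\<^esub> x) ` carrier A"
    "\<zero>\<^bsub>quot_alg A I\<^esub> = I" "\<one>\<^bsub>quot_alg A I\<^esub> = I +>\<^bsub>A\<^esub> \<one>\<^bsub>A\<^esub>"
    "\<And>x y. x \<in> carrier A \<Longrightarrow> y \<in> carrier A \<Longrightarrow> (I +>\<^bsub>A\<^esub> x) \<oplus>\<^bsub>quot_alg A I\<^esub> (I +>\<^bsub>A\<^esub> y) = I +>\<^bsub>A\<^esub> (x \<oplus>\<^bsub>A\<^esub> y)"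
    "\<And>x y. x \<in> carrier A \<Longrightarrow> y \<in> carrier A \<Longrightarrow> (I +>\<^bsub>A\<^esub> x) \<otimes>\<^bsub>quot_alg A I\<^esub> (I +>\<^bsub>A\<^esub> y) = I +>\<^bsub>A\<^esub> (x \<otimes>\<^bsub>A\<^esub> y)"
    "\<And>c x. x \<in> carrier A \<Longrightarrow> c \<odot>\<^bsub>quot_alg A I\<^esub> (I +>\<^bsub>A\<^esub> x) = I +>\<^bsub>A\<^esub> (c \<odot>\<^bsub>A\<^esub> x)"
proof -
  interpret rat_alg A by fact
  interpret I: ideal I A by fact
  show "carrier (quot_alg A I) = (\<lambda>x. I +>\<^bsub>A\<^esub> x) ` carrier A"
    by (auto simp: quot_alg_def FactRing_def A_RCOSETS_def')
  show "\<zero>\<^bsub>quot_alg A I\<^esub> = I" "\<one>\<^bsub>quot_alg A I\<^esub> = I +>\<^bsub>A\<^esub> \<one>\<^bsub>A\<^esub>"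
    by (auto simp: quot_alg_def FactRing_def)
  show "(I +> x) \<oplus>\<^bsub>quot_alg A I\<^esub> (I +> y) = I +> (x \<oplus> y)"
    "(I +> x) \<otimes>\<^bsub>quot_alg A I\<^esub> (I +> y) = I +> (x \<otimes> y)" if "x \<in> carrier A" "y \<in> carrier A" for x y
    using that by (auto simp: quot_alg_def FactRing_def I.a_rcos_sum I.rcoset_mult_add)
  show "c \<odot>\<^bsub>quot_alg A I\<^esub> (I +> x) = I +> (c \<odot> x)" if x: "x \<in> carrier A" for c x
  proof -
    have "I +> (c \<odot> y) = I +> (c \<odot> x)" if "y \<in> I +> x" for y
    proof -
      have y: "y \<in> carrier A" using that x I.a_subset a_r_coset_subset_G by blast
      have "y \<ominus> x \<in> I" using that x y I.a_rcos_module_minus[OF ring_axioms] by blast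
      then have "c \<odot> y \<ominus> c \<odot> x \<in> I" using x y ideal_smult[OF I.is_ideal] by (simp flip: smult_diff)
      then show ?thesis using x y by (subst quotient_eq_iff_same_a_r_cos[OF I.is_ideal, symmetric]) auto
    qed
    then have "(\<Union>y\<in>I +> x. I +> (c \<odot> y)) = (\<Union>y\<in>I +> x. I +> (c \<odot> x))"
      by (rule SUP_cong[OF refl])
    also have "\<dots> = I +> (c \<odot> x)" using I.a_rcos_self[OF x] by (metis UN_constant emptyE)
    finally have "(\<Union>y\<in>I +> x. I +> (c \<odot> y)) = I +> (c \<odot> x)" .
    then show ?thesis by (simp only: quot_alg_def module.simps)
  qed
qed

lemma coset_eq_iff:
  assumes "rat_alg A" "ideal I A" "x \<in> carrier A" "y \<in> carrier A"
  shows "I +>\<^bsub>A\<^esub> x = I +>\<^bsub>A\<^esub> y \<longleftrightarrow> x \<ominus>\<^bsub>A\<^esub> y \<in> I"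
  by (rule ring.quotient_eq_iff_same_a_r_cos[OF rat_alg.axioms(1)[OF assms(1)] assms(2-4), symmetric])

lemma coset_eq_self_iff:
  fixes A :: "(rat, 'a) module" (structure)
  assumes "rat_alg A" "ideal I A" "x \<in> carrier A"
  shows "I +> x = I \<longleftrightarrow> x \<in> I"
proof -
  interpret rat_alg A by fact
  interpret I: ideal I A by fact
  show ?thesis using I.a_rcos_self[OF assms(3)] a_rcos_zero[OF assms(2)] by metis
qed

lemma mem_coset_iff:
  fixes A :: "(rat, 'a) module" (structure)
  assumes "rat_alg A" "ideal I A" "x \<in> carrier A"
  shows "y \<in> I +>\<^bsub>A\<^esub> x \<longleftrightarrow> y \<in> carrier A \<and> y \<ominus>\<^bsub>A\<^esub> x \<in> I"
proof -
  interpret rat_alg A by fact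
  interpret I: ideal I A by fact
  show ?thesis
    using I.a_rcos_module_minus[OF ring_axioms assms(3)] a_r_coset_subset_G[OF I.a_subset assms(3)] by blast
qed

lemma rat_alg_quot:
  fixes A :: "(rat, 'a) module" (structure)
  assumes "rat_alg A" "ideal I A"
  shows "rat_alg (quot_alg A I)"
proof -
  interpret rat_alg A by fact
  have z: "\<zero>\<^bsub>quot_alg A I\<^esub> = I +> \<zero>"
    using a_rcos_zero[OF assms(2)] additive_subgroup.zero_closed[OF ideal.axioms(1)[OF assms(2)]]
    by (simp add: quot_alg_simps[OF assms])
  show ?thesis
    by (rule rat_algI)
       (auto simp: quot_alg_simps(1,3-)[OF assms] z a_ac m_assoc l_distr r_distr smult_l_distr
          smult_r_distr smult_smult smult_mult_left smult_mult_right)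
qed

lemma coset_finsum:
  fixes A :: "(rat, 'a) module" (structure)
  assumes "rat_alg A" "ideal I A" "finite S" "\<And>x. x \<in> S \<Longrightarrow> f x \<in> carrier A"
  shows "(\<Oplus>\<^bsub>quot_alg A I\<^esub>x\<in>S. I +>\<^bsub>A\<^esub> f x) = I +>\<^bsub>A\<^esub> (\<Oplus>\<^bsub>A\<^esub>x\<in>S. f x)"
proof (rule finsum_additive(1)[symmetric, where K = "carrier A"])
  interpret rat_alg A by fact
  interpret Q: rat_alg "quot_alg A I" by (rule rat_alg_quot) fact+
  show "abelian_monoid A" "abelian_monoid (quot_alg A I)" by unfold_locales
  show "I +> \<zero> = \<zero>\<^bsub>quot_alg A I\<^esub>"
    using coset_eq_self_iff[OF assms(1,2), of \<zero>] additive_subgroup.zero_closed[OF ideal.axioms(1)[OF assms(2)]]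
    by (simp add: quot_alg_simps[OF assms(1,2)])
  show "x \<in> carrier A \<Longrightarrow> y \<in> carrier A \<Longrightarrow> x \<oplus> y \<in> carrier A" for x y by simp
qed (use assms in \<open>auto simp: quot_alg_simps rat_alg.axioms ring.ring_simprules\<close>)

subsection \<open>Finitely supported functions\<close>

lemma finsupp_induct [consumes 2, case_names zero add]:
  fixes f :: "'x \<Rightarrow> rat"
  assumes "finite {x. f x \<noteq> 0}" "{x. f x \<noteq> 0} \<subseteq> X"
    and zero: "Q (\<lambda>x. 0)"
    and add: "\<And>c x g. x \<in> X \<Longrightarrow> finite {x. g x \<noteq> 0} \<Longrightarrow> {x. g x \<noteq> 0} \<subseteq> X \<Longrightarrow> Q g \<Longrightarrow>
      Q (\<lambda>y. (if y = x then c else 0) + g y)"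
  shows "Q f"
proof -
  have "finite S \<Longrightarrow> {x. f x \<noteq> 0} \<subseteq> S \<Longrightarrow> S \<subseteq> X \<Longrightarrow> Q f" for S f
  proof (induction S arbitrary: f rule: finite_induct)
    case empty
    then have "f = (\<lambda>x. 0)" by auto
    then show ?case using zero by simp
  next
    case (insert x S)
    let ?g = "f(x := 0)"
    have s: "{y. ?g y \<noteq> 0} \<subseteq> S" using insert.prems by auto
    then have "Q ?g" using insert by auto
    then have "Q (\<lambda>y. (if y = x then f x else 0) + ?g y)"
      using insert s by (intro add) (auto intro: finite_subset)
    also have "(\<lambda>y. (if y = x then f x else 0) + ?g y) = f" by auto
    finally show ?case .
  qed
  then show ?thesis using assms by blast
qed

text \<open>Linear extension of \<open>\<phi>\<close> from a basis to finitely supported coefficient functions.\<close>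

definition lin_ext :: "(rat, 'b) module \<Rightarrow> ('x \<Rightarrow> 'b) \<Rightarrow> ('x \<Rightarrow> rat) \<Rightarrow> 'b" where
  "lin_ext B \<phi> f = (\<Oplus>\<^bsub>B\<^esub>x\<in>{x. f x \<noteq> 0}. f x \<odot>\<^bsub>B\<^esub> \<phi> x)"

context rat_alg
begin

lemma lin_ext_superset:
  assumes "finite S" "{x. f x \<noteq> 0} \<subseteq> S" "\<And>x. x \<in> S \<Longrightarrow> \<phi> x \<in> carrier A"
  shows "lin_ext A \<phi> f = (\<Oplus>x\<in>S. f x \<odot> \<phi> x)"
  unfolding lin_ext_def using assms by (intro add.finprod_mono_neutral_cong_left) auto

lemma lin_ext_closed:
  assumes "{x. f x \<noteq> 0} \<subseteq> X" "\<And>x. x \<in> X \<Longrightarrow> \<phi> x \<in> carrier A"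
  shows "lin_ext A \<phi> f \<in> carrier A"
  unfolding lin_ext_def using assms by (intro finsum_closed) auto

lemma lin_ext_zero [simp]: "lin_ext A \<phi> (\<lambda>x. 0) = \<zero>"
  by (simp add: lin_ext_def)

lemma lin_ext_add:
  assumes "finite {x. f x \<noteq> 0}" "{x. f x \<noteq> 0} \<subseteq> X" "finite {x. g x \<noteq> 0}" "{x. g x \<noteq> 0} \<subseteq> X"
    and \<phi>: "\<And>x. x \<in> X \<Longrightarrow> \<phi> x \<in> carrier A"
  shows "lin_ext A \<phi> (\<lambda>x. f x + g x) = lin_ext A \<phi> f \<oplus> lin_ext A \<phi> g"
proof -
  let ?S = "{x. f x \<noteq> 0} \<union> {x. g x \<noteq> 0}"
  have \<phi>S: "\<phi> x \<in> carrier A" if "x \<in> ?S" for x using that assms by blast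
  have "lin_ext A \<phi> (\<lambda>x. f x + g x) = (\<Oplus>x\<in>?S. (f x + g x) \<odot> \<phi> x)"
    using assms \<phi>S by (intro lin_ext_superset) auto
  also have "\<dots> = (\<Oplus>x\<in>?S. f x \<odot> \<phi> x \<oplus> g x \<odot> \<phi> x)"
    using \<phi>S by (intro finsum_cong') (auto simp: smult_l_distr)
  also have "\<dots> = (\<Oplus>x\<in>?S. f x \<odot> \<phi> x) \<oplus> (\<Oplus>x\<in>?S. g x \<odot> \<phi> x)"
    using \<phi>S by (intro finsum_addf) auto
  also have "\<dots> = lin_ext A \<phi> f \<oplus> lin_ext A \<phi> g"
    using assms \<phi>S by (subst (1 2) lin_ext_superset[where S = ?S]) auto
  finally show ?thesis .
qed

lemma lin_ext_smult:
  assumes "finite {x. f x \<noteq> 0}" "{x. f x \<noteq> 0} \<subseteq> X" and \<phi>: "\<And>x. x \<in> X \<Longrightarrow> \<phi> x \<in> carrier A"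
  shows "lin_ext A \<phi> (\<lambda>x. c * f x) = c \<odot> lin_ext A \<phi> f"
proof -
  have "lin_ext A \<phi> (\<lambda>x. c * f x) = (\<Oplus>x\<in>{x. f x \<noteq> 0}. (c * f x) \<odot> \<phi> x)"
    using assms by (intro lin_ext_superset) auto
  also have "\<dots> = (\<Oplus>x\<in>{x. f x \<noteq> 0}. c \<odot> (f x \<odot> \<phi> x))"
    using assms by (intro finsum_cong') (auto simp: smult_smult)
  also have "\<dots> = c \<odot> lin_ext A \<phi> f"
    unfolding lin_ext_def using assms by (intro smult_finsum[symmetric]) auto
  finally show ?thesis .
qed

lemma lin_ext_single:
  assumes "\<phi> x \<in> carrier A"
  shows "lin_ext A \<phi> (\<lambda>y. if y = x then c else 0) = c \<odot> \<phi> x"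
  using assms by (subst lin_ext_superset[where S = "{x}"]) auto

end

text \<open>Bilinearity reduces the claim to products of basis elements. It applies to group algebras and to the
  free algebra, whose basis of words is closed under concatenation.\<close>

lemma lin_ext_mult:
  fixes A :: "(rat, 'x \<Rightarrow> rat) module" and B :: "(rat, 'b) module"
  assumes A: "rat_alg A" and B: "rat_alg B"
    and carr: "carrier A = {f. finite {x. f x \<noteq> 0} \<and> {x. f x \<noteq> 0} \<subseteq> X}"
    and addA: "\<And>f g. f \<oplus>\<^bsub>A\<^esub> g = (\<lambda>x. f x + g x)" and zeroA: "\<zero>\<^bsub>A\<^esub> = (\<lambda>x. 0)"
    and smult: "\<And>c f. c \<odot>\<^bsub>A\<^esub> f = (\<lambda>x. c * f x)"
    and mult: "\<And>x y. x \<in> X \<Longrightarrow> y \<in> X \<Longrightarrow> ga_elem x \<otimes>\<^bsub>A\<^esub> ga_elem y = ga_elem (m x y)"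
    and m: "\<And>x y. x \<in> X \<Longrightarrow> y \<in> X \<Longrightarrow> m x y \<in> X"
    and \<phi>: "\<And>x. x \<in> X \<Longrightarrow> \<phi> x \<in> carrier B"
    and \<phi>_mult: "\<And>x y. x \<in> X \<Longrightarrow> y \<in> X \<Longrightarrow> \<phi> (m x y) = \<phi> x \<otimes>\<^bsub>B\<^esub> \<phi> y"
    and fg: "f \<in> carrier A" "g \<in> carrier A"
  shows "lin_ext B \<phi> (f \<otimes>\<^bsub>A\<^esub> g) = lin_ext B \<phi> f \<otimes>\<^bsub>B\<^esub> lin_ext B \<phi> g"
proof -
  interpret A: rat_alg A by fact
  interpret B: rat_alg B by fact
  let ?L = "lin_ext B \<phi>"
  have single: "(\<lambda>y. if y = x then c else 0) = c \<odot>\<^bsub>A\<^esub> ga_elem x" for c x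
    by (auto simp: smult ga_elem_def)
  have gen: "ga_elem x \<in> carrier A" if "x \<in> X" for x
    using that by (auto simp: carr ga_elem_def)
  have L_add: "?L (f \<oplus>\<^bsub>A\<^esub> g) = ?L f \<oplus>\<^bsub>B\<^esub> ?L g" if "f \<in> carrier A" "g \<in> carrier A" for f g
    using that \<phi> unfolding addA by (intro B.lin_ext_add[where X = X]) (auto simp: carr)
  have L_smult: "?L (c \<odot>\<^bsub>A\<^esub> f) = c \<odot>\<^bsub>B\<^esub> ?L f" if "f \<in> carrier A" for f c
    using that \<phi> unfolding smult by (intro B.lin_ext_smult[where X = X]) (auto simp: carr)
  have L_gen: "?L (ga_elem x) = \<phi> x" if "x \<in> X" for x
    unfolding ga_elem_def using B.lin_ext_single[where \<phi> = \<phi> and x = x and c = 1] \<phi>[OF that] by simp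
  have L_closed: "?L f \<in> carrier B" if "f \<in> carrier A" for f
    using that \<phi> by (intro B.lin_ext_closed[where X = X]) (auto simp: carr)
  have L_zero: "?L \<zero>\<^bsub>A\<^esub> = \<zero>\<^bsub>B\<^esub>" by (simp add: zeroA)
  have 1: "?L (ga_elem x \<otimes>\<^bsub>A\<^esub> g) = \<phi> x \<otimes>\<^bsub>B\<^esub> ?L g" if x: "x \<in> X" and "g \<in> carrier A" for x g
  proof -
    have "finite {x. g x \<noteq> 0}" "{x. g x \<noteq> 0} \<subseteq> X" using that by (auto simp: carr)
    then show ?thesis
    proof (induction rule: finsupp_induct)
      case zero
      show ?case using A.r_null[OF gen[OF x]] \<phi>[OF x] L_zero by (simp flip: zeroA)
    next
      case (add c y g)
      have g: "g \<in> carrier A" using add by (simp add: carr)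
      have eq: "(\<lambda>z. (if z = y then c else 0) + g z) = c \<odot>\<^bsub>A\<^esub> ga_elem y \<oplus>\<^bsub>A\<^esub> g"
        by (auto simp: addA smult ga_elem_def)
      have mxy: "ga_elem (m x y) \<in> carrier A" "ga_elem x \<otimes>\<^bsub>A\<^esub> g \<in> carrier A"
        using gen[OF m[OF x add(1)]] gen[OF x] g by auto
      show ?case unfolding eq
        using add g x mxy gen[OF x] gen[OF add(1)] m \<phi> L_closed[OF g]
        by (simp add: A.r_distr L_add L_smult A.smult_mult_right mult L_gen \<phi>_mult B.r_distr B.smult_mult_right)
    qed
  qed
  have "finite {x. f x \<noteq> 0}" "{x. f x \<noteq> 0} \<subseteq> X" using fg by (auto simp: carr)
  then show ?thesis
  proof (induction rule: finsupp_induct)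
    case zero
    then show ?case using A.l_null[OF fg(2)] L_closed[OF fg(2)] L_zero by (simp flip: zeroA)
  next
    case (add c y f)
    have f: "f \<in> carrier A" using add by (simp add: carr)
    have eq: "(\<lambda>z. (if z = y then c else 0) + f z) = c \<odot>\<^bsub>A\<^esub> ga_elem y \<oplus>\<^bsub>A\<^esub> f"
      by (auto simp: addA smult ga_elem_def)
    have yg: "ga_elem y \<otimes>\<^bsub>A\<^esub> g \<in> carrier A" "f \<otimes>\<^bsub>A\<^esub> g \<in> carrier A"
      using gen[OF add(1)] f fg by auto
    show ?case unfolding eq
      using add f fg yg gen[OF add(1)] \<phi> L_closed[OF f] L_closed[OF fg(2)]
      by (simp add: A.l_distr L_add L_smult A.smult_mult_left 1 L_gen B.l_distr B.smult_mult_left)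
  qed
qed

subsection \<open>Group algebras\<close>

lemma group_algebra_mult_superset:
  assumes "finite S" "{y. f y \<noteq> 0} \<subseteq> S" "finite T" "{z. g z \<noteq> 0} \<subseteq> T"
  shows "(f \<otimes>\<^bsub>group_algebra G\<^esub> g) x = (\<Sum>y\<in>S. \<Sum>z\<in>T. if y \<otimes>\<^bsub>G\<^esub> z = x then f y * g z else 0)"
proof -
  have 1: "(\<Sum>z\<in>{z. g z \<noteq> 0}. if y \<otimes>\<^bsub>G\<^esub> z = x then f y * g z else 0)
      = (\<Sum>z\<in>T. if y \<otimes>\<^bsub>G\<^esub> z = x then f y * g z else 0)" for y
    using assms by (intro sum.mono_neutral_left) auto
  show ?thesis
    unfolding group_algebra_def monoid.simps 1
    using assms by (intro sum.mono_neutral_left) (auto intro!: sum.neutral split: if_splits)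
qed

lemma rat_alg_group_algebra:
  fixes G :: "'a monoid" (structure)
  assumes "group G"
  shows "rat_alg (group_algebra G)"
proof (rule rat_algI)
  interpret group G by fact
  let ?A = "group_algebra G"
  have carr: "f \<in> carrier ?A \<longleftrightarrow> finite {x. f x \<noteq> 0} \<and> {x. f x \<noteq> 0} \<subseteq> carrier G" for f
    by (simp add: group_algebra_def)
  have ops: "f \<oplus>\<^bsub>?A\<^esub> g = (\<lambda>x. f x + g x)" "\<zero>\<^bsub>?A\<^esub> = (\<lambda>x. 0)" "c \<odot>\<^bsub>?A\<^esub> f = (\<lambda>x. c * f x)"
    "\<one>\<^bsub>?A\<^esub> = (\<lambda>x. if x = \<one>\<^bsub>G\<^esub> then 1 else 0)" for f g c
    by (simp_all add: group_algebra_def)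
  note mult = group_algebra_mult_superset[where G = G]
  have supp_add: "{x. f x + g x \<noteq> 0} \<subseteq> {x. f x \<noteq> 0} \<union> {x. g x \<noteq> 0}" for f g :: "'a \<Rightarrow> rat" by auto
  show add_closed: "f \<oplus>\<^bsub>?A\<^esub> g \<in> carrier ?A" if "f \<in> carrier ?A" "g \<in> carrier ?A" for f g
    using that finite_subset[OF supp_add[of f g]] supp_add[of f g] by (auto simp: carr ops)
  show "\<zero>\<^bsub>?A\<^esub> \<in> carrier ?A" "\<one>\<^bsub>?A\<^esub> \<in> carrier ?A" by (auto simp: carr ops)
  show "c \<odot>\<^bsub>?A\<^esub> f \<in> carrier ?A" if "f \<in> carrier ?A" for c f
    using that by (auto simp: carr ops)
  have supp_mult: "{x. (f \<otimes>\<^bsub>?A\<^esub> g) x \<noteq> 0} \<subseteq> (\<lambda>(y, z). y \<otimes> z) ` ({y. f y \<noteq> 0} \<times> {z. g z \<noteq> 0})" for f g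
  proof
    fix x assume "x \<in> {x. (f \<otimes>\<^bsub>?A\<^esub> g) x \<noteq> 0}"
    then have "(\<Sum>y\<in>{y. f y \<noteq> 0}. \<Sum>z\<in>{z. g z \<noteq> 0}. if y \<otimes> z = x then f y * g z else 0) \<noteq> 0"
      by (simp add: group_algebra_def)
    then obtain y where "y \<in> {y. f y \<noteq> 0}" "(\<Sum>z\<in>{z. g z \<noteq> 0}. if y \<otimes> z = x then f y * g z else 0) \<noteq> 0"
      by (rule sum.not_neutral_contains_not_neutral)
    moreover from this(2) obtain z where "z \<in> {z. g z \<noteq> 0}" "(if y \<otimes> z = x then f y * g z else 0) \<noteq> 0"
      by (rule sum.not_neutral_contains_not_neutral)
    ultimately show "x \<in> (\<lambda>(y, z). y \<otimes> z) ` ({y. f y \<noteq> 0} \<times> {z. g z \<noteq> 0})"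
      by (auto split: if_splits intro!: image_eqI[of _ _ "(y, z)"])
  qed
  show mult_closed: "f \<otimes>\<^bsub>?A\<^esub> g \<in> carrier ?A" if "f \<in> carrier ?A" "g \<in> carrier ?A" for f g
    unfolding carr
  proof
    show "finite {x. (f \<otimes>\<^bsub>?A\<^esub> g) x \<noteq> 0}"
      using that by (intro finite_subset[OF supp_mult]) (auto simp: carr)
    show "{x. (f \<otimes>\<^bsub>?A\<^esub> g) x \<noteq> 0} \<subseteq> carrier G"
      using that by (intro order_trans[OF supp_mult]) (auto simp: carr)
  qed
  show "f \<oplus>\<^bsub>?A\<^esub> g \<oplus>\<^bsub>?A\<^esub> h = f \<oplus>\<^bsub>?A\<^esub> (g \<oplus>\<^bsub>?A\<^esub> h)" "f \<oplus>\<^bsub>?A\<^esub> g = g \<oplus>\<^bsub>?A\<^esub> f" "\<zero>\<^bsub>?A\<^esub> \<oplus>\<^bsub>?A\<^esub> f = f"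
    "(c + d) \<odot>\<^bsub>?A\<^esub> f = c \<odot>\<^bsub>?A\<^esub> f \<oplus>\<^bsub>?A\<^esub> d \<odot>\<^bsub>?A\<^esub> f" "c \<odot>\<^bsub>?A\<^esub> (f \<oplus>\<^bsub>?A\<^esub> g) = c \<odot>\<^bsub>?A\<^esub> f \<oplus>\<^bsub>?A\<^esub> c \<odot>\<^bsub>?A\<^esub> g"
    "c \<odot>\<^bsub>?A\<^esub> (d \<odot>\<^bsub>?A\<^esub> f) = (c * d) \<odot>\<^bsub>?A\<^esub> f" "1 \<odot>\<^bsub>?A\<^esub> f = f" "0 \<odot>\<^bsub>?A\<^esub> f = \<zero>\<^bsub>?A\<^esub>" for f g h c d
    by (auto simp: ops algebra_simps)
  have distr1: "(if b then (f + f') * g else 0) = (if b then f * g else 0) + (if b then f' * g else 0)" for b and f f' g :: rat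
    by (auto simp: algebra_simps)
  have distr2: "(if b then f * (g + g') else 0) = (if b then f * g else 0) + (if b then f * g' else 0)" for b and f g g' :: rat
    by (auto simp: algebra_simps)
  show "(f \<oplus>\<^bsub>?A\<^esub> g) \<otimes>\<^bsub>?A\<^esub> h = f \<otimes>\<^bsub>?A\<^esub> h \<oplus>\<^bsub>?A\<^esub> g \<otimes>\<^bsub>?A\<^esub> h"
    if "f \<in> carrier ?A" "g \<in> carrier ?A" "h \<in> carrier ?A" for f g h
  proof
    fix x
    let ?S = "{x. f x \<noteq> 0} \<union> {x. g x \<noteq> 0}" and ?T = "{x. h x \<noteq> 0}"
    have fin: "finite ?S" "finite ?T" using that by (auto simp: carr)
    show "((f \<oplus>\<^bsub>?A\<^esub> g) \<otimes>\<^bsub>?A\<^esub> h) x = (f \<otimes>\<^bsub>?A\<^esub> h \<oplus>\<^bsub>?A\<^esub> g \<otimes>\<^bsub>?A\<^esub> h) x"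
      using fin by (simp add: ops) (subst (1 2 3) mult[of ?S _ ?T], auto simp: distr1 sum.distrib)
  qed
  show "h \<otimes>\<^bsub>?A\<^esub> (f \<oplus>\<^bsub>?A\<^esub> g) = h \<otimes>\<^bsub>?A\<^esub> f \<oplus>\<^bsub>?A\<^esub> h \<otimes>\<^bsub>?A\<^esub> g"
    if "f \<in> carrier ?A" "g \<in> carrier ?A" "h \<in> carrier ?A" for f g h
  proof
    fix x
    let ?T = "{x. f x \<noteq> 0} \<union> {x. g x \<noteq> 0}" and ?S = "{x. h x \<noteq> 0}"
    have fin: "finite ?S" "finite ?T" using that by (auto simp: carr)
    show "(h \<otimes>\<^bsub>?A\<^esub> (f \<oplus>\<^bsub>?A\<^esub> g)) x = (h \<otimes>\<^bsub>?A\<^esub> f \<oplus>\<^bsub>?A\<^esub> h \<otimes>\<^bsub>?A\<^esub> g) x"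
      using fin by (simp add: ops) (subst (1 2 3) mult[of ?S _ ?T], auto simp: distr2 sum.distrib)
  qed
  show "(c \<odot>\<^bsub>?A\<^esub> f) \<otimes>\<^bsub>?A\<^esub> g = c \<odot>\<^bsub>?A\<^esub> (f \<otimes>\<^bsub>?A\<^esub> g)" "f \<otimes>\<^bsub>?A\<^esub> (c \<odot>\<^bsub>?A\<^esub> g) = c \<odot>\<^bsub>?A\<^esub> (f \<otimes>\<^bsub>?A\<^esub> g)"
    if "f \<in> carrier ?A" "g \<in> carrier ?A" for c f g
  proof -
    let ?S = "{x. f x \<noteq> 0}" and ?T = "{x. g x \<noteq> 0}"
    have fin: "finite ?S" "finite ?T" using that by (auto simp: carr)
    have *: "c * (if b then x else 0) = (if b then c * x else 0)" for b and c x :: rat by auto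
    show "(c \<odot>\<^bsub>?A\<^esub> f) \<otimes>\<^bsub>?A\<^esub> g = c \<odot>\<^bsub>?A\<^esub> (f \<otimes>\<^bsub>?A\<^esub> g)"
      using fin by (intro ext, simp add: ops)
        (subst (1 2) mult[of ?S _ ?T], auto simp: sum_distrib_left * mult.assoc cong: if_cong)
    show "f \<otimes>\<^bsub>?A\<^esub> (c \<odot>\<^bsub>?A\<^esub> g) = c \<odot>\<^bsub>?A\<^esub> (f \<otimes>\<^bsub>?A\<^esub> g)"
      using fin by (intro ext, simp add: ops)
        (subst (1 2) mult[of ?S _ ?T], auto simp: sum_distrib_left * mult.left_commute cong: if_cong)
  qed
  show "\<one>\<^bsub>?A\<^esub> \<otimes>\<^bsub>?A\<^esub> f = f" "f \<otimes>\<^bsub>?A\<^esub> \<one>\<^bsub>?A\<^esub> = f" if f: "f \<in> carrier ?A" for f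
  proof -
    have fin: "finite {x. f x \<noteq> 0}" and sub: "{x. f x \<noteq> 0} \<subseteq> carrier G" using f by (auto simp: carr)
    have *: "(\<Sum>z\<in>{x. f x \<noteq> 0}. if z = x then f z else 0) = f x" for x
      using fin by (simp add: sum.delta')
    show "\<one>\<^bsub>?A\<^esub> \<otimes>\<^bsub>?A\<^esub> f = f"
    proof
      fix x
      have "(\<one>\<^bsub>?A\<^esub> \<otimes>\<^bsub>?A\<^esub> f) x
          = (\<Sum>y\<in>{\<one>}. \<Sum>z\<in>{x. f x \<noteq> 0}. if y \<otimes> z = x then \<one>\<^bsub>?A\<^esub> y * f z else 0)"
        by (rule mult) (use fin in \<open>auto simp: ops\<close>)
      also have "\<dots> = (\<Sum>z\<in>{x. f x \<noteq> 0}. if \<one> \<otimes> z = x then f z else 0)"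
        by (simp add: ops cong: if_cong)
      also have "\<dots> = (\<Sum>z\<in>{x. f x \<noteq> 0}. if z = x then f z else 0)"
        by (rule sum.cong[OF refl]) (use sub in \<open>auto simp: subset_iff\<close>)
      finally show "(\<one>\<^bsub>?A\<^esub> \<otimes>\<^bsub>?A\<^esub> f) x = f x" by (simp only: *)
    qed
    show "f \<otimes>\<^bsub>?A\<^esub> \<one>\<^bsub>?A\<^esub> = f"
    proof
      fix x
      have "(f \<otimes>\<^bsub>?A\<^esub> \<one>\<^bsub>?A\<^esub>) x
          = (\<Sum>y\<in>{x. f x \<noteq> 0}. \<Sum>z\<in>{\<one>}. if y \<otimes> z = x then f y * \<one>\<^bsub>?A\<^esub> z else 0)"
        by (rule mult) (use fin in \<open>auto simp: ops\<close>)
      also have "\<dots> = (\<Sum>z\<in>{x. f x \<noteq> 0}. if z \<otimes> \<one> = x then f z else 0)"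
        by (simp add: ops cong: if_cong)
      also have "\<dots> = (\<Sum>z\<in>{x. f x \<noteq> 0}. if z = x then f z else 0)"
        by (rule sum.cong[OF refl]) (use sub in \<open>auto simp: subset_iff\<close>)
      finally show "(f \<otimes>\<^bsub>?A\<^esub> \<one>\<^bsub>?A\<^esub>) x = f x" by (simp only: *)
    qed
  qed
  show "f \<otimes>\<^bsub>?A\<^esub> g \<otimes>\<^bsub>?A\<^esub> h = f \<otimes>\<^bsub>?A\<^esub> (g \<otimes>\<^bsub>?A\<^esub> h)"
    if c: "f \<in> carrier ?A" "g \<in> carrier ?A" "h \<in> carrier ?A" for f g h
  proof
    fix x
    let ?S = "{x. f x \<noteq> 0}" and ?T = "{x. g x \<noteq> 0}" and ?U = "{x. h x \<noteq> 0}"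
    define V where "V = (\<lambda>(y, z). y \<otimes> z) ` (?S \<times> ?T)"
    define W where "W = (\<lambda>(y, z). y \<otimes> z) ` (?T \<times> ?U)"
    have fin: "finite ?S" "finite ?T" "finite ?U" "finite V" "finite W"
      using c by (auto simp: carr V_def W_def)
    have sub: "?S \<subseteq> carrier G" "?T \<subseteq> carrier G" "?U \<subseteq> carrier G" using c by (auto simp: carr)
    have dist_right: "(if b then (\<Sum>y\<in>S. \<Sum>z\<in>T. if P y z then F y * G z else 0) * r else 0)
        = (\<Sum>y\<in>S. \<Sum>z\<in>T. if P y z then (if b then F y * G z * r else 0) else 0)"
      for b S T P and F G :: "'a \<Rightarrow> rat" and r
      by (cases b) (auto simp: sum_distrib_right intro!: sum.cong cong: if_cong)
    have dist_left: "(if b then r * (\<Sum>y\<in>S. \<Sum>z\<in>T. if P y z then F y * G z else 0) else 0)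
        = (\<Sum>y\<in>S. \<Sum>z\<in>T. if P y z then (if b then r * F y * G z else 0) else 0)"
      for b S T P and F G :: "'a \<Rightarrow> rat" and r
      by (cases b) (auto simp: sum_distrib_left mult.assoc intro!: sum.cong cong: if_cong)
    have "(f \<otimes>\<^bsub>?A\<^esub> g \<otimes>\<^bsub>?A\<^esub> h) x
        = (\<Sum>u\<in>V. \<Sum>r\<in>?U. if u \<otimes> r = x then (\<Sum>y\<in>?S. \<Sum>z\<in>?T. if y \<otimes> z = u then f y * g z else 0) * h r else 0)"
      using fin supp_mult[of f g] unfolding V_def[symmetric]
      by (subst mult[of V _ ?U]) (auto simp: mult[of ?S f ?T g] cong: if_cong)
    also have "\<dots> = (\<Sum>u\<in>V. \<Sum>r\<in>?U. \<Sum>y\<in>?S. \<Sum>z\<in>?T. if y \<otimes> z = u then (if u \<otimes> r = x then f y * g z * h r else 0) else 0)"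
      by (intro sum.cong refl) (rule dist_right)
    also have "\<dots> = (\<Sum>r\<in>?U. \<Sum>u\<in>V. \<Sum>y\<in>?S. \<Sum>z\<in>?T. if y \<otimes> z = u then (if u \<otimes> r = x then f y * g z * h r else 0) else 0)"
      by (rule sum.swap)
    also have "\<dots> = (\<Sum>r\<in>?U. \<Sum>y\<in>?S. \<Sum>z\<in>?T. if y \<otimes> z \<otimes> r = x then f y * g z * h r else 0)"
    proof (rule sum.cong[OF refl])
      fix r
      have "(\<Sum>u\<in>V. \<Sum>y\<in>?S. \<Sum>z\<in>?T. if y \<otimes> z = u then (if u \<otimes> r = x then f y * g z * h r else 0) else 0)
          = (\<Sum>y\<in>?S. \<Sum>u\<in>V. \<Sum>z\<in>?T. if y \<otimes> z = u then (if u \<otimes> r = x then f y * g z * h r else 0) else 0)"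
        by (rule sum.swap)
      also have "\<dots> = (\<Sum>y\<in>?S. \<Sum>z\<in>?T. \<Sum>u\<in>V. if y \<otimes> z = u then (if u \<otimes> r = x then f y * g z * h r else 0) else 0)"
        by (intro sum.cong refl sum.swap)
      also have "\<dots> = (\<Sum>y\<in>?S. \<Sum>z\<in>?T. if y \<otimes> z \<otimes> r = x then f y * g z * h r else 0)"
        using fin by (intro sum.cong refl, subst sum.delta') (auto simp: V_def)
      finally show "(\<Sum>u\<in>V. \<Sum>y\<in>?S. \<Sum>z\<in>?T. if y \<otimes> z = u then (if u \<otimes> r = x then f y * g z * h r else 0) else 0)
          = (\<Sum>y\<in>?S. \<Sum>z\<in>?T. if y \<otimes> z \<otimes> r = x then f y * g z * h r else 0)" .
    qed
    also have "\<dots> = (\<Sum>y\<in>?S. \<Sum>r\<in>?U. \<Sum>z\<in>?T. if y \<otimes> z \<otimes> r = x then f y * g z * h r else 0)"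
      by (rule sum.swap)
    also have "\<dots> = (\<Sum>y\<in>?S. \<Sum>z\<in>?T. \<Sum>r\<in>?U. if y \<otimes> z \<otimes> r = x then f y * g z * h r else 0)"
      by (intro sum.cong refl sum.swap)
    finally have L: "(f \<otimes>\<^bsub>?A\<^esub> g \<otimes>\<^bsub>?A\<^esub> h) x = \<dots>" .
    have "(f \<otimes>\<^bsub>?A\<^esub> (g \<otimes>\<^bsub>?A\<^esub> h)) x
        = (\<Sum>y\<in>?S. \<Sum>u\<in>W. if y \<otimes> u = x then f y * (\<Sum>z\<in>?T. \<Sum>r\<in>?U. if z \<otimes> r = u then g z * h r else 0) else 0)"
      using fin supp_mult[of g h] unfolding W_def[symmetric]
      by (subst mult[of ?S _ W]) (auto simp: mult[of ?T g ?U h] cong: if_cong)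
    also have "\<dots> = (\<Sum>y\<in>?S. \<Sum>u\<in>W. \<Sum>z\<in>?T. \<Sum>r\<in>?U. if z \<otimes> r = u then (if y \<otimes> u = x then f y * g z * h r else 0) else 0)"
      by (intro sum.cong refl) (rule dist_left)
    also have "\<dots> = (\<Sum>y\<in>?S. \<Sum>z\<in>?T. \<Sum>r\<in>?U. if y \<otimes> (z \<otimes> r) = x then f y * g z * h r else 0)"
    proof (rule sum.cong[OF refl])
      fix y
      have "(\<Sum>u\<in>W. \<Sum>z\<in>?T. \<Sum>r\<in>?U. if z \<otimes> r = u then (if y \<otimes> u = x then f y * g z * h r else 0) else 0)
          = (\<Sum>z\<in>?T. \<Sum>u\<in>W. \<Sum>r\<in>?U. if z \<otimes> r = u then (if y \<otimes> u = x then f y * g z * h r else 0) else 0)"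
        by (rule sum.swap)
      also have "\<dots> = (\<Sum>z\<in>?T. \<Sum>r\<in>?U. \<Sum>u\<in>W. if z \<otimes> r = u then (if y \<otimes> u = x then f y * g z * h r else 0) else 0)"
        by (intro sum.cong refl sum.swap)
      also have "\<dots> = (\<Sum>z\<in>?T. \<Sum>r\<in>?U. if y \<otimes> (z \<otimes> r) = x then f y * g z * h r else 0)"
        using fin by (intro sum.cong refl, subst sum.delta') (auto simp: W_def)
      finally show "(\<Sum>u\<in>W. \<Sum>z\<in>?T. \<Sum>r\<in>?U. if z \<otimes> r = u then (if y \<otimes> u = x then f y * g z * h r else 0) else 0)
          = (\<Sum>z\<in>?T. \<Sum>r\<in>?U. if y \<otimes> (z \<otimes> r) = x then f y * g z * h r else 0)" .
    qed
    also have "\<dots> = (\<Sum>y\<in>?S. \<Sum>z\<in>?T. \<Sum>r\<in>?U. if y \<otimes> z \<otimes> r = x then f y * g z * h r else 0)"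
      using sub by (intro sum.cong refl) (auto simp: m_assoc subset_iff)
    finally show "(f \<otimes>\<^bsub>?A\<^esub> g \<otimes>\<^bsub>?A\<^esub> h) x = (f \<otimes>\<^bsub>?A\<^esub> (g \<otimes>\<^bsub>?A\<^esub> h)) x"
      using L by simp
  qed
qed

lemma ga_elem_mult: "ga_elem x \<otimes>\<^bsub>group_algebra G\<^esub> ga_elem y = ga_elem (x \<otimes>\<^bsub>G\<^esub> y)"
  by (rule ext, subst group_algebra_mult_superset[of "{x}" _ "{y}"]) (auto simp: ga_elem_def)

subsection \<open>Crossed products\<close>

locale alg_action = A: rat_alg A + G: group G for A :: "(rat, 'a) module" and G :: "'g monoid" +
  fixes act :: "'g \<Rightarrow> 'a \<Rightarrow> 'a"
  assumes fin: "finite (carrier G)"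
    and act_closed [simp, intro]: "x \<in> carrier G \<Longrightarrow> a \<in> carrier A \<Longrightarrow> act x a \<in> carrier A"
    and act_add: "x \<in> carrier G \<Longrightarrow> a \<in> carrier A \<Longrightarrow> b \<in> carrier A \<Longrightarrow>
      act x (a \<oplus>\<^bsub>A\<^esub> b) = act x a \<oplus>\<^bsub>A\<^esub> act x b"
    and act_mult: "x \<in> carrier G \<Longrightarrow> a \<in> carrier A \<Longrightarrow> b \<in> carrier A \<Longrightarrow>
      act x (a \<otimes>\<^bsub>A\<^esub> b) = act x a \<otimes>\<^bsub>A\<^esub> act x b"
    and act_one: "x \<in> carrier G \<Longrightarrow> act x \<one>\<^bsub>A\<^esub> = \<one>\<^bsub>A\<^esub>"
    and act_smult: "x \<in> carrier G \<Longrightarrow> a \<in> carrier A \<Longrightarrow> act x (c \<odot>\<^bsub>A\<^esub> a) = c \<odot>\<^bsub>A\<^esub> act x a"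
    and act_act: "x \<in> carrier G \<Longrightarrow> y \<in> carrier G \<Longrightarrow> a \<in> carrier A \<Longrightarrow>
      act x (act y a) = act (x \<otimes>\<^bsub>G\<^esub> y) a"
    and act_id: "a \<in> carrier A \<Longrightarrow> act \<one>\<^bsub>G\<^esub> a = a"
begin

abbreviation "C \<equiv> crossed_product A G act"

lemma act_zero [simp]: "x \<in> carrier G \<Longrightarrow> act x \<zero>\<^bsub>A\<^esub> = \<zero>\<^bsub>A\<^esub>"
  using act_smult[of x "\<zero>\<^bsub>A\<^esub>" 0] by simp

lemma act_finsum:
  assumes "x \<in> carrier G" "finite S" "\<And>y. y \<in> S \<Longrightarrow> f y \<in> carrier A"
  shows "act x (\<Oplus>\<^bsub>A\<^esub>y\<in>S. f y) = (\<Oplus>\<^bsub>A\<^esub>y\<in>S. act x (f y))"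
  by (rule finsum_additive(1)[where K = "carrier A"])
     (use assms act_add in \<open>auto intro: A.abelian_monoid_axioms\<close>)

lemma carrier_C: "f \<in> carrier C \<longleftrightarrow> f \<in> carrier G \<rightarrow>\<^sub>E carrier A"
  by (simp add: crossed_product_def)

lemma C_apply [simp]: "f \<in> carrier C \<Longrightarrow> x \<in> carrier G \<Longrightarrow> f x \<in> carrier A"
  by (auto simp: carrier_C)

lemma C_eqI: "f \<in> carrier C \<Longrightarrow> g \<in> carrier C \<Longrightarrow> (\<And>x. x \<in> carrier G \<Longrightarrow> f x = g x) \<Longrightarrow> f = g"
  unfolding carrier_C by (rule PiE_ext)

lemma C_ops:
  "z \<in> carrier G \<Longrightarrow> (f \<otimes>\<^bsub>C\<^esub> g) z = (\<Oplus>\<^bsub>A\<^esub>x\<in>carrier G. f x \<otimes>\<^bsub>A\<^esub> act x (g (inv\<^bsub>G\<^esub> x \<otimes>\<^bsub>G\<^esub> z)))"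
  "z \<in> carrier G \<Longrightarrow> (f \<oplus>\<^bsub>C\<^esub> g) z = f z \<oplus>\<^bsub>A\<^esub> g z"
  "z \<in> carrier G \<Longrightarrow> (c \<odot>\<^bsub>C\<^esub> f) z = c \<odot>\<^bsub>A\<^esub> f z"
  "z \<in> carrier G \<Longrightarrow> \<zero>\<^bsub>C\<^esub> z = \<zero>\<^bsub>A\<^esub>"
  "\<one>\<^bsub>C\<^esub> = pure_tensor A G \<one>\<^bsub>A\<^esub> \<one>\<^bsub>G\<^esub>"
  by (auto simp: crossed_product_def)

lemma pure_closed [simp, intro]: "a \<in> carrier A \<Longrightarrow> pure_tensor A G a x \<in> carrier C"
  by (auto simp: carrier_C pure_tensor_def)

lemma pure_apply: "z \<in> carrier G \<Longrightarrow> pure_tensor A G a x z = (if z = x then a else \<zero>\<^bsub>A\<^esub>)"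
  by (simp add: pure_tensor_def)

lemma C_closed:
  shows "f \<in> carrier C \<Longrightarrow> g \<in> carrier C \<Longrightarrow> f \<otimes>\<^bsub>C\<^esub> g \<in> carrier C"
    and "f \<in> carrier C \<Longrightarrow> g \<in> carrier C \<Longrightarrow> f \<oplus>\<^bsub>C\<^esub> g \<in> carrier C"
    and "f \<in> carrier C \<Longrightarrow> c \<odot>\<^bsub>C\<^esub> f \<in> carrier C"
    and "\<zero>\<^bsub>C\<^esub> \<in> carrier C" "\<one>\<^bsub>C\<^esub> \<in> carrier C"
proof -
  show "f \<otimes>\<^bsub>C\<^esub> g \<in> carrier C" if "f \<in> carrier C" "g \<in> carrier C"
  proof -
    have "f x \<in> carrier A" "g x \<in> carrier A" if "x \<in> carrier G" for x
      using \<open>f \<in> carrier C\<close> \<open>g \<in> carrier C\<close> that by simp_all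
    then show ?thesis unfolding crossed_product_def by (auto intro!: A.finsum_closed)
  qed
qed (auto simp: carrier_C crossed_product_def pure_tensor_def)

lemma term_closed [simp]: "f \<in> carrier C \<Longrightarrow> g \<in> carrier C \<Longrightarrow> x \<in> carrier G \<Longrightarrow> z \<in> carrier G \<Longrightarrow>
    f x \<otimes>\<^bsub>A\<^esub> act x (g (inv\<^bsub>G\<^esub> x \<otimes>\<^bsub>G\<^esub> z)) \<in> carrier A"
  by simp

lemma C_mult_pure_left:
  assumes a: "a \<in> carrier A" and x: "x \<in> carrier G" and g: "g \<in> carrier C" and z: "z \<in> carrier G"
  shows "(pure_tensor A G a x \<otimes>\<^bsub>C\<^esub> g) z = a \<otimes>\<^bsub>A\<^esub> act x (g (inv\<^bsub>G\<^esub> x \<otimes>\<^bsub>G\<^esub> z))"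
proof -
  have "(pure_tensor A G a x \<otimes>\<^bsub>C\<^esub> g) z
      = (\<Oplus>\<^bsub>A\<^esub>y\<in>{x}. pure_tensor A G a x y \<otimes>\<^bsub>A\<^esub> act y (g (inv\<^bsub>G\<^esub> y \<otimes>\<^bsub>G\<^esub> z)))"
    unfolding C_ops(1)[OF z] using assms fin
    by (intro A.add.finprod_mono_neutral_cong_right) (auto simp: pure_apply)
  then show ?thesis using assms by (simp add: pure_apply)
qed

text \<open>After the two sums over the group are exchanged, the inner one is shifted to \<open>u = y\<inverse> x\<close>, the argument
  at which the inner product evaluates \<open>g\<close>.\<close>

lemma C_mult_assoc:
  assumes f: "f \<in> carrier C" and g: "g \<in> carrier C" and h: "h \<in> carrier C"
  shows "f \<otimes>\<^bsub>C\<^esub> g \<otimes>\<^bsub>C\<^esub> h = f \<otimes>\<^bsub>C\<^esub> (g \<otimes>\<^bsub>C\<^esub> h)"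
proof (rule C_eqI)
  fix z assume z: "z \<in> carrier G"
  let ?t = "\<lambda>x y. (f y \<otimes>\<^bsub>A\<^esub> act y (g (inv\<^bsub>G\<^esub> y \<otimes>\<^bsub>G\<^esub> x))) \<otimes>\<^bsub>A\<^esub> act x (h (inv\<^bsub>G\<^esub> x \<otimes>\<^bsub>G\<^esub> z))"
  have "(f \<otimes>\<^bsub>C\<^esub> g \<otimes>\<^bsub>C\<^esub> h) z = (\<Oplus>\<^bsub>A\<^esub>x\<in>carrier G. \<Oplus>\<^bsub>A\<^esub>y\<in>carrier G. ?t x y)"
    unfolding C_ops(1)[OF z]
  proof (rule A.finsum_cong'[OF refl])
    fix x assume x: "x \<in> carrier G"
    show "(f \<otimes>\<^bsub>C\<^esub> g) x \<otimes>\<^bsub>A\<^esub> act x (h (inv\<^bsub>G\<^esub> x \<otimes>\<^bsub>G\<^esub> z)) = (\<Oplus>\<^bsub>A\<^esub>y\<in>carrier G. ?t x y)"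
      unfolding C_ops(1)[OF x] using f g h x z fin by (intro A.finsum_ldistr) auto
  qed (use f g h z in \<open>auto intro!: A.finsum_closed\<close>)
  also have "\<dots> = (\<Oplus>\<^bsub>A\<^esub>y\<in>carrier G. \<Oplus>\<^bsub>A\<^esub>x\<in>carrier G. ?t x y)"
    using f g h z fin by (intro A.finsum_swap) auto
  also have "\<dots> = (f \<otimes>\<^bsub>C\<^esub> (g \<otimes>\<^bsub>C\<^esub> h)) z"
    unfolding C_ops(1)[OF z]
  proof (rule A.finsum_cong'[OF refl])
    fix y assume y: "y \<in> carrier G"
    let ?s = "\<lambda>u. f y \<otimes>\<^bsub>A\<^esub> act y (g u \<otimes>\<^bsub>A\<^esub> act u (h (inv\<^bsub>G\<^esub> u \<otimes>\<^bsub>G\<^esub> (inv\<^bsub>G\<^esub> y \<otimes>\<^bsub>G\<^esub> z))))"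
    have yz: "inv\<^bsub>G\<^esub> y \<otimes>\<^bsub>G\<^esub> z \<in> carrier G" using y z by simp
    have "f y \<otimes>\<^bsub>A\<^esub> act y ((g \<otimes>\<^bsub>C\<^esub> h) (inv\<^bsub>G\<^esub> y \<otimes>\<^bsub>G\<^esub> z))
        = f y \<otimes>\<^bsub>A\<^esub> (\<Oplus>\<^bsub>A\<^esub>u\<in>carrier G. act y (g u \<otimes>\<^bsub>A\<^esub> act u (h (inv\<^bsub>G\<^esub> u \<otimes>\<^bsub>G\<^esub> (inv\<^bsub>G\<^esub> y \<otimes>\<^bsub>G\<^esub> z)))))"
      unfolding C_ops(1)[OF yz] using f g h y z fin by (subst act_finsum) auto
    also have "\<dots> = (\<Oplus>\<^bsub>A\<^esub>u\<in>carrier G. ?s u)"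
      using f g h y z fin by (intro A.finsum_rdistr) auto
    also have "\<dots> = (\<Oplus>\<^bsub>A\<^esub>u\<in>(\<lambda>x. inv\<^bsub>G\<^esub> y \<otimes>\<^bsub>G\<^esub> x) ` carrier G. ?s u)"
    proof -
      have "u = inv\<^bsub>G\<^esub> y \<otimes>\<^bsub>G\<^esub> (y \<otimes>\<^bsub>G\<^esub> u)" if "u \<in> carrier G" for u
        using y that by (simp add: G.m_assoc[symmetric])
      then have "(\<lambda>x. inv\<^bsub>G\<^esub> y \<otimes>\<^bsub>G\<^esub> x) ` carrier G = carrier G" using y by (auto intro!: image_eqI)
      then show ?thesis by simp
    qed
    also have "\<dots> = (\<Oplus>\<^bsub>A\<^esub>x\<in>carrier G. ?s (inv\<^bsub>G\<^esub> y \<otimes>\<^bsub>G\<^esub> x))"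
      using f g h y z by (intro A.finsum_reindex) (auto simp: inj_on_def)
    also have "\<dots> = (\<Oplus>\<^bsub>A\<^esub>x\<in>carrier G. ?t x y)"
    proof (rule A.finsum_cong'[OF refl])
      fix x assume x: "x \<in> carrier G"
      have "inv\<^bsub>G\<^esub> (inv\<^bsub>G\<^esub> y \<otimes>\<^bsub>G\<^esub> x) \<otimes>\<^bsub>G\<^esub> (inv\<^bsub>G\<^esub> y \<otimes>\<^bsub>G\<^esub> z) = inv\<^bsub>G\<^esub> x \<otimes>\<^bsub>G\<^esub> (y \<otimes>\<^bsub>G\<^esub> (inv\<^bsub>G\<^esub> y \<otimes>\<^bsub>G\<^esub> z))"
        using x y z by (simp add: G.inv_mult_group G.m_assoc)
      also have "\<dots> = inv\<^bsub>G\<^esub> x \<otimes>\<^bsub>G\<^esub> z" using y z by (simp add: G.m_assoc[symmetric])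
      finally have e: "inv\<^bsub>G\<^esub> (inv\<^bsub>G\<^esub> y \<otimes>\<^bsub>G\<^esub> x) \<otimes>\<^bsub>G\<^esub> (inv\<^bsub>G\<^esub> y \<otimes>\<^bsub>G\<^esub> z) = inv\<^bsub>G\<^esub> x \<otimes>\<^bsub>G\<^esub> z" .
      have e2: "y \<otimes>\<^bsub>G\<^esub> (inv\<^bsub>G\<^esub> y \<otimes>\<^bsub>G\<^esub> x) = x" using x y by (simp add: G.m_assoc[symmetric])
      show "?s (inv\<^bsub>G\<^esub> y \<otimes>\<^bsub>G\<^esub> x) = ?t x y"
        unfolding e using f g h x y z by (simp add: act_mult act_act e2 A.m_assoc)
    qed (use f g h y z in auto)
    finally show "(\<Oplus>\<^bsub>A\<^esub>x\<in>carrier G. ?t x y) = f y \<otimes>\<^bsub>A\<^esub> act y ((g \<otimes>\<^bsub>C\<^esub> h) (inv\<^bsub>G\<^esub> y \<otimes>\<^bsub>G\<^esub> z))" by simp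
  qed (use f g h z in \<open>auto simp: C_closed\<close>)
  finally show "(f \<otimes>\<^bsub>C\<^esub> g \<otimes>\<^bsub>C\<^esub> h) z = (f \<otimes>\<^bsub>C\<^esub> (g \<otimes>\<^bsub>C\<^esub> h)) z" .
qed (use assms in \<open>auto intro!: C_closed\<close>)

lemma rat_alg_C: "rat_alg C"
proof (rule rat_algI)
  note [simp] = C_closed C_ops(2-4)
  show "f \<otimes>\<^bsub>C\<^esub> g \<otimes>\<^bsub>C\<^esub> h = f \<otimes>\<^bsub>C\<^esub> (g \<otimes>\<^bsub>C\<^esub> h)" if "f \<in> carrier C" "g \<in> carrier C" "h \<in> carrier C" for f g h
    using that by (rule C_mult_assoc)
  show "(f \<oplus>\<^bsub>C\<^esub> g) \<otimes>\<^bsub>C\<^esub> h = f \<otimes>\<^bsub>C\<^esub> h \<oplus>\<^bsub>C\<^esub> g \<otimes>\<^bsub>C\<^esub> h" if c: "f \<in> carrier C" "g \<in> carrier C" "h \<in> carrier C" for f g h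
  proof (rule C_eqI)
    fix z assume z: "z \<in> carrier G"
    have "((f \<oplus>\<^bsub>C\<^esub> g) \<otimes>\<^bsub>C\<^esub> h) z = (\<Oplus>\<^bsub>A\<^esub>x\<in>carrier G. f x \<otimes>\<^bsub>A\<^esub> act x (h (inv\<^bsub>G\<^esub> x \<otimes>\<^bsub>G\<^esub> z))
         \<oplus>\<^bsub>A\<^esub> g x \<otimes>\<^bsub>A\<^esub> act x (h (inv\<^bsub>G\<^esub> x \<otimes>\<^bsub>G\<^esub> z)))"
      unfolding C_ops(1)[OF z] using c z by (intro A.finsum_cong') (auto simp: A.l_distr)
    also have "\<dots> = (f \<otimes>\<^bsub>C\<^esub> h \<oplus>\<^bsub>C\<^esub> g \<otimes>\<^bsub>C\<^esub> h) z"
      using c z by (simp add: C_ops(1))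
    finally show "((f \<oplus>\<^bsub>C\<^esub> g) \<otimes>\<^bsub>C\<^esub> h) z = (f \<otimes>\<^bsub>C\<^esub> h \<oplus>\<^bsub>C\<^esub> g \<otimes>\<^bsub>C\<^esub> h) z" .
  qed (use c in auto)
  show "h \<otimes>\<^bsub>C\<^esub> (f \<oplus>\<^bsub>C\<^esub> g) = h \<otimes>\<^bsub>C\<^esub> f \<oplus>\<^bsub>C\<^esub> h \<otimes>\<^bsub>C\<^esub> g" if c: "f \<in> carrier C" "g \<in> carrier C" "h \<in> carrier C" for f g h
  proof (rule C_eqI)
    fix z assume z: "z \<in> carrier G"
    have "(h \<otimes>\<^bsub>C\<^esub> (f \<oplus>\<^bsub>C\<^esub> g)) z = (\<Oplus>\<^bsub>A\<^esub>x\<in>carrier G. h x \<otimes>\<^bsub>A\<^esub> act x (f (inv\<^bsub>G\<^esub> x \<otimes>\<^bsub>G\<^esub> z))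
         \<oplus>\<^bsub>A\<^esub> h x \<otimes>\<^bsub>A\<^esub> act x (g (inv\<^bsub>G\<^esub> x \<otimes>\<^bsub>G\<^esub> z)))"
      unfolding C_ops(1)[OF z] using c z by (intro A.finsum_cong') (auto simp: A.r_distr act_add)
    also have "\<dots> = (h \<otimes>\<^bsub>C\<^esub> f \<oplus>\<^bsub>C\<^esub> h \<otimes>\<^bsub>C\<^esub> g) z"
      using c z by (simp add: C_ops(1))
    finally show "(h \<otimes>\<^bsub>C\<^esub> (f \<oplus>\<^bsub>C\<^esub> g)) z = (h \<otimes>\<^bsub>C\<^esub> f \<oplus>\<^bsub>C\<^esub> h \<otimes>\<^bsub>C\<^esub> g) z" .
  qed (use c in auto)
  show "(c \<odot>\<^bsub>C\<^esub> f) \<otimes>\<^bsub>C\<^esub> g = c \<odot>\<^bsub>C\<^esub> (f \<otimes>\<^bsub>C\<^esub> g)" if c: "f \<in> carrier C" "g \<in> carrier C" for c f g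
  proof (rule C_eqI)
    fix z assume z: "z \<in> carrier G"
    show "((c \<odot>\<^bsub>C\<^esub> f) \<otimes>\<^bsub>C\<^esub> g) z = (c \<odot>\<^bsub>C\<^esub> (f \<otimes>\<^bsub>C\<^esub> g)) z"
      using c z fin by (simp add: C_ops(1), subst A.smult_finsum)
        (auto intro!: A.finsum_cong' simp: A.smult_mult_left)
  qed (use c in auto)
  show "f \<otimes>\<^bsub>C\<^esub> (c \<odot>\<^bsub>C\<^esub> g) = c \<odot>\<^bsub>C\<^esub> (f \<otimes>\<^bsub>C\<^esub> g)" if c: "f \<in> carrier C" "g \<in> carrier C" for c f g
  proof (rule C_eqI)
    fix z assume z: "z \<in> carrier G"
    show "(f \<otimes>\<^bsub>C\<^esub> (c \<odot>\<^bsub>C\<^esub> g)) z = (c \<odot>\<^bsub>C\<^esub> (f \<otimes>\<^bsub>C\<^esub> g)) z"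
      using c z fin by (simp add: C_ops(1), subst A.smult_finsum)
        (auto intro!: A.finsum_cong' simp: A.smult_mult_right act_smult)
  qed (use c in auto)
  show "\<one>\<^bsub>C\<^esub> \<otimes>\<^bsub>C\<^esub> f = f" if f: "f \<in> carrier C" for f
  proof (rule C_eqI)
    fix z assume z: "z \<in> carrier G"
    show "(\<one>\<^bsub>C\<^esub> \<otimes>\<^bsub>C\<^esub> f) z = f z"
      unfolding C_ops(5) using f z by (subst C_mult_pure_left) (auto simp: act_id)
  qed (use f in auto)
  show "f \<otimes>\<^bsub>C\<^esub> \<one>\<^bsub>C\<^esub> = f" if f: "f \<in> carrier C" for f
  proof (rule C_eqI)
    fix z assume z: "z \<in> carrier G"
    have e: "inv\<^bsub>G\<^esub> x \<otimes>\<^bsub>G\<^esub> z = \<one>\<^bsub>G\<^esub> \<longleftrightarrow> x = z" if "x \<in> carrier G" for x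
      using that z by (metis G.inv_closed G.inv_inv G.l_inv G.inv_unique' G.inv_equality)
    have "(f \<otimes>\<^bsub>C\<^esub> \<one>\<^bsub>C\<^esub>) z = (\<Oplus>\<^bsub>A\<^esub>x\<in>{z}. f x)"
      unfolding C_ops(1)[OF z] C_ops(5) using f z fin e
      by (intro A.add.finprod_mono_neutral_cong_right) (auto simp: pure_apply act_one)
    then show "(f \<otimes>\<^bsub>C\<^esub> \<one>\<^bsub>C\<^esub>) z = f z" using f z by simp
  qed (use f in auto)
qed (auto intro!: C_eqI C_closed simp: C_closed C_ops(2-4) A.a_ac A.smult_l_distr A.smult_r_distr A.smult_smult)

sublocale C: rat_alg C by (rule rat_alg_C)

lemma pure_mult:
  assumes "a \<in> carrier A" "b \<in> carrier A" "x \<in> carrier G" "y \<in> carrier G"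
  shows "pure_tensor A G a x \<otimes>\<^bsub>C\<^esub> pure_tensor A G b y = pure_tensor A G (a \<otimes>\<^bsub>A\<^esub> act x b) (x \<otimes>\<^bsub>G\<^esub> y)"
proof (rule C_eqI)
  fix z assume z: "z \<in> carrier G"
  have "inv\<^bsub>G\<^esub> x \<otimes>\<^bsub>G\<^esub> z = y \<longleftrightarrow> z = x \<otimes>\<^bsub>G\<^esub> y"
    using assms z G.inv_solve_left'[of y x z] by auto
  then show "(pure_tensor A G a x \<otimes>\<^bsub>C\<^esub> pure_tensor A G b y) z = pure_tensor A G (a \<otimes>\<^bsub>A\<^esub> act x b) (x \<otimes>\<^bsub>G\<^esub> y) z"
    using assms z by (subst C_mult_pure_left) (auto simp: pure_apply)
qed (use assms in auto)

lemma C_finsum_apply: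
  assumes "finite S" "\<And>x. x \<in> S \<Longrightarrow> f x \<in> carrier C" "z \<in> carrier G"
  shows "(\<Oplus>\<^bsub>C\<^esub>x\<in>S. f x) z = (\<Oplus>\<^bsub>A\<^esub>x\<in>S. f x z)"
  by (rule finsum_additive(1)[where K = "carrier C" and h = "\<lambda>f. f z"])
     (use assms in \<open>auto simp: C_ops intro: A.abelian_monoid_axioms C.abelian_monoid_axioms\<close>)

end

subsection \<open>Truncated exponentials\<close>

context rat_alg
begin

text \<open>Divided powers turn the binomial formula for commuting elements into a plain convolution.\<close>

definition dpow :: "nat \<Rightarrow> 'a \<Rightarrow> 'a" where
  "dpow m x = (1 / fact m) \<odot> (x [^] m)"

lemma dpow_closed [simp]: "x \<in> carrier A \<Longrightarrow> dpow m x \<in> carrier A"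
  by (simp add: dpow_def)

lemma commute_pow:
  assumes "x \<in> carrier A" "y \<in> carrier A" "x \<otimes> y = y \<otimes> x"
  shows "x \<otimes> y [^] (m::nat) = y [^] m \<otimes> x"
proof (induction m)
  case (Suc m)
  have "x \<otimes> y [^] Suc m = (x \<otimes> y [^] m) \<otimes> y" using assms by (simp add: m_assoc)
  also have "\<dots> = y [^] m \<otimes> (x \<otimes> y)" using Suc assms by (simp add: m_assoc)
  also have "\<dots> = y [^] Suc m \<otimes> x" using assms by (simp add: m_assoc)
  finally show ?case .
qed (use assms in simp)

lemma commute_dpow:
  assumes "x \<in> carrier A" "y \<in> carrier A" "x \<otimes> y = y \<otimes> x"
  shows "x \<otimes> dpow m y = dpow m y \<otimes> x"
  using assms by (simp add: dpow_def smult_mult_left smult_mult_right commute_pow)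

lemma mult_dpow:
  assumes "x \<in> carrier A"
  shows "x \<otimes> dpow m x = of_nat (Suc m) \<odot> dpow (Suc m) x"
  using assms commute_pow[of x x m]
  by (simp add: dpow_def smult_mult_right smult_smult)

lemma dpow_0 [simp]: "x \<in> carrier A \<Longrightarrow> dpow 0 x = \<one>"
  by (simp add: dpow_def)

text \<open>Multiplication of the formula for \<open>N\<close> by \<open>x + y\<close> produces the term with exponents \<open>m\<close> and \<open>N + 1 - m\<close> twice,
  with the factor \<open>m\<close> from \<open>x\<close> and \<open>N + 1 - m\<close> from \<open>y\<close>. Their sum \<open>N + 1\<close> is the same for all terms.\<close>

lemma dpow_add:
  assumes x: "x \<in> carrier A" and y: "y \<in> carrier A" and xy: "x \<otimes> y = y \<otimes> x"
  shows "dpow N (x \<oplus> y) = (\<Oplus>m\<in>{..N}. dpow m x \<otimes> dpow (N - m) y)"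
proof (induction N)
  case (Suc N)
  let ?p = "\<lambda>m. dpow m x" and ?q = "\<lambda>m. dpow m y"
  have 1: "x \<otimes> (?p m \<otimes> ?q l) = of_nat (Suc m) \<odot> (?p (Suc m) \<otimes> ?q l)" for m l
    using x y mult_dpow[OF x, of m] by (simp add: m_assoc[symmetric] smult_mult_left)
  have 2: "y \<otimes> (?p m \<otimes> ?q l) = of_nat (Suc l) \<odot> (?p m \<otimes> ?q (Suc l))" for m l
  proof -
    have "y \<otimes> (?p m \<otimes> ?q l) = ?p m \<otimes> (y \<otimes> ?q l)"
      using x y commute_dpow[OF y x xy[symmetric], of m] by (simp add: m_assoc[symmetric])
    then show ?thesis using x y by (simp add: mult_dpow smult_mult_right del: of_nat_Suc)
  qed
  let ?t = "\<lambda>m. ?p m \<otimes> ?q (Suc N - m)"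
  have "of_nat (Suc N) \<odot> dpow (Suc N) (x \<oplus> y) = (x \<oplus> y) \<otimes> dpow N (x \<oplus> y)"
    using x y by (simp add: mult_dpow del: of_nat_Suc)
  also have "\<dots> = x \<otimes> (\<Oplus>m\<in>{..N}. ?p m \<otimes> ?q (N - m)) \<oplus> y \<otimes> (\<Oplus>m\<in>{..N}. ?p m \<otimes> ?q (N - m))"
    unfolding Suc using x y by (intro l_distr finsum_closed) auto
  also have "\<dots> = (\<Oplus>m\<in>{..N}. x \<otimes> (?p m \<otimes> ?q (N - m))) \<oplus> (\<Oplus>m\<in>{..N}. y \<otimes> (?p m \<otimes> ?q (N - m)))"
    using x y by (subst (1 2) finsum_rdistr) auto
  also have "(\<Oplus>m\<in>{..N}. x \<otimes> (?p m \<otimes> ?q (N - m))) = (\<Oplus>m\<in>{..N}. of_nat (Suc m) \<odot> ?t (Suc m))"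
    using x y by (intro finsum_cong') (auto simp: 1)
  also have "\<dots> = (\<Oplus>m\<in>{..Suc N}. of_nat m \<odot> ?t m)"
    using x y finsum_Suc2[of "\<lambda>m. of_nat m \<odot> ?t m" N] by (simp add: finsum_closed del: of_nat_Suc)
  also have "(\<Oplus>m\<in>{..N}. y \<otimes> (?p m \<otimes> ?q (N - m))) = (\<Oplus>m\<in>{..N}. of_nat (Suc N - m) \<odot> ?t m)"
    using x y by (intro finsum_cong') (auto simp: 2 Suc_diff_le simp del: of_nat_Suc)
  also have "\<dots> = (\<Oplus>m\<in>{..Suc N}. of_nat (Suc N - m) \<odot> ?t m)"
    using x y finsum_Suc[of "\<lambda>m. of_nat (Suc N - m) \<odot> ?t m" N] by (simp add: finsum_closed del: of_nat_Suc)
  also have "(\<Oplus>m\<in>{..Suc N}. of_nat m \<odot> ?t m) \<oplus> (\<Oplus>m\<in>{..Suc N}. of_nat (Suc N - m) \<odot> ?t m)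
      = (\<Oplus>m\<in>{..Suc N}. of_nat m \<odot> ?t m \<oplus> of_nat (Suc N - m) \<odot> ?t m)"
    using x y by (intro finsum_addf[symmetric]) auto
  also have "\<dots> = (\<Oplus>m\<in>{..Suc N}. of_nat (Suc N) \<odot> ?t m)"
    using x y by (intro finsum_cong') (auto simp: smult_l_distr[symmetric] of_nat_diff)
  also have "\<dots> = of_nat (Suc N) \<odot> (\<Oplus>m\<in>{..Suc N}. ?t m)"
    using x y by (intro smult_finsum[symmetric]) auto
  finally have eq: "of_nat (Suc N) \<odot> dpow (Suc N) (x \<oplus> y) = of_nat (Suc N) \<odot> (\<Oplus>m\<in>{..Suc N}. ?t m)" .
  have "(of_nat (Suc N) :: rat) \<noteq> 0" by (rule of_nat_neq_0)
  moreover have "dpow (Suc N) (x \<oplus> y) \<in> carrier A" using x y by simp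
  moreover have "(\<Oplus>m\<in>{..Suc N}. ?t m) \<in> carrier A" using x y by (intro finsum_closed) auto
  ultimately show ?case using eq by (rule smult_cancel)
qed (use x y in simp)

definition texp :: "nat \<Rightarrow> 'a \<Rightarrow> 'a" where
  "texp K x = (\<Oplus>m\<in>{..K}. dpow m x)"

lemma texp_closed [simp]: "x \<in> carrier A \<Longrightarrow> texp K x \<in> carrier A"
  by (auto simp: texp_def intro!: finsum_closed)

text \<open>For nilpotent elements the truncation at \<open>K\<close> loses nothing, so the double sum over \<open>m, k \<le> K\<close> can be
  reordered along the diagonals \<open>m + k = N\<close>.\<close>

lemma texp_add:
  assumes x: "x \<in> carrier A" and y: "y \<in> carrier A" and xy: "x \<otimes> y = y \<otimes> x"
    and nil: "\<And>m. m > K \<Longrightarrow> x [^] m = \<zero>" "\<And>m. m > K \<Longrightarrow> y [^] m = \<zero>" "\<And>m. m > K \<Longrightarrow> (x \<oplus> y) [^] m = \<zero>"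
  shows "texp K x \<otimes> texp K y = texp K (x \<oplus> y)"
proof -
  have z: "dpow m x = \<zero>" "dpow m y = \<zero>" "dpow m (x \<oplus> y) = \<zero>" if "m > K" for m
    using nil[OF that] by (simp_all add: dpow_def)
  have "texp K x \<otimes> texp K y = (\<Oplus>k\<in>{..K + K}. \<Oplus>i\<in>{..k}. dpow i x \<otimes> dpow (k - i) y)"
    unfolding texp_def using x y z by (intro cauchy_product[symmetric]) auto
  also have "\<dots> = (\<Oplus>k\<in>{..K + K}. dpow k (x \<oplus> y))"
    by (simp only: dpow_add[OF x y xy])
  also have "\<dots> = texp K (x \<oplus> y)"
    unfolding texp_def using x y z by (intro add.finprod_mono_neutral_cong_right) auto
  finally show ?thesis .
qed

end

subsection \<open>Associated graded algebras\<close>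

lemma finprod_cosets:
  fixes A :: "(rat, 'a) module" (structure)
  assumes "rat_alg A" "ideal I A" "finite S" "\<And>i. i \<in> S \<Longrightarrow> f i \<in> carrier A"
  shows "finprod (A A_Mod I) (\<lambda>i. I +> f i) S = I +> (\<Oplus>i\<in>S. f i)"
proof -
  interpret rat_alg A by fact
  interpret I: ideal I A by fact
  interpret M: comm_group "A A_Mod I" by (rule I.a_factorgroup_is_comm_group)
  have carr: "I +> x \<in> carrier (A A_Mod I)" if "x \<in> carrier A" for x
    using that by (auto simp: A_FactGroup_def' A_RCOSETS_def')
  show ?thesis using assms(3,4)
  proof (induction S rule: finite_induct)
    case empty
    show ?case unfolding M.finprod_empty using a_rcos_zero[OF assms(2)] I.zero_closed by (simp add: A_FactGroup_def')
  next
    case (insert i S)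
    have "f \<in> S \<rightarrow> carrier A" using insert by auto
    then show ?case
      using insert carr by (simp add: M.finprod_insert Pi_iff I.a_rcos_sum)
  qed
qed

text \<open>Each \<open>lam k\<close> induces an injection of the \<open>k\<close>-th graded piece of \<open>A\<close> into \<open>B\<close>; the images are independent
  and span \<open>B\<close>. Working with the maps \<open>lam k\<close> avoids the cosets of which the associated graded algebra
  consists.\<close>

locale graded_comparison = A: rat_alg A + B: rat_alg B
  for A :: "(rat, 'a) module" and B :: "(rat, 'b) module" +
  fixes F :: "nat \<Rightarrow> 'a set" and lam :: "nat \<Rightarrow> 'a \<Rightarrow> 'b"
  assumes F_0: "F 0 = carrier A"
    and F_ideal: "ideal (F k) A"
    and F_Suc: "F (Suc k) \<subseteq> F k"
    and F_mult: "x \<in> F i \<Longrightarrow> y \<in> F j \<Longrightarrow> x \<otimes>\<^bsub>A\<^esub> y \<in> F (i + j)"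
    and lam_closed: "x \<in> F k \<Longrightarrow> lam k x \<in> carrier B"
    and lam_add: "x \<in> F k \<Longrightarrow> y \<in> F k \<Longrightarrow> lam k (x \<oplus>\<^bsub>A\<^esub> y) = lam k x \<oplus>\<^bsub>B\<^esub> lam k y"
    and lam_smult: "x \<in> F k \<Longrightarrow> lam k (c \<odot>\<^bsub>A\<^esub> x) = c \<odot>\<^bsub>B\<^esub> lam k x"
    and lam_kernel: "x \<in> F k \<Longrightarrow> lam k x = \<zero>\<^bsub>B\<^esub> \<longleftrightarrow> x \<in> F (Suc k)"
    and lam_mult: "x \<in> F i \<Longrightarrow> y \<in> F j \<Longrightarrow> lam (i + j) (x \<otimes>\<^bsub>A\<^esub> y) = lam i x \<otimes>\<^bsub>B\<^esub> lam j y"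
    and lam_one: "lam 0 \<one>\<^bsub>A\<^esub> = \<one>\<^bsub>B\<^esub>"
    and lam_direct: "(\<And>k. X k \<in> F k) \<Longrightarrow> (\<Oplus>\<^bsub>B\<^esub>k\<in>{..N}. lam k (X k)) = \<zero>\<^bsub>B\<^esub> \<Longrightarrow> k \<le> N \<Longrightarrow> lam k (X k) = \<zero>\<^bsub>B\<^esub>"
    and lam_span: "b \<in> carrier B \<Longrightarrow> \<exists>N X. (\<forall>k. X k \<in> F k) \<and> b = (\<Oplus>\<^bsub>B\<^esub>k\<in>{..N::nat}. lam k (X k))"
begin

abbreviation "gr \<equiv> assoc_graded A F"

text \<open>Representatives of a family of cosets, with an explicit bound \<open>N\<close> beyond which they are chosen to be
  zero, so that sums over \<open>k\<close> become sums over \<open>{..N}\<close>.\<close>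

definition reps :: "(nat \<Rightarrow> 'a set) \<Rightarrow> (nat \<Rightarrow> 'a) \<Rightarrow> nat \<Rightarrow> bool" where
  "reps \<xi> x N \<longleftrightarrow> (\<forall>k. x k \<in> F k \<and> \<xi> k = F (Suc k) +>\<^bsub>A\<^esub> x k) \<and> (\<forall>k>N. x k = \<zero>\<^bsub>A\<^esub>)"

lemma F_subset: "x \<in> F k \<Longrightarrow> x \<in> carrier A"
  using ideal.Icarr[OF F_ideal] .

lemma F_zero [simp]: "\<zero>\<^bsub>A\<^esub> \<in> F k"
  by (rule additive_subgroup.zero_closed[OF ideal.axioms(1)[OF F_ideal]])

lemma F_add: "x \<in> F k \<Longrightarrow> y \<in> F k \<Longrightarrow> x \<oplus>\<^bsub>A\<^esub> y \<in> F k"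
  by (rule additive_subgroup.a_closed[OF ideal.axioms(1)[OF F_ideal]])

lemma F_smult: "x \<in> F k \<Longrightarrow> c \<odot>\<^bsub>A\<^esub> x \<in> F k"
  by (rule A.ideal_smult[OF F_ideal])

lemma F_diff: "x \<in> F k \<Longrightarrow> y \<in> F k \<Longrightarrow> x \<ominus>\<^bsub>A\<^esub> y \<in> F k"
  unfolding a_minus_def by (intro F_add additive_subgroup.a_inv_closed[OF ideal.axioms(1)[OF F_ideal]])

lemma lam_zero [simp]: "lam k \<zero>\<^bsub>A\<^esub> = \<zero>\<^bsub>B\<^esub>"
  using lam_kernel[of "\<zero>\<^bsub>A\<^esub>" k] by simp

lemma coset_zero: "F k +>\<^bsub>A\<^esub> \<zero>\<^bsub>A\<^esub> = F k"
  by (rule A.a_rcos_zero[OF F_ideal F_zero])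

lemma lam_finsum:
  assumes "finite S" "\<And>i. i \<in> S \<Longrightarrow> f i \<in> F k"
  shows "lam k (\<Oplus>\<^bsub>A\<^esub>i\<in>S. f i) = (\<Oplus>\<^bsub>B\<^esub>i\<in>S. lam k (f i))" "(\<Oplus>\<^bsub>A\<^esub>i\<in>S. f i) \<in> F k"
proof -
  have K: "F k \<subseteq> carrier A" using F_subset by blast
  note * = finsum_additive[where K = "F k" and h = "lam k" and A = A and B = B and f = f,
      OF A.abelian_monoid_axioms B.abelian_monoid_axioms K F_zero F_add lam_closed lam_zero lam_add assms]
  show "lam k (\<Oplus>\<^bsub>A\<^esub>i\<in>S. f i) = (\<Oplus>\<^bsub>B\<^esub>i\<in>S. lam k (f i))" by (rule *(1))
  show "(\<Oplus>\<^bsub>A\<^esub>i\<in>S. f i) \<in> F k" by (rule *(2))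
qed

lemma lam_diff: "x \<in> F k \<Longrightarrow> y \<in> F k \<Longrightarrow> lam k (x \<ominus>\<^bsub>A\<^esub> y) = lam k x \<ominus>\<^bsub>B\<^esub> lam k y"
proof -
  assume xy: "x \<in> F k" "y \<in> F k"
  have "x = (x \<ominus>\<^bsub>A\<^esub> y) \<oplus>\<^bsub>A\<^esub> y"
    using xy F_subset by (simp add: a_minus_def A.a_assoc A.l_neg)
  then have "lam k x = lam k (x \<ominus>\<^bsub>A\<^esub> y) \<oplus>\<^bsub>B\<^esub> lam k y"
    using lam_add[OF F_diff[OF xy] xy(2)] by simp
  then show ?thesis
    using lam_closed[OF F_diff[OF xy]] lam_closed[OF xy(2)]
    by (simp add: a_minus_def B.a_assoc B.r_neg)
qed

lemma reps_exist: "\<xi> \<in> carrier gr \<Longrightarrow> \<exists>x N. reps \<xi> x N"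
proof -
  assume \<xi>: "\<xi> \<in> carrier gr"
  have "\<exists>x\<in>F k. \<xi> k = F (Suc k) +>\<^bsub>A\<^esub> x \<and> (\<xi> k = F (Suc k) \<longrightarrow> x = \<zero>\<^bsub>A\<^esub>)" for k
  proof (cases "\<xi> k = F (Suc k)")
    case True
    then show ?thesis using coset_zero by (intro bexI[of _ "\<zero>\<^bsub>A\<^esub>"]) auto
  next
    case False
    then show ?thesis using \<xi> by (auto simp: assoc_graded_def)
  qed
  then obtain x where x: "\<And>k. x k \<in> F k" "\<And>k. \<xi> k = F (Suc k) +>\<^bsub>A\<^esub> x k" "\<And>k. \<xi> k = F (Suc k) \<Longrightarrow> x k = \<zero>\<^bsub>A\<^esub>"
    by metis
  have "finite {k. \<xi> k \<noteq> F (Suc k)}" using \<xi> by (simp add: assoc_graded_def)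
  then obtain N where N: "\<forall>k\<in>{k. \<xi> k \<noteq> F (Suc k)}. k \<le> N" unfolding finite_nat_set_iff_bounded_le ..
  have "x k = \<zero>\<^bsub>A\<^esub>" if "N < k" for k
  proof (rule x(3), rule ccontr)
    assume "\<xi> k \<noteq> F (Suc k)"
    with N that show False by fastforce
  qed
  then have "reps \<xi> x N" unfolding reps_def using x(1,2) by blast
  then show ?thesis by blast
qed

lemma reps_carrier: "reps \<xi> x N \<Longrightarrow> \<xi> \<in> carrier gr"
proof -
  assume r: "reps \<xi> x N"
  have "{k. \<xi> k \<noteq> F (Suc k)} \<subseteq> {..N}"
  proof
    fix k assume k: "k \<in> {k. \<xi> k \<noteq> F (Suc k)}"
    have "\<xi> k = F (Suc k)" if "N < k"
      using r that coset_zero[of "Suc k"] by (simp add: reps_def)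
    with k show "k \<in> {..N}" by fastforce
  qed
  then have "finite {k. \<xi> k \<noteq> F (Suc k)}" by (rule finite_subset) simp
  then show ?thesis using r by (auto simp: assoc_graded_def reps_def)
qed

lemma reps_closed: "reps \<xi> x N \<Longrightarrow> x k \<in> carrier A"
  unfolding reps_def using F_subset by blast

lemma minus_zero_iff: "a \<in> carrier B \<Longrightarrow> b \<in> carrier B \<Longrightarrow> a \<ominus>\<^bsub>B\<^esub> b = \<zero>\<^bsub>B\<^esub> \<longleftrightarrow> a = b"
  by (metis B.add.inv_closed B.add.inv_equality B.add.inv_inv B.r_neg a_minus_def)

lemma reps_mono: "reps \<xi> x N \<Longrightarrow> N \<le> M \<Longrightarrow> reps \<xi> x M"
  by (auto simp: reps_def)

lemma reps_eq_iff:
  assumes "reps \<xi> x N" "reps \<eta> y M"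
  shows "\<xi> = \<eta> \<longleftrightarrow> (\<forall>k. lam k (x k) = lam k (y k))"
proof -
  have "\<xi> k = \<eta> k \<longleftrightarrow> lam k (x k) = lam k (y k)" for k
  proof -
    have xy: "x k \<in> F k" "y k \<in> F k" using assms by (auto simp: reps_def)
    have "\<xi> k = \<eta> k \<longleftrightarrow> x k \<ominus>\<^bsub>A\<^esub> y k \<in> F (Suc k)"
      using assms coset_eq_iff[OF A.rat_alg_axioms F_ideal F_subset[OF xy(1)] F_subset[OF xy(2)]] by (simp add: reps_def)
    also have "\<dots> \<longleftrightarrow> lam k (x k) \<ominus>\<^bsub>B\<^esub> lam k (y k) = \<zero>\<^bsub>B\<^esub>"
      using xy by (simp add: lam_kernel[symmetric] F_diff lam_diff)
    also have "\<dots> \<longleftrightarrow> lam k (x k) = lam k (y k)"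
      using lam_closed[OF xy(1)] lam_closed[OF xy(2)] minus_zero_iff by simp
    finally show ?thesis .
  qed
  then show ?thesis by (auto simp: fun_eq_iff)
qed

text \<open>The product of cosets in the associated graded algebra is formed modulo \<open>F (Suc k)\<close> for factors that
  are cosets of the larger \<open>F (Suc i)\<close> and \<open>F (Suc (k - i))\<close>; the multiplicativity of the filtration
  makes this independent of representatives.\<close>

lemma rcoset_mult_filtration:
  assumes "x \<in> F i" "y \<in> F j"
  shows "rcoset_mult A (F (Suc (i + j))) (F (Suc i) +>\<^bsub>A\<^esub> x) (F (Suc j) +>\<^bsub>A\<^esub> y) = F (Suc (i + j)) +>\<^bsub>A\<^esub> (x \<otimes>\<^bsub>A\<^esub> y)"
proof -
  have xy: "x \<in> carrier A" "y \<in> carrier A" using assms F_subset by auto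
  have eq: "F (Suc (i + j)) +>\<^bsub>A\<^esub> (a \<otimes>\<^bsub>A\<^esub> b) = F (Suc (i + j)) +>\<^bsub>A\<^esub> (x \<otimes>\<^bsub>A\<^esub> y)"
    if ab: "a \<in> F (Suc i) +>\<^bsub>A\<^esub> x" "b \<in> F (Suc j) +>\<^bsub>A\<^esub> y" for a b
  proof -
    define u v where "u = a \<ominus>\<^bsub>A\<^esub> x" and "v = b \<ominus>\<^bsub>A\<^esub> y"
    have uv: "u \<in> F (Suc i)" "v \<in> F (Suc j)" "a \<in> carrier A" "b \<in> carrier A"
      using ab mem_coset_iff[OF A.rat_alg_axioms F_ideal] xy by (auto simp: u_def v_def)
    then have c: "u \<in> carrier A" "v \<in> carrier A" using F_subset by auto
    have "a \<otimes>\<^bsub>A\<^esub> b \<ominus>\<^bsub>A\<^esub> x \<otimes>\<^bsub>A\<^esub> y = u \<otimes>\<^bsub>A\<^esub> b \<oplus>\<^bsub>A\<^esub> x \<otimes>\<^bsub>A\<^esub> v"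
      unfolding u_def v_def using uv(3,4) xy
      by (simp add: a_minus_def A.l_distr A.r_distr A.l_minus A.r_minus A.a_assoc) (simp add: A.a_assoc[symmetric] A.l_neg)
    moreover have "b \<in> F j"
    proof -
      have "v \<in> F j" using uv(2) F_Suc by blast
      have "b = v \<oplus>\<^bsub>A\<^esub> y" unfolding v_def using uv xy by (simp add: a_minus_def A.a_assoc A.l_neg)
      then show ?thesis using \<open>v \<in> F j\<close> assms F_add by simp
    qed
    ultimately have "a \<otimes>\<^bsub>A\<^esub> b \<ominus>\<^bsub>A\<^esub> x \<otimes>\<^bsub>A\<^esub> y \<in> F (Suc (i + j))"
      using F_mult[OF uv(1), of b j] F_mult[OF assms(1) uv(2)] F_add by simp
    then show ?thesis using coset_eq_iff[OF A.rat_alg_axioms F_ideal] uv xy by simp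
  qed
  have mem: "x \<in> F (Suc i) +>\<^bsub>A\<^esub> x" "y \<in> F (Suc j) +>\<^bsub>A\<^esub> y"
    using mem_coset_iff[OF A.rat_alg_axioms F_ideal] xy by (simp_all add: a_minus_def A.r_neg)
  have "rcoset_mult A (F (Suc (i + j))) (F (Suc i) +>\<^bsub>A\<^esub> x) (F (Suc j) +>\<^bsub>A\<^esub> y)
      = (\<Union>a\<in>F (Suc i) +>\<^bsub>A\<^esub> x. \<Union>b\<in>F (Suc j) +>\<^bsub>A\<^esub> y. F (Suc (i + j)) +>\<^bsub>A\<^esub> (x \<otimes>\<^bsub>A\<^esub> y))"
    unfolding rcoset_mult_def by (intro SUP_cong refl eq)
  also have "\<dots> = F (Suc (i + j)) +>\<^bsub>A\<^esub> (x \<otimes>\<^bsub>A\<^esub> y)" using mem by (metis UN_constant emptyE)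
  finally show ?thesis .
qed

lemma reps_mult:
  assumes \<xi>: "reps \<xi> x N" and \<eta>: "reps \<eta> y M"
  shows "reps (\<xi> \<otimes>\<^bsub>gr\<^esub> \<eta>) (\<lambda>k. \<Oplus>\<^bsub>A\<^esub>i\<in>{..k}. x i \<otimes>\<^bsub>A\<^esub> y (k - i)) (N + M)"
  unfolding reps_def
proof (intro conjI allI impI)
  fix k
  have xy: "x i \<in> F i" "y i \<in> F i" for i using assms by (auto simp: reps_def)
  have t: "x i \<otimes>\<^bsub>A\<^esub> y (k - i) \<in> F k" if "i \<le> k" for i
    using F_mult[OF xy(1)[of i] xy(2)[of "k - i"]] that by simp
  then show "(\<Oplus>\<^bsub>A\<^esub>i\<in>{..k}. x i \<otimes>\<^bsub>A\<^esub> y (k - i)) \<in> F k"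
    by (intro lam_finsum(2)) auto
  have "rcoset_mult A (F (Suc k)) (\<xi> i) (\<eta> (k - i)) = F (Suc k) +>\<^bsub>A\<^esub> (x i \<otimes>\<^bsub>A\<^esub> y (k - i))" if "i \<le> k" for i
    using rcoset_mult_filtration[OF xy(1)[of i] xy(2)[of "k - i"]] that assms by (simp add: reps_def)
  moreover have "comm_group (A A_Mod F (Suc k))"
    by (intro abelian_subgroup.a_factorgroup_is_comm_group abelian_subgroupI3 ideal.axioms(1)[OF F_ideal] A.is_abelian_group)
  moreover have "F (Suc k) +>\<^bsub>A\<^esub> (x i \<otimes>\<^bsub>A\<^esub> y (k - i)) \<in> carrier (A A_Mod F (Suc k))" if "i \<le> k" for i
    using t[OF that] F_subset by (auto simp: A_FactGroup_def' A_RCOSETS_def')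
  ultimately have "(\<xi> \<otimes>\<^bsub>gr\<^esub> \<eta>) k = finprod (A A_Mod F (Suc k)) (\<lambda>i. F (Suc k) +>\<^bsub>A\<^esub> (x i \<otimes>\<^bsub>A\<^esub> y (k - i))) {..k}"
    unfolding assoc_graded_def monoid.simps
    by (intro comm_monoid.finprod_cong') (auto simp: comm_group_def)
  also have "\<dots> = F (Suc k) +>\<^bsub>A\<^esub> (\<Oplus>\<^bsub>A\<^esub>i\<in>{..k}. x i \<otimes>\<^bsub>A\<^esub> y (k - i))"
    using t F_subset by (intro finprod_cosets[OF A.rat_alg_axioms F_ideal]) auto
  finally show "(\<xi> \<otimes>\<^bsub>gr\<^esub> \<eta>) k = F (Suc k) +>\<^bsub>A\<^esub> (\<Oplus>\<^bsub>A\<^esub>i\<in>{..k}. x i \<otimes>\<^bsub>A\<^esub> y (k - i))" .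
  show "(\<Oplus>\<^bsub>A\<^esub>i\<in>{..k}. x i \<otimes>\<^bsub>A\<^esub> y (k - i)) = \<zero>\<^bsub>A\<^esub>" if "N + M < k"
  proof (rule A.add.finprod_one_eqI)
    fix i
    have "x i = \<zero>\<^bsub>A\<^esub> \<or> y (k - i) = \<zero>\<^bsub>A\<^esub>"
      using assms that by (cases "N < i") (auto simp: reps_def)
    then show "x i \<otimes>\<^bsub>A\<^esub> y (k - i) = \<zero>\<^bsub>A\<^esub>" using reps_closed[OF \<xi>] reps_closed[OF \<eta>] by auto
  qed
qed

lemma reps_add:
  assumes \<xi>: "reps \<xi> x N" and \<eta>: "reps \<eta> y N"
  shows "reps (\<xi> \<oplus>\<^bsub>gr\<^esub> \<eta>) (\<lambda>k. x k \<oplus>\<^bsub>A\<^esub> y k) N"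
  using assms ideal.a_rcos_sum[OF F_ideal reps_closed[OF \<xi>] reps_closed[OF \<eta>]]
  by (simp add: reps_def assoc_graded_def F_add)

lemma reps_smult:
  assumes \<xi>: "reps \<xi> x N"
  shows "reps (c \<odot>\<^bsub>gr\<^esub> \<xi>) (\<lambda>k. c \<odot>\<^bsub>A\<^esub> x k) N"
  using assms quot_alg_simps(6)[OF A.rat_alg_axioms F_ideal reps_closed[OF \<xi>]]
  by (simp add: reps_def assoc_graded_def quot_alg_def F_smult)

lemma reps_one: "reps \<one>\<^bsub>gr\<^esub> (\<lambda>k. if k = 0 then \<one>\<^bsub>A\<^esub> else \<zero>\<^bsub>A\<^esub>) 0"
  using coset_zero by (auto simp: reps_def assoc_graded_def F_0)

text \<open>Multiplicativity is the Cauchy product formula, injectivity is the independence of the images together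
  with \<open>lam_kernel\<close>, and surjectivity is that the images span.\<close>

theorem graded_iso:
  assumes \<phi>: "\<And>\<xi> x N. reps \<xi> x N \<Longrightarrow> \<phi> \<xi> = (\<Oplus>\<^bsub>B\<^esub>k\<in>{..N}. lam k (x k))"
  shows "\<phi> \<in> alg_iso gr B" "\<phi> ` assoc_graded_part A F k = lam k ` F k"
proof -
  have lamc: "lam k (x k) \<in> carrier B" if "reps \<xi> x N" for \<xi> x N k
    using that lam_closed by (auto simp: reps_def)
  have hom: "\<phi> \<in> alg_hom gr B"
    unfolding alg_hom_def
  proof (intro CollectI conjI ring_hom_memI allI ballI)
    fix \<xi> assume "\<xi> \<in> carrier gr"
    then obtain x N where x: "reps \<xi> x N" using reps_exist by blast
    show "\<phi> \<xi> \<in> carrier B" unfolding \<phi>[OF x] using lamc[OF x] by (auto intro!: B.finsum_closed)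
    show "\<phi> (c \<odot>\<^bsub>gr\<^esub> \<xi>) = c \<odot>\<^bsub>B\<^esub> \<phi> \<xi>" for c
      unfolding \<phi>[OF x] \<phi>[OF reps_smult[OF x]] using lamc[OF x] x
      by (subst B.smult_finsum) (auto simp: reps_def lam_smult)
  next
    fix \<xi> \<eta> assume "\<xi> \<in> carrier gr" "\<eta> \<in> carrier gr"
    then obtain x N y M where xy: "reps \<xi> x N" "reps \<eta> y M" using reps_exist by blast
    have xyF: "x k \<in> F k" "y k \<in> F k" for k using xy by (auto simp: reps_def)
    have "\<phi> (\<xi> \<otimes>\<^bsub>gr\<^esub> \<eta>) = (\<Oplus>\<^bsub>B\<^esub>k\<in>{..N + M}. \<Oplus>\<^bsub>B\<^esub>i\<in>{..k}. lam i (x i) \<otimes>\<^bsub>B\<^esub> lam (k - i) (y (k - i)))"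
      unfolding \<phi>[OF reps_mult[OF xy]]
    proof (rule B.finsum_cong'[OF refl])
      fix k
      have "lam k (\<Oplus>\<^bsub>A\<^esub>i\<in>{..k}. x i \<otimes>\<^bsub>A\<^esub> y (k - i)) = (\<Oplus>\<^bsub>B\<^esub>i\<in>{..k}. lam k (x i \<otimes>\<^bsub>A\<^esub> y (k - i)))"
        using F_mult[OF xyF] by (intro lam_finsum(1)) (simp, metis F_mult xyF atMost_iff le_add_diff_inverse)
      also have "\<dots> = (\<Oplus>\<^bsub>B\<^esub>i\<in>{..k}. lam i (x i) \<otimes>\<^bsub>B\<^esub> lam (k - i) (y (k - i)))"
        using lam_mult[OF xyF(1) xyF(2)] lamc[OF xy(1)] lamc[OF xy(2)]
        by (intro B.finsum_cong') (auto, metis le_add_diff_inverse)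
      finally show "lam k (\<Oplus>\<^bsub>A\<^esub>i\<in>{..k}. x i \<otimes>\<^bsub>A\<^esub> y (k - i))
          = (\<Oplus>\<^bsub>B\<^esub>i\<in>{..k}. lam i (x i) \<otimes>\<^bsub>B\<^esub> lam (k - i) (y (k - i)))" .
    qed (use lamc[OF xy(1)] lamc[OF xy(2)] in \<open>auto intro!: B.finsum_closed\<close>)
    also have "\<dots> = \<phi> \<xi> \<otimes>\<^bsub>B\<^esub> \<phi> \<eta>"
      unfolding \<phi>[OF xy(1)] \<phi>[OF xy(2)] using lamc[OF xy(1)] lamc[OF xy(2)] xy
      by (intro B.cauchy_product) (auto simp: reps_def)
    finally show "\<phi> (\<xi> \<otimes>\<^bsub>gr\<^esub> \<eta>) = \<phi> \<xi> \<otimes>\<^bsub>B\<^esub> \<phi> \<eta>" .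
    have xy': "reps \<xi> x (max N M)" "reps \<eta> y (max N M)" using xy by (auto intro: reps_mono)
    show "\<phi> (\<xi> \<oplus>\<^bsub>gr\<^esub> \<eta>) = \<phi> \<xi> \<oplus>\<^bsub>B\<^esub> \<phi> \<eta>"
      unfolding \<phi>[OF xy'(1)] \<phi>[OF xy'(2)] \<phi>[OF reps_add[OF xy']]
      using lamc[OF xy(1)] lamc[OF xy(2)] xyF by (subst B.finsum_addf[symmetric]) (auto simp: lam_add)
  next
    show "\<phi> \<one>\<^bsub>gr\<^esub> = \<one>\<^bsub>B\<^esub>" unfolding \<phi>[OF reps_one] by (simp add: lam_one)
  qed
  have inj: "inj_on \<phi> (carrier gr)"
  proof (rule inj_onI)
    fix \<xi> \<eta> assume "\<xi> \<in> carrier gr" "\<eta> \<in> carrier gr" and eq: "\<phi> \<xi> = \<phi> \<eta>"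
    then obtain x N y M where "reps \<xi> x N" "reps \<eta> y M" using reps_exist by blast
    then have xy: "reps \<xi> x (max N M)" "reps \<eta> y (max N M)" by (auto intro: reps_mono)
    let ?K = "max N M"
    have xyF: "x k \<in> F k" "y k \<in> F k" for k using xy by (auto simp: reps_def)
    let ?d = "\<lambda>k. x k \<ominus>\<^bsub>A\<^esub> y k"
    have dF: "?d k \<in> F k" for k using xyF F_diff by simp
    have "(\<Oplus>\<^bsub>B\<^esub>k\<in>{..?K}. lam k (?d k)) \<oplus>\<^bsub>B\<^esub> \<phi> \<eta> = (\<Oplus>\<^bsub>B\<^esub>k\<in>{..?K}. lam k (?d k) \<oplus>\<^bsub>B\<^esub> lam k (y k))"
      unfolding \<phi>[OF xy(2)] using dF lam_closed xyF by (intro B.finsum_addf[symmetric]) auto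
    also have "\<dots> = \<phi> \<xi>"
      unfolding \<phi>[OF xy(1)]
    proof (rule B.finsum_cong'[OF refl])
      fix k
      have "lam k (?d k) \<oplus>\<^bsub>B\<^esub> lam k (y k) = lam k (?d k \<oplus>\<^bsub>A\<^esub> y k)" by (rule lam_add[OF dF xyF(2), symmetric])
      also have "?d k \<oplus>\<^bsub>A\<^esub> y k = x k"
        using reps_closed[OF xy(1)] reps_closed[OF xy(2)] by (simp add: a_minus_def A.a_assoc A.l_neg)
      finally show "lam k (?d k) \<oplus>\<^bsub>B\<^esub> lam k (y k) = lam k (x k)" .
    qed (use lam_closed xyF in auto)
    finally have "(\<Oplus>\<^bsub>B\<^esub>k\<in>{..?K}. lam k (?d k)) \<oplus>\<^bsub>B\<^esub> \<phi> \<eta> = \<phi> \<eta>" using eq by simp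
    moreover have "(\<Oplus>\<^bsub>B\<^esub>k\<in>{..?K}. lam k (?d k)) \<in> carrier B" using dF lam_closed by (auto intro!: B.finsum_closed)
    moreover have "\<phi> \<eta> \<in> carrier B" unfolding \<phi>[OF xy(2)] using lamc[OF xy(2)] by (auto intro!: B.finsum_closed)
    ultimately have "(\<Oplus>\<^bsub>B\<^esub>k\<in>{..?K}. lam k (?d k)) = \<zero>\<^bsub>B\<^esub>" by simp
    then have d0: "lam k (?d k) = \<zero>\<^bsub>B\<^esub>" if "k \<le> ?K" for k using lam_direct[of ?d, OF dF] that by blast
    have "lam k (x k) = lam k (y k)" for k
    proof (cases "k \<le> ?K")
      case True
      then have "lam k (x k) \<ominus>\<^bsub>B\<^esub> lam k (y k) = \<zero>\<^bsub>B\<^esub>" using d0 xyF lam_diff by simp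
      then show ?thesis using lamc[OF xy(1)] lamc[OF xy(2)] minus_zero_iff by simp
    next
      case False
      then have "max N M < k" by (simp only: not_le)
      then have "x k = \<zero>\<^bsub>A\<^esub>" "y k = \<zero>\<^bsub>A\<^esub>" using xy unfolding reps_def by blast+
      then show ?thesis by simp
    qed
    then show "\<xi> = \<eta>" using reps_eq_iff[OF xy] by blast
  qed
  have surj: "carrier B \<subseteq> \<phi> ` carrier gr"
  proof
    fix b assume "b \<in> carrier B"
    then obtain N :: nat and x where x: "\<And>k. x k \<in> F k" "b = (\<Oplus>\<^bsub>B\<^esub>k\<in>{..N}. lam k (x k))"
      using lam_span by blast
    let ?x = "\<lambda>k. if k \<le> N then x k else \<zero>\<^bsub>A\<^esub>"
    have r: "reps (\<lambda>k. F (Suc k) +>\<^bsub>A\<^esub> ?x k) ?x N" using x by (auto simp: reps_def)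
    have "\<phi> (\<lambda>k. F (Suc k) +>\<^bsub>A\<^esub> ?x k) = b"
      unfolding \<phi>[OF r] x(2) using x lam_closed by (intro B.finsum_cong') auto
    then show "b \<in> \<phi> ` carrier gr" using reps_carrier[OF r] by blast
  qed
  have "\<phi> \<in> carrier gr \<rightarrow> carrier B" using hom by (auto simp: alg_hom_def ring_hom_def)
  then show "\<phi> \<in> alg_iso gr B"
    using hom inj surj by (auto simp: alg_iso_def bij_betw_def)
  show "\<phi> ` assoc_graded_part A F k = lam k ` F k"
  proof (intro equalityI subsetI)
    fix b assume "b \<in> \<phi> ` assoc_graded_part A F k"
    then obtain \<xi> where \<xi>: "\<xi> \<in> carrier gr" "\<And>m. m \<noteq> k \<Longrightarrow> \<xi> m = F (Suc m)" "b = \<phi> \<xi>"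
      by (auto simp: assoc_graded_part_def)
    then obtain x N where x: "reps \<xi> x N" using reps_exist by blast
    let ?N = "max N k"
    have x': "reps \<xi> x ?N" using x by (rule reps_mono) simp
    have "lam m (x m) = \<zero>\<^bsub>B\<^esub>" if "m \<noteq> k" for m
    proof -
      have m: "x m \<in> F m" "F (Suc m) = F (Suc m) +>\<^bsub>A\<^esub> x m" using x \<xi>(2)[OF that] by (auto simp: reps_def)
      then have "x m \<in> F (Suc m)" using coset_eq_self_iff[OF A.rat_alg_axioms F_ideal F_subset] by metis
      then show ?thesis using lam_kernel[OF m(1)] by simp
    qed
    then have "b = (\<Oplus>\<^bsub>B\<^esub>m\<in>{k}. lam m (x m))"
      unfolding \<xi>(3) \<phi>[OF x'] using lamc[OF x] by (intro B.add.finprod_mono_neutral_cong_right) auto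
    then have "b = lam k (x k)" using lamc[OF x] by simp
    then show "b \<in> lam k ` F k" using x by (auto simp: reps_def)
  next
    fix b assume "b \<in> lam k ` F k"
    then obtain y where y: "y \<in> F k" "b = lam k y" by blast
    let ?x = "\<lambda>m. if m = k then y else \<zero>\<^bsub>A\<^esub>"
    have r: "reps (\<lambda>m. F (Suc m) +>\<^bsub>A\<^esub> ?x m) ?x k" using y by (auto simp: reps_def)
    have "\<phi> (\<lambda>m. F (Suc m) +>\<^bsub>A\<^esub> ?x m) = (\<Oplus>\<^bsub>B\<^esub>m\<in>{k}. lam m (?x m))"
      unfolding \<phi>[OF r] using lamc[OF r] by (intro B.add.finprod_mono_neutral_cong_right) auto
    also have "\<dots> = b" using y lam_closed by simp
    finally have "\<phi> (\<lambda>m. F (Suc m) +>\<^bsub>A\<^esub> ?x m) = b" .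
    moreover have "(\<lambda>m. F (Suc m) +>\<^bsub>A\<^esub> ?x m) \<in> assoc_graded_part A F k"
      using reps_carrier[OF r] coset_zero by (auto simp: assoc_graded_part_def)
    ultimately show "b \<in> \<phi> ` assoc_graded_part A F k" by blast
  qed
qed

end

section \<open>Noncommutative power series\<close>

lemma series_carrier: "f \<in> carrier (series_alg n) \<longleftrightarrow> (\<forall>w. f w \<noteq> 0 \<longrightarrow> set w \<subseteq> indices n)"
  by (simp add: series_alg_def)

lemma free_carrier: "f \<in> carrier (free_alg n) \<longleftrightarrow> f \<in> carrier (series_alg n) \<and> finite {w. f w \<noteq> 0}"
  by (simp add: free_alg_def)

lemma free_ops [simp]:
  "f \<oplus>\<^bsub>free_alg n\<^esub> g = f \<oplus>\<^bsub>series_alg n\<^esub> g" "f \<otimes>\<^bsub>free_alg n\<^esub> g = f \<otimes>\<^bsub>series_alg n\<^esub> g"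
  "\<zero>\<^bsub>free_alg n\<^esub> = \<zero>\<^bsub>series_alg n\<^esub>" "\<one>\<^bsub>free_alg n\<^esub> = \<one>\<^bsub>series_alg n\<^esub>"
  "c \<odot>\<^bsub>free_alg n\<^esub> f = c \<odot>\<^bsub>series_alg n\<^esub> f"
  by (simp_all add: free_alg_def)

lemma series_ops:
  "(f \<oplus>\<^bsub>series_alg n\<^esub> g) w = f w + g w" "\<zero>\<^bsub>series_alg n\<^esub> w = 0" "(c \<odot>\<^bsub>series_alg n\<^esub> f) w = c * f w"
  "(f \<otimes>\<^bsub>series_alg n\<^esub> g) w = (\<Sum>k\<le>length w. f (take k w) * g (drop k w))"
  "\<one>\<^bsub>series_alg n\<^esub> w = (if w = [] then 1 else 0)"
  by (simp_all add: series_alg_def)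

lemma rat_alg_series: "rat_alg (series_alg n)"
proof (rule rat_algI)
  let ?S = "series_alg n"
  show "f \<oplus>\<^bsub>?S\<^esub> g \<in> carrier ?S" if "f \<in> carrier ?S" "g \<in> carrier ?S" for f g
  proof -
    have "f w \<noteq> 0 \<or> g w \<noteq> 0" if "f w + g w \<noteq> 0" for w using that by auto
    then show ?thesis using that unfolding series_carrier series_ops by blast
  qed
  show "f \<otimes>\<^bsub>?S\<^esub> g \<in> carrier ?S" if "f \<in> carrier ?S" "g \<in> carrier ?S" for f g
    unfolding series_carrier
  proof (intro allI impI)
    fix w assume "(f \<otimes>\<^bsub>?S\<^esub> g) w \<noteq> 0"
    then obtain k where "f (take k w) * g (drop k w) \<noteq> 0"
      unfolding series_ops by (meson sum.neutral)
    then have "set (take k w) \<subseteq> indices n" "set (drop k w) \<subseteq> indices n"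
      using that by (auto simp: series_carrier)
    then show "set w \<subseteq> indices n"
      by (metis append_take_drop_id le_sup_iff set_append)
  qed
  show "(f \<otimes>\<^bsub>?S\<^esub> g) \<otimes>\<^bsub>?S\<^esub> h = f \<otimes>\<^bsub>?S\<^esub> (g \<otimes>\<^bsub>?S\<^esub> h)" for f g h
  proof
    fix w :: "(nat \<times> nat) list"
    let ?N = "length w"
    define G where "G i l = f (take i w) * g (take l (drop i w)) * h (drop (i + l) w)" for i l
    have "((f \<otimes>\<^bsub>?S\<^esub> g) \<otimes>\<^bsub>?S\<^esub> h) w = (\<Sum>j\<le>?N. \<Sum>i\<le>j. G i (j - i))"
      unfolding series_ops
      by (intro sum.cong refl) (auto simp: sum_distrib_right G_def drop_take min_def intro!: sum.cong)
    also have "\<dots> = (\<Sum>(i, l)\<in>{(i, l). i + l \<le> ?N}. G i l)"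
      by (rule sum.triangle_reindex_eq[symmetric])
    also have "{(i, l). i + l \<le> ?N} = (SIGMA i:{..?N}. {..?N - i})" by auto
    also have "(\<Sum>(i, l)\<in>(SIGMA i:{..?N}. {..?N - i}). G i l) = (\<Sum>i\<le>?N. \<Sum>l\<le>?N - i. G i l)"
      by (rule sum.Sigma[symmetric]) auto
    also have "\<dots> = (f \<otimes>\<^bsub>?S\<^esub> (g \<otimes>\<^bsub>?S\<^esub> h)) w"
      unfolding series_ops
      by (intro sum.cong refl) (auto simp: sum_distrib_left G_def mult.assoc add.commute intro!: sum.cong)
    finally show "((f \<otimes>\<^bsub>?S\<^esub> g) \<otimes>\<^bsub>?S\<^esub> h) w = (f \<otimes>\<^bsub>?S\<^esub> (g \<otimes>\<^bsub>?S\<^esub> h)) w" .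
  qed
  show "\<one>\<^bsub>?S\<^esub> \<otimes>\<^bsub>?S\<^esub> f = f" "f \<otimes>\<^bsub>?S\<^esub> \<one>\<^bsub>?S\<^esub> = f" for f
  proof -
    have "(\<Sum>k\<le>length w. (if take k w = [] then 1 else 0) * f (drop k w)) = (\<Sum>k\<in>{0}. f (drop k w))" for w
      by (rule sum.mono_neutral_cong_right) auto
    moreover have "(\<Sum>k\<le>length w. f (take k w) * (if drop k w = [] then 1 else 0)) = (\<Sum>k\<in>{length w}. f (take k w))" for w
      by (rule sum.mono_neutral_cong_right) auto
    ultimately show "\<one>\<^bsub>?S\<^esub> \<otimes>\<^bsub>?S\<^esub> f = f" "f \<otimes>\<^bsub>?S\<^esub> \<one>\<^bsub>?S\<^esub> = f"
      by (auto simp: series_ops fun_eq_iff)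
  qed
qed (auto simp: series_ops fun_eq_iff series_carrier algebra_simps sum.distrib sum_distrib_left)

interpretation S: rat_alg "series_alg n" for n by (rule rat_alg_series)

lemma S_minus_apply: "f \<in> carrier (series_alg n) \<Longrightarrow> (\<ominus>\<^bsub>series_alg n\<^esub> f) w = - f w"
proof -
  assume f: "f \<in> carrier (series_alg n)"
  have "(f \<oplus>\<^bsub>series_alg n\<^esub> \<ominus>\<^bsub>series_alg n\<^esub> f) w = 0" using f by (simp add: S.r_neg series_ops)
  then show ?thesis by (simp add: series_ops)
qed

lemma S_diff_apply: "g \<in> carrier (series_alg n) \<Longrightarrow> (f \<ominus>\<^bsub>series_alg n\<^esub> g) w = f w - g w"
  by (simp add: a_minus_def series_ops S_minus_apply)

lemma S_finsum_apply:
  "finite T \<Longrightarrow> (\<And>i. i \<in> T \<Longrightarrow> f i \<in> carrier (series_alg n)) \<Longrightarrow> (\<Oplus>\<^bsub>series_alg n\<^esub>i\<in>T. f i) w = (\<Sum>i\<in>T. f i w)"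
proof (induction T rule: finite_induct)
  case (insert i T)
  then have "f \<in> T \<rightarrow> carrier (series_alg n)" by auto
  then show ?case using insert by (simp add: series_ops)
qed (simp add: series_ops)

lemma rat_alg_free: "rat_alg (free_alg n)"
proof (rule rat_algI)
  let ?S = "series_alg n"
  show "f \<oplus>\<^bsub>free_alg n\<^esub> g \<in> carrier (free_alg n)" if "f \<in> carrier (free_alg n)" "g \<in> carrier (free_alg n)" for f g
  proof -
    have "{w. f w + g w \<noteq> 0} \<subseteq> {w. f w \<noteq> 0} \<union> {w. g w \<noteq> 0}" by auto
    from finite_subset[OF this] show ?thesis using that by (auto simp: free_carrier series_ops)
  qed
  show "f \<otimes>\<^bsub>free_alg n\<^esub> g \<in> carrier (free_alg n)" if "f \<in> carrier (free_alg n)" "g \<in> carrier (free_alg n)" for f g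
  proof -
    have "{w. (f \<otimes>\<^bsub>?S\<^esub> g) w \<noteq> 0} \<subseteq> (\<lambda>(u, v). u @ v) ` ({w. f w \<noteq> 0} \<times> {w. g w \<noteq> 0})"
    proof
      fix w assume "w \<in> {w. (f \<otimes>\<^bsub>?S\<^esub> g) w \<noteq> 0}"
      then obtain k where "f (take k w) * g (drop k w) \<noteq> 0"
        unfolding series_ops by (metis (mono_tags, lifting) mem_Collect_eq sum.neutral)
      then show "w \<in> (\<lambda>(u, v). u @ v) ` ({w. f w \<noteq> 0} \<times> {w. g w \<noteq> 0})"
        by (intro image_eqI[of _ _ "(take k w, drop k w)"]) auto
    qed
    from finite_subset[OF this] show ?thesis using that by (auto simp: free_carrier)
  qed
  show "c \<odot>\<^bsub>free_alg n\<^esub> f \<in> carrier (free_alg n)" if "f \<in> carrier (free_alg n)" for c f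
    using that by (auto simp: free_carrier series_ops)
qed (auto simp: free_carrier series_ops S.a_ac S.m_assoc S.l_distr S.r_distr S.smult_l_distr
    S.smult_r_distr S.smult_smult S.smult_mult_left S.smult_mult_right)

interpretation Fr: rat_alg "free_alg n" for n by (rule rat_alg_free)

lemma free_in_series: "f \<in> carrier (free_alg n) \<Longrightarrow> f \<in> carrier (series_alg n)"
  by (simp add: free_carrier)

lemma free_minus: "f \<in> carrier (free_alg n) \<Longrightarrow> \<ominus>\<^bsub>free_alg n\<^esub> f = \<ominus>\<^bsub>series_alg n\<^esub> f"
  by (metis Fr.l_neg Fr.a_inv_closed S.minus_equality free_in_series free_ops(1,3))

lemma free_diff: "g \<in> carrier (free_alg n) \<Longrightarrow> f \<ominus>\<^bsub>free_alg n\<^esub> g = f \<ominus>\<^bsub>series_alg n\<^esub> g"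
  by (simp add: a_minus_def free_minus)

lemma free_finsum:
  "finite T \<Longrightarrow> (\<And>i. i \<in> T \<Longrightarrow> f i \<in> carrier (free_alg n)) \<Longrightarrow> (\<Oplus>\<^bsub>free_alg n\<^esub>i\<in>T. f i) = (\<Oplus>\<^bsub>series_alg n\<^esub>i\<in>T. f i)"
proof (induction T rule: finite_induct)
  case (insert i T)
  then have "f \<in> T \<rightarrow> carrier (free_alg n)" "f \<in> T \<rightarrow> carrier (series_alg n)" by (auto simp: free_carrier)
  then show ?case using insert by (simp add: free_in_series)
qed simp

subsection \<open>Homogeneous components\<close>

lemma finite_indices: "finite (indices n)"
  by (rule finite_subset[of _ "{1..n} \<times> {1..n}"]) (auto simp: indices_def)

lemma comp_in_free: "f \<in> carrier (series_alg n) \<Longrightarrow> series_comp k f \<in> carrier (free_alg n)"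
proof -
  assume f: "f \<in> carrier (series_alg n)"
  have "{w. series_comp k f w \<noteq> 0} \<subseteq> {w. set w \<subseteq> indices n \<and> length w = k}"
    using f by (auto simp: series_comp_def series_carrier split: if_splits)
  from finite_subset[OF this finite_lists_length_eq[OF finite_indices]]
  show ?thesis using f by (auto simp: free_carrier series_carrier series_comp_def)
qed

lemma comp_in_series: "f \<in> carrier (series_alg n) \<Longrightarrow> series_comp k f \<in> carrier (series_alg n)"
  using comp_in_free by (simp add: free_carrier)

lemma comp_add: "series_comp k (f \<oplus>\<^bsub>series_alg n\<^esub> g) = series_comp k f \<oplus>\<^bsub>series_alg n\<^esub> series_comp k g"
  by (auto simp: series_comp_def series_ops)

lemma comp_smult: "series_comp k (c \<odot>\<^bsub>series_alg n\<^esub> f) = c \<odot>\<^bsub>series_alg n\<^esub> series_comp k f"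
  by (auto simp: series_comp_def series_ops)

lemma comp_zero [simp]: "series_comp k \<zero>\<^bsub>series_alg n\<^esub> = \<zero>\<^bsub>series_alg n\<^esub>"
  by (auto simp: series_comp_def series_ops)

lemma comp_mult:
  assumes "f \<in> carrier (series_alg n)" "g \<in> carrier (series_alg n)"
  shows "series_comp k (f \<otimes>\<^bsub>series_alg n\<^esub> g)
    = (\<Oplus>\<^bsub>free_alg n\<^esub>i\<in>{..k}. series_comp i f \<otimes>\<^bsub>free_alg n\<^esub> series_comp (k - i) g)"
proof
  fix w
  have c: "series_comp i f \<otimes>\<^bsub>free_alg n\<^esub> series_comp (k - i) g \<in> carrier (free_alg n)" for i
    using assms by (intro Fr.m_closed comp_in_free)
  have t: "(series_comp i f \<otimes>\<^bsub>series_alg n\<^esub> series_comp (k - i) g) w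
      = (if length w = k then f (take i w) * g (drop i w) else 0)" if "i \<le> k" for i
  proof -
    have "(series_comp i f \<otimes>\<^bsub>series_alg n\<^esub> series_comp (k - i) g) w
        = (\<Sum>j\<le>length w. if j = i then (if length w = k then f (take i w) * g (drop i w) else 0) else 0)"
      unfolding series_ops series_comp_def using that by (intro sum.cong) auto
    also have "\<dots> = (if length w = k then f (take i w) * g (drop i w) else 0)"
      using that by (subst sum.delta) auto
    finally show ?thesis .
  qed
  have "(\<Oplus>\<^bsub>free_alg n\<^esub>i\<in>{..k}. series_comp i f \<otimes>\<^bsub>free_alg n\<^esub> series_comp (k - i) g) w
      = (\<Sum>i\<le>k. (series_comp i f \<otimes>\<^bsub>series_alg n\<^esub> series_comp (k - i) g) w)"
    using c by (subst free_finsum) (auto simp: S_finsum_apply free_in_series)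
  also have "\<dots> = (\<Sum>i\<le>k. if length w = k then f (take i w) * g (drop i w) else 0)"
    using t by (intro sum.cong) auto
  also have "\<dots> = series_comp k (f \<otimes>\<^bsub>series_alg n\<^esub> g) w"
    by (auto simp: series_comp_def series_ops)
  finally show "series_comp k (f \<otimes>\<^bsub>series_alg n\<^esub> g) w
      = (\<Oplus>\<^bsub>free_alg n\<^esub>i\<in>{..k}. series_comp i f \<otimes>\<^bsub>free_alg n\<^esub> series_comp (k - i) g) w" by simp
qed

text \<open>Only the splitting of a word at position \<open>i\<close> contributes: every other one makes a factor too short.\<close>

lemma comp_mult_filt:
  assumes "f \<in> series_filt n i" "g \<in> series_filt n j"
  shows "series_comp (i + j) (f \<otimes>\<^bsub>series_alg n\<^esub> g) = series_comp i f \<otimes>\<^bsub>series_alg n\<^esub> series_comp j g"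
proof
  fix w
  have "(\<Sum>k\<le>length w. f (take k w) * g (drop k w)) = f (take i w) * g (drop i w)" if w: "length w = i + j"
  proof -
    have "(\<Sum>k\<le>length w. f (take k w) * g (drop k w)) = (\<Sum>k\<in>{i}. f (take k w) * g (drop k w))"
    proof (rule sum.mono_neutral_right)
      show "\<forall>k\<in>{..length w} - {i}. f (take k w) * g (drop k w) = 0"
      proof
        fix k assume "k \<in> {..length w} - {i}"
        then have "length (take k w) < i \<or> length (drop k w) < j" using w by auto
        then show "f (take k w) * g (drop k w) = 0" using assms by (auto simp: series_filt_def)
      qed
    qed (use w in auto)
    then show ?thesis by simp
  qed
  moreover have "(\<Sum>k\<le>length w. series_comp i f (take k w) * series_comp j g (drop k w))
      = (if length w = i + j then f (take i w) * g (drop i w) else 0)"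
  proof -
    have "(\<Sum>k\<le>length w. series_comp i f (take k w) * series_comp j g (drop k w))
        = (\<Sum>k\<le>length w. if k = i then (if length w = i + j then f (take i w) * g (drop i w) else 0) else 0)"
      by (intro sum.cong) (auto simp: series_comp_def)
    then show ?thesis by (simp add: sum.delta)
  qed
  ultimately show "series_comp (i + j) (f \<otimes>\<^bsub>series_alg n\<^esub> g) w = (series_comp i f \<otimes>\<^bsub>series_alg n\<^esub> series_comp j g) w"
    by (simp add: series_comp_def[of "i + j"] series_ops)
qed

lemma filt_mult:
  assumes "f \<in> series_filt n i" "g \<in> series_filt n j"
  shows "f \<otimes>\<^bsub>series_alg n\<^esub> g \<in> series_filt n (i + j)"
proof -
  have "f (take k w) * g (drop k w) = 0" if "length w < i + j" for k w
  proof -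
    have "length (take k w) < i \<or> length (drop k w) < j" using that by auto
    then show ?thesis using assms by (auto simp: series_filt_def)
  qed
  then have "(f \<otimes>\<^bsub>series_alg n\<^esub> g) w = 0" if "length w < i + j" for w
    using that unfolding series_ops by (intro sum.neutral) blast
  then show ?thesis using assms by (simp add: series_filt_def)
qed

lemma filt_0: "series_filt n 0 = carrier (series_alg n)"
  by (simp add: series_filt_def)

lemma filt_Suc: "series_filt n (Suc k) \<subseteq> series_filt n k"
  by (auto simp: series_filt_def)

lemma filt_carrier: "f \<in> series_filt n k \<Longrightarrow> f \<in> carrier (series_alg n)"
  by (simp add: series_filt_def)

lemma filt_ops:
  "f \<in> series_filt n k \<Longrightarrow> g \<in> series_filt n k \<Longrightarrow> f \<oplus>\<^bsub>series_alg n\<^esub> g \<in> series_filt n k"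
  "f \<in> series_filt n k \<Longrightarrow> c \<odot>\<^bsub>series_alg n\<^esub> f \<in> series_filt n k"
  "\<zero>\<^bsub>series_alg n\<^esub> \<in> series_filt n k"
  "f \<in> series_filt n k \<Longrightarrow> g \<in> series_filt n k \<Longrightarrow> f \<ominus>\<^bsub>series_alg n\<^esub> g \<in> series_filt n k"
  by (auto simp: series_filt_def series_ops S_diff_apply)

lemma filt_Suc_iff: "f \<in> series_filt n k \<Longrightarrow> f \<ominus>\<^bsub>series_alg n\<^esub> series_comp k f \<in> series_filt n (Suc k)"
  using comp_in_series[of f n k]
  by (auto simp: series_filt_def S_diff_apply series_comp_def less_Suc_eq)

text \<open>With \<open>T = UNIV\<close> this is the closed ideal, and with \<open>T = {..K}\<close> its truncation at degree \<open>K\<close>.\<close>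

definition comps_in :: "nat \<Rightarrow> nat set \<Rightarrow> series set \<Rightarrow> series set" where
  "comps_in n T D = {f \<in> carrier (series_alg n). \<forall>k\<in>T. series_comp k f \<in> D}"

lemma ideal_finsum:
  assumes "ring R" "ideal D R" "finite T" "\<And>i. i \<in> T \<Longrightarrow> f i \<in> D"
  shows "finsum R f T \<in> D"
proof -
  interpret ring R by fact
  interpret ideal D R by fact
  show ?thesis using assms(3,4)
  proof (induction T rule: finite_induct)
    case (insert i T)
    then have "f \<in> T \<rightarrow> carrier R" "f i \<in> carrier R" by (auto intro: Icarr)
    then show ?case using insert by simp
  qed simp
qed

lemma comps_in_ideal:
  assumes D: "ideal D (free_alg n)" and T: "\<And>j k. k \<in> T \<Longrightarrow> j \<le> k \<Longrightarrow> j \<in> T"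
  shows "ideal (comps_in n T D) (series_alg n)"
proof (rule idealI)
  interpret D: ideal D "free_alg n" by fact
  show "ring (series_alg n)" by unfold_locales
  show "subgroup (comps_in n T D) (add_monoid (series_alg n))"
  proof (rule S.add.subgroupI, goal_cases)
    case 2
    have "\<zero>\<^bsub>series_alg n\<^esub> \<in> comps_in n T D" using D.zero_closed by (simp add: comps_in_def)
    then show ?case by blast
  next
    case (3 f)
    have "series_comp k (\<ominus>\<^bsub>series_alg n\<^esub> f) = \<ominus>\<^bsub>free_alg n\<^esub> series_comp k f" for k
      using 3 comp_in_series[of f n k] comp_in_free[of f n k]
      by (auto simp: comps_in_def free_minus S_minus_apply series_comp_def fun_eq_iff)
    then show ?case using 3 by (auto simp: comps_in_def)
  next
    case (4 f g)
    then show ?case using D.a_closed by (auto simp: comps_in_def comp_add)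
  qed (auto simp: comps_in_def)
  fix f x assume f: "f \<in> comps_in n T D" and x: "x \<in> carrier (series_alg n)"
  have fc: "f \<in> carrier (series_alg n)" using f by (simp add: comps_in_def)
  have "series_comp k (x \<otimes>\<^bsub>series_alg n\<^esub> f) \<in> D" if "k \<in> T" for k
    unfolding comp_mult[OF x fc]
    by (rule ideal_finsum[OF Fr.ring_axioms D])
       (use f T[OF that] in \<open>auto intro!: D.I_l_closed[unfolded free_ops] comp_in_free x simp: comps_in_def\<close>)
  then show "x \<otimes>\<^bsub>series_alg n\<^esub> f \<in> comps_in n T D" using x fc by (simp add: comps_in_def)
  have "series_comp k (f \<otimes>\<^bsub>series_alg n\<^esub> x) \<in> D" if "k \<in> T" for k
    unfolding comp_mult[OF fc x]
    by (rule ideal_finsum[OF Fr.ring_axioms D])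
       (use f T[OF that] in \<open>auto intro!: D.I_r_closed[unfolded free_ops] comp_in_free x simp: comps_in_def\<close>)
  then show "f \<otimes>\<^bsub>series_alg n\<^esub> x \<in> comps_in n T D" using x fc by (simp add: comps_in_def)
qed

subsection \<open>The relations\<close>

lemma var_free: "(i, j) \<in> indices n \<Longrightarrow> series_var i j \<in> carrier (free_alg n)"
  by (auto simp: free_carrier series_carrier series_var_def)

lemma var_series: "(i, j) \<in> indices n \<Longrightarrow> series_var i j \<in> carrier (series_alg n)"
  by (rule free_in_series[OF var_free])

lemma comm_free:
  assumes "f \<in> carrier (free_alg n)" "g \<in> carrier (free_alg n)"
  shows "commutator (free_alg n) f g = commutator (series_alg n) f g"
  using assms Fr.m_closed[OF assms(2,1)] by (simp add: commutator_def free_diff)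

lemma relators_cases:
  assumes "r \<in> relators n A"
  obtains (same) i j k where "{i, j, k} \<subseteq> {1..n}" "distinct [i, j, k]"
      "r = commutator A (series_var i k) (series_var j k)"
    | (triple) i j k where "{i, j, k} \<subseteq> {1..n}" "distinct [i, j, k]"
      "r = commutator A (series_var i j) (series_var i k \<oplus>\<^bsub>A\<^esub> series_var j k)"
    | (disjoint) i j k l where "{i, j, k, l} \<subseteq> {1..n}" "distinct [i, j, k, l]"
      "r = commutator A (series_var i j) (series_var k l)"
  using assms unfolding relators_def Un_iff mem_Collect_eq
  by (elim disjE exE conjE) (erule (2) that(1), erule (2) that(2), erule (2) that(3))

lemma relatorsI:
  "{i, j, k} \<subseteq> {1..n} \<Longrightarrow> distinct [i, j, k] \<Longrightarrow> commutator A (series_var i k) (series_var j k) \<in> relators n A"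
  "{i, j, k} \<subseteq> {1..n} \<Longrightarrow> distinct [i, j, k] \<Longrightarrow>
    commutator A (series_var i j) (series_var i k \<oplus>\<^bsub>A\<^esub> series_var j k) \<in> relators n A"
  "{i, j, k, l} \<subseteq> {1..n} \<Longrightarrow> distinct [i, j, k, l] \<Longrightarrow> commutator A (series_var i j) (series_var k l) \<in> relators n A"
  unfolding relators_def
    apply (rule UnI1, rule UnI1, rule CollectI, intro exI conjI, rule refl, assumption+)
   apply (rule UnI1, rule UnI2, rule CollectI, intro exI conjI, rule refl, assumption+)
  apply (rule UnI2, rule CollectI, intro exI conjI, rule refl, assumption+)
  done

lemma relators_form:
  assumes "r \<in> relators n (series_alg n)"
  obtains f g where "f \<in> carrier (free_alg n)" "g \<in> carrier (free_alg n)"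
    "\<And>w. length w \<noteq> 1 \<Longrightarrow> f w = 0" "\<And>w. length w \<noteq> 1 \<Longrightarrow> g w = 0"
    "r = commutator (series_alg n) f g" "r = commutator (free_alg n) f g" "r \<in> relators n (free_alg n)"
  using assms
proof (cases rule: relators_cases)
  case (same i j k)
  then have c: "series_var i k \<in> carrier (free_alg n)" "series_var j k \<in> carrier (free_alg n)"
    by (auto intro!: var_free simp: indices_def)
  show ?thesis
    by (rule that[OF c]) (use same c relatorsI(1)[OF same(1,2), of "free_alg n"] in \<open>auto simp: comm_free series_var_def\<close>)
next
  case (triple i j k)
  then have c: "series_var i j \<in> carrier (free_alg n)" "series_var i k \<in> carrier (free_alg n)" "series_var j k \<in> carrier (free_alg n)"
    by (auto intro!: var_free simp: indices_def)
  have c': "series_var i k \<oplus>\<^bsub>series_alg n\<^esub> series_var j k \<in> carrier (free_alg n)"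
    using Fr.a_closed[OF c(2,3)] by simp
  show ?thesis
    by (rule that[OF c(1) c'])
       (use triple c c' relatorsI(2)[OF triple(1,2), of "free_alg n"] in \<open>auto simp: comm_free series_var_def series_ops\<close>)
next
  case (disjoint i j k l)
  then have c: "series_var i j \<in> carrier (free_alg n)" "series_var k l \<in> carrier (free_alg n)"
    by (auto intro!: var_free simp: indices_def)
  show ?thesis
    by (rule that[OF c]) (use disjoint c relatorsI(3)[OF disjoint(1,2), of "free_alg n"] in \<open>auto simp: comm_free series_var_def\<close>)
qed

lemma relators_free_series: "relators n (free_alg n) = relators n (series_alg n)"
proof -
  have "\<And>i j. i \<in> {1..n} \<Longrightarrow> j \<in> {1..n} \<Longrightarrow> i \<noteq> j \<Longrightarrow> series_var i j \<in> carrier (free_alg n)"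
    by (auto intro!: var_free simp: indices_def)
  note v = this
  have "r \<in> relators n (series_alg n)" if "r \<in> relators n (free_alg n)" for r
    using that
  proof (cases rule: relators_cases)
    case (same i j k)
    then show ?thesis using relatorsI(1)[OF same(1,2), of "series_alg n"] v by (simp add: comm_free)
  next
    case (triple i j k)
    have "series_var i k \<oplus>\<^bsub>series_alg n\<^esub> series_var j k \<in> carrier (free_alg n)"
      using Fr.a_closed[of "series_var i k" n "series_var j k"] v triple by simp
    then show ?thesis using relatorsI(2)[OF triple(1,2), of "series_alg n"] triple v by (simp add: comm_free)
  next
    case (disjoint i j k l)
    then show ?thesis using relatorsI(3)[OF disjoint(1,2), of "series_alg n"] v by (simp add: comm_free)
  qed
  moreover have "r \<in> relators n (free_alg n)" if "r \<in> relators n (series_alg n)" for r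
    using that by (rule relators_form)
  ultimately show ?thesis by (intro equalityI subsetI)
qed

lemma relators_carrier: "relators n (free_alg n) \<subseteq> carrier (free_alg n)"
proof
  fix r assume "r \<in> relators n (free_alg n)"
  then have "r \<in> relators n (series_alg n)" by (simp add: relators_free_series)
  then obtain f g where "f \<in> carrier (free_alg n)" "g \<in> carrier (free_alg n)" "r = commutator (free_alg n) f g"
    by (rule relators_form)
  then show "r \<in> carrier (free_alg n)"
    unfolding commutator_def by (metis Fr.m_closed Fr.minus_closed)
qed

lemma graded_ideal: "ideal (graded_ideal n) (free_alg n)"
  unfolding graded_ideal_def by (rule Fr.genideal_ideal[OF relators_carrier])

lemma graded_ideal_zero: "\<zero>\<^bsub>series_alg n\<^esub> \<in> graded_ideal n"
  using additive_subgroup.zero_closed[OF ideal.axioms(1)[OF graded_ideal]] by simp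

lemma relators_graded_ideal: "r \<in> relators n (free_alg n) \<Longrightarrow> r \<in> graded_ideal n"
  unfolding graded_ideal_def using Fr.genideal_self[OF relators_carrier] by blast

lemma comp_commutator:
  assumes "f \<in> carrier (series_alg n)" "g \<in> carrier (series_alg n)"
    "\<And>w. length w \<noteq> 1 \<Longrightarrow> f w = 0" "\<And>w. length w \<noteq> 1 \<Longrightarrow> g w = 0"
  shows "commutator (series_alg n) f g w \<noteq> 0 \<Longrightarrow> length w = 2"
proof (rule ccontr)
  assume w: "length w \<noteq> 2" and "commutator (series_alg n) f g w \<noteq> 0"
  have "length (take k w) \<noteq> 1 \<or> length (drop k w) \<noteq> 1" for k using w by auto
  then have "f (take k w) * g (drop k w) = 0" "g (take k w) * f (drop k w) = 0" for k
    using assms(3,4) by (metis mult_eq_0_iff)+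
  then have "(f \<otimes>\<^bsub>series_alg n\<^esub> g) w = 0" "(g \<otimes>\<^bsub>series_alg n\<^esub> f) w = 0"
    unfolding series_ops by (intro sum.neutral ballI; blast)+
  then have "commutator (series_alg n) f g w = 0"
    using assms by (simp add: commutator_def S_diff_apply)
  with \<open>commutator (series_alg n) f g w \<noteq> 0\<close> show False by simp
qed

text \<open>The relators are commutators of linear forms, hence homogeneous of degree two. This is what makes the
  graded ideal homogeneous and the closed ideal a product of its components.\<close>

lemma relators_homogeneous:
  assumes "r \<in> relators n (series_alg n)"
  shows "series_comp k r = (if k = 2 then r else \<zero>\<^bsub>series_alg n\<^esub>)"
proof -
  obtain f g where f: "f \<in> carrier (free_alg n)" "g \<in> carrier (free_alg n)"
    "\<And>w. length w \<noteq> 1 \<Longrightarrow> f w = 0" "\<And>w. length w \<noteq> 1 \<Longrightarrow> g w = 0"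
    "r = commutator (series_alg n) f g"
    by (rule relators_form[OF assms]) blast
  have "r w \<noteq> 0 \<Longrightarrow> length w = 2" for w
    unfolding f(5) using f by (intro comp_commutator) (auto simp: free_in_series)
  then show ?thesis by (auto simp: series_comp_def fun_eq_iff series_ops)
qed

abbreviation "series_ideal n \<equiv> genideal (series_alg n) (relators n (series_alg n))"

lemma relators_series_carrier: "relators n (series_alg n) \<subseteq> carrier (series_alg n)"
  using relators_carrier free_in_series by (auto simp: relators_free_series)

lemma series_ideal: "ideal (series_ideal n) (series_alg n)"
  by (rule S.genideal_ideal[OF relators_series_carrier])

lemma comp_series_ideal: "f \<in> series_ideal n \<Longrightarrow> series_comp k f \<in> graded_ideal n"
proof -
  have "series_comp k r \<in> graded_ideal n" if "r \<in> relators n (series_alg n)" for r k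
    using that relators_graded_ideal[of r n] graded_ideal_zero[of n]
    by (simp add: relators_homogeneous relators_free_series)
  then have "relators n (series_alg n) \<subseteq> comps_in n UNIV (graded_ideal n)"
    using relators_series_carrier by (auto simp: comps_in_def)
  then have "series_ideal n \<subseteq> comps_in n UNIV (graded_ideal n)"
    by (intro S.genideal_minimal comps_in_ideal graded_ideal) auto
  then show "f \<in> series_ideal n \<Longrightarrow> series_comp k f \<in> graded_ideal n"
    by (auto simp: comps_in_def)
qed

lemma ideal_free_restrict:
  assumes "ideal D (series_alg n)"
  shows "ideal (D \<inter> carrier (free_alg n)) (free_alg n)"
proof (rule idealI)
  interpret D: ideal D "series_alg n" by fact
  show "ring (free_alg n)" by unfold_locales
  show "subgroup (D \<inter> carrier (free_alg n)) (add_monoid (free_alg n))"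
  proof (rule Fr.add.subgroupI, goal_cases)
    case 2
    have "\<zero>\<^bsub>free_alg n\<^esub> \<in> D \<inter> carrier (free_alg n)" using D.zero_closed Fr.zero_closed[of n] by simp
    then show ?case by blast
  next
    case (3 f)
    then show ?case using D.a_inv_closed Fr.a_inv_closed[of f n] by (auto simp: free_minus)
  next
    case (4 f g)
    then show ?case using D.a_closed Fr.a_closed[of f n g] by auto
  qed auto
next
  interpret D: ideal D "series_alg n" by fact
  fix f x assume "f \<in> D \<inter> carrier (free_alg n)" "x \<in> carrier (free_alg n)"
  then show "x \<otimes>\<^bsub>free_alg n\<^esub> f \<in> D \<inter> carrier (free_alg n)" "f \<otimes>\<^bsub>free_alg n\<^esub> x \<in> D \<inter> carrier (free_alg n)"
    using D.I_l_closed[of f x] D.I_r_closed[of f x] Fr.m_closed[of x n f] Fr.m_closed[of f n x] free_in_series[of x n] by auto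
qed

lemma graded_in_series_ideal: "f \<in> graded_ideal n \<Longrightarrow> f \<in> series_ideal n"
proof -
  have "relators n (free_alg n) \<subseteq> series_ideal n \<inter> carrier (free_alg n)"
    using S.genideal_self[OF relators_series_carrier] relators_carrier relators_free_series by blast
  then have "graded_ideal n \<subseteq> series_ideal n \<inter> carrier (free_alg n)"
    unfolding graded_ideal_def by (intro Fr.genideal_minimal ideal_free_restrict series_ideal)
  then show "f \<in> graded_ideal n \<Longrightarrow> f \<in> series_ideal n" by blast
qed

lemma comp_graded_ideal: "f \<in> graded_ideal n \<Longrightarrow> series_comp k f \<in> graded_ideal n"
  by (rule comp_series_ideal[OF graded_in_series_ideal])

text \<open>A series of the closed ideal agrees in low degrees with an element of the ideal, whose components
  lie in the graded ideal. Conversely a truncation of a series is a finite sum of its components.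
  This reduces all questions about the completed algebra to the graded one.\<close>

lemma closed_ideal_eq: "closed_ideal n = comps_in n UNIV (graded_ideal n)"
proof (intro equalityI subsetI)
  fix f assume f: "f \<in> closed_ideal n"
  have "series_comp k f \<in> graded_ideal n" for k
  proof -
    obtain g where g: "g \<in> series_ideal n" "f \<ominus>\<^bsub>series_alg n\<^esub> g \<in> series_filt n (Suc k)"
      using f by (auto simp: closed_ideal_def)
    have "g \<in> carrier (series_alg n)" using ideal.Icarr[OF series_ideal g(1)] .
    then have "series_comp k f = series_comp k g"
      using g(2) by (fastforce simp: series_filt_def series_comp_def S_diff_apply fun_eq_iff)
    then show ?thesis using comp_series_ideal[OF g(1)] by simp
  qed
  then show "f \<in> comps_in n UNIV (graded_ideal n)" using f by (simp add: comps_in_def closed_ideal_def)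
next
  fix f assume f: "f \<in> comps_in n UNIV (graded_ideal n)"
  then have fc: "f \<in> carrier (series_alg n)" and fk: "\<And>k. series_comp k f \<in> graded_ideal n"
    by (auto simp: comps_in_def)
  have "\<exists>g\<in>series_ideal n. f \<ominus>\<^bsub>series_alg n\<^esub> g \<in> series_filt n k" for k
  proof
    \<comment> \<open>the truncation of \<open>f\<close> below degree \<open>k\<close>\<close>
    let ?g = "\<Oplus>\<^bsub>series_alg n\<^esub>i\<in>{..<k}. series_comp i f"
    show "?g \<in> series_ideal n"
      using fk by (intro ideal_finsum[OF S.ring_axioms series_ideal]) (auto intro: graded_in_series_ideal)
    have "?g w = f w" if "length w < k" for w
    proof -
      have "?g w = (\<Sum>i<k. series_comp i f w)" using fc by (intro S_finsum_apply) (auto intro: comp_in_series)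
      also have "\<dots> = (\<Sum>i<k. if i = length w then f w else 0)" by (intro sum.cong) (auto simp: series_comp_def)
      finally show ?thesis using that by simp
    qed
    moreover have "?g \<in> carrier (series_alg n)" using fc by (auto intro!: S.finsum_closed comp_in_series)
    ultimately show "f \<ominus>\<^bsub>series_alg n\<^esub> ?g \<in> series_filt n k"
      using fc by (simp add: series_filt_def S_diff_apply)
  qed
  then show "f \<in> closed_ideal n" using fc by (simp add: closed_ideal_def)
qed

lemma closed_ideal: "ideal (closed_ideal n) (series_alg n)"
  unfolding closed_ideal_eq by (intro comps_in_ideal graded_ideal) auto

interpretation Art: rat_alg "artin_alg n" for n
  unfolding artin_alg_def by (rule rat_alg_quot[OF rat_alg_series closed_ideal])

interpretation GArt: rat_alg "graded_artin_alg n" for n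
  unfolding graded_artin_alg_def by (rule rat_alg_quot[OF rat_alg_free graded_ideal])

abbreviation art :: "nat \<Rightarrow> series \<Rightarrow> series set" where
  "art n f \<equiv> closed_ideal n +>\<^bsub>series_alg n\<^esub> f"

abbreviation gart :: "nat \<Rightarrow> series \<Rightarrow> series set" where
  "gart n f \<equiv> graded_ideal n +>\<^bsub>free_alg n\<^esub> f"

lemmas art_simps = quot_alg_simps[OF rat_alg_series closed_ideal, folded artin_alg_def]
lemmas gart_simps = quot_alg_simps[OF rat_alg_free graded_ideal, folded graded_artin_alg_def]

lemma art_closed [simp, intro]: "f \<in> carrier (series_alg n) \<Longrightarrow> art n f \<in> carrier (artin_alg n)"
  by (simp add: art_simps)

lemma gart_closed [simp, intro]: "f \<in> carrier (free_alg n) \<Longrightarrow> gart n f \<in> carrier (graded_artin_alg n)"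
  by (simp add: gart_simps)

lemma art_eq_iff: "f \<in> carrier (series_alg n) \<Longrightarrow> g \<in> carrier (series_alg n) \<Longrightarrow>
    art n f = art n g \<longleftrightarrow> f \<ominus>\<^bsub>series_alg n\<^esub> g \<in> closed_ideal n"
  by (rule coset_eq_iff[OF rat_alg_series closed_ideal])

lemma gart_eq_iff: "f \<in> carrier (free_alg n) \<Longrightarrow> g \<in> carrier (free_alg n) \<Longrightarrow>
    gart n f = gart n g \<longleftrightarrow> f \<ominus>\<^bsub>series_alg n\<^esub> g \<in> graded_ideal n"
  using coset_eq_iff[OF rat_alg_free graded_ideal] by (simp add: free_diff)

subsection \<open>Exponentials\<close>

lemma pow_filt: "f \<in> series_filt n 1 \<Longrightarrow> f [^]\<^bsub>series_alg n\<^esub> m \<in> series_filt n m"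
proof (induction m)
  case 0
  then show ?case using S.one_closed by (simp add: series_filt_def)
next
  case (Suc m)
  then show ?case using filt_mult[of "f [^]\<^bsub>series_alg n\<^esub> m" n m f 1] by simp
qed

lemma exp_carrier:
  assumes "f \<in> carrier (series_alg n)"
  shows "series_exp n f \<in> carrier (series_alg n)"
  unfolding series_carrier series_exp_def
proof (intro allI impI)
  fix w assume "(\<Sum>k\<le>length w. (f [^]\<^bsub>series_alg n\<^esub> k) w / fact k) \<noteq> 0"
  then obtain k where "(f [^]\<^bsub>series_alg n\<^esub> k) w / fact k \<noteq> 0"
    by (rule sum.not_neutral_contains_not_neutral)
  then have "(f [^]\<^bsub>series_alg n\<^esub> k) w \<noteq> 0" by auto
  then show "set w \<subseteq> indices n" using S.nat_pow_closed[OF assms, of k] by (auto simp: series_carrier)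
qed

text \<open>Powers beyond the \<open>K\<close>-th have order greater than \<open>K\<close>.\<close>

lemma exp_truncate:
  assumes f: "f \<in> series_filt n 1"
  shows "series_exp n f \<ominus>\<^bsub>series_alg n\<^esub> S.texp n K f \<in> series_filt n (Suc K)"
proof -
  have fc: "f \<in> carrier (series_alg n)" using f by (rule filt_carrier)
  have "series_exp n f w = S.texp n K f w" if w: "length w \<le> K" for w
  proof -
    have "S.texp n K f w = (\<Sum>m\<le>K. (f [^]\<^bsub>series_alg n\<^esub> m) w / fact m)"
      unfolding S.texp_def using fc
      by (subst S_finsum_apply) (auto simp: S.dpow_def series_ops field_simps)
    also have "\<dots> = series_exp n f w"
      unfolding series_exp_def using w pow_filt[OF f]
      by (intro sum.mono_neutral_right) (auto simp: series_filt_def)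
    finally show ?thesis by simp
  qed
  then show ?thesis using exp_carrier[OF fc] fc by (auto simp: series_filt_def S_diff_apply)
qed

text \<open>Modulo the components of degree greater than \<open>K\<close> the exponential is a truncated exponential of a
  nilpotent element, to which the formal identities apply. Equality in the completed algebra is
  equality for all \<open>K\<close>.\<close>

definition trunc_ideal :: "nat \<Rightarrow> nat \<Rightarrow> series set" where
  "trunc_ideal n K = comps_in n {..K} (graded_ideal n)"

lemma trunc_ideal: "ideal (trunc_ideal n K) (series_alg n)"
  unfolding trunc_ideal_def by (intro comps_in_ideal graded_ideal) auto

lemma closed_ideal_trunc: "f \<in> closed_ideal n \<longleftrightarrow> (\<forall>K. f \<in> trunc_ideal n K)"
  by (auto simp: closed_ideal_eq trunc_ideal_def comps_in_def)

lemma filt_trunc_ideal: "f \<in> series_filt n (Suc K) \<Longrightarrow> f \<in> trunc_ideal n K"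
proof -
  assume f: "f \<in> series_filt n (Suc K)"
  then have "series_comp k f = \<zero>\<^bsub>free_alg n\<^esub>" if "k \<le> K" for k
    using that by (auto simp: series_filt_def series_comp_def series_ops fun_eq_iff)
  then show ?thesis using f graded_ideal_zero[of n] by (auto simp: trunc_ideal_def comps_in_def series_filt_def)
qed

abbreviation "trunc_alg n K \<equiv> quot_alg (series_alg n) (trunc_ideal n K)"

interpretation T: rat_alg "trunc_alg n K" for n K
  by (rule rat_alg_quot[OF rat_alg_series trunc_ideal])

abbreviation trn :: "nat \<Rightarrow> nat \<Rightarrow> series \<Rightarrow> series set" where
  "trn n K f \<equiv> trunc_ideal n K +>\<^bsub>series_alg n\<^esub> f"

lemmas trn_simps = quot_alg_simps[OF rat_alg_series trunc_ideal]

lemma trn_closed [simp, intro]: "f \<in> carrier (series_alg n) \<Longrightarrow> trn n K f \<in> carrier (trunc_alg n K)"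
  by (simp add: trn_simps)

lemma trn_eq_iff: "f \<in> carrier (series_alg n) \<Longrightarrow> g \<in> carrier (series_alg n) \<Longrightarrow>
    trn n K f = trn n K g \<longleftrightarrow> f \<ominus>\<^bsub>series_alg n\<^esub> g \<in> trunc_ideal n K"
  by (rule coset_eq_iff[OF rat_alg_series trunc_ideal])

lemma art_eq_trn: "f \<in> carrier (series_alg n) \<Longrightarrow> g \<in> carrier (series_alg n) \<Longrightarrow>
    art n f = art n g \<longleftrightarrow> (\<forall>K. trn n K f = trn n K g)"
  by (simp add: art_eq_iff trn_eq_iff closed_ideal_trunc)

lemma trn_pow: "f \<in> carrier (series_alg n) \<Longrightarrow> trn n K f [^]\<^bsub>trunc_alg n K\<^esub> (m::nat) = trn n K (f [^]\<^bsub>series_alg n\<^esub> m)"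
  by (induction m) (auto simp: trn_simps)

lemma trn_texp:
  assumes "f \<in> carrier (series_alg n)"
  shows "trn n K (S.texp n L f) = T.texp n K L (trn n K f)"
  unfolding S.texp_def T.texp_def S.dpow_def T.dpow_def
  using assms by (subst coset_finsum[OF rat_alg_series trunc_ideal, symmetric]) (auto simp: trn_pow trn_simps)

lemma trn_exp:
  assumes "f \<in> series_filt n 1"
  shows "trn n K (series_exp n f) = T.texp n K K (trn n K f)"
  using filt_trunc_ideal[OF exp_truncate[OF assms]] assms filt_carrier[OF assms] exp_carrier
  by (simp add: trn_texp[symmetric] trn_eq_iff)

lemma trn_nilpotent:
  assumes "f \<in> series_filt n 1" "m > K"
  shows "trn n K f [^]\<^bsub>trunc_alg n K\<^esub> m = \<zero>\<^bsub>trunc_alg n K\<^esub>"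
proof -
  have "f [^]\<^bsub>series_alg n\<^esub> m \<in> series_filt n (Suc K)"
    using pow_filt[OF assms(1), of m] assms(2) by (auto simp: series_filt_def)
  then have "f [^]\<^bsub>series_alg n\<^esub> m \<in> trunc_ideal n K" by (rule filt_trunc_ideal)
  then show ?thesis using filt_carrier[OF assms(1)]
    by (simp add: trn_pow trn_simps coset_eq_self_iff[OF rat_alg_series trunc_ideal])
qed

lemma trn_commute:
  assumes "f \<in> carrier (series_alg n)" "g \<in> carrier (series_alg n)"
    "art n f \<otimes>\<^bsub>artin_alg n\<^esub> art n g = art n g \<otimes>\<^bsub>artin_alg n\<^esub> art n f"
  shows "trn n K f \<otimes>\<^bsub>trunc_alg n K\<^esub> trn n K g = trn n K g \<otimes>\<^bsub>trunc_alg n K\<^esub> trn n K f"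
  using assms by (simp add: trn_simps art_simps art_eq_trn)

text \<open>Checked in each truncation, where it is \<open>texp_add\<close>. The series \<open>f\<close> and \<open>g\<close> commute only modulo the
  relations, so the identity has no counterpart for the series themselves.\<close>

theorem exp_add:
  assumes f: "f \<in> series_filt n 1" and g: "g \<in> series_filt n 1"
    and fg: "art n f \<otimes>\<^bsub>artin_alg n\<^esub> art n g = art n g \<otimes>\<^bsub>artin_alg n\<^esub> art n f"
  shows "art n (series_exp n f) \<otimes>\<^bsub>artin_alg n\<^esub> art n (series_exp n g) = art n (series_exp n (f \<oplus>\<^bsub>series_alg n\<^esub> g))"
proof -
  note c = filt_carrier[OF f] filt_carrier[OF g]
  note fg1 = filt_ops(1)[OF f g]
  have "trn n K (series_exp n f \<otimes>\<^bsub>series_alg n\<^esub> series_exp n g) = trn n K (series_exp n (f \<oplus>\<^bsub>series_alg n\<^esub> g))" for K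
  proof -
    have "trn n K (series_exp n f \<otimes>\<^bsub>series_alg n\<^esub> series_exp n g)
        = T.texp n K K (trn n K f) \<otimes>\<^bsub>trunc_alg n K\<^esub> T.texp n K K (trn n K g)"
      using c by (simp add: trn_simps(5)[symmetric] exp_carrier trn_exp[OF f] trn_exp[OF g])
    also have "\<dots> = T.texp n K K (trn n K f \<oplus>\<^bsub>trunc_alg n K\<^esub> trn n K g)"
    proof (rule T.texp_add)
      show "trn n K f \<otimes>\<^bsub>trunc_alg n K\<^esub> trn n K g = trn n K g \<otimes>\<^bsub>trunc_alg n K\<^esub> trn n K f"
        by (rule trn_commute[OF c fg])
      show "(trn n K f \<oplus>\<^bsub>trunc_alg n K\<^esub> trn n K g) [^]\<^bsub>trunc_alg n K\<^esub> m = \<zero>\<^bsub>trunc_alg n K\<^esub>" if "K < m" for m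
        using trn_nilpotent[OF fg1 that] c by (simp add: trn_simps)
    qed (use c f g trn_nilpotent in auto)
    also have "\<dots> = trn n K (series_exp n (f \<oplus>\<^bsub>series_alg n\<^esub> g))"
      using c by (simp add: trn_exp[OF fg1] trn_simps)
    finally show ?thesis .
  qed
  then show ?thesis using c by (simp add: art_simps exp_carrier art_eq_trn)
qed

theorem exp_commute:
  assumes f: "f \<in> series_filt n 1" and g: "g \<in> series_filt n 1"
    and fg: "art n f \<otimes>\<^bsub>artin_alg n\<^esub> art n g = art n g \<otimes>\<^bsub>artin_alg n\<^esub> art n f"
  shows "art n (series_exp n f) \<otimes>\<^bsub>artin_alg n\<^esub> art n (series_exp n g)
    = art n (series_exp n g) \<otimes>\<^bsub>artin_alg n\<^esub> art n (series_exp n f)"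
proof -
  note c = filt_carrier[OF f] filt_carrier[OF g]
  show ?thesis
    using exp_add[OF f g fg] exp_add[OF g f fg[symmetric]] S.a_comm[OF c] by simp
qed

lemma exp_zero: "series_exp n \<zero>\<^bsub>series_alg n\<^esub> = \<one>\<^bsub>series_alg n\<^esub>"
proof
  fix w
  have "(\<Sum>k\<le>length w. (\<zero>\<^bsub>series_alg n\<^esub> [^]\<^bsub>series_alg n\<^esub> k) w / fact k)
      = (\<Sum>k\<in>{0}. (\<zero>\<^bsub>series_alg n\<^esub> [^]\<^bsub>series_alg n\<^esub> k) w / fact k)"
    by (intro sum.mono_neutral_right) (auto simp: S.nat_pow_zero series_ops)
  then show "series_exp n \<zero>\<^bsub>series_alg n\<^esub> w = \<one>\<^bsub>series_alg n\<^esub> w"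
    by (simp add: series_exp_def)
qed

lemma exp_inverse:
  assumes f: "f \<in> series_filt n 1"
  shows "art n (series_exp n f) \<otimes>\<^bsub>artin_alg n\<^esub> art n (series_exp n (\<ominus>\<^bsub>series_alg n\<^esub> f)) = \<one>\<^bsub>artin_alg n\<^esub>"
proof -
  note c = filt_carrier[OF f]
  have g: "\<ominus>\<^bsub>series_alg n\<^esub> f \<in> series_filt n 1" using f c by (auto simp: series_filt_def S_minus_apply)
  have "art n f \<otimes>\<^bsub>artin_alg n\<^esub> art n (\<ominus>\<^bsub>series_alg n\<^esub> f) = art n (\<ominus>\<^bsub>series_alg n\<^esub> f) \<otimes>\<^bsub>artin_alg n\<^esub> art n f"
    using c by (simp add: art_simps S.l_minus S.r_minus)
  from exp_add[OF f g this] show ?thesis using c by (simp add: S.r_neg exp_zero art_simps)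
qed

text \<open>Source of the lower bound: \<open>exp f - 1\<close> and \<open>f\<close> have the same leading term.\<close>

lemma exp_leading:
  assumes f: "f \<in> series_filt n 1"
  shows "series_exp n f \<ominus>\<^bsub>series_alg n\<^esub> \<one>\<^bsub>series_alg n\<^esub> \<in> series_filt n 1"
    "series_comp 1 (series_exp n f \<ominus>\<^bsub>series_alg n\<^esub> \<one>\<^bsub>series_alg n\<^esub>) = series_comp 1 f"
proof -
  note c = filt_carrier[OF f]
  have 0: "series_exp n f w = \<one>\<^bsub>series_alg n\<^esub> w" if "length w = 0" for w
    using that by (simp add: series_exp_def)
  have 1: "series_exp n f w = f w" if "length w = 1" for w
    using that c by (cases w) (auto simp: series_exp_def series_ops)
  show "series_exp n f \<ominus>\<^bsub>series_alg n\<^esub> \<one>\<^bsub>series_alg n\<^esub> \<in> series_filt n 1"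
    using 0 exp_carrier[OF c] by (auto simp: series_filt_def S_diff_apply)
  show "series_comp 1 (series_exp n f \<ominus>\<^bsub>series_alg n\<^esub> \<one>\<^bsub>series_alg n\<^esub>) = series_comp 1 f"
    using 1 by (auto simp: series_comp_def S_diff_apply series_ops fun_eq_iff)
qed

section \<open>The braid algebras\<close>

subsection \<open>The action of the symmetric group\<close>

abbreviation "pmap \<pi> \<equiv> map (map_prod (Hilbert_Choice.inv \<pi>) (Hilbert_Choice.inv \<pi>))"

lemma indices_perm:
  assumes "\<pi> permutes {1..n}"
  shows "(\<pi> i, \<pi> j) \<in> indices n \<longleftrightarrow> (i, j) \<in> indices n"
proof -
  have "\<pi> i \<in> {1..n} \<longleftrightarrow> i \<in> {1..n}" "\<pi> j \<in> {1..n} \<longleftrightarrow> j \<in> {1..n}"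
    by (rule permutes_in_image[OF assms])+
  moreover have "\<pi> i = \<pi> j \<longleftrightarrow> i = j" using permutes_inj[OF assms] by (auto simp: inj_eq)
  ultimately show ?thesis unfolding indices_def mem_Collect_eq prod.case by blast
qed

lemma pmap_indices:
  assumes "\<pi> permutes {1..n}"
  shows "set (pmap \<pi> w) \<subseteq> indices n \<longleftrightarrow> set w \<subseteq> indices n"
  using indices_perm[OF permutes_inv[OF assms]] by (auto simp: subset_iff image_iff) force+

lemma act_series:
  assumes "\<pi> permutes {1..n}" "f \<in> carrier (series_alg n)"
  shows "series_act \<pi> f \<in> carrier (series_alg n)"
  using assms(2) pmap_indices[OF assms(1)] unfolding series_carrier series_act_def by blast

lemma act_filt: "\<pi> permutes {1..n} \<Longrightarrow> f \<in> series_filt n k \<Longrightarrow> series_act \<pi> f \<in> series_filt n k"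
  using act_series by (auto simp: series_filt_def series_act_def)

lemma act_compose:
  assumes "\<pi> permutes {1..n}" "\<tau> permutes {1..n}"
  shows "series_act \<pi> (series_act \<tau> f) = series_act (\<pi> \<circ> \<tau>) f"
proof -
  have "Hilbert_Choice.inv (\<pi> \<circ> \<tau>) = Hilbert_Choice.inv \<tau> \<circ> Hilbert_Choice.inv \<pi>"
    using assms by (intro o_inv_distrib permutes_bij)
  then show ?thesis by (simp add: series_act_def fun_eq_iff map_prod.comp comp_def map_prod_def case_prod_unfold)
qed

lemma act_id: "series_act id f = f"
  by (simp add: series_act_def map_prod.id)

lemma act_inverse:
  assumes "\<pi> permutes {1..n}"
  shows "series_act \<pi> (series_act (Hilbert_Choice.inv \<pi>) f) = f" "series_act (Hilbert_Choice.inv \<pi>) (series_act \<pi> f) = f"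
  using act_compose[OF assms permutes_inv[OF assms]] act_compose[OF permutes_inv[OF assms] assms]
    permutes_inv_o[OF assms] by (simp_all add: act_id)

lemma act_ops:
  "series_act \<pi> (f \<oplus>\<^bsub>series_alg n\<^esub> g) = series_act \<pi> f \<oplus>\<^bsub>series_alg n\<^esub> series_act \<pi> g"
  "series_act \<pi> (f \<otimes>\<^bsub>series_alg n\<^esub> g) = series_act \<pi> f \<otimes>\<^bsub>series_alg n\<^esub> series_act \<pi> g"
  "series_act \<pi> (c \<odot>\<^bsub>series_alg n\<^esub> f) = c \<odot>\<^bsub>series_alg n\<^esub> series_act \<pi> f"
  "series_act \<pi> \<one>\<^bsub>series_alg n\<^esub> = \<one>\<^bsub>series_alg n\<^esub>"
  "series_act \<pi> \<zero>\<^bsub>series_alg n\<^esub> = \<zero>\<^bsub>series_alg n\<^esub>"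
  "series_act \<pi> (series_comp k f) = series_comp k (series_act \<pi> f)"
  by (auto simp: series_act_def series_ops fun_eq_iff take_map drop_map series_comp_def)

lemma act_diff:
  assumes "\<pi> permutes {1..n}" "g \<in> carrier (series_alg n)"
  shows "series_act \<pi> (f \<ominus>\<^bsub>series_alg n\<^esub> g) = series_act \<pi> f \<ominus>\<^bsub>series_alg n\<^esub> series_act \<pi> g"
  using assms act_series[OF assms] by (auto simp: fun_eq_iff S_diff_apply series_act_def)

lemma act_free:
  assumes "\<pi> permutes {1..n}" "f \<in> carrier (free_alg n)"
  shows "series_act \<pi> f \<in> carrier (free_alg n)"
proof -
  have "pmap \<pi> w = pmap \<pi> w' \<Longrightarrow> w = w'" for w w'
    using permutes_inj[OF permutes_inv[OF assms(1)]]
    by (metis inj_map_eq_map map_prod_inj_on UNIV_Times_UNIV)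
  then have "inj (pmap \<pi>)" unfolding inj_def by blast
  then have "finite (pmap \<pi> -` {w. f w \<noteq> 0})" using assms(2) by (intro finite_vimageI) (auto simp: free_carrier)
  moreover have "pmap \<pi> -` {w. f w \<noteq> 0} = {w. series_act \<pi> f w \<noteq> 0}" by (auto simp: series_act_def)
  ultimately show ?thesis using act_series[OF assms(1)] assms(2) by (simp add: free_carrier)
qed

lemma act_var:
  assumes "\<pi> permutes {1..n}"
  shows "series_act \<pi> (series_var i j) = series_var (\<pi> i) (\<pi> j)"
proof
  fix w
  have "Hilbert_Choice.inv \<pi> x = y \<longleftrightarrow> x = \<pi> y" for x y
    using permutes_inv_eq[OF assms, of x y] by auto
  then have "pmap \<pi> w = [(i, j)] \<longleftrightarrow> w = [(\<pi> i, \<pi> j)]"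
    by (auto simp: map_eq_Cons_conv map_prod_def split: prod.splits)
  then show "series_act \<pi> (series_var i j) w = series_var (\<pi> i) (\<pi> j) w"
    by (simp add: series_act_def series_var_def)
qed

lemma act_relators:
  assumes \<pi>: "\<pi> permutes {1..n}" and r: "r \<in> relators n (series_alg n)"
  shows "series_act \<pi> r \<in> relators n (series_alg n)"
proof -
  have im: "\<pi> i \<in> {1..n} \<longleftrightarrow> i \<in> {1..n}" for i by (rule permutes_in_image[OF \<pi>])
  have inj: "\<pi> i = \<pi> j \<longleftrightarrow> i = j" for i j using permutes_inj[OF \<pi>] by (auto simp: inj_eq)
  have comm: "series_act \<pi> (commutator (series_alg n) f g)
      = commutator (series_alg n) (series_act \<pi> f) (series_act \<pi> g)"
    if "f \<in> carrier (series_alg n)" "g \<in> carrier (series_alg n)" for f g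
    using that act_diff[OF \<pi>] by (simp add: commutator_def act_ops)
  have v: "series_var i j \<in> carrier (series_alg n)" if "i \<in> {1..n}" "j \<in> {1..n}" "i \<noteq> j" for i j
    using that by (intro var_series) (auto simp: indices_def)
  show ?thesis using r
  proof (cases rule: relators_cases)
    case (same i j k)
    have "{\<pi> i, \<pi> j, \<pi> k} \<subseteq> {1..n}" "distinct [\<pi> i, \<pi> j, \<pi> k]" using same im inj by auto
    from relatorsI(1)[OF this] show ?thesis using same v by (simp add: comm act_var[OF \<pi>])
  next
    case (triple i j k)
    have "{\<pi> i, \<pi> j, \<pi> k} \<subseteq> {1..n}" "distinct [\<pi> i, \<pi> j, \<pi> k]" using triple im inj by auto
    from relatorsI(2)[OF this] show ?thesis using triple v by (simp add: comm act_var[OF \<pi>] act_ops)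
  next
    case (disjoint i j k l)
    have "{\<pi> i, \<pi> j, \<pi> k, \<pi> l} \<subseteq> {1..n}" "distinct [\<pi> i, \<pi> j, \<pi> k, \<pi> l]" using disjoint im inj by auto
    from relatorsI(3)[OF this] show ?thesis using disjoint v by (simp add: comm act_var[OF \<pi>])
  qed
qed

lemma act_graded_ideal:
  assumes \<pi>: "\<pi> permutes {1..n}" and f: "f \<in> graded_ideal n"
  shows "series_act \<pi> f \<in> graded_ideal n"
proof -
  let ?D = "{f \<in> carrier (free_alg n). series_act \<pi> f \<in> graded_ideal n}"
  interpret D: ideal "graded_ideal n" "free_alg n" by (rule graded_ideal)
  have "ideal ?D (free_alg n)"
  proof (rule idealI)
    show "ring (free_alg n)" by unfold_locales
    show "subgroup ?D (add_monoid (free_alg n))"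
    proof (rule Fr.add.subgroupI, goal_cases)
      case 2
      have "\<zero>\<^bsub>free_alg n\<^esub> \<in> ?D" using graded_ideal_zero Fr.zero_closed[of n] by (simp add: act_ops)
      then show ?case by blast
    next
      case (3 f)
      then have "\<ominus>\<^bsub>free_alg n\<^esub> f \<in> carrier (free_alg n)" by simp
      moreover have "series_act \<pi> (\<ominus>\<^bsub>free_alg n\<^esub> f) = \<ominus>\<^bsub>free_alg n\<^esub> (series_act \<pi> f)"
        using 3 act_free[OF \<pi>, of f] by (auto simp: free_minus fun_eq_iff S_minus_apply free_in_series series_act_def)
      ultimately show ?case using 3 D.a_inv_closed by auto
    next
      case (4 f g)
      then show ?case using D.a_closed Fr.a_closed[of f n g] by (auto simp: act_ops)
    qed auto
    fix f x assume "f \<in> ?D" "x \<in> carrier (free_alg n)"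
    then show "x \<otimes>\<^bsub>free_alg n\<^esub> f \<in> ?D" "f \<otimes>\<^bsub>free_alg n\<^esub> x \<in> ?D"
      using D.I_l_closed[OF _ act_free[OF \<pi>]] D.I_r_closed[OF _ act_free[OF \<pi>]]
        Fr.m_closed[of x n f] Fr.m_closed[of f n x] by (auto simp: act_ops)
  qed
  moreover have "relators n (free_alg n) \<subseteq> ?D"
    using relators_carrier act_relators[OF \<pi>] relators_graded_ideal by (auto simp: relators_free_series)
  ultimately have "graded_ideal n \<subseteq> ?D" unfolding graded_ideal_def[of n] by (rule Fr.genideal_minimal)
  then show ?thesis using f by blast
qed

lemma act_closed_ideal:
  assumes "\<pi> permutes {1..n}" "f \<in> closed_ideal n"
  shows "series_act \<pi> f \<in> closed_ideal n"
  using assms act_series act_graded_ideal by (auto simp: closed_ideal_eq comps_in_def act_ops(6)[symmetric])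

text \<open>Applies to the action on cosets: a bijective additive map that preserves the ideal in both directions
  permutes its cosets.\<close>

lemma image_coset:
  assumes A: "rat_alg A" "ideal I A"
    and a: "\<And>x. x \<in> carrier A \<Longrightarrow> a x \<in> carrier A" "\<And>x. x \<in> carrier A \<Longrightarrow> b x \<in> carrier A"
    and ab: "\<And>x. x \<in> carrier A \<Longrightarrow> a (b x) = x" "\<And>x. x \<in> carrier A \<Longrightarrow> b (a x) = x"
    and diff: "\<And>x y. x \<in> carrier A \<Longrightarrow> y \<in> carrier A \<Longrightarrow> a (x \<ominus>\<^bsub>A\<^esub> y) = a x \<ominus>\<^bsub>A\<^esub> a y"
      "\<And>x y. x \<in> carrier A \<Longrightarrow> y \<in> carrier A \<Longrightarrow> b (x \<ominus>\<^bsub>A\<^esub> y) = b x \<ominus>\<^bsub>A\<^esub> b y"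
    and I: "\<And>x. x \<in> I \<Longrightarrow> a x \<in> I" "\<And>x. x \<in> I \<Longrightarrow> b x \<in> I"
    and x: "x \<in> carrier A"
  shows "a ` (I +>\<^bsub>A\<^esub> x) = I +>\<^bsub>A\<^esub> a x"
proof (intro equalityI subsetI)
  fix y assume "y \<in> a ` (I +>\<^bsub>A\<^esub> x)"
  then obtain z where z: "z \<in> carrier A" "z \<ominus>\<^bsub>A\<^esub> x \<in> I" "y = a z"
    using mem_coset_iff[OF A x] by blast
  then show "y \<in> I +>\<^bsub>A\<^esub> a x"
    using I(1)[OF z(2)] a(1)[OF z(1)] diff(1)[OF z(1) x] mem_coset_iff[OF A a(1)[OF x]] by simp
next
  fix y assume "y \<in> I +>\<^bsub>A\<^esub> a x"
  then have y: "y \<in> carrier A" "y \<ominus>\<^bsub>A\<^esub> a x \<in> I" using mem_coset_iff[OF A a(1)[OF x]] by auto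
  have "b y \<ominus>\<^bsub>A\<^esub> x \<in> I" using I(2)[OF y(2)] diff(2)[OF y(1) a(1)[OF x]] ab(2)[OF x] by simp
  then have "b y \<in> I +>\<^bsub>A\<^esub> x" using mem_coset_iff[OF A x] a(2)[OF y(1)] by simp
  then show "y \<in> a ` (I +>\<^bsub>A\<^esub> x)" using ab(1)[OF y(1)] by (metis image_eqI)
qed

lemma coset_act_art:
  assumes "\<pi> permutes {1..n}" "f \<in> carrier (series_alg n)"
  shows "coset_act \<pi> (art n f) = art n (series_act \<pi> f)"
  unfolding coset_act_def
  by (rule image_coset[OF rat_alg_series closed_ideal, where b = "series_act (Hilbert_Choice.inv \<pi>)"])
     (use assms permutes_inv[OF assms(1)] in \<open>auto intro: act_series act_closed_ideal act_inverse act_diff\<close>)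

lemma coset_act_gart:
  assumes "\<pi> permutes {1..n}" "f \<in> carrier (free_alg n)"
  shows "coset_act \<pi> (gart n f) = gart n (series_act \<pi> f)"
proof -
  have d: "series_act \<sigma> (x \<ominus>\<^bsub>free_alg n\<^esub> y) = series_act \<sigma> x \<ominus>\<^bsub>free_alg n\<^esub> series_act \<sigma> y"
    if "\<sigma> permutes {1..n}" "x \<in> carrier (free_alg n)" "y \<in> carrier (free_alg n)" for \<sigma> x y
    using that act_diff[OF that(1) free_in_series[OF that(3)]] by (simp add: free_diff[OF that(3)] free_diff[OF act_free[OF that(1,3)]])
  show ?thesis
    unfolding coset_act_def
    by (rule image_coset[OF rat_alg_free graded_ideal, where b = "series_act (Hilbert_Choice.inv \<pi>)"])
       (use assms permutes_inv[OF assms(1)] in \<open>auto intro: act_free act_graded_ideal act_inverse d\<close>)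
qed

lemma artE:
  assumes "X \<in> carrier (artin_alg n)"
  obtains f where "f \<in> carrier (series_alg n)" "X = art n f"
  using assms by (auto simp: art_simps)

lemma gartE:
  assumes "X \<in> carrier (graded_artin_alg n)"
  obtains f where "f \<in> carrier (free_alg n)" "X = gart n f"
  using assms by (auto simp: gart_simps)

lemma finite_sym_group: "finite (carrier (sym_group n))"
  using finite_permutations[of "{1..n}"] by (simp add: sym_group_def)

lemma artin_action: "alg_action (artin_alg n) (sym_group n) coset_act"
proof (intro alg_action.intro alg_action_axioms.intro)
  show "rat_alg (artin_alg n)" by unfold_locales
  show "group (sym_group n)" by (rule sym_group_is_group)
qed (auto elim!: artE simp: finite_sym_group sym_group_carrier sym_group_mult sym_group_one coset_act_art
    act_series art_simps act_ops act_compose act_id permutes_compose)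

lemma graded_artin_action: "alg_action (graded_artin_alg n) (sym_group n) coset_act"
proof (intro alg_action.intro alg_action_axioms.intro)
  show "rat_alg (graded_artin_alg n)" by unfold_locales
  show "group (sym_group n)" by (rule sym_group_is_group)
qed (use Fr.a_closed Fr.m_closed Fr.one_closed Fr.smult_closed in
    \<open>auto elim!: gartE simp: finite_sym_group sym_group_carrier sym_group_mult sym_group_one coset_act_gart
    act_free gart_simps act_ops act_compose act_id permutes_compose\<close>)

interpretation Br: alg_action "artin_alg n" "sym_group n" coset_act
  rewrites "crossed_product (artin_alg n) (sym_group n) coset_act = braid_alg n" for n
  by (rule artin_action) (simp add: braid_alg_def)

interpretation GBr: alg_action "graded_artin_alg n" "sym_group n" coset_act
  rewrites "crossed_product (graded_artin_alg n) (sym_group n) coset_act = graded_braid_alg n" for n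
  by (rule graded_artin_action) (simp add: graded_braid_alg_def)

subsection \<open>Leading parts\<close>

text \<open>Independence of the representative: two series with the same class differ by an element of the
  closed ideal, whose components lie in the graded ideal.\<close>

lemma leading_part_art:
  assumes f: "f \<in> series_filt n k"
  shows "leading_part n k (art n f) = gart n (series_comp k f)"
proof -
  note fc = filt_carrier[OF f]
  have eq: "gart n (series_comp k g) = gart n (series_comp k f)" if "g \<in> art n f \<inter> series_filt n k" for g
  proof -
    have g: "g \<in> carrier (series_alg n)" "g \<ominus>\<^bsub>series_alg n\<^esub> f \<in> closed_ideal n"
      using that mem_coset_iff[OF rat_alg_series closed_ideal fc] by auto
    then have "series_comp k (g \<ominus>\<^bsub>series_alg n\<^esub> f) \<in> graded_ideal n" by (auto simp: closed_ideal_eq comps_in_def)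
    also have "series_comp k (g \<ominus>\<^bsub>series_alg n\<^esub> f) = series_comp k g \<ominus>\<^bsub>series_alg n\<^esub> series_comp k f"
      using fc comp_in_series[OF fc] by (auto simp: series_comp_def S_diff_apply fun_eq_iff)
    finally show ?thesis using g fc by (simp add: gart_eq_iff comp_in_free)
  qed
  have ne: "f \<in> art n f \<inter> series_filt n k"
    using f fc mem_coset_iff[OF rat_alg_series closed_ideal fc] additive_subgroup.zero_closed[OF ideal.axioms(1)[OF closed_ideal]]
    by (simp add: a_minus_def S.r_neg)
  have "leading_part n k (art n f) = (\<Union>g\<in>art n f \<inter> series_filt n k. gart n (series_comp k f))"
    unfolding leading_part_def by (intro SUP_cong refl eq)
  then show ?thesis using ne by (metis UN_constant emptyE)
qed

lemma artin_filtE: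
  assumes "X \<in> artin_filt n k"
  obtains f where "f \<in> series_filt n k" "X = art n f"
  using assms by (auto simp: artin_filt_def)

lemma artin_filtI: "f \<in> series_filt n k \<Longrightarrow> art n f \<in> artin_filt n k"
  by (simp add: artin_filt_def)

lemma artin_filt_carrier: "X \<in> artin_filt n k \<Longrightarrow> X \<in> carrier (artin_alg n)"
  by (auto elim!: artin_filtE simp: filt_carrier)

lemma artin_filt_ops:
  "X \<in> artin_filt n k \<Longrightarrow> Y \<in> artin_filt n k \<Longrightarrow> X \<oplus>\<^bsub>artin_alg n\<^esub> Y \<in> artin_filt n k"
  "X \<in> artin_filt n k \<Longrightarrow> c \<odot>\<^bsub>artin_alg n\<^esub> X \<in> artin_filt n k"
  "X \<in> artin_filt n i \<Longrightarrow> Y \<in> artin_filt n j \<Longrightarrow> X \<otimes>\<^bsub>artin_alg n\<^esub> Y \<in> artin_filt n (i + j)"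
  "\<pi> permutes {1..n} \<Longrightarrow> X \<in> artin_filt n k \<Longrightarrow> coset_act \<pi> X \<in> artin_filt n k"
  by (auto elim!: artin_filtE simp: art_simps filt_carrier filt_ops filt_mult act_filt coset_act_art intro!: artin_filtI)

lemma artin_filt_zero: "\<zero>\<^bsub>artin_alg n\<^esub> \<in> artin_filt n k"
proof -
  have "\<zero>\<^bsub>artin_alg n\<^esub> = art n \<zero>\<^bsub>series_alg n\<^esub>"
    using coset_eq_self_iff[OF rat_alg_series closed_ideal S.zero_closed]
      additive_subgroup.zero_closed[OF ideal.axioms(1)[OF closed_ideal]] by (simp add: art_simps)
  then show ?thesis by (simp add: artin_filtI filt_ops)
qed

lemma artin_filt_0: "artin_filt n 0 = carrier (artin_alg n)"
  by (simp add: artin_filt_def filt_0 art_simps)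

lemma artin_filt_Suc: "artin_filt n (Suc k) \<subseteq> artin_filt n k"
  using filt_Suc by (auto simp: artin_filt_def)

lemma gart_comp_part: "f \<in> carrier (series_alg n) \<Longrightarrow> gart n (series_comp k f) \<in> graded_artin_part n k"
  unfolding graded_artin_part_def using comp_in_free
  by (intro imageI CollectI conjI allI impI) (auto simp: series_comp_def split: if_splits)

lemma leading_part_closed: "X \<in> artin_filt n k \<Longrightarrow> leading_part n k X \<in> graded_artin_part n k"
  by (auto elim!: artin_filtE simp: leading_part_art filt_carrier intro!: gart_comp_part)

lemma graded_artin_part_carrier: "X \<in> graded_artin_part n k \<Longrightarrow> X \<in> carrier (graded_artin_alg n)"
  by (auto simp: graded_artin_part_def)

lemma leading_part_carrier: "X \<in> artin_filt n k \<Longrightarrow> leading_part n k X \<in> carrier (graded_artin_alg n)"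
  by (rule graded_artin_part_carrier[OF leading_part_closed])

lemma leading_part_ops:
  "X \<in> artin_filt n k \<Longrightarrow> Y \<in> artin_filt n k \<Longrightarrow>
    leading_part n k (X \<oplus>\<^bsub>artin_alg n\<^esub> Y) = leading_part n k X \<oplus>\<^bsub>graded_artin_alg n\<^esub> leading_part n k Y"
  "X \<in> artin_filt n k \<Longrightarrow> leading_part n k (c \<odot>\<^bsub>artin_alg n\<^esub> X) = c \<odot>\<^bsub>graded_artin_alg n\<^esub> leading_part n k X"
  "X \<in> artin_filt n i \<Longrightarrow> Y \<in> artin_filt n j \<Longrightarrow>
    leading_part n (i + j) (X \<otimes>\<^bsub>artin_alg n\<^esub> Y) = leading_part n i X \<otimes>\<^bsub>graded_artin_alg n\<^esub> leading_part n j Y"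
  "\<pi> permutes {1..n} \<Longrightarrow> X \<in> artin_filt n k \<Longrightarrow>
    leading_part n k (coset_act \<pi> X) = coset_act \<pi> (leading_part n k X)"
  by (auto elim!: artin_filtE simp: art_simps gart_simps filt_carrier leading_part_art filt_ops filt_mult comp_add
      comp_smult comp_mult_filt comp_in_free coset_act_art coset_act_gart act_filt act_ops)

text \<open>If the component of degree \<open>k\<close> lies in the graded ideal, it lies in the closed ideal and may be
  subtracted from the series, which raises its order.\<close>

lemma leading_part_kernel:
  assumes "X \<in> artin_filt n k"
  shows "leading_part n k X = \<zero>\<^bsub>graded_artin_alg n\<^esub> \<longleftrightarrow> X \<in> artin_filt n (Suc k)"
proof -
  obtain f where f: "f \<in> series_filt n k" "X = art n f" using assms by (rule artin_filtE)
  note fc = filt_carrier[OF f(1)]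
  have "leading_part n k X = \<zero>\<^bsub>graded_artin_alg n\<^esub> \<longleftrightarrow> series_comp k f \<in> graded_ideal n"
    using coset_eq_self_iff[OF rat_alg_free graded_ideal comp_in_free[OF fc]]
    by (simp add: f(2) leading_part_art[OF f(1)] gart_simps)
  also have "\<dots> \<longleftrightarrow> X \<in> artin_filt n (Suc k)"
  proof
    assume c: "series_comp k f \<in> graded_ideal n"
    let ?g = "f \<ominus>\<^bsub>series_alg n\<^esub> series_comp k f"
    have "f \<ominus>\<^bsub>series_alg n\<^esub> ?g = series_comp k f"
      using fc comp_in_series[OF fc] by (auto simp: fun_eq_iff S_diff_apply)
    moreover have "series_comp k f \<in> closed_ideal n"
      using c comp_in_series[OF fc] comp_graded_ideal by (auto simp: closed_ideal_eq comps_in_def)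
    ultimately have "X = art n ?g" using fc comp_in_series[OF fc] by (simp add: f(2) art_eq_iff)
    then show "X \<in> artin_filt n (Suc k)" using filt_Suc_iff[OF f(1)] by (auto intro: artin_filtI)
  next
    assume "X \<in> artin_filt n (Suc k)"
    then obtain g where g: "g \<in> series_filt n (Suc k)" "X = art n g" by (rule artin_filtE)
    then have "f \<ominus>\<^bsub>series_alg n\<^esub> g \<in> closed_ideal n" using f(2) fc filt_carrier[OF g(1)] by (simp add: art_eq_iff[symmetric])
    then have "series_comp k (f \<ominus>\<^bsub>series_alg n\<^esub> g) \<in> graded_ideal n" by (auto simp: closed_ideal_eq comps_in_def)
    also have "series_comp k (f \<ominus>\<^bsub>series_alg n\<^esub> g) = series_comp k f"
      using g(1) filt_carrier[OF g(1)] by (auto simp: series_comp_def S_diff_apply fun_eq_iff series_filt_def)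
    finally show "series_comp k f \<in> graded_ideal n" .
  qed
  finally show ?thesis .
qed

lemma braid_filt_carrier: "y \<in> braid_filt n k \<Longrightarrow> y \<in> carrier (braid_alg n)"
  using artin_filt_carrier by (auto simp: braid_filt_def Br.carrier_C)

lemma braid_filt_iff: "y \<in> braid_filt n k \<longleftrightarrow> y \<in> carrier (braid_alg n) \<and> (\<forall>s\<in>carrier (sym_group n). y s \<in> artin_filt n k)"
  using braid_filt_carrier[of y n k] by (auto simp: braid_filt_def Br.carrier_C)

lemma braid_filt_0: "braid_filt n 0 = carrier (braid_alg n)"
  by (auto simp: braid_filt_iff artin_filt_0)

lemma artin_filt_finsum:
  assumes "finite T" "\<And>x. x \<in> T \<Longrightarrow> f x \<in> artin_filt n k"
  shows "leading_part n k (\<Oplus>\<^bsub>artin_alg n\<^esub>x\<in>T. f x) = (\<Oplus>\<^bsub>graded_artin_alg n\<^esub>x\<in>T. leading_part n k (f x))"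
    "(\<Oplus>\<^bsub>artin_alg n\<^esub>x\<in>T. f x) \<in> artin_filt n k"
proof -
  have K: "artin_filt n k \<subseteq> carrier (artin_alg n)" using artin_filt_carrier by blast
  have z: "leading_part n k \<zero>\<^bsub>artin_alg n\<^esub> = \<zero>\<^bsub>graded_artin_alg n\<^esub>"
    using leading_part_kernel[OF artin_filt_zero] artin_filt_zero by blast
  note * = finsum_additive[where h = "leading_part n k" and f = f, OF Art.abelian_monoid_axioms GArt.abelian_monoid_axioms K artin_filt_zero
      artin_filt_ops(1) leading_part_carrier z leading_part_ops(1) assms]
  show "leading_part n k (\<Oplus>\<^bsub>artin_alg n\<^esub>x\<in>T. f x) = (\<Oplus>\<^bsub>graded_artin_alg n\<^esub>x\<in>T. leading_part n k (f x))" by (rule *(1))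
  show "(\<Oplus>\<^bsub>artin_alg n\<^esub>x\<in>T. f x) \<in> artin_filt n k" by (rule *(2))
qed

lemma braid_term_filt:
  assumes "y \<in> braid_filt n i" "z \<in> braid_filt n j" "s \<in> carrier (sym_group n)" "x \<in> carrier (sym_group n)"
  shows "y x \<in> artin_filt n i" "z (inv\<^bsub>sym_group n\<^esub> x \<otimes>\<^bsub>sym_group n\<^esub> s) \<in> artin_filt n j"
    "y x \<otimes>\<^bsub>artin_alg n\<^esub> coset_act x (z (inv\<^bsub>sym_group n\<^esub> x \<otimes>\<^bsub>sym_group n\<^esub> s)) \<in> artin_filt n (i + j)"
proof -
  show 1: "y x \<in> artin_filt n i" using assms by (auto simp: braid_filt_iff)
  have "inv\<^bsub>sym_group n\<^esub> x \<otimes>\<^bsub>sym_group n\<^esub> s \<in> carrier (sym_group n)"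
    using assms by (intro group.subgroup_self group.is_monoid monoid.m_closed Br.G.m_closed Br.G.inv_closed)
  then show 2: "z (inv\<^bsub>sym_group n\<^esub> x \<otimes>\<^bsub>sym_group n\<^esub> s) \<in> artin_filt n j"
    using assms(2) unfolding braid_filt_iff by blast
  have "x permutes {1..n}" using assms(4) unfolding sym_group_carrier .
  from artin_filt_ops(3)[OF 1 artin_filt_ops(4)[OF this 2]]
  show "y x \<otimes>\<^bsub>artin_alg n\<^esub> coset_act x (z (inv\<^bsub>sym_group n\<^esub> x \<otimes>\<^bsub>sym_group n\<^esub> s)) \<in> artin_filt n (i + j)" .
qed

lemma braid_filt_ops:
  "y \<in> braid_filt n k \<Longrightarrow> z \<in> braid_filt n k \<Longrightarrow> y \<oplus>\<^bsub>braid_alg n\<^esub> z \<in> braid_filt n k"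
  "y \<in> braid_filt n k \<Longrightarrow> c \<odot>\<^bsub>braid_alg n\<^esub> y \<in> braid_filt n k"
  "y \<in> braid_filt n i \<Longrightarrow> z \<in> braid_filt n j \<Longrightarrow> y \<otimes>\<^bsub>braid_alg n\<^esub> z \<in> braid_filt n (i + j)"
  "\<zero>\<^bsub>braid_alg n\<^esub> \<in> braid_filt n k"
proof -
  show "y \<otimes>\<^bsub>braid_alg n\<^esub> z \<in> braid_filt n (i + j)" if yz: "y \<in> braid_filt n i" "z \<in> braid_filt n j"
    unfolding braid_filt_iff
  proof (intro conjI ballI)
    show "y \<otimes>\<^bsub>braid_alg n\<^esub> z \<in> carrier (braid_alg n)"
      using yz braid_filt_carrier by (intro Br.C.m_closed)
    fix s assume s: "s \<in> carrier (sym_group n)"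
    show "(y \<otimes>\<^bsub>braid_alg n\<^esub> z) s \<in> artin_filt n (i + j)"
      unfolding Br.C_ops(1)[OF s] by (intro artin_filt_finsum(2) finite_sym_group braid_term_filt(3)[OF yz s])
  qed
qed (auto simp: braid_filt_iff Br.C_ops artin_filt_ops artin_filt_zero)

lemma braid_filt_ideal: "ideal (braid_filt n k) (braid_alg n)"
proof (rule idealI)
  show "ring (braid_alg n)" by (rule Br.C.ring_axioms)
  show "subgroup (braid_filt n k) (add_monoid (braid_alg n))"
  proof (rule Br.C.add.subgroupI, goal_cases)
    case 2
    show ?case using braid_filt_ops(4) by blast
  next
    case (3 y)
    then have yc: "y \<in> carrier (braid_alg n)" by (rule braid_filt_carrier)
    have "\<ominus>\<^bsub>braid_alg n\<^esub> y = (-1) \<odot>\<^bsub>braid_alg n\<^esub> y"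
    proof (rule Br.C.minus_equality)
      have "(-1) \<odot>\<^bsub>braid_alg n\<^esub> y \<oplus>\<^bsub>braid_alg n\<^esub> y = (-1 + 1) \<odot>\<^bsub>braid_alg n\<^esub> y"
        using yc by (simp only: Br.C.smult_l_distr Br.C.smult_one)
      then show "(-1) \<odot>\<^bsub>braid_alg n\<^esub> y \<oplus>\<^bsub>braid_alg n\<^esub> y = \<zero>\<^bsub>braid_alg n\<^esub>" using yc by simp
    qed (use yc in auto)
    then show ?case using braid_filt_ops(2)[OF 3] by simp
  qed (use braid_filt_carrier braid_filt_ops in auto)
  fix y z assume "y \<in> braid_filt n k" "z \<in> carrier (braid_alg n)"
  then show "z \<otimes>\<^bsub>braid_alg n\<^esub> y \<in> braid_filt n k" "y \<otimes>\<^bsub>braid_alg n\<^esub> z \<in> braid_filt n k"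
    using braid_filt_ops(3)[of z n 0 y k] braid_filt_ops(3)[of y n k z 0] by (auto simp: braid_filt_0)
qed

lemma braid_filt_Suc: "braid_filt n (Suc k) \<subseteq> braid_filt n k"
  using artin_filt_Suc unfolding braid_filt_iff subset_iff by blast

text \<open>The leading term of degree \<open>k\<close> of an element of the braid algebra.\<close>

definition lead :: "nat \<Rightarrow> nat \<Rightarrow> ((nat \<Rightarrow> nat) \<Rightarrow> series set) \<Rightarrow> (nat \<Rightarrow> nat) \<Rightarrow> series set" where
  "lead n k y = (\<lambda>s\<in>carrier (sym_group n). leading_part n k (y s))"

lemma lead_part: "y \<in> braid_filt n k \<Longrightarrow> lead n k y \<in> graded_braid_part n k"
  by (auto simp: lead_def graded_braid_part_def braid_filt_iff leading_part_closed)

lemma graded_braid_part_carrier: "b \<in> graded_braid_part n k \<Longrightarrow> b \<in> carrier (graded_braid_alg n)"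
  using graded_artin_part_carrier by (auto simp: graded_braid_part_def GBr.carrier_C)

lemma lead_carrier: "y \<in> braid_filt n k \<Longrightarrow> lead n k y \<in> carrier (graded_braid_alg n)"
  by (rule graded_braid_part_carrier[OF lead_part])

lemma lead_apply: "s \<in> carrier (sym_group n) \<Longrightarrow> lead n k y s = leading_part n k (y s)"
  by (simp add: lead_def)

lemma lead_add:
  assumes "y \<in> braid_filt n k" "z \<in> braid_filt n k"
  shows "lead n k (y \<oplus>\<^bsub>braid_alg n\<^esub> z) = lead n k y \<oplus>\<^bsub>graded_braid_alg n\<^esub> lead n k z"
  by (rule GBr.C_eqI)
     (use assms braid_filt_ops lead_carrier GBr.C_closed(2) in
       \<open>auto simp: lead_apply GBr.C_ops Br.C_ops braid_filt_iff leading_part_ops\<close>)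

lemma lead_smult:
  assumes "y \<in> braid_filt n k"
  shows "lead n k (c \<odot>\<^bsub>braid_alg n\<^esub> y) = c \<odot>\<^bsub>graded_braid_alg n\<^esub> lead n k y"
  by (rule GBr.C_eqI)
     (use assms braid_filt_ops lead_carrier GBr.C_closed(3) in
       \<open>auto simp: lead_apply GBr.C_ops Br.C_ops braid_filt_iff leading_part_ops\<close>)

lemma lead_mult:
  assumes "y \<in> braid_filt n i" "z \<in> braid_filt n j"
  shows "lead n (i + j) (y \<otimes>\<^bsub>braid_alg n\<^esub> z) = lead n i y \<otimes>\<^bsub>graded_braid_alg n\<^esub> lead n j z"
proof (rule GBr.C_eqI)
  show "lead n (i + j) (y \<otimes>\<^bsub>braid_alg n\<^esub> z) \<in> carrier (graded_braid_alg n)"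
    by (rule lead_carrier[OF braid_filt_ops(3)[OF assms]])
  show "lead n i y \<otimes>\<^bsub>graded_braid_alg n\<^esub> lead n j z \<in> carrier (graded_braid_alg n)"
    using lead_carrier[OF assms(1)] lead_carrier[OF assms(2)] by (rule GBr.C_closed(1))
  fix s assume s: "s \<in> carrier (sym_group n)"
  have "lead n (i + j) (y \<otimes>\<^bsub>braid_alg n\<^esub> z) s = (\<Oplus>\<^bsub>graded_artin_alg n\<^esub>x\<in>carrier (sym_group n).
      leading_part n (i + j) (y x \<otimes>\<^bsub>artin_alg n\<^esub> coset_act x (z (inv\<^bsub>sym_group n\<^esub> x \<otimes>\<^bsub>sym_group n\<^esub> s))))"
    unfolding lead_apply[OF s] Br.C_ops(1)[OF s]
    by (intro artin_filt_finsum(1) finite_sym_group braid_term_filt(3)[OF assms s])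
  also have "\<dots> = (lead n i y \<otimes>\<^bsub>graded_braid_alg n\<^esub> lead n j z) s"
    unfolding GBr.C_ops(1)[OF s]
  proof (rule GArt.finsum_cong'[OF refl])
    fix x assume x: "x \<in> carrier (sym_group n)"
    note t = braid_term_filt[OF assms s x]
    have xp: "x permutes {1..n}" using x unfolding sym_group_carrier .
    have xs: "inv\<^bsub>sym_group n\<^esub> x \<otimes>\<^bsub>sym_group n\<^esub> s \<in> carrier (sym_group n)"
      using x s by (intro Br.G.m_closed Br.G.inv_closed)
    show "leading_part n (i + j) (y x \<otimes>\<^bsub>artin_alg n\<^esub> coset_act x (z (inv\<^bsub>sym_group n\<^esub> x \<otimes>\<^bsub>sym_group n\<^esub> s)))
        = lead n i y x \<otimes>\<^bsub>graded_artin_alg n\<^esub> coset_act x (lead n j z (inv\<^bsub>sym_group n\<^esub> x \<otimes>\<^bsub>sym_group n\<^esub> s))"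
      unfolding lead_apply[OF x] lead_apply[OF xs]
      by (simp only: leading_part_ops(3)[OF t(1) artin_filt_ops(4)[OF xp t(2)]] leading_part_ops(4)[OF xp t(2)])
  qed (intro funcsetI GBr.term_closed lead_carrier assms s)
  finally show "lead n (i + j) (y \<otimes>\<^bsub>braid_alg n\<^esub> z) s = (lead n i y \<otimes>\<^bsub>graded_braid_alg n\<^esub> lead n j z) s" .
qed

lemma lead_kernel:
  assumes "y \<in> braid_filt n k"
  shows "lead n k y = \<zero>\<^bsub>graded_braid_alg n\<^esub> \<longleftrightarrow> y \<in> braid_filt n (Suc k)"
proof -
  have "lead n k y = \<zero>\<^bsub>graded_braid_alg n\<^esub> \<longleftrightarrow> (\<forall>s\<in>carrier (sym_group n). leading_part n k (y s) = \<zero>\<^bsub>graded_artin_alg n\<^esub>)"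
  proof
    assume l: "lead n k y = \<zero>\<^bsub>graded_braid_alg n\<^esub>"
    show "\<forall>s\<in>carrier (sym_group n). leading_part n k (y s) = \<zero>\<^bsub>graded_artin_alg n\<^esub>"
    proof
      fix s assume "s \<in> carrier (sym_group n)"
      then show "leading_part n k (y s) = \<zero>\<^bsub>graded_artin_alg n\<^esub>"
        using fun_cong[OF l, of s] GBr.C_ops(4)[of s n] lead_apply[of s n k y] by simp
    qed
  next
    assume "\<forall>s\<in>carrier (sym_group n). leading_part n k (y s) = \<zero>\<^bsub>graded_artin_alg n\<^esub>"
    then show "lead n k y = \<zero>\<^bsub>graded_braid_alg n\<^esub>"
      by (intro GBr.C_eqI[OF lead_carrier[OF assms] GBr.C_closed(4)]) (simp add: lead_apply GBr.C_ops)
  qed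
  also have "\<dots> \<longleftrightarrow> y \<in> braid_filt n (Suc k)"
    using assms leading_part_kernel by (auto simp: braid_filt_iff)
  finally show ?thesis .
qed

lemma lead_pure:
  assumes "f \<in> series_filt n k" "s \<in> carrier (sym_group n)"
  shows "lead n k (pure_tensor (artin_alg n) (sym_group n) (art n f) s)
    = pure_tensor (graded_artin_alg n) (sym_group n) (gart n (series_comp k f)) s"
    "pure_tensor (artin_alg n) (sym_group n) (art n f) s \<in> braid_filt n k"
proof -
  have z: "leading_part n k \<zero>\<^bsub>artin_alg n\<^esub> = \<zero>\<^bsub>graded_artin_alg n\<^esub>"
    using leading_part_kernel[OF artin_filt_zero] artin_filt_zero by blast
  show "lead n k (pure_tensor (artin_alg n) (sym_group n) (art n f) s)
    = pure_tensor (graded_artin_alg n) (sym_group n) (gart n (series_comp k f)) s"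
    using assms z by (auto simp: lead_def pure_tensor_def leading_part_art restrict_def fun_eq_iff)
  show "pure_tensor (artin_alg n) (sym_group n) (art n f) s \<in> braid_filt n k"
    using assms filt_carrier[OF assms(1)] by (auto simp: braid_filt_iff pure_tensor_def artin_filtI artin_filt_zero Br.carrier_C)
qed

text \<open>The graded ideal is homogeneous, so a finite sum of classes of different degrees vanishes only
  termwise.\<close>

lemma graded_artin_direct:
  assumes "\<And>k. b k \<in> graded_artin_part n k" "(\<Oplus>\<^bsub>graded_artin_alg n\<^esub>k\<in>{..N}. b k) = \<zero>\<^bsub>graded_artin_alg n\<^esub>" "k \<le> N"
  shows "b k = \<zero>\<^bsub>graded_artin_alg n\<^esub>"
proof -
  have "\<exists>f. f \<in> carrier (free_alg n) \<and> (\<forall>w. f w \<noteq> 0 \<longrightarrow> length w = k) \<and> b k = gart n f" for k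
    using assms(1)[of k] by (auto simp: graded_artin_part_def)
  then obtain f where f: "\<And>k. f k \<in> carrier (free_alg n)" "\<And>k w. f k w \<noteq> 0 \<Longrightarrow> length w = k" "\<And>k. b k = gart n (f k)"
    by metis
  let ?F = "\<Oplus>\<^bsub>free_alg n\<^esub>k\<in>{..N}. f k"
  have Fc: "?F \<in> carrier (free_alg n)" using f(1) by (auto intro!: Fr.finsum_closed)
  have "gart n ?F = \<zero>\<^bsub>graded_artin_alg n\<^esub>"
    using coset_finsum[OF rat_alg_free graded_ideal, of "{..N}" f] f assms(2) by (simp add: graded_artin_alg_def)
  then have "?F \<in> graded_ideal n"
    using coset_eq_self_iff[OF rat_alg_free graded_ideal Fc] by (simp add: gart_simps)
  then have "series_comp k ?F \<in> graded_ideal n" by (rule comp_graded_ideal)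
  also have "series_comp k ?F = f k"
  proof
    fix w
    have "?F w = (\<Sum>i\<le>N. f i w)"
      using f(1) by (subst free_finsum) (auto simp: S_finsum_apply free_in_series)
    also have "\<dots> = (\<Sum>i\<le>N. if i = length w then f i w else 0)" using f(2) by (intro sum.cong) auto
    also have "\<dots> = (if length w \<le> N then f (length w) w else 0)" by simp
    finally show "series_comp k ?F w = f k w" using assms(3) f(2)[of k w] by (auto simp: series_comp_def)
  qed
  finally have "f k \<in> graded_ideal n" .
  then show ?thesis using f coset_eq_self_iff[OF rat_alg_free graded_ideal f(1)] by (simp add: gart_simps)
qed

lemma graded_braid_direct:
  assumes "\<And>k. b k \<in> graded_braid_part n k" "(\<Oplus>\<^bsub>graded_braid_alg n\<^esub>k\<in>{..N}. b k) = \<zero>\<^bsub>graded_braid_alg n\<^esub>" "k \<le> N"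
  shows "b k = \<zero>\<^bsub>graded_braid_alg n\<^esub>"
proof (rule GBr.C_eqI)
  have bc: "b k \<in> carrier (graded_braid_alg n)" for k using assms(1) by (rule graded_braid_part_carrier)
  then show "b k \<in> carrier (graded_braid_alg n)" .
  fix s assume s: "s \<in> carrier (sym_group n)"
  have "(\<Oplus>\<^bsub>graded_artin_alg n\<^esub>k\<in>{..N}. b k s) = (\<Oplus>\<^bsub>graded_braid_alg n\<^esub>k\<in>{..N}. b k) s"
    using bc s by (intro GBr.C_finsum_apply[symmetric]) auto
  also have "\<dots> = \<zero>\<^bsub>graded_artin_alg n\<^esub>" using s by (simp add: assms(2) GBr.C_ops)
  finally have sum: "(\<Oplus>\<^bsub>graded_artin_alg n\<^esub>k\<in>{..N}. b k s) = \<zero>\<^bsub>graded_artin_alg n\<^esub>" .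
  have "b m s \<in> graded_artin_part n m" for m
    using assms(1)[of m] s unfolding graded_braid_part_def by blast
  then have "b k s = \<zero>\<^bsub>graded_artin_alg n\<^esub>"
    by (rule graded_artin_direct[where b = "\<lambda>k. b k s", OF _ sum assms(3)])
  then show "b k s = \<zero>\<^bsub>graded_braid_alg n\<^esub> s" using s by (simp add: GBr.C_ops)
qed (rule GBr.C_closed)

lemma graded_braid_span:
  assumes b: "b \<in> carrier (graded_braid_alg n)"
  shows "\<exists>N c. (\<forall>k. c k \<in> graded_braid_part n k) \<and> b = (\<Oplus>\<^bsub>graded_braid_alg n\<^esub>k\<in>{..N::nat}. c k)"
proof -
  have "\<exists>f. f \<in> carrier (free_alg n) \<and> b s = gart n f" if "s \<in> carrier (sym_group n)" for s
    using gartE[OF GBr.C_apply[OF b that]] by metis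
  then obtain f where f: "\<And>s. s \<in> carrier (sym_group n) \<Longrightarrow> f s \<in> carrier (free_alg n)"
    "\<And>s. s \<in> carrier (sym_group n) \<Longrightarrow> b s = gart n (f s)" by metis
  let ?W = "\<Union>s\<in>carrier (sym_group n). {w. f s w \<noteq> 0}"
  have "finite (length ` ?W)" using f(1) finite_sym_group by (auto simp: free_carrier)
  then obtain N where N: "\<forall>m\<in>length ` ?W. m \<le> N" unfolding finite_nat_set_iff_bounded_le ..
  let ?c = "\<lambda>k. \<lambda>s\<in>carrier (sym_group n). gart n (series_comp k (f s))"
  have c: "?c k \<in> graded_braid_part n k" for k
    using f(1) by (auto simp: graded_braid_part_def free_in_series intro!: gart_comp_part)
  have sum: "b = (\<Oplus>\<^bsub>graded_braid_alg n\<^esub>k\<in>{..N}. ?c k)"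
  proof (rule GBr.C_eqI[OF b])
    show "(\<Oplus>\<^bsub>graded_braid_alg n\<^esub>k\<in>{..N}. ?c k) \<in> carrier (graded_braid_alg n)"
      using graded_braid_part_carrier[OF c] by (auto intro!: GBr.C.finsum_closed)
    fix s assume s: "s \<in> carrier (sym_group n)"
    have fs: "f s \<in> carrier (series_alg n)" using f(1)[OF s] by (rule free_in_series)
    have "(\<Oplus>\<^bsub>graded_braid_alg n\<^esub>k\<in>{..N}. ?c k) s = (\<Oplus>\<^bsub>graded_artin_alg n\<^esub>k\<in>{..N}. gart n (series_comp k (f s)))"
      using graded_braid_part_carrier[OF c] s by (subst GBr.C_finsum_apply) auto
    also have "\<dots> = gart n (\<Oplus>\<^bsub>free_alg n\<^esub>k\<in>{..N}. series_comp k (f s))"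
      unfolding graded_artin_alg_def using fs by (intro coset_finsum[OF rat_alg_free graded_ideal]) (auto intro: comp_in_free)
    also have "(\<Oplus>\<^bsub>free_alg n\<^esub>k\<in>{..N}. series_comp k (f s)) = f s"
    proof
      fix w
      have "(\<Oplus>\<^bsub>free_alg n\<^esub>k\<in>{..N}. series_comp k (f s)) w = (\<Sum>k\<le>N. series_comp k (f s) w)"
        using comp_in_free[OF fs] comp_in_series[OF fs] by (subst free_finsum) (auto simp: S_finsum_apply)
      also have "\<dots> = (\<Sum>k\<le>N. if k = length w then f s w else 0)" by (intro sum.cong) (auto simp: series_comp_def)
      also have "\<dots> = (if length w \<le> N then f s w else 0)" by simp
      also have "\<dots> = f s w" using N s by force
      finally show "(\<Oplus>\<^bsub>free_alg n\<^esub>k\<in>{..N}. series_comp k (f s)) w = f s w" .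
    qed
    finally show "b s = (\<Oplus>\<^bsub>graded_braid_alg n\<^esub>k\<in>{..N}. ?c k) s" unfolding f(2)[OF s] by (rule sym)
  qed
  show ?thesis
    by (rule exI[of _ N], rule exI[of _ ?c]) (intro conjI allI c sum)
qed

section \<open>Existence and uniqueness of the representation\<close>

interpretation Q: rat_alg "BP_alg n" for n
  unfolding BP_alg_def by (rule rat_alg_group_algebra[OF group_BP])

interpretation B: group "BP n" for n by (rule group_BP)

lemma BP_alg_ops:
  "f \<oplus>\<^bsub>BP_alg n\<^esub> g = (\<lambda>x. f x + g x)" "\<zero>\<^bsub>BP_alg n\<^esub> = (\<lambda>x. 0)" "c \<odot>\<^bsub>BP_alg n\<^esub> f = (\<lambda>x. c * f x)"
  "\<one>\<^bsub>BP_alg n\<^esub> = ga_elem \<one>\<^bsub>BP n\<^esub>"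
  by (auto simp: BP_alg_def group_algebra_def ga_elem_def)

lemma carrier_BP_alg: "carrier (BP_alg n) = {f. finite {x. f x \<noteq> 0} \<and> {x. f x \<noteq> 0} \<subseteq> carrier (BP n)}"
  by (simp add: BP_alg_def group_algebra_def)

lemma ga_closed [simp, intro]: "a \<in> carrier (BP n) \<Longrightarrow> ga_elem a \<in> carrier (BP_alg n)"
  by (auto simp: carrier_BP_alg ga_elem_def)

lemma ga_mult: "ga_elem a \<otimes>\<^bsub>BP_alg n\<^esub> ga_elem b = ga_elem (a \<otimes>\<^bsub>BP n\<^esub> b)"
  unfolding BP_alg_def by (rule ga_elem_mult)

lemma BP_alg_induct [consumes 1, case_names zero add]:
  assumes "f \<in> carrier (BP_alg n)" "Q \<zero>\<^bsub>BP_alg n\<^esub>"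
    and "\<And>c a g. a \<in> carrier (BP n) \<Longrightarrow> g \<in> carrier (BP_alg n) \<Longrightarrow> Q g \<Longrightarrow>
      Q (c \<odot>\<^bsub>BP_alg n\<^esub> ga_elem a \<oplus>\<^bsub>BP_alg n\<^esub> g)"
  shows "Q f"
proof -
  have "finite {x. f x \<noteq> 0}" "{x. f x \<noteq> 0} \<subseteq> carrier (BP n)" using assms(1) by (auto simp: carrier_BP_alg)
  then show ?thesis
  proof (induction rule: finsupp_induct)
    case zero
    then show ?case using assms(2) by (simp add: BP_alg_ops)
  next
    case (add c x g)
    have "(\<lambda>y. (if y = x then c else 0) + g y) = c \<odot>\<^bsub>BP_alg n\<^esub> ga_elem x \<oplus>\<^bsub>BP_alg n\<^esub> g"
      by (auto simp: BP_alg_ops ga_elem_def fun_eq_iff)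
    then show ?case using assms(3)[of x g c] add by (simp add: carrier_BP_alg)
  qed
qed

abbreviation pure :: "nat \<Rightarrow> series set \<Rightarrow> (nat \<Rightarrow> nat) \<Rightarrow> (nat \<Rightarrow> nat) \<Rightarrow> series set" where
  "pure n \<equiv> pure_tensor (artin_alg n) (sym_group n)"

abbreviation gpure :: "nat \<Rightarrow> series set \<Rightarrow> (nat \<Rightarrow> nat) \<Rightarrow> (nat \<Rightarrow> nat) \<Rightarrow> series set" where
  "gpure n \<equiv> pure_tensor (graded_artin_alg n) (sym_group n)"

lemma id_sym [simp]: "id \<in> carrier (sym_group n)"
  by (simp add: sym_group_carrier permutes_id)

lemma coset_act_id_art: "X \<in> carrier (artin_alg n) \<Longrightarrow> coset_act id X = X"
  using Br.act_id[of X n] by (simp add: sym_group_one)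

lemma pure_mult_perm:
  assumes "X \<in> carrier (artin_alg n)" "Y \<in> carrier (artin_alg n)" "s \<in> carrier (sym_group n)" "t \<in> carrier (sym_group n)"
  shows "pure n X s \<otimes>\<^bsub>braid_alg n\<^esub> pure n Y t = pure n (X \<otimes>\<^bsub>artin_alg n\<^esub> coset_act s Y) (s \<circ> t)"
  using Br.pure_mult[OF assms] by (simp add: sym_group_mult)

lemma pure_id_mult:
  assumes "X \<in> carrier (artin_alg n)" "Y \<in> carrier (artin_alg n)" "t \<in> carrier (sym_group n)"
  shows "pure n X id \<otimes>\<^bsub>braid_alg n\<^esub> pure n Y t = pure n (X \<otimes>\<^bsub>artin_alg n\<^esub> Y) t"
  using pure_mult_perm[OF assms(1,2) id_sym assms(3)] coset_act_id_art[OF assms(2)] by simp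

lemma is_artin_rep_conj:
  assumes "is_artin_rep n R" "(i, j) \<in> indices n"
  shows "R (ga_elem (conj_aut n i j)) = pure_tensor (artin_alg n) (sym_group n) (artin_exp n i j) id"
  using assms unfolding is_artin_rep_def by (auto dest!: bspec[of _ _ "(i, j)"] simp: sym_group_one)

lemma is_artin_rep_perm:
  assumes "is_artin_rep n R" "s \<in> carrier (sym_group n)"
  shows "R (ga_elem (perm_aut n s)) = pure_tensor (artin_alg n) (sym_group n) \<one>\<^bsub>artin_alg n\<^esub> s"
  using assms unfolding is_artin_rep_def by blast

lemma pure_one: "pure n \<one>\<^bsub>artin_alg n\<^esub> id = \<one>\<^bsub>braid_alg n\<^esub>"
  by (simp add: Br.C_ops(5) sym_group_one)

lemma var_filt: "(i, j) \<in> indices n \<Longrightarrow> series_var i j \<in> series_filt n 1"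
  using var_series by (auto simp: series_filt_def series_var_def)

lemma series_act_pow:
  assumes "\<pi> permutes {1..n}" "f \<in> carrier (series_alg n)"
  shows "series_act \<pi> (f [^]\<^bsub>series_alg n\<^esub> (k::nat)) = series_act \<pi> f [^]\<^bsub>series_alg n\<^esub> k"
  by (induction k) (auto simp: act_ops)

lemma series_act_exp:
  assumes "\<pi> permutes {1..n}" "f \<in> carrier (series_alg n)"
  shows "series_act \<pi> (series_exp n f) = series_exp n (series_act \<pi> f)"
proof
  fix w
  have "series_act \<pi> (series_exp n f) w = (\<Sum>k\<le>length w. series_act \<pi> (f [^]\<^bsub>series_alg n\<^esub> k) w / fact k)"
    by (simp add: series_act_def series_exp_def)
  also have "\<dots> = series_exp n (series_act \<pi> f) w"
    by (simp only: series_act_pow[OF assms] series_exp_def)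
  finally show "series_act \<pi> (series_exp n f) w = series_exp n (series_act \<pi> f) w" .
qed

lemma artin_exp_closed: "(i, j) \<in> indices n \<Longrightarrow> artin_exp n i j \<in> carrier (artin_alg n)"
  unfolding artin_exp_def by (intro art_closed exp_carrier var_series)

lemma coset_act_artin_exp:
  assumes "\<pi> permutes {1..n}" "(i, j) \<in> indices n"
  shows "coset_act \<pi> (artin_exp n i j) = artin_exp n (\<pi> i) (\<pi> j)"
  unfolding artin_exp_def
  by (simp only: coset_act_art[OF assms(1) exp_carrier[OF var_series[OF assms(2)]]]
      series_act_exp[OF assms(1) var_series[OF assms(2)]] act_var[OF assms(1)])

text \<open>The relators are commutators, so that dividing by them makes the two entries commute.\<close>

lemma relator_commute:
  assumes "f \<in> carrier (series_alg n)" "g \<in> carrier (series_alg n)"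
    "commutator (series_alg n) f g \<in> relators n (series_alg n)"
  shows "art n f \<otimes>\<^bsub>artin_alg n\<^esub> art n g = art n g \<otimes>\<^bsub>artin_alg n\<^esub> art n f"
proof -
  have "commutator (series_alg n) f g \<in> graded_ideal n"
    using assms(3) by (intro relators_graded_ideal) (simp add: relators_free_series)
  then have "commutator (series_alg n) f g \<in> closed_ideal n"
    using assms(1,2) comp_graded_ideal by (auto simp: closed_ideal_eq comps_in_def commutator_def)
  then show ?thesis using assms(1,2) by (simp add: art_simps art_eq_iff commutator_def)
qed

lemma indicesI: "i \<in> {1..n} \<Longrightarrow> j \<in> {1..n} \<Longrightarrow> i \<noteq> j \<Longrightarrow> (i, j) \<in> indices n"
  unfolding indices_def by blast

lemma artin_exp_same:
  assumes "{i, j, k} \<subseteq> {1..n}" "distinct [i, j, k]"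
  shows "artin_exp n i k \<otimes>\<^bsub>artin_alg n\<^esub> artin_exp n j k = artin_exp n j k \<otimes>\<^bsub>artin_alg n\<^esub> artin_exp n i k"
proof -
  have ix: "(i, k) \<in> indices n" "(j, k) \<in> indices n" using assms by (auto intro!: indicesI)
  show ?thesis unfolding artin_exp_def
    by (rule exp_commute[OF var_filt[OF ix(1)] var_filt[OF ix(2)]])
       (rule relator_commute[OF var_series[OF ix(1)] var_series[OF ix(2)] relatorsI(1)[OF assms]])
qed

lemma artin_exp_disjoint:
  assumes "{i, j, k, l} \<subseteq> {1..n}" "distinct [i, j, k, l]"
  shows "artin_exp n i j \<otimes>\<^bsub>artin_alg n\<^esub> artin_exp n k l = artin_exp n k l \<otimes>\<^bsub>artin_alg n\<^esub> artin_exp n i j"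
proof -
  have ix: "(i, j) \<in> indices n" "(k, l) \<in> indices n" using assms by (auto intro!: indicesI)
  show ?thesis unfolding artin_exp_def
    by (rule exp_commute[OF var_filt[OF ix(1)] var_filt[OF ix(2)]])
       (rule relator_commute[OF var_series[OF ix(1)] var_series[OF ix(2)] relatorsI(3)[OF assms]])
qed

text \<open>The two factors on the right commute, so their product is the exponential of \<open>v\<^sub>i\<^sub>k + v\<^sub>j\<^sub>k\<close>, which commutes
  with \<open>v\<^sub>i\<^sub>j\<close>.\<close>

lemma artin_exp_triple:
  assumes "{i, j, k} \<subseteq> {1..n}" "distinct [i, j, k]"
  shows "artin_exp n i j \<otimes>\<^bsub>artin_alg n\<^esub> (artin_exp n i k \<otimes>\<^bsub>artin_alg n\<^esub> artin_exp n j k)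
       = (artin_exp n i k \<otimes>\<^bsub>artin_alg n\<^esub> artin_exp n j k) \<otimes>\<^bsub>artin_alg n\<^esub> artin_exp n i j"
proof -
  have ix: "(i, j) \<in> indices n" "(i, k) \<in> indices n" "(j, k) \<in> indices n" using assms by (auto intro!: indicesI)
  let ?g = "series_var i k \<oplus>\<^bsub>series_alg n\<^esub> series_var j k"
  have g: "?g \<in> series_filt n 1" by (intro filt_ops var_filt ix)
  have prod: "artin_exp n i k \<otimes>\<^bsub>artin_alg n\<^esub> artin_exp n j k = art n (series_exp n ?g)"
    unfolding artin_exp_def
    by (rule exp_add[OF var_filt[OF ix(2)] var_filt[OF ix(3)]])
       (rule relator_commute[OF var_series[OF ix(2)] var_series[OF ix(3)] relatorsI(1)[OF assms]])
  show ?thesis unfolding prod unfolding artin_exp_def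
    by (rule exp_commute[OF var_filt[OF ix(1)] g])
       (rule relator_commute[OF var_series[OF ix(1)] filt_carrier[OF g] relatorsI(2)[OF assms]])
qed

lemma artin_exp_inverse:
  assumes "(i, j) \<in> indices n"
  shows "\<exists>X\<in>carrier (artin_alg n). artin_exp n i j \<otimes>\<^bsub>artin_alg n\<^esub> X = \<one>\<^bsub>artin_alg n\<^esub> \<and>
    X \<otimes>\<^bsub>artin_alg n\<^esub> artin_exp n i j = \<one>\<^bsub>artin_alg n\<^esub>"
proof -
  let ?f = "series_var i j"
  let ?g = "\<ominus>\<^bsub>series_alg n\<^esub> ?f"
  note f = var_filt[OF assms] and fc = var_series[OF assms]
  have g: "?g \<in> series_filt n 1" using f fc by (auto simp: series_filt_def S_minus_apply)
  have "\<ominus>\<^bsub>series_alg n\<^esub> ?g = ?f" using fc by simp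
  then show ?thesis
    using exp_inverse[OF f] exp_inverse[OF g] exp_carrier[OF filt_carrier[OF g]]
    by (intro bexI[of _ "art n (series_exp n ?g)"]) (auto simp: artin_exp_def)
qed

lemma pure_exp_unit:
  assumes "(i, j) \<in> indices n"
  shows "pure n (artin_exp n i j) id \<in> Units (braid_alg n)"
proof -
  obtain X where X: "X \<in> carrier (artin_alg n)" "artin_exp n i j \<otimes>\<^bsub>artin_alg n\<^esub> X = \<one>\<^bsub>artin_alg n\<^esub>"
    "X \<otimes>\<^bsub>artin_alg n\<^esub> artin_exp n i j = \<one>\<^bsub>artin_alg n\<^esub>"
    using artin_exp_inverse[OF assms] by blast
  note e = artin_exp_closed[OF assms]
  show ?thesis unfolding Units_def mem_Collect_eq
    by (intro conjI bexI[of _ "pure n X id"])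
       (use X e in \<open>auto simp: pure_mult_perm coset_act_id_art pure_one\<close>)
qed

lemma coset_act_one: "s permutes {1..n} \<Longrightarrow> coset_act s \<one>\<^bsub>artin_alg n\<^esub> = \<one>\<^bsub>artin_alg n\<^esub>"
  using Br.act_one[of s n] unfolding sym_group_carrier .

lemma pure_perm_unit:
  assumes "s \<in> carrier (sym_group n)"
  shows "pure n \<one>\<^bsub>artin_alg n\<^esub> s \<in> Units (braid_alg n)"
proof -
  have s: "s permutes {1..n}" using assms unfolding sym_group_carrier .
  have t: "Hilbert_Choice.inv s permutes {1..n}" by (rule permutes_inv[OF s])
  then have tc: "Hilbert_Choice.inv s \<in> carrier (sym_group n)" unfolding sym_group_carrier .
  show ?thesis unfolding Units_def mem_Collect_eq
    by (intro conjI bexI[of _ "pure n \<one>\<^bsub>artin_alg n\<^esub> (Hilbert_Choice.inv s)"])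
       (use assms tc s t in \<open>auto simp: pure_mult_perm coset_act_one permutes_inv_o pure_one\<close>)
qed

interpretation Rel: BP_relations "units_of (braid_alg n)" n "\<lambda>i j. pure n (artin_exp n i j) id" "\<lambda>s. pure n \<one>\<^bsub>artin_alg n\<^esub> s" for n
proof (intro BP_relations.intro BP_relations_axioms.intro)
  show "group (units_of (braid_alg n))" by (rule Br.C.units_group)
  show "pure n (artin_exp n i j) id \<in> carrier (units_of (braid_alg n))" if "(i, j) \<in> indices n" for i j
    unfolding units_of_carrier by (rule pure_exp_unit[OF that])
  show "(\<lambda>s. pure n \<one>\<^bsub>artin_alg n\<^esub> s) \<in> hom (sym_group n) (units_of (braid_alg n))"
  proof (rule homI)
    fix s t assume st: "s \<in> carrier (sym_group n)" "t \<in> carrier (sym_group n)"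
    show "pure n \<one>\<^bsub>artin_alg n\<^esub> s \<in> carrier (units_of (braid_alg n))"
      unfolding units_of_carrier by (rule pure_perm_unit[OF st(1)])
    have "s permutes {1..n}" using st(1) unfolding sym_group_carrier .
    then show "pure n \<one>\<^bsub>artin_alg n\<^esub> (s \<otimes>\<^bsub>sym_group n\<^esub> t)
        = pure n \<one>\<^bsub>artin_alg n\<^esub> s \<otimes>\<^bsub>units_of (braid_alg n)\<^esub> pure n \<one>\<^bsub>artin_alg n\<^esub> t"
      using st by (simp add: units_of_mult pure_mult_perm coset_act_one sym_group_mult)
  qed
  fix i j k l :: nat
  show "pure n \<one>\<^bsub>artin_alg n\<^esub> s \<otimes>\<^bsub>units_of (braid_alg n)\<^esub> pure n (artin_exp n i j) id
      = pure n (artin_exp n (s i) (s j)) id \<otimes>\<^bsub>units_of (braid_alg n)\<^esub> pure n \<one>\<^bsub>artin_alg n\<^esub> s"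
    if s: "s permutes {1..n}" and ij: "(i, j) \<in> indices n" for s
  proof -
    have "s \<in> carrier (sym_group n)" using s unfolding sym_group_carrier .
    moreover have "(s i, s j) \<in> indices n" using ij by (simp only: indices_perm[OF s])
    ultimately show ?thesis
      using artin_exp_closed[OF ij] artin_exp_closed[of "s i" "s j" n]
      by (simp add: units_of_mult pure_mult_perm coset_act_artin_exp[OF s ij] coset_act_one[OF permutes_id])
  qed
  show "pure n (artin_exp n i k) id \<otimes>\<^bsub>units_of (braid_alg n)\<^esub> pure n (artin_exp n j k) id
      = pure n (artin_exp n j k) id \<otimes>\<^bsub>units_of (braid_alg n)\<^esub> pure n (artin_exp n i k) id"
    if h: "{i, j, k} \<subseteq> {1..n}" "distinct [i, j, k]"
  proof -
    have "(i, k) \<in> indices n" "(j, k) \<in> indices n" using h by (auto intro!: indicesI)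
    then show ?thesis using artin_exp_same[OF h]
      by (simp add: units_of_mult artin_exp_closed pure_id_mult)
  qed
  show "pure n (artin_exp n i j) id \<otimes>\<^bsub>units_of (braid_alg n)\<^esub> pure n (artin_exp n k l) id
      = pure n (artin_exp n k l) id \<otimes>\<^bsub>units_of (braid_alg n)\<^esub> pure n (artin_exp n i j) id"
    if h: "{i, j, k, l} \<subseteq> {1..n}" "distinct [i, j, k, l]"
  proof -
    have "(i, j) \<in> indices n" "(k, l) \<in> indices n" using h by (auto intro!: indicesI)
    then show ?thesis using artin_exp_disjoint[OF h]
      by (simp add: units_of_mult artin_exp_closed pure_id_mult)
  qed
  show "pure n (artin_exp n i j) id \<otimes>\<^bsub>units_of (braid_alg n)\<^esub>
        (pure n (artin_exp n i k) id \<otimes>\<^bsub>units_of (braid_alg n)\<^esub> pure n (artin_exp n j k) id)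
      = pure n (artin_exp n i k) id \<otimes>\<^bsub>units_of (braid_alg n)\<^esub> pure n (artin_exp n j k) id
        \<otimes>\<^bsub>units_of (braid_alg n)\<^esub> pure n (artin_exp n i j) id"
    if h: "{i, j, k} \<subseteq> {1..n}" "distinct [i, j, k]"
  proof -
    have "(i, j) \<in> indices n" "(i, k) \<in> indices n" "(j, k) \<in> indices n" using h by (auto intro!: indicesI)
    then show ?thesis using artin_exp_triple[OF h]
      by (simp add: units_of_mult artin_exp_closed pure_id_mult)
  qed
qed

definition artin_rep :: "nat \<Rightarrow> ((word \<Rightarrow> word) \<Rightarrow> rat) \<Rightarrow> (nat \<Rightarrow> nat) \<Rightarrow> series set" where
  "artin_rep n = lin_ext (braid_alg n) (Rel.rep n)"

lemma rep_in_Units: "a \<in> carrier (BP n) \<Longrightarrow> Rel.rep n a \<in> Units (braid_alg n)"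
  using Rel.rep_closed[of a n] unfolding units_of_carrier .

lemma rep_in_carrier: "a \<in> carrier (BP n) \<Longrightarrow> Rel.rep n a \<in> carrier (braid_alg n)"
  by (rule Br.C.Units_closed[OF rep_in_Units])

lemma rep_mult: "a \<in> carrier (BP n) \<Longrightarrow> b \<in> carrier (BP n) \<Longrightarrow>
    Rel.rep n (a \<otimes>\<^bsub>BP n\<^esub> b) = Rel.rep n a \<otimes>\<^bsub>braid_alg n\<^esub> Rel.rep n b"
  using Rel.rep_hom[of n] by (auto simp: hom_def units_of_mult)

lemma artin_rep_ga: "a \<in> carrier (BP n) \<Longrightarrow> artin_rep n (ga_elem a) = Rel.rep n a"
  using Br.C.lin_ext_single[of "Rel.rep n" a n 1] rep_in_carrier[of a n]
  by (simp add: artin_rep_def ga_elem_def)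

lemma artin_rep_alg_hom: "artin_rep n \<in> alg_hom (BP_alg n) (braid_alg n)"
  unfolding alg_hom_def
proof (intro CollectI conjI ring_hom_memI allI ballI)
  fix f g assume f: "f \<in> carrier (BP_alg n)"
  then have ff: "finite {x. f x \<noteq> 0}" "{x. f x \<noteq> 0} \<subseteq> carrier (BP n)" by (auto simp: carrier_BP_alg)
  show "artin_rep n f \<in> carrier (braid_alg n)"
    unfolding artin_rep_def by (rule Br.C.lin_ext_closed[OF ff(2) rep_in_carrier])
  show "artin_rep n (c \<odot>\<^bsub>BP_alg n\<^esub> f) = c \<odot>\<^bsub>braid_alg n\<^esub> artin_rep n f" for c
    unfolding artin_rep_def BP_alg_ops by (rule Br.C.lin_ext_smult[OF ff rep_in_carrier])
  assume g: "g \<in> carrier (BP_alg n)"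
  then have gf: "finite {x. g x \<noteq> 0}" "{x. g x \<noteq> 0} \<subseteq> carrier (BP n)" by (auto simp: carrier_BP_alg)
  show "artin_rep n (f \<oplus>\<^bsub>BP_alg n\<^esub> g) = artin_rep n f \<oplus>\<^bsub>braid_alg n\<^esub> artin_rep n g"
    unfolding artin_rep_def BP_alg_ops by (rule Br.C.lin_ext_add[OF ff gf rep_in_carrier])
  show "artin_rep n (f \<otimes>\<^bsub>BP_alg n\<^esub> g) = artin_rep n f \<otimes>\<^bsub>braid_alg n\<^esub> artin_rep n g"
    unfolding artin_rep_def
    by (rule lin_ext_mult[where A = "BP_alg n" and B = "braid_alg n" and X = "carrier (BP n)"
          and m = "\<lambda>a b. a \<otimes>\<^bsub>BP n\<^esub> b" and \<phi> = "Rel.rep n"])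
       (simp_all only: Q.rat_alg_axioms Br.C.rat_alg_axioms carrier_BP_alg[symmetric] BP_alg_ops ga_mult
          B.m_closed rep_in_carrier rep_mult f g)
next
  have "Rel.rep n \<one>\<^bsub>BP n\<^esub> = \<one>\<^bsub>braid_alg n\<^esub>"
    using Rel.rep_perm[OF permutes_id, of n] by (simp add: perm_aut_id pure_one)
  then show "artin_rep n \<one>\<^bsub>BP_alg n\<^esub> = \<one>\<^bsub>braid_alg n\<^esub>"
    by (simp add: BP_alg_ops artin_rep_ga)
qed

lemma conj_aut_BP: "(i, j) \<in> indices n \<Longrightarrow> conj_aut n i j \<in> carrier (BP n)"
  unfolding conj_aut_eq_move by (rule move_in_BP) (simp add: moves_def indices_def)

lemma perm_aut_BP: "s \<in> carrier (sym_group n) \<Longrightarrow> perm_aut n s \<in> carrier (BP n)"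
  unfolding sym_group_carrier by (rule perm_in_BP)

lemma artin_rep: "is_artin_rep n (artin_rep n)"
proof -
  have "artin_rep n (ga_elem (conj_aut n i j)) = pure n (artin_exp n i j) \<one>\<^bsub>sym_group n\<^esub>" if "(i, j) \<in> indices n" for i j
    using that by (simp add: artin_rep_ga conj_aut_BP Rel.rep_conj_aut sym_group_one)
  moreover have "artin_rep n (ga_elem (perm_aut n s)) = pure n \<one>\<^bsub>artin_alg n\<^esub> s" if "s \<in> carrier (sym_group n)" for s
    using that by (simp add: artin_rep_ga perm_aut_BP) (rule Rel.rep_perm, simp add: sym_group_carrier)
  ultimately show ?thesis using artin_rep_alg_hom by (auto simp: is_artin_rep_def)
qed

lemma moves_indices: "(i, j, e) \<in> moves n \<longleftrightarrow> (i, j) \<in> indices n"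
  by (simp add: moves_def indices_def)

text \<open>The group is generated by the permutations and the \<open>a\<^sub>i\<^sub>j\<close>, and the value at an inverse is determined by
  the value at the element.\<close>

lemma artin_rep_unique:
  assumes R': "is_artin_rep n R'" and x: "x \<in> carrier (BP_alg n)"
  shows "R' x = artin_rep n x"
proof -
  define R where "R = artin_rep n"
  have R: "is_artin_rep n R" unfolding R_def by (rule artin_rep)
  have hom: "h \<in> ring_hom (BP_alg n) (braid_alg n)" "\<And>c x. x \<in> carrier (BP_alg n) \<Longrightarrow> h (c \<odot>\<^bsub>BP_alg n\<^esub> x) = c \<odot>\<^bsub>braid_alg n\<^esub> h x"
    if "is_artin_rep n h" for h using that by (auto simp: is_artin_rep_def alg_hom_def)
  have hmult: "h (ga_elem a \<otimes>\<^bsub>BP_alg n\<^esub> ga_elem b) = h (ga_elem a) \<otimes>\<^bsub>braid_alg n\<^esub> h (ga_elem b)"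
    if "is_artin_rep n h" "a \<in> carrier (BP n)" "b \<in> carrier (BP n)" for h a b
    using ring_hom_mult[OF hom(1)[OF that(1)]] that(2,3) by blast
  have hcl: "h (ga_elem a) \<in> carrier (braid_alg n)" if "is_artin_rep n h" "a \<in> carrier (BP n)" for h a
    using ring_hom_closed[OF hom(1)[OF that(1)]] that(2) by blast
  have mv: "R' (ga_elem (conj_move n m)) = R (ga_elem (conj_move n m))" if m: "m \<in> moves n" for m
  proof -
    obtain i j e where ije: "m = (i, j, e)" by (cases m)
    have ij: "(i, j) \<in> indices n" using m ije by (simp add: moves_indices)
    have pos: "R' (ga_elem (conj_move n (i, j, True))) = R (ga_elem (conj_move n (i, j, True)))"
      unfolding conj_aut_eq_move[OF ij, symmetric] is_artin_rep_conj[OF R ij] is_artin_rep_conj[OF R' ij] ..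
    let ?p = "conj_move n (i, j, True)" and ?q = "conj_move n (i, j, False)"
    have pq: "?p \<in> carrier (BP n)" "?q \<in> carrier (BP n)" using ij by (auto intro!: move_in_BP simp: moves_indices)
    have e: "?p \<otimes>\<^bsub>BP n\<^esub> ?q = \<one>\<^bsub>BP n\<^esub>" "?q \<otimes>\<^bsub>BP n\<^esub> ?p = \<one>\<^bsub>BP n\<^esub>"
      using move_inverse[OF B.one_closed, of i j True n] move_inverse[OF B.one_closed, of i j False n] ij pq
      by (auto simp: moves_indices)
    have inv: "h (ga_elem ?p) \<otimes>\<^bsub>braid_alg n\<^esub> h (ga_elem ?q) = \<one>\<^bsub>braid_alg n\<^esub>"
      "h (ga_elem ?q) \<otimes>\<^bsub>braid_alg n\<^esub> h (ga_elem ?p) = \<one>\<^bsub>braid_alg n\<^esub>" if h: "is_artin_rep n h" for h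
      using hmult[OF h pq] hmult[OF h pq(2,1)] ring_hom_one[OF hom(1)[OF h]]
      by (simp_all add: ga_mult e BP_alg_ops(4))
    have "R' (ga_elem ?q) = R (ga_elem ?q)"
      by (rule Br.C.inv_unique[OF inv(2)[OF R', unfolded pos] inv(1)[OF R] hcl[OF R pq(1)] hcl[OF R' pq(2)] hcl[OF R pq(2)]])
    then show ?thesis using pos ije by (cases e) auto
  qed
  have elem: "R' (ga_elem a) = R (ga_elem a)" if "a \<in> carrier (BP n)" for a
    using that
  proof (induction rule: BP_induct)
    case (perm s)
    then have "s \<in> carrier (sym_group n)" unfolding sym_group_carrier .
    then show ?case using is_artin_rep_perm[OF R] is_artin_rep_perm[OF R'] by simp
  next
    case (move b m)
    then show ?case
      using hmult[OF R move(1) move_in_BP[OF move(2)]] hmult[OF R' move(1) move_in_BP[OF move(2)]] mv[OF move(2)]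
      by (simp add: ga_mult)
  qed
  show ?thesis using x unfolding R_def[symmetric]
  proof (induction rule: BP_alg_induct)
    case zero
    have "h \<zero>\<^bsub>BP_alg n\<^esub> = \<zero>\<^bsub>braid_alg n\<^esub>" if h: "is_artin_rep n h" for h
      using hom(2)[OF h Q.zero_closed, of 0] ring_hom_closed[OF hom(1)[OF h] Q.zero_closed] by simp
    then show ?case using R R' by simp
  next
    case (add c a g)
    then show ?case
      using ring_hom_add[OF hom(1)[OF R], of "c \<odot>\<^bsub>BP_alg n\<^esub> ga_elem a" g] ring_hom_add[OF hom(1)[OF R'], of "c \<odot>\<^bsub>BP_alg n\<^esub> ga_elem a" g]
      by (simp add: hom(2)[OF R] hom(2)[OF R'] elem)
  qed
qed

section \<open>The adic filtration of the group algebra\<close>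

definition perm_elem :: "nat \<Rightarrow> (nat \<Rightarrow> nat) \<Rightarrow> (word \<Rightarrow> word) \<Rightarrow> rat" where
  "perm_elem n s = ga_elem (perm_aut n s)"

text \<open>The element \<open>A\<^sub>i\<^sub>j = a\<^sub>i\<^sub>j - 1\<close> of the augmentation ideal.\<close>

definition aug :: "nat \<Rightarrow> nat \<times> nat \<Rightarrow> (word \<Rightarrow> word) \<Rightarrow> rat" where
  "aug n p = ga_elem (conj_aut n (fst p) (snd p)) \<ominus>\<^bsub>BP_alg n\<^esub> \<one>\<^bsub>BP_alg n\<^esub>"

definition aug_word :: "nat \<Rightarrow> (nat \<times> nat) list \<Rightarrow> (word \<Rightarrow> word) \<Rightarrow> rat" where
  "aug_word n w = foldr (\<lambda>p x. aug n p \<otimes>\<^bsub>BP_alg n\<^esub> x) w \<one>\<^bsub>BP_alg n\<^esub>"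

lemma perm_elem_closed [simp]: "s \<in> carrier (sym_group n) \<Longrightarrow> perm_elem n s \<in> carrier (BP_alg n)"
  unfolding perm_elem_def by (rule ga_closed[OF perm_aut_BP])

lemma aug_closed [simp]: "p \<in> indices n \<Longrightarrow> aug n p \<in> carrier (BP_alg n)"
  unfolding aug_def using conj_aut_BP[of "fst p" "snd p" n] by (intro Q.minus_closed ga_closed Q.one_closed) simp

lemma aug_word_simps [simp]: "aug_word n [] = \<one>\<^bsub>BP_alg n\<^esub>" "aug_word n (p # w) = aug n p \<otimes>\<^bsub>BP_alg n\<^esub> aug_word n w"
  by (simp_all add: aug_word_def)

lemma aug_word_closed [simp]: "set w \<subseteq> indices n \<Longrightarrow> aug_word n w \<in> carrier (BP_alg n)"
  by (induction w) auto

lemma aug_word_append: "set u \<subseteq> indices n \<Longrightarrow> set v \<subseteq> indices n \<Longrightarrow> aug_word n (u @ v) = aug_word n u \<otimes>\<^bsub>BP_alg n\<^esub> aug_word n v"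
  by (induction u) (auto simp: Q.m_assoc)

lemma perm_elem_mult: "s \<in> carrier (sym_group n) \<Longrightarrow> t \<in> carrier (sym_group n) \<Longrightarrow> perm_elem n s \<otimes>\<^bsub>BP_alg n\<^esub> perm_elem n t = perm_elem n (s \<circ> t)"
  unfolding perm_elem_def sym_group_carrier by (simp only: ga_mult perm_aut_mult)

lemma perm_elem_id: "perm_elem n id = \<one>\<^bsub>BP_alg n\<^esub>"
  by (simp add: perm_elem_def perm_aut_id BP_alg_ops)

lemma ga_conj: "p \<in> indices n \<Longrightarrow> ga_elem (conj_aut n (fst p) (snd p)) = aug n p \<oplus>\<^bsub>BP_alg n\<^esub> \<one>\<^bsub>BP_alg n\<^esub>"
  using conj_aut_BP[of "fst p" "snd p" n] unfolding aug_def
  by (simp add: a_minus_def Q.a_assoc Q.l_neg)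

lemma perm_conj:
  assumes s: "s permutes {1..n}" and ij: "(i, j) \<in> indices n"
  shows "perm_aut n s \<otimes>\<^bsub>BP n\<^esub> conj_aut n i j = conj_aut n (s i) (s j) \<otimes>\<^bsub>BP n\<^esub> perm_aut n s" "(s i, s j) \<in> indices n"
proof -
  show sij: "(s i, s j) \<in> indices n" using ij by (simp only: indices_perm[OF s])
  have m: "(i, j, True) \<in> moves n" "(s i, s j, True) \<in> moves n" using ij sij by (simp_all only: moves_indices)
  show "perm_aut n s \<otimes>\<^bsub>BP n\<^esub> conj_aut n i j = conj_aut n (s i) (s j) \<otimes>\<^bsub>BP n\<^esub> perm_aut n s"
    using perm_move(1)[OF B.one_closed m(1) s] perm_in_BP[OF s] move_in_BP[OF m(1)] move_in_BP[OF m(2)]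
    by (simp add: conj_aut_eq_move[OF ij] conj_aut_eq_move[OF sij])
qed

lemma perm_elem_aug:
  assumes s: "s \<in> carrier (sym_group n)" and p: "p \<in> indices n"
  shows "perm_elem n s \<otimes>\<^bsub>BP_alg n\<^esub> aug n p = aug n (map_prod s s p) \<otimes>\<^bsub>BP_alg n\<^esub> perm_elem n s" "map_prod s s p \<in> indices n"
proof -
  have sp: "s permutes {1..n}" using s unfolding sym_group_carrier .
  obtain i j where ij: "p = (i, j)" by (cases p)
  note c = perm_conj[OF sp p[unfolded ij]]
  show "map_prod s s p \<in> indices n" using c(2) ij by simp
  have cl: "ga_elem (conj_aut n i j) \<in> carrier (BP_alg n)" "ga_elem (conj_aut n (s i) (s j)) \<in> carrier (BP_alg n)"
    using p c(2) ij by (auto intro: conj_aut_BP)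
  have "perm_elem n s \<otimes>\<^bsub>BP_alg n\<^esub> ga_elem (conj_aut n i j) = ga_elem (conj_aut n (s i) (s j)) \<otimes>\<^bsub>BP_alg n\<^esub> perm_elem n s"
    unfolding perm_elem_def ga_mult c(1) ..
  then show "perm_elem n s \<otimes>\<^bsub>BP_alg n\<^esub> aug n p = aug n (map_prod s s p) \<otimes>\<^bsub>BP_alg n\<^esub> perm_elem n s"
    using cl perm_elem_closed[OF s] unfolding ij aug_def
    by (simp add: a_minus_def Q.r_distr Q.l_distr Q.r_minus Q.l_minus)
qed

lemma perm_elem_aug_word:
  assumes s: "s \<in> carrier (sym_group n)" and w: "set w \<subseteq> indices n"
  shows "perm_elem n s \<otimes>\<^bsub>BP_alg n\<^esub> aug_word n w = aug_word n (map (map_prod s s) w) \<otimes>\<^bsub>BP_alg n\<^esub> perm_elem n s \<and> set (map (map_prod s s) w) \<subseteq> indices n"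
  using w
proof (induction w)
  case Nil
  then show ?case using perm_elem_closed[OF s] by simp
next
  case (Cons p w)
  have p: "p \<in> indices n" and w: "set w \<subseteq> indices n" using Cons.prems by auto
  note IH = Cons.IH[OF w] and a = perm_elem_aug[OF s p]
  have "perm_elem n s \<otimes>\<^bsub>BP_alg n\<^esub> aug_word n (p # w) = (perm_elem n s \<otimes>\<^bsub>BP_alg n\<^esub> aug n p) \<otimes>\<^bsub>BP_alg n\<^esub> aug_word n w"
    using s p w by (simp add: Q.m_assoc)
  also have "\<dots> = aug n (map_prod s s p) \<otimes>\<^bsub>BP_alg n\<^esub> (perm_elem n s \<otimes>\<^bsub>BP_alg n\<^esub> aug_word n w)"
    unfolding a(1) using s w a(2) by (simp add: Q.m_assoc)
  also have "\<dots> = aug n (map_prod s s p) \<otimes>\<^bsub>BP_alg n\<^esub> (aug_word n (map (map_prod s s) w) \<otimes>\<^bsub>BP_alg n\<^esub> perm_elem n s)"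
    using IH by simp
  also have "\<dots> = aug_word n (map (map_prod s s) (p # w)) \<otimes>\<^bsub>BP_alg n\<^esub> perm_elem n s"
    using IH s a(2) aug_word_closed[of "map (map_prod s s) w" n] by (simp add: Q.m_assoc)
  finally show ?case using IH a(2) by simp
qed

subsection \<open>Powers of the ideal\<close>

lemma transpose_sym: "1 \<le> i \<Longrightarrow> i < n \<Longrightarrow> transpose i (i + 1) \<in> carrier (sym_group n)"
  unfolding sym_group_carrier by (rule permutes_swap_id) auto

text \<open>As \<open>\<sigma>\<^sub>i = a\<^sub>i\<^sub>,\<^sub>i\<^sub>+\<^sub>1 s\<^sub>i\<close>, the generators of \<open>J\<close> are \<open>A\<^sub>i\<^sub>,\<^sub>i\<^sub>+\<^sub>1 s\<^sub>i\<close>.\<close>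

lemma generator_eq:
  assumes "1 \<le> i" "i < n"
  shows "ga_elem (artin_gen n i) \<ominus>\<^bsub>BP_alg n\<^esub> ga_elem (perm_aut n (transpose i (i + 1)))
    = aug n (i, i + 1) \<otimes>\<^bsub>BP_alg n\<^esub> perm_elem n (transpose i (i + 1))" "(i, i + 1) \<in> indices n"
proof -
  show ix: "(i, i + 1) \<in> indices n" using assms by (auto intro!: indicesI)
  have c: "ga_elem (conj_aut n i (i + 1)) \<in> carrier (BP_alg n)" using conj_aut_BP[OF ix] by blast
  note p = perm_elem_closed[OF transpose_sym[OF assms]]
  have "ga_elem (artin_gen n i) = ga_elem (conj_aut n i (i + 1)) \<otimes>\<^bsub>BP_alg n\<^esub> perm_elem n (transpose i (i + 1))"
    unfolding artin_gen_def perm_elem_def ga_mult ..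
  then show "ga_elem (artin_gen n i) \<ominus>\<^bsub>BP_alg n\<^esub> ga_elem (perm_aut n (transpose i (i + 1)))
    = aug n (i, i + 1) \<otimes>\<^bsub>BP_alg n\<^esub> perm_elem n (transpose i (i + 1))"
    unfolding aug_def perm_elem_def[symmetric] using c p by (simp add: a_minus_def Q.l_distr Q.l_minus)
qed

definition J_gens :: "nat \<Rightarrow> ((word \<Rightarrow> word) \<Rightarrow> rat) set" where
  "J_gens n = {aug n (i, i + 1) \<otimes>\<^bsub>BP_alg n\<^esub> perm_elem n (transpose i (i + 1)) | i. 1 \<le> i \<and> i < n}"

lemma J_ideal_gens: "J_ideal n = genideal (BP_alg n) (J_gens n)"
proof -
  have "{ga_elem (artin_gen n i) \<ominus>\<^bsub>BP_alg n\<^esub> ga_elem (perm_aut n (transpose i (i + 1))) | i. 1 \<le> i \<and> i < n} = J_gens n"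
    unfolding J_gens_def using generator_eq(1) by (auto; metis)
  then show ?thesis unfolding J_ideal_def by simp
qed

lemma J_gens_closed: "J_gens n \<subseteq> carrier (BP_alg n)"
  unfolding J_gens_def using generator_eq(2) transpose_sym by (auto intro!: Q.m_closed aug_closed perm_elem_closed)

lemma J_ideal: "ideal (J_ideal n) (BP_alg n)"
  unfolding J_ideal_gens by (rule Q.genideal_ideal[OF J_gens_closed])

lemma J_filt_0: "J_filt n 0 = carrier (BP_alg n)"
  by (simp add: J_filt_def ideal_power_def ideals_set_def)

lemma J_filt_Suc: "J_filt n (Suc k) = ideal_prod (BP_alg n) (J_filt n k) (J_ideal n)"
  by (simp add: J_filt_def ideal_power_def ideals_set_def)

lemma J_filt_ideal: "ideal (J_filt n k) (BP_alg n)"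
  by (induction k) (auto simp: J_filt_0 J_filt_Suc Q.oneideal intro: Q.ideal_prod_is_ideal J_ideal)

lemma J_filt_closed: "x \<in> J_filt n k \<Longrightarrow> x \<in> carrier (BP_alg n)"
  by (rule ideal.Icarr[OF J_filt_ideal])

lemma J_filt_mono: "J_filt n (Suc k) \<subseteq> J_filt n k"
  unfolding J_filt_Suc using Q.ideal_prod_inter[OF J_filt_ideal J_ideal] by blast

lemma J_filt_1: "J_filt n (Suc 0) = J_ideal n"
proof
  show "J_filt n (Suc 0) \<subseteq> J_ideal n"
    unfolding J_filt_Suc using Q.ideal_prod_inter[OF J_filt_ideal J_ideal] by blast
  show "J_ideal n \<subseteq> J_filt n (Suc 0)"
  proof
    fix x assume x: "x \<in> J_ideal n"
    have "\<one>\<^bsub>BP_alg n\<^esub> \<otimes>\<^bsub>BP_alg n\<^esub> x \<in> J_filt n (Suc 0)"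
      unfolding J_filt_Suc J_filt_0 by (rule ideal_prod.prod[OF Q.one_closed x])
    then show "x \<in> J_filt n (Suc 0)" using ideal.Icarr[OF J_ideal x] by simp
  qed
qed

lemma J_add: "x \<in> J_filt n k \<Longrightarrow> y \<in> J_filt n k \<Longrightarrow> x \<oplus>\<^bsub>BP_alg n\<^esub> y \<in> J_filt n k"
  by (rule additive_subgroup.a_closed[OF ideal.axioms(1)[OF J_filt_ideal]])

lemma J_zero: "\<zero>\<^bsub>BP_alg n\<^esub> \<in> J_filt n k"
  by (rule additive_subgroup.zero_closed[OF ideal.axioms(1)[OF J_filt_ideal]])

lemma J_minus: "x \<in> J_filt n k \<Longrightarrow> \<ominus>\<^bsub>BP_alg n\<^esub> x \<in> J_filt n k"
  by (rule additive_subgroup.a_inv_closed[OF ideal.axioms(1)[OF J_filt_ideal]])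

lemma J_diff: "x \<in> J_filt n k \<Longrightarrow> y \<in> J_filt n k \<Longrightarrow> x \<ominus>\<^bsub>BP_alg n\<^esub> y \<in> J_filt n k"
  unfolding a_minus_def by (intro J_add J_minus)

lemma J_smult: "x \<in> J_filt n k \<Longrightarrow> c \<odot>\<^bsub>BP_alg n\<^esub> x \<in> J_filt n k"
  by (rule Q.ideal_smult[OF J_filt_ideal])

lemma J_mult: "x \<in> J_filt n i \<Longrightarrow> y \<in> J_filt n j \<Longrightarrow> x \<otimes>\<^bsub>BP_alg n\<^esub> y \<in> J_filt n (i + j)"
proof (induction j arbitrary: x y)
  case 0
  then show ?case using ideal.I_r_closed[OF J_filt_ideal] by (simp add: J_filt_0)
next
  case (Suc j)
  have x: "x \<in> carrier (BP_alg n)" using Suc.prems(1) by (rule J_filt_closed)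
  have "y \<in> carrier (BP_alg n) \<and> x \<otimes>\<^bsub>BP_alg n\<^esub> y \<in> J_filt n (Suc (i + j))"
    using Suc.prems(2) unfolding J_filt_Suc
  proof (induction y rule: ideal_prod.induct)
    case (prod a b)
    have ab: "a \<in> carrier (BP_alg n)" "b \<in> carrier (BP_alg n)"
      using prod J_filt_closed ideal.Icarr[OF J_ideal] by auto
    have "(x \<otimes>\<^bsub>BP_alg n\<^esub> a) \<otimes>\<^bsub>BP_alg n\<^esub> b \<in> ideal_prod (BP_alg n) (J_filt n (i + j)) (J_ideal n)"
      by (rule ideal_prod.prod[OF Suc.IH[OF Suc.prems(1) prod(1)] prod(2)])
    then show ?case using x ab by (simp add: Q.m_assoc)
  next
    case (sum a b)
    then show ?case using x by (simp add: Q.r_distr ideal_prod.sum)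
  qed
  then show ?case by simp
qed

lemma J_mult_left: "x \<in> carrier (BP_alg n) \<Longrightarrow> y \<in> J_filt n k \<Longrightarrow> x \<otimes>\<^bsub>BP_alg n\<^esub> y \<in> J_filt n k"
  by (rule ideal.I_l_closed[OF J_filt_ideal])

lemma J_mult_right: "x \<in> carrier (BP_alg n) \<Longrightarrow> y \<in> J_filt n k \<Longrightarrow> y \<otimes>\<^bsub>BP_alg n\<^esub> x \<in> J_filt n k"
  by (rule ideal.I_r_closed[OF J_filt_ideal])

text \<open>The symmetric group is doubly transitive, hence transitive on the \<open>A\<^sub>i\<^sub>j\<close>.\<close>

lemma exists_perm_pair:
  assumes "(i, j) \<in> indices n" "(k, l) \<in> indices n"
  shows "\<exists>\<pi>. \<pi> \<in> carrier (sym_group n) \<and> \<pi> k = i \<and> \<pi> l = j"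
proof -
  have ij: "i \<in> {1..n}" "j \<in> {1..n}" "i \<noteq> j" "k \<in> {1..n}" "l \<in> {1..n}" "k \<noteq> l"
    using assms unfolding indices_def by auto
  define \<tau> where "\<tau> = transpose k i"
  have t: "\<tau> permutes {1..n}" unfolding \<tau>_def by (rule permutes_swap_id[OF ij(4,1)])
  have tl: "\<tau> l \<in> {1..n}" using permutes_in_image[OF t] ij(5) by blast
  have "\<tau> k = i" by (simp add: \<tau>_def)
  moreover have "\<tau> l \<noteq> i" using \<open>\<tau> k = i\<close> permutes_inj[OF t] ij(6) by (metis injD)
  ultimately have "(transpose (\<tau> l) j \<circ> \<tau>) k = i" "(transpose (\<tau> l) j \<circ> \<tau>) l = j"
    using ij(3) by (auto simp: transpose_def)
  moreover have "transpose (\<tau> l) j \<circ> \<tau> \<in> carrier (sym_group n)"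
    unfolding sym_group_carrier by (rule permutes_compose[OF t permutes_swap_id[OF tl ij(2)]])
  ultimately show ?thesis by blast
qed

text \<open>Cancelling \<open>s\<^sub>1\<close> from a generator of \<open>J\<close> leaves \<open>A\<^sub>1\<^sub>2\<close>, and conjugation by permutations moves it to any
  \<open>A\<^sub>i\<^sub>j\<close>.\<close>

lemma aug_in_J:
  assumes p: "p \<in> indices n"
  shows "aug n p \<in> J_filt n (Suc 0)"
proof -
  obtain i j where ij: "p = (i, j)" by (cases p)
  have n2: "1 \<le> (1::nat)" "1 < n" using p unfolding ij indices_def by auto
  let ?t = "transpose 1 (1 + 1) :: nat \<Rightarrow> nat"
  note t = transpose_sym[OF n2] and ix = generator_eq(2)[OF n2]
  have "aug n (1, 1 + 1) \<otimes>\<^bsub>BP_alg n\<^esub> perm_elem n ?t \<in> J_ideal n"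
    unfolding J_ideal_gens using Q.genideal_self[OF J_gens_closed, of n] n2 unfolding J_gens_def by blast
  then have "aug n (1, 1 + 1) \<otimes>\<^bsub>BP_alg n\<^esub> perm_elem n ?t \<otimes>\<^bsub>BP_alg n\<^esub> perm_elem n ?t \<in> J_filt n (Suc 0)"
    unfolding J_filt_1 using ideal.I_r_closed[OF J_ideal _ perm_elem_closed[OF t]] by blast
  also have "aug n (1, 1 + 1) \<otimes>\<^bsub>BP_alg n\<^esub> perm_elem n ?t \<otimes>\<^bsub>BP_alg n\<^esub> perm_elem n ?t = aug n (1, 1 + 1)"
    using aug_closed[OF ix] perm_elem_closed[OF t] perm_elem_mult[OF t t] by (simp add: Q.m_assoc perm_elem_id)
  finally have a: "aug n (1, 1 + 1) \<in> J_filt n (Suc 0)" .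
  obtain \<pi> where \<pi>: "\<pi> \<in> carrier (sym_group n)" "\<pi> 1 = i" "\<pi> (1 + 1) = j" using exists_perm_pair[OF p[unfolded ij] ix] by blast
  have \<pi>p: "\<pi> permutes {1..n}" using \<pi>(1) unfolding sym_group_carrier .
  have \<pi>i: "Hilbert_Choice.inv \<pi> \<in> carrier (sym_group n)" unfolding sym_group_carrier by (rule permutes_inv[OF \<pi>p])
  have "perm_elem n \<pi> \<otimes>\<^bsub>BP_alg n\<^esub> aug n (1, 1 + 1) \<otimes>\<^bsub>BP_alg n\<^esub> perm_elem n (Hilbert_Choice.inv \<pi>) \<in> J_filt n (Suc 0)"
    by (intro J_mult_right J_mult_left a perm_elem_closed \<pi> \<pi>i)
  also have "perm_elem n \<pi> \<otimes>\<^bsub>BP_alg n\<^esub> aug n (1, 1 + 1) = aug n p \<otimes>\<^bsub>BP_alg n\<^esub> perm_elem n \<pi>"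
    using perm_elem_aug(1)[OF \<pi>(1) ix] \<pi> ij by simp
  also have "aug n p \<otimes>\<^bsub>BP_alg n\<^esub> perm_elem n \<pi> \<otimes>\<^bsub>BP_alg n\<^esub> perm_elem n (Hilbert_Choice.inv \<pi>) = aug n p"
    using aug_closed[OF p] perm_elem_closed[OF \<pi>(1)] perm_elem_closed[OF \<pi>i] perm_elem_mult[OF \<pi>(1) \<pi>i] permutes_inv_o(1)[OF \<pi>p]
    by (simp add: Q.m_assoc perm_elem_id)
  finally show ?thesis .
qed

lemma aug_word_in_J: "set w \<subseteq> indices n \<Longrightarrow> aug_word n w \<in> J_filt n (length w)"
proof (induction w)
  case Nil
  then show ?case by (simp add: J_filt_0)
next
  case (Cons p w)
  then show ?case using J_mult[OF aug_in_J[of p n], of "aug_word n w" "length w"] by simp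
qed

subsection \<open>Spanning the powers modulo the next power\<close>

text \<open>The span of the products \<open>A\<^sub>w s\<close> with \<open>w\<close> of length \<open>k\<close>, generated one summand at a time so that its
  properties follow by rule induction.\<close>

inductive_set wspan :: "nat \<Rightarrow> nat \<Rightarrow> ((word \<Rightarrow> word) \<Rightarrow> rat) set" for n k where
  zero: "\<zero>\<^bsub>BP_alg n\<^esub> \<in> wspan n k"
| add: "set w \<subseteq> indices n \<Longrightarrow> length w = k \<Longrightarrow> s \<in> carrier (sym_group n) \<Longrightarrow> x \<in> wspan n k \<Longrightarrow>
    c \<odot>\<^bsub>BP_alg n\<^esub> (aug_word n w \<otimes>\<^bsub>BP_alg n\<^esub> perm_elem n s) \<oplus>\<^bsub>BP_alg n\<^esub> x \<in> wspan n k"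

lemma wspan_J: "x \<in> wspan n k \<Longrightarrow> x \<in> J_filt n k"
proof (induction rule: wspan.induct)
  case (add w s x c)
  have "aug_word n w \<in> J_filt n k" using aug_word_in_J[OF add(1)] add(2) by simp
  then show ?case using add by (intro J_add J_smult J_mult_right perm_elem_closed) auto
qed (rule J_zero)

lemma wspan_closed: "x \<in> wspan n k \<Longrightarrow> x \<in> carrier (BP_alg n)"
  by (rule J_filt_closed[OF wspan_J])

lemma wspan_single:
  assumes "set w \<subseteq> indices n" "length w = k" "s \<in> carrier (sym_group n)"
  shows "aug_word n w \<otimes>\<^bsub>BP_alg n\<^esub> perm_elem n s \<in> wspan n k"
  using wspan.add[OF assms wspan.zero, of 1] aug_word_closed[OF assms(1)] perm_elem_closed[OF assms(3)] by simp

lemma wspan_add: "x \<in> wspan n k \<Longrightarrow> y \<in> wspan n k \<Longrightarrow> x \<oplus>\<^bsub>BP_alg n\<^esub> y \<in> wspan n k"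
proof (induction rule: wspan.induct)
  case zero
  then show ?case using wspan_closed by simp
next
  case (add w s x c)
  have "aug_word n w \<otimes>\<^bsub>BP_alg n\<^esub> perm_elem n s \<in> carrier (BP_alg n)" using add by simp
  then show ?case using wspan.add[OF add(1-3) add.IH[OF add.prems]] wspan_closed[OF add(4)] wspan_closed[OF add.prems]
    by (simp add: Q.a_assoc)
qed

lemma wspan_smult: "x \<in> wspan n k \<Longrightarrow> c \<odot>\<^bsub>BP_alg n\<^esub> x \<in> wspan n k"
proof (induction rule: wspan.induct)
  case zero
  then show ?case using wspan.zero by simp
next
  case (add w s x d)
  have "aug_word n w \<otimes>\<^bsub>BP_alg n\<^esub> perm_elem n s \<in> carrier (BP_alg n)" using add by simp
  then show ?case using wspan.add[OF add(1-3) add.IH, of "c * d"] wspan_closed[OF add(4)]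
    by (simp add: Q.smult_r_distr Q.smult_smult)
qed

text \<open>Permutations can be moved to the right past the \<open>A\<^sub>i\<^sub>j\<close>, at the cost of renaming the indices.\<close>

lemma basis_mult:
  assumes "set u \<subseteq> indices n" "set v \<subseteq> indices n" "s \<in> carrier (sym_group n)" "t \<in> carrier (sym_group n)"
  shows "(aug_word n u \<otimes>\<^bsub>BP_alg n\<^esub> perm_elem n s) \<otimes>\<^bsub>BP_alg n\<^esub> (aug_word n v \<otimes>\<^bsub>BP_alg n\<^esub> perm_elem n t)
    = aug_word n (u @ map (map_prod s s) v) \<otimes>\<^bsub>BP_alg n\<^esub> perm_elem n (s \<circ> t)"
proof -
  note m = perm_elem_aug_word[OF assms(3,2)]
  let ?v = "map (map_prod s s) v"
  have c: "aug_word n u \<in> carrier (BP_alg n)" "aug_word n v \<in> carrier (BP_alg n)" "aug_word n ?v \<in> carrier (BP_alg n)"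
    "perm_elem n s \<in> carrier (BP_alg n)" "perm_elem n t \<in> carrier (BP_alg n)" using assms m by (auto intro: aug_word_closed)
  have "(aug_word n u \<otimes>\<^bsub>BP_alg n\<^esub> perm_elem n s) \<otimes>\<^bsub>BP_alg n\<^esub> (aug_word n v \<otimes>\<^bsub>BP_alg n\<^esub> perm_elem n t)
      = aug_word n u \<otimes>\<^bsub>BP_alg n\<^esub> (perm_elem n s \<otimes>\<^bsub>BP_alg n\<^esub> aug_word n v) \<otimes>\<^bsub>BP_alg n\<^esub> perm_elem n t"
    using c by (simp add: Q.m_assoc)
  also have "\<dots> = aug_word n u \<otimes>\<^bsub>BP_alg n\<^esub> aug_word n ?v \<otimes>\<^bsub>BP_alg n\<^esub> (perm_elem n s \<otimes>\<^bsub>BP_alg n\<^esub> perm_elem n t)"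
    using c m by (simp add: Q.m_assoc)
  also have "\<dots> = aug_word n (u @ ?v) \<otimes>\<^bsub>BP_alg n\<^esub> perm_elem n (s \<circ> t)"
    using m assms by (simp only: aug_word_append perm_elem_mult)
  finally show ?thesis .
qed

lemma sym_comp: "s \<in> carrier (sym_group n) \<Longrightarrow> t \<in> carrier (sym_group n) \<Longrightarrow> s \<circ> t \<in> carrier (sym_group n)"
  unfolding sym_group_carrier by (rule permutes_compose)

lemma wspan_mult: "x \<in> wspan n i \<Longrightarrow> y \<in> wspan n j \<Longrightarrow> x \<otimes>\<^bsub>BP_alg n\<^esub> y \<in> wspan n (i + j)"
proof (induction rule: wspan.induct)
  case zero
  then show ?case using wspan_closed wspan.zero by simp
next
  case (add u s x c)
  have b: "aug_word n u \<otimes>\<^bsub>BP_alg n\<^esub> perm_elem n s \<in> carrier (BP_alg n)" using add by simp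
  have "(aug_word n u \<otimes>\<^bsub>BP_alg n\<^esub> perm_elem n s) \<otimes>\<^bsub>BP_alg n\<^esub> y \<in> wspan n (i + j)"
    using add.prems
  proof (induction rule: wspan.induct)
    case zero
    then show ?case using b wspan.zero by simp
  next
    case (add v t y d)
    have b': "aug_word n v \<otimes>\<^bsub>BP_alg n\<^esub> perm_elem n t \<in> carrier (BP_alg n)" using add by simp
    have v: "set (u @ map (map_prod s s) v) \<subseteq> indices n" "length (u @ map (map_prod s s) v) = i + j"
      using perm_elem_aug_word[OF \<open>s \<in> carrier (sym_group n)\<close> add(1)] \<open>set u \<subseteq> indices n\<close> \<open>length u = i\<close> add(2) by auto
    from wspan.add[OF v sym_comp[OF \<open>s \<in> carrier (sym_group n)\<close> add(3)] add.IH, of d]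
    show ?case
      using b b' wspan_closed[OF add(4)] basis_mult[OF \<open>set u \<subseteq> indices n\<close> add(1) \<open>s \<in> carrier (sym_group n)\<close> add(3)]
      by (simp add: Q.r_distr Q.smult_mult_right del: map_append)
  qed
  from wspan_add[OF wspan_smult[OF this, of c] add.IH[OF add.prems]]
  show ?case using b wspan_closed[OF add(4)] wspan_closed[OF add.prems]
    by (simp add: Q.l_distr Q.smult_mult_left)
qed

definition spanned :: "nat \<Rightarrow> nat \<Rightarrow> ((word \<Rightarrow> word) \<Rightarrow> rat) \<Rightarrow> bool" where
  "spanned n k x \<longleftrightarrow> x \<in> J_filt n k \<and> (\<exists>y\<in>wspan n k. x \<ominus>\<^bsub>BP_alg n\<^esub> y \<in> J_filt n (Suc k))"

lemma spanned_wspan: "x \<in> wspan n k \<Longrightarrow> spanned n k x"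
  unfolding spanned_def using wspan_J[of x n k] wspan_closed[of x n k] J_zero
  by (intro conjI bexI[of _ x]) (auto simp: a_minus_def Q.r_neg)

lemma spanned_close:
  assumes "x \<in> carrier (BP_alg n)" "y \<in> wspan n k" "x \<ominus>\<^bsub>BP_alg n\<^esub> y \<in> J_filt n (Suc k)"
  shows "spanned n k x"
proof -
  have "x = (x \<ominus>\<^bsub>BP_alg n\<^esub> y) \<oplus>\<^bsub>BP_alg n\<^esub> y" using assms wspan_closed by (simp add: a_minus_def Q.a_assoc Q.l_neg)
  moreover have "(x \<ominus>\<^bsub>BP_alg n\<^esub> y) \<oplus>\<^bsub>BP_alg n\<^esub> y \<in> J_filt n k" using assms J_filt_mono wspan_J by (intro J_add) auto
  ultimately show ?thesis using assms by (auto simp: spanned_def)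
qed

lemma spanned_closed: "spanned n k x \<Longrightarrow> x \<in> carrier (BP_alg n)"
  by (auto simp: spanned_def intro: J_filt_closed)

lemma spanned_add:
  assumes "spanned n k x" "spanned n k y"
  shows "spanned n k (x \<oplus>\<^bsub>BP_alg n\<^esub> y)"
proof -
  obtain a b where ab: "a \<in> wspan n k" "x \<ominus>\<^bsub>BP_alg n\<^esub> a \<in> J_filt n (Suc k)" "b \<in> wspan n k" "y \<ominus>\<^bsub>BP_alg n\<^esub> b \<in> J_filt n (Suc k)"
    using assms by (auto simp: spanned_def)
  note c = spanned_closed[OF assms(1)] spanned_closed[OF assms(2)] wspan_closed[OF ab(1)] wspan_closed[OF ab(3)]
  have "(x \<oplus>\<^bsub>BP_alg n\<^esub> y) \<ominus>\<^bsub>BP_alg n\<^esub> (a \<oplus>\<^bsub>BP_alg n\<^esub> b) = (x \<ominus>\<^bsub>BP_alg n\<^esub> a) \<oplus>\<^bsub>BP_alg n\<^esub> (y \<ominus>\<^bsub>BP_alg n\<^esub> b)"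
    using c by (simp add: a_minus_def Q.minus_add Q.a_ac)
  then show ?thesis
    using ab c J_add[OF ab(2,4)] by (intro spanned_close[OF _ wspan_add[OF ab(1,3)]]) auto
qed

text \<open>From \<open>x y - a b = (x - a) y + a (y - b)\<close>.\<close>

lemma spanned_mult:
  assumes "spanned n i x" "spanned n j y"
  shows "spanned n (i + j) (x \<otimes>\<^bsub>BP_alg n\<^esub> y)"
proof -
  obtain a b where ab: "a \<in> wspan n i" "x \<ominus>\<^bsub>BP_alg n\<^esub> a \<in> J_filt n (Suc i)" "b \<in> wspan n j" "y \<ominus>\<^bsub>BP_alg n\<^esub> b \<in> J_filt n (Suc j)"
    using assms by (auto simp: spanned_def)
  note c = spanned_closed[OF assms(1)] spanned_closed[OF assms(2)] wspan_closed[OF ab(1)] wspan_closed[OF ab(3)]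
  have "(x \<otimes>\<^bsub>BP_alg n\<^esub> y) \<ominus>\<^bsub>BP_alg n\<^esub> (a \<otimes>\<^bsub>BP_alg n\<^esub> b) = (x \<ominus>\<^bsub>BP_alg n\<^esub> a) \<otimes>\<^bsub>BP_alg n\<^esub> y \<oplus>\<^bsub>BP_alg n\<^esub> a \<otimes>\<^bsub>BP_alg n\<^esub> (y \<ominus>\<^bsub>BP_alg n\<^esub> b)"
  proof -
    have "(x \<ominus>\<^bsub>BP_alg n\<^esub> a) \<otimes>\<^bsub>BP_alg n\<^esub> y \<oplus>\<^bsub>BP_alg n\<^esub> a \<otimes>\<^bsub>BP_alg n\<^esub> (y \<ominus>\<^bsub>BP_alg n\<^esub> b) = x \<otimes>\<^bsub>BP_alg n\<^esub> y \<oplus>\<^bsub>BP_alg n\<^esub> (\<ominus>\<^bsub>BP_alg n\<^esub> (a \<otimes>\<^bsub>BP_alg n\<^esub> y) \<oplus>\<^bsub>BP_alg n\<^esub> (a \<otimes>\<^bsub>BP_alg n\<^esub> y)) \<oplus>\<^bsub>BP_alg n\<^esub> \<ominus>\<^bsub>BP_alg n\<^esub> (a \<otimes>\<^bsub>BP_alg n\<^esub> b)"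
      using c by (simp add: a_minus_def Q.l_distr Q.r_distr Q.l_minus Q.r_minus Q.a_assoc)
    then show ?thesis using c by (simp add: Q.l_neg a_minus_def)
  qed
  moreover have "y \<in> J_filt n j" using assms(2) by (simp add: spanned_def)
  ultimately have "(x \<otimes>\<^bsub>BP_alg n\<^esub> y) \<ominus>\<^bsub>BP_alg n\<^esub> (a \<otimes>\<^bsub>BP_alg n\<^esub> b) \<in> J_filt n (Suc (i + j))"
    using J_mult[OF ab(2), of y j] J_mult[OF wspan_J[OF ab(1)] ab(4)] J_add by simp
  then show ?thesis using c by (intro spanned_close[OF _ wspan_mult[OF ab(1,3)]]) auto
qed

text \<open>Modulo \<open>J\<close> every \<open>a\<^sub>i\<^sub>j\<close> is \<open>1\<close>, and so is its inverse since \<open>a\<inverse> - 1 = - a\<inverse> (a - 1)\<close>.\<close>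

lemma spanned_move:
  assumes m: "m \<in> moves n"
  shows "spanned n 0 (ga_elem (conj_move n m))"
proof -
  obtain i j e where ije: "m = (i, j, e)" by (cases m)
  have ij: "(i, j) \<in> indices n" using m by (simp only: ije moves_indices)
  let ?p = "conj_move n (i, j, True)" and ?q = "conj_move n (i, j, False)"
  have pq: "?p \<in> carrier (BP n)" "?q \<in> carrier (BP n)" using ij by (auto intro!: move_in_BP simp: moves_indices)
  have qp: "?q \<otimes>\<^bsub>BP n\<^esub> ?p = \<one>\<^bsub>BP n\<^esub>"
    using move_inverse[OF B.one_closed, of i j False n] ij pq by (auto simp: moves_indices)
  have one: "\<one>\<^bsub>BP_alg n\<^esub> \<in> wspan n 0"
    using wspan_single[of "[]" n 0 id] by (simp add: perm_elem_id)
  have a: "ga_elem ?p \<ominus>\<^bsub>BP_alg n\<^esub> \<one>\<^bsub>BP_alg n\<^esub> \<in> J_filt n (Suc 0)"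
    using aug_in_J[OF ij] by (simp add: aug_def conj_aut_eq_move[OF ij])
  have "ga_elem ?q \<otimes>\<^bsub>BP_alg n\<^esub> (ga_elem ?p \<ominus>\<^bsub>BP_alg n\<^esub> \<one>\<^bsub>BP_alg n\<^esub>) = \<one>\<^bsub>BP_alg n\<^esub> \<ominus>\<^bsub>BP_alg n\<^esub> ga_elem ?q"
    using pq by (simp add: a_minus_def Q.r_distr Q.r_minus ga_mult qp BP_alg_ops(4))
  then have "\<one>\<^bsub>BP_alg n\<^esub> \<ominus>\<^bsub>BP_alg n\<^esub> ga_elem ?q \<in> J_filt n (Suc 0)"
    using J_mult_left[OF ga_closed[OF pq(2)] a] by simp
  then have "\<ominus>\<^bsub>BP_alg n\<^esub> (\<one>\<^bsub>BP_alg n\<^esub> \<ominus>\<^bsub>BP_alg n\<^esub> ga_elem ?q) \<in> J_filt n (Suc 0)" by (rule J_minus)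
  also have "\<ominus>\<^bsub>BP_alg n\<^esub> (\<one>\<^bsub>BP_alg n\<^esub> \<ominus>\<^bsub>BP_alg n\<^esub> ga_elem ?q) = ga_elem ?q \<ominus>\<^bsub>BP_alg n\<^esub> \<one>\<^bsub>BP_alg n\<^esub>"
    using ga_closed[OF pq(2)] by (simp add: a_minus_def Q.minus_add Q.a_comm)
  finally have b: "ga_elem ?q \<ominus>\<^bsub>BP_alg n\<^esub> \<one>\<^bsub>BP_alg n\<^esub> \<in> J_filt n (Suc 0)" .
  show ?thesis unfolding ije
    by (cases e) (use a b pq one in \<open>auto intro: spanned_close\<close>)
qed

lemma spanned_0:
  assumes "x \<in> carrier (BP_alg n)"
  shows "spanned n 0 x"
proof -
  have ga: "spanned n 0 (ga_elem a)" if "a \<in> carrier (BP n)" for a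
    using that
  proof (induction rule: BP_induct)
    case (perm s)
    then have s: "s \<in> carrier (sym_group n)" unfolding sym_group_carrier .
    have "perm_elem n s \<in> wspan n 0" using wspan_single[of "[]" n 0 s] s by simp
    then show ?case unfolding perm_elem_def by (rule spanned_wspan)
  next
    case (move b m)
    then show ?case using spanned_mult[OF move(3) spanned_move[OF move(2)]] by (simp add: ga_mult)
  qed
  have smult: "spanned n 0 (c \<odot>\<^bsub>BP_alg n\<^esub> x)" if x: "spanned n 0 x" for c x
  proof -
    obtain y where y: "y \<in> wspan n 0" "x \<ominus>\<^bsub>BP_alg n\<^esub> y \<in> J_filt n (Suc 0)" using x by (auto simp: spanned_def)
    show ?thesis
      using spanned_closed[OF x] wspan_closed[OF y(1)] J_smult[OF y(2), of c]
      by (intro spanned_close[OF _ wspan_smult[OF y(1)]]) (auto simp: Q.smult_diff)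
  qed
  show ?thesis using assms
  proof (induction rule: BP_alg_induct)
    case zero
    show ?case by (rule spanned_wspan[OF wspan.zero])
  next
    case (add c a g)
    then show ?case using ga smult spanned_add by blast
  qed
qed

text \<open>The elements that are spanned in degree one form an ideal, because every element of the group algebra
  is spanned in degree zero.\<close>

lemma spanned_1:
  assumes "x \<in> J_ideal n"
  shows "spanned n (Suc 0) x"
proof -
  let ?D = "{x. spanned n (Suc 0) x}"
  have mult: "spanned n (Suc 0) (x \<otimes>\<^bsub>BP_alg n\<^esub> y)" "spanned n (Suc 0) (y \<otimes>\<^bsub>BP_alg n\<^esub> x)"
    if "spanned n (Suc 0) y" "x \<in> carrier (BP_alg n)" for x y
    using spanned_mult[OF spanned_0[OF that(2)] that(1)] spanned_mult[OF that(1) spanned_0[OF that(2)]] by simp_all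
  have "ideal ?D (BP_alg n)"
  proof (rule idealI)
    show "ring (BP_alg n)" by (rule Q.ring_axioms)
    show "subgroup ?D (add_monoid (BP_alg n))"
    proof (rule Q.add.subgroupI, goal_cases)
      case 1
      show ?case using spanned_closed by auto
    next
      case 2
      show ?case using spanned_wspan[OF wspan.zero] by blast
    next
      case (3 x)
      then have x: "spanned n (Suc 0) x" by simp
      have "\<ominus>\<^bsub>BP_alg n\<^esub> x = (\<ominus>\<^bsub>BP_alg n\<^esub> \<one>\<^bsub>BP_alg n\<^esub>) \<otimes>\<^bsub>BP_alg n\<^esub> x" using spanned_closed[OF x] by (simp add: Q.l_minus)
      then show ?case using mult(1)[OF x Q.a_inv_closed[OF Q.one_closed]] by simp
    next
      case (4 x y)
      then show ?case using spanned_add by simp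
    qed
  qed (use mult in auto)
  moreover have "J_gens n \<subseteq> ?D"
  proof
    fix g assume "g \<in> J_gens n"
    then obtain i where i: "1 \<le> i" "i < n" "g = aug n (i, i + 1) \<otimes>\<^bsub>BP_alg n\<^esub> perm_elem n (transpose i (i + 1))"
      unfolding J_gens_def by blast
    have "aug_word n [(i, i + 1)] \<otimes>\<^bsub>BP_alg n\<^esub> perm_elem n (transpose i (i + 1)) \<in> wspan n (Suc 0)"
      using generator_eq(2)[OF i(1,2)] transpose_sym[OF i(1,2)] by (intro wspan_single) auto
    then show "g \<in> ?D" using spanned_wspan i(3) aug_closed[OF generator_eq(2)[OF i(1,2)]] by simp
  qed
  ultimately have "J_ideal n \<subseteq> ?D" unfolding J_ideal_gens by (rule Q.genideal_minimal)
  then show ?thesis using assms by blast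
qed

text \<open>The products of elements spanned in degrees \<open>k\<close> and one are spanned in degree \<open>k + 1\<close>, so the claim
  propagates through the powers of \<open>J\<close>.\<close>

lemma spanned_J: "x \<in> J_filt n k \<Longrightarrow> spanned n k x"
proof (induction k arbitrary: x)
  case 0
  then show ?case by (simp add: J_filt_0 spanned_0)
next
  case (Suc k)
  from Suc.prems show ?case unfolding J_filt_Suc
  proof (induction rule: ideal_prod.induct)
    case (prod a b)
    then show ?case using spanned_mult[OF Suc.IH[OF prod(1)] spanned_1[OF prod(2)]] by simp
  next
    case (sum a b)
    then show ?case by (intro spanned_add)
  qed
qed

section \<open>The representation respects the filtrations\<close>

lemma rep_ring: "artin_rep n \<in> ring_hom (BP_alg n) (braid_alg n)"
  using artin_rep_alg_hom[of n] unfolding alg_hom_def mem_Collect_eq by (rule conjunct1)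

lemma rep_closed: "x \<in> carrier (BP_alg n) \<Longrightarrow> artin_rep n x \<in> carrier (braid_alg n)"
  by (rule ring_hom_closed[OF rep_ring])

lemma rep_ops:
  "x \<in> carrier (BP_alg n) \<Longrightarrow> y \<in> carrier (BP_alg n) \<Longrightarrow> artin_rep n (x \<oplus>\<^bsub>BP_alg n\<^esub> y) = artin_rep n x \<oplus>\<^bsub>braid_alg n\<^esub> artin_rep n y"
  "x \<in> carrier (BP_alg n) \<Longrightarrow> y \<in> carrier (BP_alg n) \<Longrightarrow> artin_rep n (x \<otimes>\<^bsub>BP_alg n\<^esub> y) = artin_rep n x \<otimes>\<^bsub>braid_alg n\<^esub> artin_rep n y"
  "x \<in> carrier (BP_alg n) \<Longrightarrow> artin_rep n (c \<odot>\<^bsub>BP_alg n\<^esub> x) = c \<odot>\<^bsub>braid_alg n\<^esub> artin_rep n x"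
  "artin_rep n \<one>\<^bsub>BP_alg n\<^esub> = \<one>\<^bsub>braid_alg n\<^esub>"
proof -
  show "artin_rep n (c \<odot>\<^bsub>BP_alg n\<^esub> x) = c \<odot>\<^bsub>braid_alg n\<^esub> artin_rep n x" if "x \<in> carrier (BP_alg n)"
    using artin_rep_alg_hom[of n] that unfolding alg_hom_def mem_Collect_eq by blast
qed (rule ring_hom_add[OF rep_ring] ring_hom_mult[OF rep_ring] ring_hom_one[OF rep_ring]; assumption)+

lemma rep_ring_hom: "ring_hom_ring (BP_alg n) (braid_alg n) (artin_rep n)"
  by (rule ring_hom_ringI2[OF Q.ring_axioms Br.C.ring_axioms rep_ring])

lemma rep_perm_elem: "s \<in> carrier (sym_group n) \<Longrightarrow> artin_rep n (perm_elem n s) = pure n \<one>\<^bsub>artin_alg n\<^esub> s"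
  unfolding perm_elem_def by (rule is_artin_rep_perm[OF artin_rep])

lemma rep_aug:
  assumes ij: "(i, j) \<in> indices n"
  shows "artin_rep n (aug n (i, j)) = pure n (art n (series_exp n (series_var i j) \<ominus>\<^bsub>series_alg n\<^esub> \<one>\<^bsub>series_alg n\<^esub>)) id"
proof -
  let ?e = "series_exp n (series_var i j)"
  have e: "?e \<in> carrier (series_alg n)" by (rule exp_carrier[OF var_series[OF ij]])
  have d: "?e \<ominus>\<^bsub>series_alg n\<^esub> \<one>\<^bsub>series_alg n\<^esub> \<in> carrier (series_alg n)" using e by simp
  have "(?e \<ominus>\<^bsub>series_alg n\<^esub> \<one>\<^bsub>series_alg n\<^esub>) \<oplus>\<^bsub>series_alg n\<^esub> \<one>\<^bsub>series_alg n\<^esub> = ?e" using e by (simp add: a_minus_def S.a_assoc S.l_neg)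
  then have ar: "art n (?e \<ominus>\<^bsub>series_alg n\<^esub> \<one>\<^bsub>series_alg n\<^esub>) \<oplus>\<^bsub>artin_alg n\<^esub> \<one>\<^bsub>artin_alg n\<^esub> = art n ?e"
    using d e by (simp add: art_simps)
  have "pure n (art n (?e \<ominus>\<^bsub>series_alg n\<^esub> \<one>\<^bsub>series_alg n\<^esub>)) id \<oplus>\<^bsub>braid_alg n\<^esub> pure n \<one>\<^bsub>artin_alg n\<^esub> id = pure n (art n ?e) id"
  proof (rule Br.C_eqI)
    fix s assume s: "s \<in> carrier (sym_group n)"
    show "(pure n (art n (?e \<ominus>\<^bsub>series_alg n\<^esub> \<one>\<^bsub>series_alg n\<^esub>)) id \<oplus>\<^bsub>braid_alg n\<^esub> pure n \<one>\<^bsub>artin_alg n\<^esub> id) s = pure n (art n ?e) id s"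
      using s ar by (simp add: Br.C_ops Br.pure_apply)
  qed (use e d in auto)
  also have "\<dots> = artin_rep n (ga_elem (conj_aut n i j))"
    using is_artin_rep_conj[OF artin_rep ij] by (simp add: artin_exp_def)
  also have "\<dots> = artin_rep n (aug n (i, j)) \<oplus>\<^bsub>braid_alg n\<^esub> pure n \<one>\<^bsub>artin_alg n\<^esub> id"
    using ga_conj[OF ij] aug_closed[OF ij] by (simp add: rep_ops pure_one)
  finally have eq: "pure n (art n (?e \<ominus>\<^bsub>series_alg n\<^esub> \<one>\<^bsub>series_alg n\<^esub>)) id \<oplus>\<^bsub>braid_alg n\<^esub> pure n \<one>\<^bsub>artin_alg n\<^esub> id = artin_rep n (aug n (i, j)) \<oplus>\<^bsub>braid_alg n\<^esub> pure n \<one>\<^bsub>artin_alg n\<^esub> id" .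
  have c: "artin_rep n (aug n (i, j)) \<in> carrier (braid_alg n)" "pure n (art n (?e \<ominus>\<^bsub>series_alg n\<^esub> \<one>\<^bsub>series_alg n\<^esub>)) id \<in> carrier (braid_alg n)"
    "pure n \<one>\<^bsub>artin_alg n\<^esub> id \<in> carrier (braid_alg n)"
    by (rule rep_closed[OF aug_closed[OF ij]], rule Br.pure_closed[OF art_closed[OF d]], rule Br.pure_closed[OF Art.one_closed])
  show ?thesis by (rule iffD1[OF Br.C.add.right_cancel[OF c(3,1,2)] eq[symmetric]])
qed

lemma var_comp: "series_comp 1 (series_var i j) = series_var i j"
  by (auto simp: series_comp_def series_var_def)

text \<open>As the image of \<open>A\<^sub>i\<^sub>j\<close> is \<open>exp v\<^sub>i\<^sub>j - 1\<close>, this is \<open>exp_leading\<close>.\<close>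

lemma rep_aug_lead:
  assumes p: "p \<in> indices n"
  shows "artin_rep n (aug n p) \<in> braid_filt n 1"
    "lead n 1 (artin_rep n (aug n p)) = gpure n (gart n (ga_elem [p])) id"
proof -
  obtain i j where ij: "p = (i, j)" by (cases p)
  note f = var_filt[OF p[unfolded ij]]
  have v: "series_var i j = ga_elem [p]" by (auto simp: series_var_def ga_elem_def ij)
  show "artin_rep n (aug n p) \<in> braid_filt n 1"
    unfolding ij rep_aug[OF p[unfolded ij]] by (rule lead_pure(2)[OF exp_leading(1)[OF f] id_sym])
  show "lead n 1 (artin_rep n (aug n p)) = gpure n (gart n (ga_elem [p])) id"
    unfolding v[symmetric] unfolding ij rep_aug[OF p[unfolded ij]] lead_pure(1)[OF exp_leading(1)[OF f] id_sym]
      exp_leading(2)[OF f] var_comp ..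
qed

text \<open>The elements mapped into the first filtration step form an ideal that contains the generators of \<open>J\<close>,
  and the target filtration is multiplicative.\<close>

lemma rep_filt: "x \<in> J_filt n k \<Longrightarrow> artin_rep n x \<in> braid_filt n k"
proof (induction k arbitrary: x)
  case 0
  then show ?case by (simp add: J_filt_0 braid_filt_0 rep_closed)
next
  case (Suc k)
  interpret R: ring_hom_ring "BP_alg n" "braid_alg n" "artin_rep n" by (rule rep_ring_hom)
  let ?D = "{x \<in> carrier (BP_alg n). artin_rep n x \<in> braid_filt n 1}"
  have D: "ideal ?D (BP_alg n)" by (rule R.ideal_vimage[OF braid_filt_ideal])
  have "J_gens n \<subseteq> ?D"
  proof
    fix g assume "g \<in> J_gens n"
    then obtain i where i: "1 \<le> i" "i < n" "g = aug n (i, i + 1) \<otimes>\<^bsub>BP_alg n\<^esub> perm_elem n (transpose i (i + 1))"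
      unfolding J_gens_def by blast
    note ix = generator_eq(2)[OF i(1,2)] and t = perm_elem_closed[OF transpose_sym[OF i(1,2)]]
    have "aug n (i, i + 1) \<in> ?D" using rep_aug_lead(1)[OF ix] aug_closed[OF ix] by blast
    then show "g \<in> ?D" unfolding i(3) by (rule ideal.I_r_closed[OF D _ t])
  qed
  then have J: "J_ideal n \<subseteq> ?D" unfolding J_ideal_gens by (rule Q.genideal_minimal[OF D])
  from Suc.prems show ?case unfolding J_filt_Suc
  proof (induction rule: ideal_prod.induct)
    case (prod a b)
    then have "artin_rep n a \<in> braid_filt n k" "artin_rep n b \<in> braid_filt n 1" using J Suc.IH by auto
    from braid_filt_ops(3)[OF this] show ?case
      using J_filt_closed[OF prod(1)] ideal.Icarr[OF J_ideal prod(2)] by (simp add: rep_ops)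
  next
    case (sum a b)
    have "ideal_prod (BP_alg n) (J_filt n k) (J_ideal n) \<subseteq> carrier (BP_alg n)"
      using J_filt_closed[of _ n "Suc k"] unfolding J_filt_Suc by blast
    then show ?case using sum braid_filt_ops(1) by (simp add: rep_ops subset_iff)
  qed
qed

subsection \<open>Leading parts of words\<close>

text \<open>The map induced by the representation on the \<open>k\<close>-th graded piece, evaluated on representatives.\<close>

definition lead_rep :: "nat \<Rightarrow> nat \<Rightarrow> ((word \<Rightarrow> word) \<Rightarrow> rat) \<Rightarrow> (nat \<Rightarrow> nat) \<Rightarrow> series set" where
  "lead_rep n k x = lead n k (artin_rep n x)"

lemma lead_rep_part: "x \<in> J_filt n k \<Longrightarrow> lead_rep n k x \<in> graded_braid_part n k"
  unfolding lead_rep_def by (rule lead_part[OF rep_filt])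

lemma lead_rep_closed: "x \<in> J_filt n k \<Longrightarrow> lead_rep n k x \<in> carrier (graded_braid_alg n)"
  by (rule graded_braid_part_carrier[OF lead_rep_part])

lemma lead_rep_add: "x \<in> J_filt n k \<Longrightarrow> y \<in> J_filt n k \<Longrightarrow> lead_rep n k (x \<oplus>\<^bsub>BP_alg n\<^esub> y) = lead_rep n k x \<oplus>\<^bsub>graded_braid_alg n\<^esub> lead_rep n k y"
  unfolding lead_rep_def using lead_add[OF rep_filt rep_filt, of x n k y] J_filt_closed by (simp add: rep_ops)

lemma lead_rep_smult: "x \<in> J_filt n k \<Longrightarrow> lead_rep n k (c \<odot>\<^bsub>BP_alg n\<^esub> x) = c \<odot>\<^bsub>graded_braid_alg n\<^esub> lead_rep n k x"
  unfolding lead_rep_def using lead_smult[OF rep_filt, of x n k c] J_filt_closed by (simp add: rep_ops)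

lemma lead_rep_mult: "x \<in> J_filt n i \<Longrightarrow> y \<in> J_filt n j \<Longrightarrow> lead_rep n (i + j) (x \<otimes>\<^bsub>BP_alg n\<^esub> y) = lead_rep n i x \<otimes>\<^bsub>graded_braid_alg n\<^esub> lead_rep n j y"
  unfolding lead_rep_def using lead_mult[OF rep_filt rep_filt, of x n i y j] J_filt_closed by (simp add: rep_ops)

lemma lead_rep_next: "x \<in> J_filt n (Suc k) \<Longrightarrow> lead_rep n k x = \<zero>\<^bsub>graded_braid_alg n\<^esub>"
  unfolding lead_rep_def using lead_kernel[OF rep_filt, of x n k] rep_filt[of x n "Suc k"] J_filt_mono by blast

lemma word_free: "set w \<subseteq> indices n \<Longrightarrow> ga_elem w \<in> carrier (free_alg n)"
  by (auto simp: free_carrier series_carrier ga_elem_def)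

lemma word_mult: "ga_elem u \<otimes>\<^bsub>series_alg n\<^esub> ga_elem v = ga_elem (u @ v)"
proof
  fix w :: "(nat \<times> nat) list"
  have "(ga_elem u \<otimes>\<^bsub>series_alg n\<^esub> ga_elem v) w = (\<Sum>k\<le>length w. if k = length u then (if w = u @ v then 1 else 0) else 0)"
    unfolding series_ops(4)
  proof (rule sum.cong[OF refl])
    fix k assume "k \<in> {..length w}"
    then have "take k w = u \<and> drop k w = v \<longleftrightarrow> k = length u \<and> w = u @ v"
      by (metis append_eq_conv_conj append_take_drop_id atMost_iff length_take min.absorb2)
    moreover have "ga_elem u x * ga_elem v y = (if x = u \<and> y = v then 1 else 0)" for x y :: "(nat \<times> nat) list"
      by (simp add: ga_elem_def)
    ultimately show "ga_elem u (take k w) * ga_elem v (drop k w) = (if k = length u then (if w = u @ v then 1 else 0) else 0)"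
      by (cases "k = length u"; cases "w = u @ v"; simp only: simp_thms if_True if_False)
  qed
  also have "\<dots> = ga_elem (u @ v) w" by (auto simp: ga_elem_def)
  finally show "(ga_elem u \<otimes>\<^bsub>series_alg n\<^esub> ga_elem v) w = ga_elem (u @ v) w" .
qed

lemma gpure_mult:
  assumes "X \<in> carrier (graded_artin_alg n)" "Y \<in> carrier (graded_artin_alg n)" "s \<in> carrier (sym_group n)"
  shows "gpure n X id \<otimes>\<^bsub>graded_braid_alg n\<^esub> gpure n Y s = gpure n (X \<otimes>\<^bsub>graded_artin_alg n\<^esub> Y) s"
  using GBr.pure_mult[OF assms(1,2) id_sym assms(3)] GBr.act_id[of Y n] assms(2)
  by (simp add: sym_group_mult sym_group_one)

text \<open>Leading terms are multiplicative, so that it is enough to know them for the factors of \<open>A\<^sub>w s\<close>.\<close>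

lemma lead_rep_word:
  assumes "set w \<subseteq> indices n" "s \<in> carrier (sym_group n)"
  shows "lead_rep n (length w) (aug_word n w \<otimes>\<^bsub>BP_alg n\<^esub> perm_elem n s) = gpure n (gart n (ga_elem w)) s"
  using assms(1)
proof (induction w)
  case Nil
  have "ga_elem [] = \<one>\<^bsub>series_alg n\<^esub>" by (auto simp: ga_elem_def series_ops)
  moreover have "series_comp 0 \<one>\<^bsub>series_alg n\<^esub> = \<one>\<^bsub>series_alg n\<^esub>" by (auto simp: series_comp_def series_ops)
  moreover have "\<one>\<^bsub>series_alg n\<^esub> \<in> series_filt n 0" by (simp add: filt_0)
  ultimately show ?case
    using lead_pure(1)[of "\<one>\<^bsub>series_alg n\<^esub>" n 0 s] assms(2) perm_elem_closed[OF assms(2)] by (simp add: lead_rep_def rep_perm_elem art_simps)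
next
  case (Cons p w)
  have p: "p \<in> indices n" and w: "set w \<subseteq> indices n" using Cons.prems by auto
  let ?x = "aug_word n w \<otimes>\<^bsub>BP_alg n\<^esub> perm_elem n s"
  have x: "?x \<in> J_filt n (length w)" by (rule J_mult_right[OF perm_elem_closed[OF assms(2)] aug_word_in_J[OF w]])
  have "lead_rep n (Suc (length w)) (aug n p \<otimes>\<^bsub>BP_alg n\<^esub> ?x) = lead_rep n (Suc 0) (aug n p) \<otimes>\<^bsub>graded_braid_alg n\<^esub> lead_rep n (length w) ?x"
    using lead_rep_mult[OF aug_in_J[OF p] x] by simp
  also have "\<dots> = gpure n (gart n (ga_elem [p])) id \<otimes>\<^bsub>graded_braid_alg n\<^esub> gpure n (gart n (ga_elem w)) s"
    using rep_aug_lead(2)[OF p] Cons.IH[OF w] by (simp add: lead_rep_def)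
  also have "\<dots> = gpure n (gart n (ga_elem [p]) \<otimes>\<^bsub>graded_artin_alg n\<^esub> gart n (ga_elem w)) s"
    using p w assms(2) by (intro gpure_mult gart_closed word_free) auto
  also have "gart n (ga_elem [p]) \<otimes>\<^bsub>graded_artin_alg n\<^esub> gart n (ga_elem w) = gart n (ga_elem (p # w))"
    using word_free[of "[p]" n] word_free[OF w] p by (simp add: gart_simps word_mult)
  finally show ?case using p w assms(2) by (simp add: Q.m_assoc)
qed

section \<open>Lifting the graded algebra to the group algebra\<close>

text \<open>The substitution of \<open>A\<^sub>i\<^sub>j\<close> for \<open>v\<^sub>i\<^sub>j\<close>. It is defined on noncommutative polynomials only, as the group
  algebra is not complete.\<close>

definition lift :: "nat \<Rightarrow> series \<Rightarrow> (word \<Rightarrow> word) \<Rightarrow> rat" where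
  "lift n = lin_ext (BP_alg n) (aug_word n)"

lemma free_carrier_words: "carrier (free_alg n) = {f. finite {w. f w \<noteq> 0} \<and> {w. f w \<noteq> 0} \<subseteq> {w. set w \<subseteq> indices n}}"
  by (simp add: set_eq_iff free_carrier series_carrier subset_iff) blast

lemma free_alg_ops: "f \<oplus>\<^bsub>free_alg n\<^esub> g = (\<lambda>w. f w + g w)" "\<zero>\<^bsub>free_alg n\<^esub> = (\<lambda>w. 0)" "c \<odot>\<^bsub>free_alg n\<^esub> f = (\<lambda>w. c * f w)"
  by (auto simp: fun_eq_iff series_ops)

lemma lift_closed [simp, intro]: "f \<in> carrier (free_alg n) \<Longrightarrow> lift n f \<in> carrier (BP_alg n)"
  unfolding lift_def free_carrier_words by (rule Q.lin_ext_closed[where X = "{w. set w \<subseteq> indices n}"]) auto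

lemma lift_add: "f \<in> carrier (free_alg n) \<Longrightarrow> g \<in> carrier (free_alg n) \<Longrightarrow> lift n (f \<oplus>\<^bsub>free_alg n\<^esub> g) = lift n f \<oplus>\<^bsub>BP_alg n\<^esub> lift n g"
  unfolding lift_def free_carrier_words free_alg_ops
  by (rule Q.lin_ext_add[where X = "{w. set w \<subseteq> indices n}"]) auto

lemma lift_smult: "f \<in> carrier (free_alg n) \<Longrightarrow> lift n (c \<odot>\<^bsub>free_alg n\<^esub> f) = c \<odot>\<^bsub>BP_alg n\<^esub> lift n f"
  unfolding lift_def free_carrier_words free_alg_ops
  by (rule Q.lin_ext_smult[where X = "{w. set w \<subseteq> indices n}"]) auto

lemma lift_zero: "lift n \<zero>\<^bsub>free_alg n\<^esub> = \<zero>\<^bsub>BP_alg n\<^esub>"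
  unfolding lift_def free_alg_ops by (rule Q.lin_ext_zero)

lemma lift_mult:
  assumes "f \<in> carrier (free_alg n)" "g \<in> carrier (free_alg n)"
  shows "lift n (f \<otimes>\<^bsub>free_alg n\<^esub> g) = lift n f \<otimes>\<^bsub>BP_alg n\<^esub> lift n g"
  unfolding lift_def
  by (rule lin_ext_mult[where A = "free_alg n" and B = "BP_alg n" and X = "{w. set w \<subseteq> indices n}"
        and m = "(@)" and \<phi> = "aug_word n"])
     (use assms in \<open>simp_all only: rat_alg_free Q.rat_alg_axioms free_carrier_words free_alg_ops free_ops(2) word_mult
        mem_Collect_eq aug_word_closed aug_word_append set_append Un_subset_iff\<close>)

lemma lift_word: "set w \<subseteq> indices n \<Longrightarrow> lift n (ga_elem w) = aug_word n w"
  unfolding lift_def ga_elem_def using Q.lin_ext_single[of "aug_word n" w n 1] by simp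

lemma lift_homogeneous:
  assumes "f \<in> carrier (free_alg n)" "\<And>w. f w \<noteq> 0 \<Longrightarrow> length w = k"
  shows "lift n f \<in> J_filt n k"
  unfolding lift_def lin_ext_def
proof (rule ideal_finsum[OF Q.ring_axioms J_filt_ideal])
  show "finite {w. f w \<noteq> 0}" using assms(1) by (simp add: free_carrier)
  fix w assume "w \<in> {w. f w \<noteq> 0}"
  then have "set w \<subseteq> indices n" "length w = k" using assms by (auto simp: free_carrier series_carrier)
  then show "f w \<odot>\<^bsub>BP_alg n\<^esub> aug_word n w \<in> J_filt n k" using aug_word_in_J by (auto intro: J_smult)
qed

lemma lift_comp: "f \<in> carrier (series_alg n) \<Longrightarrow> lift n (series_comp k f) \<in> J_filt n k"
  by (rule lift_homogeneous[OF comp_in_free]) (auto simp: series_comp_def split: if_splits)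

text \<open>The lower bound: on homogeneous polynomials the leading term undoes the substitution.\<close>

lemma lead_rep_lift:
  assumes f: "f \<in> carrier (free_alg n)" "\<And>w. f w \<noteq> 0 \<Longrightarrow> length w = k" and s: "s \<in> carrier (sym_group n)"
  shows "lead_rep n k (lift n f \<otimes>\<^bsub>BP_alg n\<^esub> perm_elem n s) = gpure n (gart n f) s"
proof -
  let ?X = "{w. set w \<subseteq> indices n \<and> length w = k}"
  have "finite {w. f w \<noteq> 0}" "{w. f w \<noteq> 0} \<subseteq> ?X" using f by (auto simp: free_carrier series_carrier)
  then show ?thesis
  proof (induction rule: finsupp_induct)
    case zero
    have "gart n \<zero>\<^bsub>free_alg n\<^esub> = \<zero>\<^bsub>graded_artin_alg n\<^esub>" using coset_eq_self_iff[OF rat_alg_free graded_ideal Fr.zero_closed] graded_ideal_zero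
      by (simp add: gart_simps)
    then have "gpure n (gart n (\<lambda>w. 0)) s = \<zero>\<^bsub>graded_braid_alg n\<^esub>"
      unfolding free_alg_ops by (intro GBr.C_eqI) (auto simp: GBr.pure_apply GBr.C_ops)
    moreover have "lift n (\<lambda>w. 0) \<otimes>\<^bsub>BP_alg n\<^esub> perm_elem n s = \<zero>\<^bsub>BP_alg n\<^esub>"
      using lift_zero[of n] perm_elem_closed[OF s] unfolding free_alg_ops by simp
    ultimately show ?case using lead_rep_next[OF J_zero] by simp
  next
    case (add c w f)
    have w: "set w \<subseteq> indices n" "length w = k" using add(1) by auto
    have f: "f \<in> carrier (free_alg n)" "\<And>w. f w \<noteq> 0 \<Longrightarrow> length w = k"
      using add by (auto simp: free_carrier series_carrier)
    have eq: "(\<lambda>y. (if y = w then c else 0) + f y) = c \<odot>\<^bsub>free_alg n\<^esub> ga_elem w \<oplus>\<^bsub>free_alg n\<^esub> f"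
      by (auto simp: fun_eq_iff series_ops ga_elem_def)
    note wf = word_free[OF w(1)]
    have J: "aug_word n w \<otimes>\<^bsub>BP_alg n\<^esub> perm_elem n s \<in> J_filt n k" "lift n f \<otimes>\<^bsub>BP_alg n\<^esub> perm_elem n s \<in> J_filt n k"
      using aug_word_in_J[OF w(1)] w(2) lift_homogeneous[OF f] by (auto intro!: J_mult_right perm_elem_closed s)
    have "lift n (c \<odot>\<^bsub>free_alg n\<^esub> ga_elem w \<oplus>\<^bsub>free_alg n\<^esub> f) \<otimes>\<^bsub>BP_alg n\<^esub> perm_elem n s = c \<odot>\<^bsub>BP_alg n\<^esub> (aug_word n w \<otimes>\<^bsub>BP_alg n\<^esub> perm_elem n s) \<oplus>\<^bsub>BP_alg n\<^esub> lift n f \<otimes>\<^bsub>BP_alg n\<^esub> perm_elem n s"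
      using wf f(1) w(1) perm_elem_closed[OF s] aug_word_closed[OF w(1)]
      by (simp only: lift_add lift_smult lift_word Fr.smult_closed Q.l_distr Q.smult_mult_left Q.smult_closed lift_closed)
    then have "lead_rep n k (lift n (c \<odot>\<^bsub>free_alg n\<^esub> ga_elem w \<oplus>\<^bsub>free_alg n\<^esub> f) \<otimes>\<^bsub>BP_alg n\<^esub> perm_elem n s)
        = c \<odot>\<^bsub>graded_braid_alg n\<^esub> gpure n (gart n (ga_elem w)) s \<oplus>\<^bsub>graded_braid_alg n\<^esub> gpure n (gart n f) s"
      using J lead_rep_word[OF w(1) s] w(2) add.IH by (simp only: lead_rep_add lead_rep_smult J_smult)
    also have "\<dots> = gpure n (gart n (c \<odot>\<^bsub>free_alg n\<^esub> ga_elem w \<oplus>\<^bsub>free_alg n\<^esub> f)) s"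
    proof (rule GBr.C_eqI)
      fix t assume t: "t \<in> carrier (sym_group n)"
      show "(c \<odot>\<^bsub>graded_braid_alg n\<^esub> gpure n (gart n (ga_elem w)) s \<oplus>\<^bsub>graded_braid_alg n\<^esub> gpure n (gart n f) s) t
        = gpure n (gart n (c \<odot>\<^bsub>free_alg n\<^esub> ga_elem w \<oplus>\<^bsub>free_alg n\<^esub> f)) s t"
      proof (cases "t = s")
        case True
        then show ?thesis
          using t wf f(1) Fr.smult_closed[OF wf, of c] by (simp add: GBr.C_ops GBr.pure_apply gart_simps del: free_ops)
      next
        case False
        then show ?thesis using t by (simp add: GBr.C_ops GBr.pure_apply)
      qed
    qed (use wf f(1) Fr.smult_closed[OF wf, of c] in \<open>auto simp del: free_ops\<close>)
    finally show ?case unfolding eq .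
  qed
qed

subsection \<open>The relators are lifted to the third power\<close>

lemma conj_commute:
  assumes "(i, j) \<in> indices n" "(k, l) \<in> indices n" "i \<noteq> k" "i \<noteq> l" "k \<noteq> j"
  shows "conj_aut n i j \<otimes>\<^bsub>BP n\<^esub> conj_aut n k l = conj_aut n k l \<otimes>\<^bsub>BP n\<^esub> conj_aut n i j"
proof -
  have m: "(i, j, True) \<in> moves n" "(k, l, True) \<in> moves n" using assms(1,2) by (simp_all only: moves_indices)
  show ?thesis
    using moves_commute[OF B.one_closed m assms(3-5)] move_in_BP[OF m(1)] move_in_BP[OF m(2)]
    by (simp add: conj_aut_eq_move[OF assms(1)] conj_aut_eq_move[OF assms(2)])
qed

text \<open>Comparison of the conjugators of the two products, computed with \<open>conj_data_move\<close>.\<close>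

lemma conj_triple:
  assumes ix: "(i, j) \<in> indices n" "(i, k) \<in> indices n" "(j, k) \<in> indices n"
  shows "conj_aut n i j \<otimes>\<^bsub>BP n\<^esub> (conj_aut n i k \<otimes>\<^bsub>BP n\<^esub> conj_aut n j k) = (conj_aut n i k \<otimes>\<^bsub>BP n\<^esub> conj_aut n j k) \<otimes>\<^bsub>BP n\<^esub> conj_aut n i j"
proof -
  have m: "(i, j, True) \<in> moves n" "(i, k, True) \<in> moves n" "(j, k, True) \<in> moves n"
    using ix by (simp_all only: moves_indices)
  have d: "i \<noteq> j" "i \<noteq> k" "j \<noteq> k" using ix by (auto simp: indices_def)
  have "\<one>\<^bsub>BP n\<^esub> \<otimes>\<^bsub>BP n\<^esub> conj_move n (i, j, True) \<otimes>\<^bsub>BP n\<^esub> conj_move n (i, k, True) \<otimes>\<^bsub>BP n\<^esub> conj_move n (j, k, True)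
      = \<one>\<^bsub>BP n\<^esub> \<otimes>\<^bsub>BP n\<^esub> conj_move n (i, k, True) \<otimes>\<^bsub>BP n\<^esub> conj_move n (j, k, True) \<otimes>\<^bsub>BP n\<^esub> conj_move n (i, j, True)"
    by (rule conj_data_eqI[OF conj_data_move[OF conj_data_move[OF conj_data_move[OF conj_data_one m(1)] m(2)] m(3)]
          conj_data_move[OF conj_data_move[OF conj_data_move[OF conj_data_one m(2)] m(3)] m(1)]])
       (use d in \<open>auto simp: nf_def fg_cons_def\<close>)
  then show ?thesis
    using move_in_BP[OF m(1)] move_in_BP[OF m(2)] move_in_BP[OF m(3)]
    by (simp add: conj_aut_eq_move[OF ix(1)] conj_aut_eq_move[OF ix(2)] conj_aut_eq_move[OF ix(3)] B.m_assoc)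
qed

text \<open>Passage from the commutation of group elements \<open>1 + x\<close> to that of the augmented elements \<open>x\<close>.\<close>

lemma (in ring) commute_add_one:
  assumes x: "x \<in> carrier R" and t: "t \<in> carrier R"
    and eq: "(x \<oplus> \<one>) \<otimes> (t \<oplus> \<one>) = (t \<oplus> \<one>) \<otimes> (x \<oplus> \<one>)"
  shows "x \<otimes> t = t \<otimes> x"
proof -
  let ?r = "x \<oplus> t \<oplus> \<one>"
  have "(x \<oplus> \<one>) \<otimes> (t \<oplus> \<one>) = x \<otimes> t \<oplus> ?r" "(t \<oplus> \<one>) \<otimes> (x \<oplus> \<one>) = t \<otimes> x \<oplus> ?r"
    using x t by (simp_all add: l_distr r_distr a_ac)
  with eq have "x \<otimes> t \<oplus> ?r = t \<otimes> x \<oplus> ?r" by simp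
  then show ?thesis using x t by (simp add: add.right_cancel)
qed

lemma aug_commute:
  assumes ix: "(i, j) \<in> indices n" "(k, l) \<in> indices n" "i \<noteq> k" "i \<noteq> l" "k \<noteq> j"
  shows "aug n (i, j) \<otimes>\<^bsub>BP_alg n\<^esub> aug n (k, l) = aug n (k, l) \<otimes>\<^bsub>BP_alg n\<^esub> aug n (i, j)"
proof (rule Q.commute_add_one[OF aug_closed[OF ix(1)] aug_closed[OF ix(2)]])
  show "(aug n (i, j) \<oplus>\<^bsub>BP_alg n\<^esub> \<one>\<^bsub>BP_alg n\<^esub>) \<otimes>\<^bsub>BP_alg n\<^esub> (aug n (k, l) \<oplus>\<^bsub>BP_alg n\<^esub> \<one>\<^bsub>BP_alg n\<^esub>) = (aug n (k, l) \<oplus>\<^bsub>BP_alg n\<^esub> \<one>\<^bsub>BP_alg n\<^esub>) \<otimes>\<^bsub>BP_alg n\<^esub> (aug n (i, j) \<oplus>\<^bsub>BP_alg n\<^esub> \<one>\<^bsub>BP_alg n\<^esub>)"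
    unfolding ga_conj[OF ix(1), symmetric] ga_conj[OF ix(2), symmetric] fst_conv snd_conv ga_mult
    by (simp only: conj_commute[OF assms])
qed

text \<open>With \<open>X = A\<^sub>i\<^sub>j\<close>, \<open>Y = A\<^sub>i\<^sub>k\<close>, \<open>Z = A\<^sub>j\<^sub>k\<close>, the element \<open>1 + X\<close> commutes with \<open>(1 + Y) (1 + Z) = 1 + (Y + Z + Y Z)\<close>.
  Hence \<open>X\<close> commutes with \<open>Y + Z + Y Z\<close>, and its commutator with \<open>Y + Z\<close> is \<open>Y Z X - X Y Z\<close>, of degree three.\<close>

lemma aug_triple:
  assumes ix: "(i, j) \<in> indices n" "(i, k) \<in> indices n" "(j, k) \<in> indices n"
  shows "commutator (BP_alg n) (aug n (i, j)) (aug n (i, k) \<oplus>\<^bsub>BP_alg n\<^esub> aug n (j, k)) \<in> J_filt n 3"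
proof -
  let ?x = "aug n (i, j)" and ?y = "aug n (i, k)" and ?z = "aug n (j, k)"
  note c = aug_closed[OF ix(1)] aug_closed[OF ix(2)] aug_closed[OF ix(3)]
  let ?t = "(?y \<oplus>\<^bsub>BP_alg n\<^esub> ?z) \<oplus>\<^bsub>BP_alg n\<^esub> ?y \<otimes>\<^bsub>BP_alg n\<^esub> ?z"
  have t: "?t \<oplus>\<^bsub>BP_alg n\<^esub> \<one>\<^bsub>BP_alg n\<^esub> = (?y \<oplus>\<^bsub>BP_alg n\<^esub> \<one>\<^bsub>BP_alg n\<^esub>) \<otimes>\<^bsub>BP_alg n\<^esub> (?z \<oplus>\<^bsub>BP_alg n\<^esub> \<one>\<^bsub>BP_alg n\<^esub>)"
    using c by (simp add: Q.l_distr Q.r_distr Q.a_ac)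
  have "?x \<otimes>\<^bsub>BP_alg n\<^esub> ?t = ?t \<otimes>\<^bsub>BP_alg n\<^esub> ?x"
  proof (rule Q.commute_add_one[OF c(1)])
    show "(?x \<oplus>\<^bsub>BP_alg n\<^esub> \<one>\<^bsub>BP_alg n\<^esub>) \<otimes>\<^bsub>BP_alg n\<^esub> (?t \<oplus>\<^bsub>BP_alg n\<^esub> \<one>\<^bsub>BP_alg n\<^esub>) = (?t \<oplus>\<^bsub>BP_alg n\<^esub> \<one>\<^bsub>BP_alg n\<^esub>) \<otimes>\<^bsub>BP_alg n\<^esub> (?x \<oplus>\<^bsub>BP_alg n\<^esub> \<one>\<^bsub>BP_alg n\<^esub>)"
      unfolding t ga_conj[OF ix(1), symmetric] ga_conj[OF ix(2), symmetric] ga_conj[OF ix(3), symmetric]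
        fst_conv snd_conv ga_mult by (simp only: conj_triple[OF ix])
  qed (use c in simp)
  then have e: "?x \<otimes>\<^bsub>BP_alg n\<^esub> (?y \<oplus>\<^bsub>BP_alg n\<^esub> ?z) \<oplus>\<^bsub>BP_alg n\<^esub> ?x \<otimes>\<^bsub>BP_alg n\<^esub> (?y \<otimes>\<^bsub>BP_alg n\<^esub> ?z) = (?y \<oplus>\<^bsub>BP_alg n\<^esub> ?z) \<otimes>\<^bsub>BP_alg n\<^esub> ?x \<oplus>\<^bsub>BP_alg n\<^esub> (?y \<otimes>\<^bsub>BP_alg n\<^esub> ?z) \<otimes>\<^bsub>BP_alg n\<^esub> ?x"
    using c Q.r_distr[of "?y \<oplus>\<^bsub>BP_alg n\<^esub> ?z" n "?y \<otimes>\<^bsub>BP_alg n\<^esub> ?z" ?x] Q.l_distr[of "?y \<oplus>\<^bsub>BP_alg n\<^esub> ?z" n "?y \<otimes>\<^bsub>BP_alg n\<^esub> ?z" ?x] by simp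
  have gen: "a \<ominus>\<^bsub>BP_alg n\<^esub> b = d \<ominus>\<^bsub>BP_alg n\<^esub> u" if "a \<oplus>\<^bsub>BP_alg n\<^esub> u = b \<oplus>\<^bsub>BP_alg n\<^esub> d" "a \<in> carrier (BP_alg n)" "b \<in> carrier (BP_alg n)"
    "d \<in> carrier (BP_alg n)" "u \<in> carrier (BP_alg n)" for a b d u
  proof -
    have "a \<ominus>\<^bsub>BP_alg n\<^esub> b = (a \<oplus>\<^bsub>BP_alg n\<^esub> u) \<ominus>\<^bsub>BP_alg n\<^esub> (b \<oplus>\<^bsub>BP_alg n\<^esub> u)"
      using that(2-) Q.r_neg1[of u n "\<ominus>\<^bsub>BP_alg n\<^esub> b"] by (simp add: a_minus_def Q.minus_add Q.a_ac Q.r_neg2)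
    also have "\<dots> = (b \<oplus>\<^bsub>BP_alg n\<^esub> d) \<ominus>\<^bsub>BP_alg n\<^esub> (b \<oplus>\<^bsub>BP_alg n\<^esub> u)" by (simp only: that(1))
    also have "\<dots> = d \<ominus>\<^bsub>BP_alg n\<^esub> u"
      using that(2-) Q.a_lcomm[of b n d "\<ominus>\<^bsub>BP_alg n\<^esub> b \<oplus>\<^bsub>BP_alg n\<^esub> \<ominus>\<^bsub>BP_alg n\<^esub> u"]
      by (simp add: a_minus_def Q.minus_add Q.a_assoc Q.r_neg2)
    finally show ?thesis .
  qed
  have "commutator (BP_alg n) ?x (?y \<oplus>\<^bsub>BP_alg n\<^esub> ?z) = (?y \<otimes>\<^bsub>BP_alg n\<^esub> ?z) \<otimes>\<^bsub>BP_alg n\<^esub> ?x \<ominus>\<^bsub>BP_alg n\<^esub> ?x \<otimes>\<^bsub>BP_alg n\<^esub> (?y \<otimes>\<^bsub>BP_alg n\<^esub> ?z)"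
    unfolding commutator_def by (rule gen[OF e]) (use c in auto)
  moreover have "?y \<otimes>\<^bsub>BP_alg n\<^esub> ?z \<otimes>\<^bsub>BP_alg n\<^esub> ?x = aug_word n [(i, k), (j, k), (i, j)]" "?x \<otimes>\<^bsub>BP_alg n\<^esub> (?y \<otimes>\<^bsub>BP_alg n\<^esub> ?z) = aug_word n [(i, j), (i, k), (j, k)]"
    using c by (simp_all add: Q.m_assoc)
  moreover have "aug_word n [(i, k), (j, k), (i, j)] \<in> J_filt n 3" "aug_word n [(i, j), (i, k), (j, k)] \<in> J_filt n 3"
    using aug_word_in_J[of "[(i, k), (j, k), (i, j)]" n] aug_word_in_J[of "[(i, j), (i, k), (j, k)]" n] ix
    by (simp_all add: numeral_3_eq_3 del: aug_word_simps)
  ultimately show ?thesis using J_diff by (simp only:)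
qed

lemma lift_minus: "f \<in> carrier (free_alg n) \<Longrightarrow> lift n (\<ominus>\<^bsub>free_alg n\<^esub> f) = \<ominus>\<^bsub>BP_alg n\<^esub> lift n f"
proof -
  assume f: "f \<in> carrier (free_alg n)"
  have "lift n (\<ominus>\<^bsub>free_alg n\<^esub> f) \<oplus>\<^bsub>BP_alg n\<^esub> lift n f = \<zero>\<^bsub>BP_alg n\<^esub>"
    using lift_add[OF Fr.a_inv_closed[OF f] f] by (simp only: Fr.l_neg[OF f] lift_zero)
  then show ?thesis by (rule Q.minus_equality[symmetric]) (auto intro: lift_closed f)
qed

lemma lift_commutator:
  assumes "f \<in> carrier (free_alg n)" "g \<in> carrier (free_alg n)"
  shows "lift n (commutator (free_alg n) f g) = commutator (BP_alg n) (lift n f) (lift n g)"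
  unfolding commutator_def a_minus_def
  using Fr.m_closed[OF assms] Fr.m_closed[OF assms(2,1)] lift_mult[OF assms] lift_mult[OF assms(2,1)]
  by (simp only: lift_add lift_minus Fr.a_inv_closed)

lemma lift_var: "(i, j) \<in> indices n \<Longrightarrow> lift n (series_var i j) = aug n (i, j)"
proof -
  assume ij: "(i, j) \<in> indices n"
  have "series_var i j = ga_elem [(i, j)]" by (auto simp: series_var_def ga_elem_def)
  then show ?thesis using lift_word[of "[(i, j)]" n] ij aug_closed[OF ij] by simp
qed

lemma commutator_zero:
  assumes "x \<in> carrier (BP_alg n)" "y \<in> carrier (BP_alg n)" "x \<otimes>\<^bsub>BP_alg n\<^esub> y = y \<otimes>\<^bsub>BP_alg n\<^esub> x"
  shows "commutator (BP_alg n) x y \<in> J_filt n k"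
  unfolding commutator_def assms(3) a_minus_def using assms J_zero by (simp add: Q.r_neg)

lemma lift_relator:
  assumes "r \<in> relators n (free_alg n)"
  shows "lift n r \<in> J_filt n 3"
  using assms
proof (cases rule: relators_cases)
  case (same i j k)
  have ix: "(i, k) \<in> indices n" "(j, k) \<in> indices n" using same(1,2) by (auto intro!: indicesI)
  have "aug n (i, k) \<otimes>\<^bsub>BP_alg n\<^esub> aug n (j, k) = aug n (j, k) \<otimes>\<^bsub>BP_alg n\<^esub> aug n (i, k)"
    by (rule aug_commute[OF ix]) (use same(2) in auto)
  then show ?thesis
    unfolding same(3) lift_commutator[OF var_free[OF ix(1)] var_free[OF ix(2)]] lift_var[OF ix(1)] lift_var[OF ix(2)]
    by (rule commutator_zero[OF aug_closed[OF ix(1)] aug_closed[OF ix(2)]])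
next
  case (triple i j k)
  have ix: "(i, j) \<in> indices n" "(i, k) \<in> indices n" "(j, k) \<in> indices n" using triple(1,2) by (auto intro!: indicesI)
  note v = var_free[OF ix(1)] var_free[OF ix(2)] var_free[OF ix(3)]
  show ?thesis
    unfolding triple(3) lift_commutator[OF v(1) Fr.a_closed[OF v(2,3)]] lift_add[OF v(2,3)]
      lift_var[OF ix(1)] lift_var[OF ix(2)] lift_var[OF ix(3)]
    by (rule aug_triple[OF ix])
next
  case (disjoint i j k l)
  have ix: "(i, j) \<in> indices n" "(k, l) \<in> indices n" using disjoint(1,2) by (auto intro!: indicesI)
  have "aug n (i, j) \<otimes>\<^bsub>BP_alg n\<^esub> aug n (k, l) = aug n (k, l) \<otimes>\<^bsub>BP_alg n\<^esub> aug n (i, j)"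
    by (rule aug_commute[OF ix]) (use disjoint(2) in auto)
  then show ?thesis
    unfolding disjoint(3) lift_commutator[OF var_free[OF ix(1)] var_free[OF ix(2)]] lift_var[OF ix(1)] lift_var[OF ix(2)]
    by (rule commutator_zero[OF aug_closed[OF ix(1)] aug_closed[OF ix(2)]])
qed

lemma lift_comp_mult:
  assumes fg: "f \<in> carrier (free_alg n)" "g \<in> carrier (free_alg n)"
    and terms: "\<And>i. i \<le> k \<Longrightarrow> lift n (series_comp i f) \<otimes>\<^bsub>BP_alg n\<^esub> lift n (series_comp (k - i) g) \<in> J_filt n m"
  shows "lift n (series_comp k (f \<otimes>\<^bsub>free_alg n\<^esub> g)) \<in> J_filt n m"
proof -
  have c: "series_comp i f \<in> carrier (free_alg n)" "series_comp i g \<in> carrier (free_alg n)" for i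
    using fg by (auto intro: comp_in_free free_in_series)
  have "lift n (series_comp k (f \<otimes>\<^bsub>free_alg n\<^esub> g)) = lift n (\<Oplus>\<^bsub>free_alg n\<^esub> i\<in>{..k}. series_comp i f \<otimes>\<^bsub>free_alg n\<^esub> series_comp (k - i) g)"
    using comp_mult[OF free_in_series[OF fg(1)] free_in_series[OF fg(2)], of k] by (simp only: free_ops)
  also have "\<dots> = (\<Oplus>\<^bsub>BP_alg n\<^esub> i\<in>{..k}. lift n (series_comp i f \<otimes>\<^bsub>free_alg n\<^esub> series_comp (k - i) g))"
    by (rule finsum_additive(1)[where K = "carrier (free_alg n)" and h = "lift n",
          OF Fr.abelian_monoid_axioms Q.abelian_monoid_axioms subset_refl Fr.zero_closed Fr.a_closed
          lift_closed lift_zero lift_add finite_atMost Fr.m_closed[OF c(1) c(2)]])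
  also have "\<dots> = (\<Oplus>\<^bsub>BP_alg n\<^esub> i\<in>{..k}. lift n (series_comp i f) \<otimes>\<^bsub>BP_alg n\<^esub> lift n (series_comp (k - i) g))"
    by (simp only: lift_mult[OF c(1) c(2)])
  also have "\<dots> \<in> J_filt n m"
    by (rule ideal_finsum[OF Q.ring_axioms J_filt_ideal finite_atMost]) (use terms in simp)
  finally show ?thesis .
qed

text \<open>The polynomials all of whose components are sent one step deeper than their degree form an ideal, and
  it contains the relators, which have degree two and are sent to \<open>J\<^sup>3\<close>.\<close>

lemma lift_graded_ideal:
  assumes f: "f \<in> graded_ideal n"
  shows "lift n (series_comp k f) \<in> J_filt n (Suc k)"
proof -
  let ?D = "{f \<in> carrier (free_alg n). \<forall>k. lift n (series_comp k f) \<in> J_filt n (Suc k)}"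
  have "ideal ?D (free_alg n)"
  proof (rule idealI)
    show "ring (free_alg n)" by (rule Fr.ring_axioms)
    show "subgroup ?D (add_monoid (free_alg n))"
    proof (rule Fr.add.subgroupI, goal_cases)
      case 2
      have "\<zero>\<^bsub>free_alg n\<^esub> \<in> ?D" using Fr.zero_closed[of n] lift_zero[of n] J_zero by (simp add: free_ops(3))
      then show ?case by blast
    next
      case (3 f)
      then have f: "f \<in> carrier (free_alg n)" by simp
      have "series_comp k (\<ominus>\<^bsub>free_alg n\<^esub> f) = \<ominus>\<^bsub>free_alg n\<^esub> series_comp k f" for k
        using f comp_in_series[OF free_in_series[OF f], of k] comp_in_free[OF free_in_series[OF f], of k]
        by (auto simp: free_minus fun_eq_iff S_minus_apply free_in_series series_comp_def)
      then show ?case using 3 J_minus comp_in_free[OF free_in_series[OF f]] by (simp add: lift_minus)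
    next
      case (4 f g)
      then have c: "series_comp k f \<in> carrier (free_alg n)" "series_comp k g \<in> carrier (free_alg n)" for k
        by (auto intro: comp_in_free free_in_series)
      have "lift n (series_comp k (f \<oplus>\<^bsub>free_alg n\<^esub> g)) = lift n (series_comp k f) \<oplus>\<^bsub>BP_alg n\<^esub> lift n (series_comp k g)" for k
        using lift_add[OF c] by (simp add: comp_add)
      then show ?case using 4 J_add Fr.a_closed[of f n g] by (simp del: free_ops)
    qed auto
    fix f x assume f: "f \<in> ?D" and x: "x \<in> carrier (free_alg n)"
    have fc: "f \<in> carrier (free_alg n)" and fJ: "lift n (series_comp k f) \<in> J_filt n (Suc k)" for k using f by auto
    have xJ: "lift n (series_comp k x) \<in> J_filt n k" for k by (rule lift_comp[OF free_in_series[OF x]])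
    have "lift n (series_comp k (x \<otimes>\<^bsub>free_alg n\<^esub> f)) \<in> J_filt n (Suc k)" for k
      by (rule lift_comp_mult[OF x fc]) (use J_mult[OF xJ fJ] in \<open>metis add_Suc_right le_add_diff_inverse\<close>)
    then show "x \<otimes>\<^bsub>free_alg n\<^esub> f \<in> ?D" using Fr.m_closed[OF x fc] by (simp del: free_ops)
    have "lift n (series_comp k (f \<otimes>\<^bsub>free_alg n\<^esub> x)) \<in> J_filt n (Suc k)" for k
      by (rule lift_comp_mult[OF fc x]) (use J_mult[OF fJ xJ] in \<open>metis add_Suc le_add_diff_inverse\<close>)
    then show "f \<otimes>\<^bsub>free_alg n\<^esub> x \<in> ?D" using Fr.m_closed[OF fc x] by (simp del: free_ops)
  qed
  moreover have "relators n (free_alg n) \<subseteq> ?D"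
  proof
    fix r assume r: "r \<in> relators n (free_alg n)"
    then have "lift n r \<in> J_filt n (Suc 2)" using lift_relator[OF r] by (simp add: numeral_3_eq_3 numeral_2_eq_2)
    moreover have "r \<in> relators n (series_alg n)" using r by (simp only: relators_free_series)
    ultimately show "r \<in> ?D"
      using relators_carrier r J_zero lift_zero[of n] by (auto simp: relators_homogeneous)
  qed
  ultimately have "graded_ideal n \<subseteq> ?D" unfolding graded_ideal_def by (rule Fr.genideal_minimal)
  then show ?thesis using f by blast
qed

section \<open>The isomorphism of associated graded algebras\<close>

definition homog :: "nat \<Rightarrow> nat \<Rightarrow> series \<Rightarrow> bool" where
  "homog n k f \<longleftrightarrow> f \<in> carrier (free_alg n) \<and> (\<forall>w. f w \<noteq> 0 \<longrightarrow> length w = k)"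

text \<open>The element \<open>\<Sum> f\<^sub>s \<otimes> s\<close> of the crossed product with the free algebra, with \<open>A\<^sub>i\<^sub>j\<close> substituted for \<open>v\<^sub>i\<^sub>j\<close>.\<close>

definition family :: "nat \<Rightarrow> ((nat \<Rightarrow> nat) \<Rightarrow> series) \<Rightarrow> (word \<Rightarrow> word) \<Rightarrow> rat" where
  "family n f = (\<Oplus>\<^bsub>BP_alg n\<^esub> s\<in>carrier (sym_group n). lift n (f s) \<otimes>\<^bsub>BP_alg n\<^esub> perm_elem n s)"

lemma homog_carrier: "homog n k f \<Longrightarrow> f \<in> carrier (free_alg n)"
  by (simp add: homog_def)

lemma homog_comp: "homog n k f \<Longrightarrow> series_comp k f = f"
  by (auto simp: homog_def series_comp_def fun_eq_iff)

lemma homog_term: "homog n k f \<Longrightarrow> s \<in> carrier (sym_group n) \<Longrightarrow> lift n f \<otimes>\<^bsub>BP_alg n\<^esub> perm_elem n s \<in> J_filt n k"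
  by (rule J_mult_right[OF perm_elem_closed lift_homogeneous]) (auto simp: homog_def)

text \<open>Collecting the words that occur with the same permutation.\<close>

lemma wspan_family: "y \<in> wspan n k \<Longrightarrow> \<exists>f. (\<forall>s\<in>carrier (sym_group n). homog n k (f s)) \<and> y = family n f"
proof (induction rule: wspan.induct)
  case zero
  have "family n (\<lambda>_. \<zero>\<^bsub>free_alg n\<^esub>) = (\<Oplus>\<^bsub>BP_alg n\<^esub> s\<in>carrier (sym_group n). \<zero>\<^bsub>BP_alg n\<^esub>)"
    unfolding family_def lift_zero by (rule Q.finsum_cong') (use perm_elem_closed in auto)
  then have "family n (\<lambda>_. \<zero>\<^bsub>free_alg n\<^esub>) = \<zero>\<^bsub>BP_alg n\<^esub>" by simp
  moreover have "homog n k \<zero>\<^bsub>free_alg n\<^esub>" using Fr.zero_closed[of n] by (auto simp: homog_def series_ops)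
  ultimately show ?case by (intro exI[of _ "\<lambda>_. \<zero>\<^bsub>free_alg n\<^esub>"]) simp
next
  case (add w s y c)
  then obtain f where f: "\<And>t. t \<in> carrier (sym_group n) \<Longrightarrow> homog n k (f t)" "y = family n f" by blast
  \<comment> \<open>the new word is added to the component at \<open>s\<close>\<close>
  let ?g = "\<lambda>t. if s = t then c \<odot>\<^bsub>free_alg n\<^esub> ga_elem w \<oplus>\<^bsub>free_alg n\<^esub> f t else f t"
  have wf: "ga_elem w \<in> carrier (free_alg n)" by (rule word_free[OF add(1)])
  have fc: "f t \<in> carrier (free_alg n)" if "t \<in> carrier (sym_group n)" for t using homog_carrier[OF f(1)[OF that]] .
  have wc: "aug_word n w \<otimes>\<^bsub>BP_alg n\<^esub> perm_elem n s \<in> carrier (BP_alg n)" using add(1,3) by simp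
  have ft: "lift n (f t) \<otimes>\<^bsub>BP_alg n\<^esub> perm_elem n t \<in> carrier (BP_alg n)" if "t \<in> carrier (sym_group n)" for t
    by (rule Q.m_closed[OF lift_closed[OF fc[OF that]] perm_elem_closed[OF that]])
  have hom: "homog n k (?g t)" if t: "t \<in> carrier (sym_group n)" for t
  proof -
    have "c \<odot>\<^bsub>free_alg n\<^esub> ga_elem w \<oplus>\<^bsub>free_alg n\<^esub> f t \<in> carrier (free_alg n)" by (rule Fr.a_closed[OF Fr.smult_closed[OF wf] fc[OF t]])
    moreover have "length v = k" if "(c \<odot>\<^bsub>free_alg n\<^esub> ga_elem w \<oplus>\<^bsub>free_alg n\<^esub> f t) v \<noteq> 0" for v
      using that f(1)[OF t] add(2) by (auto simp: homog_def series_ops ga_elem_def split: if_splits)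
    ultimately show ?thesis using f(1)[OF t] by (simp add: homog_def del: free_ops)
  qed
  have "family n ?g = (\<Oplus>\<^bsub>BP_alg n\<^esub> t\<in>carrier (sym_group n). (if s = t then c \<odot>\<^bsub>BP_alg n\<^esub> (aug_word n w \<otimes>\<^bsub>BP_alg n\<^esub> perm_elem n t) else \<zero>\<^bsub>BP_alg n\<^esub>) \<oplus>\<^bsub>BP_alg n\<^esub> lift n (f t) \<otimes>\<^bsub>BP_alg n\<^esub> perm_elem n t)"
    unfolding family_def
  proof (rule Q.finsum_cong'[OF refl])
    show "(\<lambda>t. (if s = t then c \<odot>\<^bsub>BP_alg n\<^esub> (aug_word n w \<otimes>\<^bsub>BP_alg n\<^esub> perm_elem n t) else \<zero>\<^bsub>BP_alg n\<^esub>) \<oplus>\<^bsub>BP_alg n\<^esub> lift n (f t) \<otimes>\<^bsub>BP_alg n\<^esub> perm_elem n t) \<in> carrier (sym_group n) \<rightarrow> carrier (BP_alg n)"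
      using wc ft by auto
    fix t assume t: "t \<in> carrier (sym_group n)"
    show "lift n (?g t) \<otimes>\<^bsub>BP_alg n\<^esub> perm_elem n t = (if s = t then c \<odot>\<^bsub>BP_alg n\<^esub> (aug_word n w \<otimes>\<^bsub>BP_alg n\<^esub> perm_elem n t) else \<zero>\<^bsub>BP_alg n\<^esub>) \<oplus>\<^bsub>BP_alg n\<^esub> lift n (f t) \<otimes>\<^bsub>BP_alg n\<^esub> perm_elem n t"
    proof (cases "s = t")
      case True
      have "lift n (c \<odot>\<^bsub>free_alg n\<^esub> ga_elem w \<oplus>\<^bsub>free_alg n\<^esub> f t) = c \<odot>\<^bsub>BP_alg n\<^esub> aug_word n w \<oplus>\<^bsub>BP_alg n\<^esub> lift n (f t)"
        by (simp only: lift_add[OF Fr.smult_closed[OF wf] fc[OF t]] lift_smult[OF wf] lift_word[OF add(1)])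
      then show ?thesis
        using True add(1) perm_elem_closed[OF t] lift_closed[OF fc[OF t]]
        by (simp add: Q.l_distr Q.smult_mult_left del: free_ops)
    next
      case False
      then show ?thesis using ft[OF t] by simp
    qed
  qed
  also have "\<dots> = (\<Oplus>\<^bsub>BP_alg n\<^esub> t\<in>carrier (sym_group n). if s = t then c \<odot>\<^bsub>BP_alg n\<^esub> (aug_word n w \<otimes>\<^bsub>BP_alg n\<^esub> perm_elem n t) else \<zero>\<^bsub>BP_alg n\<^esub>) \<oplus>\<^bsub>BP_alg n\<^esub> family n f"
    unfolding family_def by (rule Q.finsum_addf) (use wc ft in auto)
  also have "(\<Oplus>\<^bsub>BP_alg n\<^esub> t\<in>carrier (sym_group n). if s = t then c \<odot>\<^bsub>BP_alg n\<^esub> (aug_word n w \<otimes>\<^bsub>BP_alg n\<^esub> perm_elem n t) else \<zero>\<^bsub>BP_alg n\<^esub>) = c \<odot>\<^bsub>BP_alg n\<^esub> (aug_word n w \<otimes>\<^bsub>BP_alg n\<^esub> perm_elem n s)"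
    by (rule Q.finsum_singleton[OF add(3) finite_sym_group]) (use add(1) perm_elem_closed in auto)
  finally have "c \<odot>\<^bsub>BP_alg n\<^esub> (aug_word n w \<otimes>\<^bsub>BP_alg n\<^esub> perm_elem n s) \<oplus>\<^bsub>BP_alg n\<^esub> y = family n ?g" by (simp only: f(2))
  then show ?case using hom by (intro exI[of _ ?g] conjI ballI)
qed

lemma lead_rep_zero: "lead_rep n k \<zero>\<^bsub>BP_alg n\<^esub> = \<zero>\<^bsub>graded_braid_alg n\<^esub>"
  by (rule lead_rep_next[OF J_zero])

lemma lead_rep_family:
  assumes f: "\<And>s. s \<in> carrier (sym_group n) \<Longrightarrow> homog n k (f s)"
  shows "family n f \<in> J_filt n k" "lead_rep n k (family n f) = (\<lambda>s\<in>carrier (sym_group n). gart n (f s))"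
proof -
  have sub: "J_filt n k \<subseteq> carrier (BP_alg n)" using J_filt_closed by blast
  note * = finsum_additive[where K = "J_filt n k" and h = "lead_rep n k" and f = "\<lambda>s. lift n (f s) \<otimes>\<^bsub>BP_alg n\<^esub> perm_elem n s",
      OF Q.abelian_monoid_axioms GBr.C.abelian_monoid_axioms sub J_zero J_add lead_rep_closed lead_rep_zero lead_rep_add
      finite_sym_group homog_term[OF f]]
  show "family n f \<in> J_filt n k" unfolding family_def by (rule *(2))
  have fc: "f s \<in> carrier (free_alg n)" if "s \<in> carrier (sym_group n)" for s using homog_carrier[OF f[OF that]] .
  have ls: "lead_rep n k (lift n (f s) \<otimes>\<^bsub>BP_alg n\<^esub> perm_elem n s) = gpure n (gart n (f s)) s" if s: "s \<in> carrier (sym_group n)" for s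
    by (rule lead_rep_lift[OF fc[OF s] _ s]) (use f[OF s] in \<open>auto simp: homog_def\<close>)
  have eq: "lead_rep n k (family n f) = (\<Oplus>\<^bsub>graded_braid_alg n\<^esub> s\<in>carrier (sym_group n). gpure n (gart n (f s)) s)"
    unfolding family_def
    by (rule trans[OF *(1) GBr.C.finsum_cong'[OF refl _ ls]]) (use fc in auto)
  show "lead_rep n k (family n f) = (\<lambda>s\<in>carrier (sym_group n). gart n (f s))"
  proof (rule GBr.C_eqI)
    show "lead_rep n k (family n f) \<in> carrier (graded_braid_alg n)"
      unfolding family_def by (rule lead_rep_closed[OF *(2)])
    show "(\<lambda>s\<in>carrier (sym_group n). gart n (f s)) \<in> carrier (graded_braid_alg n)" unfolding GBr.carrier_C using fc by auto
    fix t assume t: "t \<in> carrier (sym_group n)"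
    have "lead_rep n k (family n f) t = (\<Oplus>\<^bsub>graded_artin_alg n\<^esub> s\<in>carrier (sym_group n). gpure n (gart n (f s)) s t)"
      unfolding eq by (rule GBr.C_finsum_apply[OF finite_sym_group _ t]) (use fc in auto)
    also have "\<dots> = (\<Oplus>\<^bsub>graded_artin_alg n\<^esub> s\<in>carrier (sym_group n). if t = s then gart n (f s) else \<zero>\<^bsub>graded_artin_alg n\<^esub>)"
      by (simp only: GBr.pure_apply[OF t])
    also have "\<dots> = gart n (f t)" by (rule GArt.finsum_singleton[OF t finite_sym_group]) (use fc in auto)
    finally show "lead_rep n k (family n f) t = (\<lambda>s\<in>carrier (sym_group n). gart n (f s)) t" using t by simp
  qed
qed

lemma diff_add_cancel_BP: "x \<in> carrier (BP_alg n) \<Longrightarrow> y \<in> carrier (BP_alg n) \<Longrightarrow> (x \<ominus>\<^bsub>BP_alg n\<^esub> y) \<oplus>\<^bsub>BP_alg n\<^esub> y = x"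
  by (simp add: a_minus_def Q.a_assoc Q.l_neg)

text \<open>Modulo \<open>J\<^sup>k\<^sup>+\<^sup>1\<close> an element of \<open>J\<^sup>k\<close> is the substitution of a homogeneous family \<open>f\<close>, whose leading term is
  the class of \<open>f\<close>. If this class vanishes, \<open>f\<close> lies in the graded ideal and its substitution in \<open>J\<^sup>k\<^sup>+\<^sup>1\<close>.\<close>

lemma lead_rep_kernel:
  assumes x: "x \<in> J_filt n k"
  shows "lead_rep n k x = \<zero>\<^bsub>graded_braid_alg n\<^esub> \<longleftrightarrow> x \<in> J_filt n (Suc k)"
proof
  assume l: "lead_rep n k x = \<zero>\<^bsub>graded_braid_alg n\<^esub>"
  obtain y where y: "y \<in> wspan n k" "x \<ominus>\<^bsub>BP_alg n\<^esub> y \<in> J_filt n (Suc k)"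
    using spanned_J[OF x] unfolding spanned_def by blast
  obtain f where f: "\<And>s. s \<in> carrier (sym_group n) \<Longrightarrow> homog n k (f s)" "y = family n f" using wspan_family[OF y(1)] by blast
  have xy: "x = (x \<ominus>\<^bsub>BP_alg n\<^esub> y) \<oplus>\<^bsub>BP_alg n\<^esub> y" using diff_add_cancel_BP[OF J_filt_closed[OF x] wspan_closed[OF y(1)]] by (rule sym)
  have "lead_rep n k x = lead_rep n k (x \<ominus>\<^bsub>BP_alg n\<^esub> y) \<oplus>\<^bsub>graded_braid_alg n\<^esub> lead_rep n k y"
    by (subst xy) (rule lead_rep_add[OF subsetD[OF J_filt_mono y(2)] wspan_J[OF y(1)]])
  then have "lead_rep n k y = \<zero>\<^bsub>graded_braid_alg n\<^esub>"
    using l lead_rep_next[OF y(2)] lead_rep_closed[OF wspan_J[OF y(1)]] by simp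
  then have z: "(\<lambda>s\<in>carrier (sym_group n). gart n (f s)) = \<zero>\<^bsub>graded_braid_alg n\<^esub>" using lead_rep_family(2)[OF f(1)] f(2) by simp
  have "lift n (f s) \<otimes>\<^bsub>BP_alg n\<^esub> perm_elem n s \<in> J_filt n (Suc k)" if s: "s \<in> carrier (sym_group n)" for s
  proof -
    have "gart n (f s) = graded_ideal n"
      using fun_cong[OF z, of s] s by (simp add: GBr.C_ops gart_simps)
    then have "f s \<in> graded_ideal n"
      using coset_eq_self_iff[OF rat_alg_free graded_ideal homog_carrier[OF f(1)[OF s]]] by simp
    then have "lift n (f s) \<in> J_filt n (Suc k)"
      using lift_graded_ideal[of "f s" n k] homog_comp[OF f(1)[OF s]] by simp
    then show ?thesis by (rule J_mult_right[OF perm_elem_closed[OF s]])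
  qed
  then have "y \<in> J_filt n (Suc k)"
    unfolding f(2) family_def by (rule ideal_finsum[OF Q.ring_axioms J_filt_ideal finite_sym_group])
  then show "x \<in> J_filt n (Suc k)" by (subst xy) (rule J_add[OF y(2)])
qed (rule lead_rep_next)

text \<open>Every homogeneous family is the leading term of its own substitution.\<close>

lemma lead_rep_image: "lead_rep n k ` J_filt n k = graded_braid_part n k"
proof (intro equalityI subsetI)
  fix b assume b: "b \<in> graded_braid_part n k"
  have "\<exists>f. homog n k f \<and> b s = gart n f" if "s \<in> carrier (sym_group n)" for s
  proof -
    have "b s \<in> graded_artin_part n k" using b that unfolding graded_braid_part_def by (rule PiE_mem)
    then show ?thesis unfolding graded_artin_part_def homog_def by blast
  qed
  then have "\<exists>f. \<forall>s\<in>carrier (sym_group n). homog n k (f s) \<and> b s = gart n (f s)" by (intro bchoice ballI)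
  then obtain f where "\<forall>s\<in>carrier (sym_group n). homog n k (f s) \<and> b s = gart n (f s)" ..
  then have f: "\<And>s. s \<in> carrier (sym_group n) \<Longrightarrow> homog n k (f s)" "\<And>s. s \<in> carrier (sym_group n) \<Longrightarrow> b s = gart n (f s)" by simp_all
  have "b \<in> extensional (carrier (sym_group n))" using b unfolding graded_braid_part_def PiE_def by (rule IntD2)
  then have "b = (\<lambda>s\<in>carrier (sym_group n). gart n (f s))"
    by (rule extensionalityI[OF _ restrict_extensional]) (simp only: f(2) restrict_apply')
  then have "b = lead_rep n k (family n f)" using lead_rep_family(2)[OF f(1)] by simp
  then show "b \<in> lead_rep n k ` J_filt n k" by (rule image_eqI[OF _ lead_rep_family(1)[OF f(1)]])
next
  fix b assume "b \<in> lead_rep n k ` J_filt n k"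
  then show "b \<in> graded_braid_part n k" by (elim imageE) (simp only: lead_rep_part)
qed

interpretation Gr: graded_comparison "BP_alg n" "graded_braid_alg n" "J_filt n" "lead_rep n" for n
proof (intro graded_comparison.intro graded_comparison_axioms.intro Q.rat_alg_axioms GBr.C.rat_alg_axioms
    J_filt_0 J_filt_ideal J_filt_mono J_mult lead_rep_closed lead_rep_add lead_rep_smult lead_rep_kernel lead_rep_mult)
  have "gart n (ga_elem []) = \<one>\<^bsub>graded_artin_alg n\<^esub>" by (simp add: gart_simps ga_elem_def series_alg_def)
  then show "lead_rep n 0 \<one>\<^bsub>BP_alg n\<^esub> = \<one>\<^bsub>graded_braid_alg n\<^esub>"
    using lead_rep_word[of "[]" n id] by (simp add: perm_elem_id GBr.C_ops(5) sym_group_one)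
  show "lead_rep n k (X k) = \<zero>\<^bsub>graded_braid_alg n\<^esub>"
    if "\<And>k. X k \<in> J_filt n k" "(\<Oplus>\<^bsub>graded_braid_alg n\<^esub> k\<in>{..N}. lead_rep n k (X k)) = \<zero>\<^bsub>graded_braid_alg n\<^esub>" "k \<le> N" for X N k
    by (rule graded_braid_direct[where b = "\<lambda>k. lead_rep n k (X k)", OF lead_rep_part[OF that(1)] that(2,3)])
  fix b assume "b \<in> carrier (graded_braid_alg n)"
  then obtain N c where c: "\<And>k. c k \<in> graded_braid_part n k" "b = (\<Oplus>\<^bsub>graded_braid_alg n\<^esub> k\<in>{..N::nat}. c k)"
    using graded_braid_span by blast
  have "\<exists>x. x \<in> J_filt n k \<and> c k = lead_rep n k x" for k
    using c(1)[of k] unfolding lead_rep_image[symmetric] by blast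
  then have "\<exists>X. \<forall>k. X k \<in> J_filt n k \<and> c k = lead_rep n k (X k)" by (intro choice allI)
  then obtain X where "\<forall>k. X k \<in> J_filt n k \<and> c k = lead_rep n k (X k)" ..
  then show "\<exists>N X. (\<forall>k. X k \<in> J_filt n k) \<and> b = (\<Oplus>\<^bsub>graded_braid_alg n\<^esub> k\<in>{..N}. lead_rep n k (X k))"
    using c(2) by (intro exI[of _ N] exI[of _ X]) simp
qed

lemma UN_constant_on: "S \<noteq> {} \<Longrightarrow> (\<And>x. x \<in> S \<Longrightarrow> f x = c) \<Longrightarrow> (\<Union>x\<in>S. f x) = c"
  by auto

lemma coset_rep:
  assumes "rat_alg A" "ideal I A" "x \<in> carrier A"
  shows "I +>\<^bsub>A\<^esub> x \<noteq> {}"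
  using abelian_subgroup.a_rcos_self[OF abelian_subgroupI3[OF ideal.axioms(1)[OF assms(2)]] assms(3)]
    rat_alg.axioms(1)[OF assms(1)] ring.is_abelian_group by blast

lemma gr_map_coset:
  assumes x: "x \<in> J_filt n k"
  shows "(\<Union>y\<in>J_filt n (Suc k) +>\<^bsub>BP_alg n\<^esub> x. braid_filt n (Suc k) +>\<^bsub>braid_alg n\<^esub> artin_rep n y)
    = braid_filt n (Suc k) +>\<^bsub>braid_alg n\<^esub> artin_rep n x"
proof (rule UN_constant_on)
  note xc = J_filt_closed[OF x]
  show "J_filt n (Suc k) +>\<^bsub>BP_alg n\<^esub> x \<noteq> {}" by (rule coset_rep[OF Q.rat_alg_axioms J_filt_ideal xc])
  fix y assume "y \<in> J_filt n (Suc k) +>\<^bsub>BP_alg n\<^esub> x"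
  then have y: "y \<in> carrier (BP_alg n)" "y \<ominus>\<^bsub>BP_alg n\<^esub> x \<in> J_filt n (Suc k)"
    using mem_coset_iff[OF Q.rat_alg_axioms J_filt_ideal xc] by auto
  interpret R: ring_hom_ring "BP_alg n" "braid_alg n" "artin_rep n" by (rule rep_ring_hom)
  have "artin_rep n (y \<ominus>\<^bsub>BP_alg n\<^esub> x) = artin_rep n y \<ominus>\<^bsub>braid_alg n\<^esub> artin_rep n x"
    using xc y(1) by (simp add: a_minus_def)
  then have "artin_rep n y \<ominus>\<^bsub>braid_alg n\<^esub> artin_rep n x \<in> braid_filt n (Suc k)" using rep_filt[OF y(2)] by simp
  then show "braid_filt n (Suc k) +>\<^bsub>braid_alg n\<^esub> artin_rep n y = braid_filt n (Suc k) +>\<^bsub>braid_alg n\<^esub> artin_rep n x"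
    by (simp only: coset_eq_iff[OF Br.C.rat_alg_axioms braid_filt_ideal rep_closed[OF y(1)] rep_closed[OF xc]])
qed

lemma leading_part_coset:
  assumes y: "y \<in> braid_filt n k" and s: "s \<in> carrier (sym_group n)"
  shows "(\<Union>X\<in>braid_filt n (Suc k) +>\<^bsub>braid_alg n\<^esub> y. leading_part n k (X s)) = lead n k y s"
proof (rule UN_constant_on)
  note yc = braid_filt_carrier[OF y]
  show "braid_filt n (Suc k) +>\<^bsub>braid_alg n\<^esub> y \<noteq> {}" by (rule coset_rep[OF Br.C.rat_alg_axioms braid_filt_ideal yc])
  fix X assume "X \<in> braid_filt n (Suc k) +>\<^bsub>braid_alg n\<^esub> y"
  then have X: "X \<in> carrier (braid_alg n)" "X \<ominus>\<^bsub>braid_alg n\<^esub> y \<in> braid_filt n (Suc k)"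
    using mem_coset_iff[OF Br.C.rat_alg_axioms braid_filt_ideal yc] by auto
  have d: "X \<ominus>\<^bsub>braid_alg n\<^esub> y \<in> braid_filt n k" by (rule subsetD[OF braid_filt_Suc X(2)])
  have "X = (X \<ominus>\<^bsub>braid_alg n\<^esub> y) \<oplus>\<^bsub>braid_alg n\<^esub> y" using X(1) yc by (simp add: a_minus_def Br.C.a_assoc Br.C.l_neg)
  then have "lead n k X = lead n k (X \<ominus>\<^bsub>braid_alg n\<^esub> y) \<oplus>\<^bsub>graded_braid_alg n\<^esub> lead n k y" using lead_add[OF d y] by simp
  also have "lead n k (X \<ominus>\<^bsub>braid_alg n\<^esub> y) = \<zero>\<^bsub>graded_braid_alg n\<^esub>" using lead_kernel[OF d] X(2) by simp
  also have "\<zero>\<^bsub>graded_braid_alg n\<^esub> \<oplus>\<^bsub>graded_braid_alg n\<^esub> lead n k y = lead n k y" by (rule GBr.C.l_zero[OF lead_carrier[OF y]])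
  finally show "leading_part n k (X s) = lead n k y s" by (simp only: lead_apply[OF s, symmetric])
qed

text \<open>All cosets in the definitions of the induced map and of the identification have a representative from
  the given family, which turns both unions into single leading terms.\<close>

lemma gr_map_reps:
  assumes r: "Gr.reps n \<xi> x N"
  shows "(gr_braid_ident n \<circ> gr_map (braid_alg n) (braid_filt n) (artin_rep n)) \<xi> = (\<Oplus>\<^bsub>graded_braid_alg n\<^esub> k\<in>{..N}. lead_rep n k (x k))"
proof -
  have x: "x k \<in> J_filt n k" "\<xi> k = J_filt n (Suc k) +>\<^bsub>BP_alg n\<^esub> x k" for k using r unfolding Gr.reps_def by auto
  have x0: "x k = \<zero>\<^bsub>BP_alg n\<^esub>" if "N < k" for k using r that unfolding Gr.reps_def by blast
  define \<eta> where "\<eta> = gr_map (braid_alg n) (braid_filt n) (artin_rep n) \<xi>"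
  have \<eta>: "\<eta> k = braid_filt n (Suc k) +>\<^bsub>braid_alg n\<^esub> artin_rep n (x k)" for k
    unfolding \<eta>_def gr_map_def x(2) by (rule gr_map_coset[OF x(1)])
  have \<eta>0: "\<eta> k = braid_filt n (Suc k) \<longleftrightarrow> lead_rep n k (x k) = \<zero>\<^bsub>graded_braid_alg n\<^esub>" for k
    unfolding \<eta> lead_rep_def lead_kernel[OF rep_filt[OF x(1)]]
    by (rule coset_eq_self_iff[OF Br.C.rat_alg_axioms braid_filt_ideal rep_closed[OF J_filt_closed[OF x(1)]]])
  have sub: "{k. \<eta> k \<noteq> braid_filt n (Suc k)} \<subseteq> {..N}"
    using x0 lead_rep_zero unfolding \<eta>0 by (auto simp: not_less[symmetric])
  have lc: "lead_rep n k (x k) \<in> carrier (graded_braid_alg n)" for k by (rule lead_rep_closed[OF x(1)])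
  have sc: "(\<Oplus>\<^bsub>graded_braid_alg n\<^esub> k\<in>{..N}. lead_rep n k (x k)) \<in> carrier (graded_braid_alg n)" using lc by (intro GBr.C.finsum_closed) auto
  have "gr_braid_ident n \<eta> s = (\<Oplus>\<^bsub>graded_braid_alg n\<^esub> k\<in>{..N}. lead_rep n k (x k)) s" if s: "s \<in> carrier (sym_group n)" for s
  proof -
    have "gr_braid_ident n \<eta> s = (\<Oplus>\<^bsub>graded_artin_alg n\<^esub> k\<in>{k. \<eta> k \<noteq> braid_filt n (Suc k)}. lead_rep n k (x k) s)"
      unfolding gr_braid_ident_def restrict_apply'[OF s] \<eta> lead_rep_def
      by (simp only: leading_part_coset[OF rep_filt[OF x(1)] s])
    also have "\<dots> = (\<Oplus>\<^bsub>graded_artin_alg n\<^esub> k\<in>{..N}. lead_rep n k (x k) s)"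
    proof -
      have z: "lead_rep n i (x i) s = \<zero>\<^bsub>graded_artin_alg n\<^esub>" if "i \<in> {..N} - {k. \<eta> k \<noteq> braid_filt n (Suc k)}" for i
      proof -
        have "lead_rep n i (x i) = \<zero>\<^bsub>graded_braid_alg n\<^esub>" using that by (simp add: \<eta>0[symmetric])
        then show ?thesis using s by (simp add: GBr.C_ops)
      qed
      show ?thesis
        using GBr.C_apply[OF lc s] z sub by (intro GArt.add.finprod_mono_neutral_cong_left) auto
    qed
    also have "\<dots> = (\<Oplus>\<^bsub>graded_braid_alg n\<^esub> k\<in>{..N}. lead_rep n k (x k)) s"
      by (rule GBr.C_finsum_apply[symmetric, OF finite_atMost lc s])
    finally show ?thesis .
  qed
  moreover have "gr_braid_ident n \<eta> \<in> extensional (carrier (sym_group n))" by (simp add: gr_braid_ident_def)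
  moreover have "(\<Oplus>\<^bsub>graded_braid_alg n\<^esub> k\<in>{..N}. lead_rep n k (x k)) \<in> extensional (carrier (sym_group n))"
    using sc unfolding GBr.carrier_C PiE_def by blast
  ultimately show ?thesis unfolding \<eta>_def[symmetric] comp_def by (intro extensionalityI) auto
qed

theorem theorem1p3:
  fixes n :: nat
  assumes "n \<ge> 1"
  shows "\<exists>R. is_artin_rep n R
    \<and> (\<forall>R'. is_artin_rep n R' \<longrightarrow> (\<forall>x \<in> carrier (BP_alg n). R' x = R x))
    \<and> (\<forall>k. R ` J_filt n k \<subseteq> braid_filt n k)
    \<and> gr_braid_ident n \<circ> gr_map (braid_alg n) (braid_filt n) R
        \<in> alg_iso (assoc_graded (BP_alg n) (J_filt n)) (graded_braid_alg n)
    \<and> (\<forall>k. (gr_braid_ident n \<circ> gr_map (braid_alg n) (braid_filt n) R)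
              ` assoc_graded_part (BP_alg n) (J_filt n) k
            = graded_braid_part n k)"
proof (intro exI[of _ "artin_rep n"] conjI allI impI ballI)
  show "is_artin_rep n (artin_rep n)" by (rule artin_rep)
  show "R' x = artin_rep n x" if "is_artin_rep n R'" "x \<in> carrier (BP_alg n)" for R' x
    by (rule artin_rep_unique[OF that])
  show "artin_rep n ` J_filt n k \<subseteq> braid_filt n k" for k using rep_filt by blast
  note iso = Gr.graded_iso[where \<phi> = "gr_braid_ident n \<circ> gr_map (braid_alg n) (braid_filt n) (artin_rep n)", OF gr_map_reps]
  show "gr_braid_ident n \<circ> gr_map (braid_alg n) (braid_filt n) (artin_rep n)
      \<in> alg_iso (assoc_graded (BP_alg n) (J_filt n)) (graded_braid_alg n)"
    by (rule iso(1))
  show "(gr_braid_ident n \<circ> gr_map (braid_alg n) (braid_filt n) (artin_rep n))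
      ` assoc_graded_part (BP_alg n) (J_filt n) k = graded_braid_part n k" for k
    by (rule trans[OF iso(2) lead_rep_image])
qed

end
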